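(* Let $(\Gamma,\mu)$ be a weighted graph (as described in the context: countably infinite, connected, locally uniformly finite) and let $\beta\ge2$. Assume that: - (doubling) there exists $C_{dv}>0$ such that $V(x,2r)\le C_{dv}V(x,r)$ for all $x\in\Gamma$ and all $r\in\mathbb N^*$; - (sub-Gaussian upper estimates) there exist $c,C>0$ such that $$p_k(x,y)\le \frac{C}{V(x,k^{1/\beta})}\exp\left[-c\left(\frac{d(x,y)^\beta}{k}\right)^{\frac1{\beta-1}}\right]\qquad\forall x,y\in\Gamma,\ \forall k\in\mathbb N^*;$$ - $P$ is analytic on $L^2(\Gamma)$, that is, there exists $C'>0$ such that $\|(I-P)P^k\|_{2\to2}\le \frac{C'}{k}$ for all $k\in\mathbb N^*$. Then, for all $p\in(1,2]$, the Riesz transform $\nabla\Delta^{-1/2}$ is bounded on $L^p(\Gamma)$, that is, there exists $C_p>0$ such that $$\|\nabla\Delta^{-1/2}f\|_p\le C_p\|f\|_p\qquad\forall f\in L^p(\Gamma)\cap L^2(\Gamma).$$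
   Context: $\mathbb N=\{0,1,2,\dots\}$ and $\mathbb N^*=\mathbb N\setminus\{0\}$. Graph. $\Gamma$ is a countably infinite set with a symmetric weight $\mu_{xy}=\mu_{yx}\ge0$ on $\Gamma\times\Gamma$. Write $x\sim y$ if $\mu_{xy}>0$ (the case $x=y$ is allowed). A path of length $n$ is a sequence $x_0,\dots,x_n$ with $x_{i-1}\sim x_i$ for $1\le i\le n$; $d(x,y)$ is the length of the shortest path from $x$ to $y$. The graph is assumed connected, i.e. $d(x,y)<+\infty$ for all $x,y\in\Gamma$, and locally uniformly finite: there is $N_{dvl}\in\mathbb N$ such that $\#(\{y\in\Gamma: y\sim x\}\cup\{x\})\le N_{dvl}$ for all $x\in\Gamma$. Put $m(x)=\sum_{y\sim x}\mu_{xy}$ (which is $>0$), $m(E)=\sum_{x\in E}m(x)$ for $E\subset\Gamma$, $B(x,r)=\{y: d(x,y)<r\}$, $V(x,r)=m(B(x,r))$ (for real $r>0$). Function spaces. For $1\le p<\infty$, $L^p(\Gamma)=L^p(\Gamma,m)$ with $\|f\|_p=(\sum_x|f(x)|^pm(x))^{1/p}$; $\|L\|_{p\to p}=\sup_{\|f\|_p=1}\|Lf\|_p$. Random walk. $p(x,y)=\frac{\mu_{xy}}{m(x)m(y)}$, $p_0(x,y)=\frac{\delta(x,y)}{m(y)}$ (with $\delta(x,y)=1$ if $x=y$ and $0$ otherwise), $p_{k+1}(x,y)=\sum_{z\in\Gamma}p(x,z)p_k(z,y)m(z)$. The Markov operator is $Pf(x)=\sum_{y}p(x,y)f(y)m(y)$;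 $p_k$ is the kernel of $P^k$ with respect to $m$. $P$ is a self-adjoint contraction on $L^2(\Gamma)$. Riesz transform. $\Delta=I-P$ is the positive Laplacian, and the length of the gradient is $$\nabla f(x)=\Big(\sum_{y\in\Gamma}p(x,y)|f(x)-f(y)|^2m(y)\Big)^{1/2}.$$ $\Delta^{-1/2}$ is defined by the spectral theorem for the self-adjoint operator $\Delta$ on $L^2(\Gamma)$. Since $\|\nabla g\|_2^2=2\langle\Delta g,g\rangle$ for $g\in L^2(\Gamma)$ and $|\nabla g-\nabla h|\le\nabla(g-h)$ pointwise, the sublinear operator $f\mapsto\nabla(\Delta^{-1/2}f)$, defined on the (dense) range of $\Delta^{1/2}$ in $L^2(\Gamma)$, extends by continuity to $L^2(\Gamma)$; this extension is the Riesz transform $\nabla\Delta^{-1/2}$. *)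

theory Defs
  imports "HOL-Analysis.Analysis"
begin

section \<open>Weighted graphs\<close>

text \<open>The vertex set is the universe of the type \<open>'a\<close>; the weight is \<open>\<mu> :: 'a \<Rightarrow> 'a \<Rightarrow> real\<close>.\<close>

definition adj :: "('a \<Rightarrow> 'a \<Rightarrow> real) \<Rightarrow> 'a \<Rightarrow> 'a \<Rightarrow> bool" where
  "adj \<mu> x y \<longleftrightarrow> \<mu> x y > 0"

definition walk :: "('a \<Rightarrow> 'a \<Rightarrow> real) \<Rightarrow> nat \<Rightarrow> (nat \<Rightarrow> 'a) \<Rightarrow> 'a \<Rightarrow> 'a \<Rightarrow> bool" where
  "walk \<mu> n w x y \<longleftrightarrow> w 0 = x \<and> w n = y \<and> (\<forall>i\<in>{1..n}. adj \<mu> (w (i - 1)) (w i))"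

definition gdist :: "('a \<Rightarrow> 'a \<Rightarrow> real) \<Rightarrow> 'a \<Rightarrow> 'a \<Rightarrow> nat" where
  "gdist \<mu> x y = (LEAST n. \<exists>w. walk \<mu> n w x y)"

definition weighted_graph :: "('a \<Rightarrow> 'a \<Rightarrow> real) \<Rightarrow> bool" where
  "weighted_graph \<mu> \<longleftrightarrow>
     countable (UNIV :: 'a set) \<and> infinite (UNIV :: 'a set) \<and>
     (\<forall>x y. \<mu> x y = \<mu> y x) \<and> (\<forall>x y. \<mu> x y \<ge> 0) \<and>
     (\<forall>x y. \<exists>n w. walk \<mu> n w x y) \<and>
     (\<exists>N::nat. \<forall>x. finite ({y. adj \<mu> y x} \<union> {x}) \<and> card ({y. adj \<mu> y x} \<union> {x}) \<le> N)"

definition vmass :: "('a \<Rightarrow> 'a \<Rightarrow> real) \<Rightarrow> 'a \<Rightarrow> real" where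
  "vmass \<mu> x = (\<Sum>y | adj \<mu> y x. \<mu> x y)"

definition gball :: "('a \<Rightarrow> 'a \<Rightarrow> real) \<Rightarrow> 'a \<Rightarrow> real \<Rightarrow> 'a set" where
  "gball \<mu> x r = {y. real (gdist \<mu> x y) < r}"

text \<open>Balls of a weighted graph are finite.\<close>

definition gvolume :: "('a \<Rightarrow> 'a \<Rightarrow> real) \<Rightarrow> 'a \<Rightarrow> real \<Rightarrow> real" where
  "gvolume \<mu> x r = (\<Sum>y\<in>gball \<mu> x r. vmass \<mu> y)"


section \<open>Weighted Lebesgue spaces over a discrete set\<close>

definition Lp :: "('a \<Rightarrow> real) \<Rightarrow> real \<Rightarrow> ('a \<Rightarrow> 'b::real_normed_vector) set" where
  "Lp m p = {f. (\<lambda>x. norm (f x) powr p * m x) summable_on UNIV}"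

definition Lp_norm :: "('a \<Rightarrow> real) \<Rightarrow> real \<Rightarrow> ('a \<Rightarrow> 'b::real_normed_vector) \<Rightarrow> real" where
  "Lp_norm m p f = (\<Sum>\<^sub>\<infinity>x. norm (f x) powr p * m x) powr (1 / p)"

text \<open>A real supremum: meaningful for operators that are bounded on the space, such as
  polynomials in the Markov operator on the space with exponent 2.\<close>

definition Lp_opnorm ::
  "('a \<Rightarrow> real) \<Rightarrow> real \<Rightarrow> (('a \<Rightarrow> complex) \<Rightarrow> ('a \<Rightarrow> complex)) \<Rightarrow> real" where
  "Lp_opnorm m p L = (SUP f\<in>{f \<in> Lp m p. Lp_norm m p f = 1}. Lp_norm m p (L f))"

text \<open>Membership of the difference is required, since \<^const>\<open>Lp_norm\<close> is \<open>0\<close> by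
  convention outside \<^const>\<open>Lp\<close>.\<close>

definition Lp_tendsto ::
  "('a \<Rightarrow> real) \<Rightarrow> real \<Rightarrow> (nat \<Rightarrow> 'a \<Rightarrow> 'b::real_normed_vector) \<Rightarrow> ('a \<Rightarrow> 'b) \<Rightarrow> bool" where
  "Lp_tendsto m p u f \<longleftrightarrow>
     (\<forall>n. (\<lambda>x. u n x - f x) \<in> Lp m p) \<and> (\<lambda>n. Lp_norm m p (\<lambda>x. u n x - f x)) \<longlonglongrightarrow> 0"

definition L2_inner :: "('a \<Rightarrow> real) \<Rightarrow> ('a \<Rightarrow> complex) \<Rightarrow> ('a \<Rightarrow> complex) \<Rightarrow> complex" where
  "L2_inner m f g = (\<Sum>\<^sub>\<infinity>x. f x * cnj (g x) * of_real (m x))"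


section \<open>Spectral measures and functional calculus on the weighted Hilbert space\<close>

text \<open>Operators are total functions on \<open>'a \<Rightarrow> complex\<close>; only their values on \<open>Lp m 2\<close> matter.\<close>

definition orth_projection ::
  "('a \<Rightarrow> real) \<Rightarrow> (('a \<Rightarrow> complex) \<Rightarrow> ('a \<Rightarrow> complex)) \<Rightarrow> bool" where
  "orth_projection m Q \<longleftrightarrow>
     (\<forall>f\<in>Lp m 2. Q f \<in> Lp m 2) \<and>
     (\<forall>f\<in>Lp m 2. \<forall>g\<in>Lp m 2. \<forall>a b.
        Q (\<lambda>x. a * f x + b * g x) = (\<lambda>x. a * Q f x + b * Q g x)) \<and>
     (\<forall>f\<in>Lp m 2. Q (Q f) = Q f) \<and>
     (\<forall>f\<in>Lp m 2. \<forall>g\<in>Lp m 2. L2_inner m (Q f) g = L2_inner m f (Q g))"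

definition projection_valued_measure ::
  "('a \<Rightarrow> real) \<Rightarrow> (real set \<Rightarrow> ('a \<Rightarrow> complex) \<Rightarrow> ('a \<Rightarrow> complex)) \<Rightarrow> bool" where
  "projection_valued_measure m E \<longleftrightarrow>
     (\<forall>A\<in>sets borel. orth_projection m (E A)) \<and>
     (\<forall>f\<in>Lp m 2. E UNIV f = f) \<and>
     (\<forall>A\<in>sets borel. \<forall>B\<in>sets borel. \<forall>f\<in>Lp m 2. E (A \<inter> B) f = E A (E B f)) \<and>
     (\<forall>A :: nat \<Rightarrow> real set. range A \<subseteq> sets borel \<longrightarrow> disjoint_family A \<longrightarrow>
        (\<forall>f\<in>Lp m 2. Lp_tendsto m 2 (\<lambda>n x. \<Sum>i<n. E (A i) f x) (E (\<Union>i. A i) f)))"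

text \<open>The measure \<open>A \<mapsto> \<langle>E A f, f\<rangle> = \<parallel>E A f\<parallel>\<^sup>2\<close>.\<close>

definition scalar_spectral_measure ::
  "('a \<Rightarrow> real) \<Rightarrow> (real set \<Rightarrow> ('a \<Rightarrow> complex) \<Rightarrow> ('a \<Rightarrow> complex)) \<Rightarrow> ('a \<Rightarrow> complex) \<Rightarrow> real measure"
  where
  "scalar_spectral_measure m E f =
     measure_of UNIV (sets borel) (\<lambda>A. ennreal ((Lp_norm m 2 (E A f))\<^sup>2))"

definition simple_spectral_integral ::
  "(real set \<Rightarrow> ('a \<Rightarrow> complex) \<Rightarrow> ('a \<Rightarrow> complex)) \<Rightarrow> (real \<Rightarrow> real) \<Rightarrow> ('a \<Rightarrow> complex) \<Rightarrow> 'a \<Rightarrow> complex"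
  where
  "simple_spectral_integral E s f = (\<lambda>x. \<Sum>c\<in>range s. of_real c * E (s -` {c}) f x)"

text \<open>\<open>f\<close> is in the domain of \<open>\<integral> \<phi> dE\<close>, and \<open>(\<integral> \<phi> dE) f = g\<close>. The approximating simple
  functions exist iff \<open>\<phi>\<close> is square integrable for the scalar spectral measure of \<open>f\<close>, and
  \<open>g\<close> does not depend on them because \<open>\<parallel>(\<integral> s dE) f\<parallel>\<^sup>2 = \<integral> \<bar>s\<bar>\<^sup>2 d\<langle>E f, f\<rangle>\<close> for simple \<open>s\<close>.\<close>

definition has_spectral_integral ::
  "('a \<Rightarrow> real) \<Rightarrow> (real set \<Rightarrow> ('a \<Rightarrow> complex) \<Rightarrow> ('a \<Rightarrow> complex)) \<Rightarrow> (real \<Rightarrow> real) \<Rightarrow>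
     ('a \<Rightarrow> complex) \<Rightarrow> ('a \<Rightarrow> complex) \<Rightarrow> bool" where
  "has_spectral_integral m E \<phi> f g \<longleftrightarrow>
     \<phi> \<in> borel_measurable borel \<and> f \<in> Lp m 2 \<and> g \<in> Lp m 2 \<and>
     (\<exists>s :: nat \<Rightarrow> real \<Rightarrow> real.
        (\<forall>n. simple_function borel (s n)) \<and>
        (\<lambda>n. \<integral>\<^sup>+ t. ennreal (\<bar>\<phi> t - s n t\<bar>\<^sup>2) \<partial>scalar_spectral_measure m E f) \<longlonglongrightarrow> 0 \<and>
        Lp_tendsto m 2 (\<lambda>n. simple_spectral_integral E (s n) f) g)"

definition is_spectral_resolution ::
  "('a \<Rightarrow> real) \<Rightarrow> (('a \<Rightarrow> complex) \<Rightarrow> ('a \<Rightarrow> complex)) \<Rightarrow>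
     (real set \<Rightarrow> ('a \<Rightarrow> complex) \<Rightarrow> ('a \<Rightarrow> complex)) \<Rightarrow> bool" where
  "is_spectral_resolution m T E \<longleftrightarrow>
     projection_valued_measure m E \<and> (\<forall>f\<in>Lp m 2. has_spectral_integral m E (\<lambda>t. t) f (T f))"

text \<open>For a bounded self-adjoint \<open>T\<close> the spectral theorem gives existence. The resolution is
  unique up to its values outside Borel sets and outside \<open>Lp m 2\<close>, so the choice is immaterial.\<close>

definition spectral_resolution ::
  "('a \<Rightarrow> real) \<Rightarrow> (('a \<Rightarrow> complex) \<Rightarrow> ('a \<Rightarrow> complex)) \<Rightarrow>
     (real set \<Rightarrow> ('a \<Rightarrow> complex) \<Rightarrow> ('a \<Rightarrow> complex))" where
  "spectral_resolution m T = (SOME E. is_spectral_resolution m T E)"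

definition spectral_fun ::
  "('a \<Rightarrow> real) \<Rightarrow> (('a \<Rightarrow> complex) \<Rightarrow> ('a \<Rightarrow> complex)) \<Rightarrow> (real \<Rightarrow> real) \<Rightarrow>
     ('a \<Rightarrow> complex) \<Rightarrow> ('a \<Rightarrow> complex)" where
  "spectral_fun m T \<phi> f = (THE g. has_spectral_integral m (spectral_resolution m T) \<phi> f g)"


section \<open>Random walk, Laplacian and Riesz transform\<close>

definition pker :: "('a \<Rightarrow> 'a \<Rightarrow> real) \<Rightarrow> 'a \<Rightarrow> 'a \<Rightarrow> real" where
  "pker \<mu> x y = \<mu> x y / (vmass \<mu> x * vmass \<mu> y)"

text \<open>All sums over \<open>UNIV\<close> weighted by \<open>pker \<mu> x\<close> have finitely many nonzero terms.\<close>

primrec pker_iter :: "('a \<Rightarrow> 'a \<Rightarrow> real) \<Rightarrow> nat \<Rightarrow> 'a \<Rightarrow> 'a \<Rightarrow> real" where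
  "pker_iter \<mu> 0 = (\<lambda>x y. (if x = y then 1 else 0) / vmass \<mu> y)"
| "pker_iter \<mu> (Suc k) = (\<lambda>x y. \<Sum>\<^sub>\<infinity>z. pker \<mu> x z * pker_iter \<mu> k z y * vmass \<mu> z)"

definition markov :: "('a \<Rightarrow> 'a \<Rightarrow> real) \<Rightarrow> ('a \<Rightarrow> complex) \<Rightarrow> ('a \<Rightarrow> complex)" where
  "markov \<mu> f = (\<lambda>x. \<Sum>\<^sub>\<infinity>y. of_real (pker \<mu> x y) * f y * of_real (vmass \<mu> y))"

definition laplacian :: "('a \<Rightarrow> 'a \<Rightarrow> real) \<Rightarrow> ('a \<Rightarrow> complex) \<Rightarrow> ('a \<Rightarrow> complex)" where
  "laplacian \<mu> f = (\<lambda>x. f x - markov \<mu> f x)"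

definition gradient :: "('a \<Rightarrow> 'a \<Rightarrow> real) \<Rightarrow> ('a \<Rightarrow> complex) \<Rightarrow> ('a \<Rightarrow> real)" where
  "gradient \<mu> f = (\<lambda>x. sqrt (\<Sum>\<^sub>\<infinity>y. pker \<mu> x y * (cmod (f x - f y))\<^sup>2 * vmass \<mu> y))"

text \<open>The spectrum of the Laplacian lies in \<open>[0, 2]\<close>. Since \<open>0 powr s = 0\<close>, a negative power is
  the inverse of the positive one on the orthogonal complement of the kernel, which contains
  the range of \<open>laplacian_powr \<mu> (1/2)\<close>.\<close>

definition laplacian_powr ::
  "('a \<Rightarrow> 'a \<Rightarrow> real) \<Rightarrow> real \<Rightarrow> ('a \<Rightarrow> complex) \<Rightarrow> ('a \<Rightarrow> complex)" where
  "laplacian_powr \<mu> s = spectral_fun (vmass \<mu>) (laplacian \<mu>) (\<lambda>t. t powr s)"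

definition range_sqrt_laplacian :: "('a \<Rightarrow> 'a \<Rightarrow> real) \<Rightarrow> ('a \<Rightarrow> complex) set" where
  "range_sqrt_laplacian \<mu> = laplacian_powr \<mu> (1/2) ` Lp (vmass \<mu>) 2"

text \<open>The extension by continuity to the whole Hilbert space of
  \<open>f \<mapsto> gradient \<mu> (laplacian_powr \<mu> (-1/2) f)\<close>, defined on the range of the square root.\<close>

definition riesz_transform :: "('a \<Rightarrow> 'a \<Rightarrow> real) \<Rightarrow> ('a \<Rightarrow> complex) \<Rightarrow> ('a \<Rightarrow> real)" where
  "riesz_transform \<mu> f =
     (THE h. h \<in> Lp (vmass \<mu>) 2 \<and>
        (\<forall>u. (\<forall>n. u n \<in> range_sqrt_laplacian \<mu>) \<longrightarrow> Lp_tendsto (vmass \<mu>) 2 u f \<longrightarrow>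
           Lp_tendsto (vmass \<mu>) 2 (\<lambda>n. gradient \<mu> (laplacian_powr \<mu> (-1/2) (u n))) h))"

end

theory Submission
  imports Defs "HOL-Probability.Probability" "HOL-Computational_Algebra.Polynomial"
begin

text \<open>Write \<open>\<Delta> = I - P\<close> and let \<open>A\<^sub>n = \<Sum>\<^bsub>l\<le>n\<^esub> a\<^sub>l P\<^sup>l\<close>, where \<open>a\<^sub>l\<close> are the coefficients of \<open>(1 - t)\<^bsup>-1/2\<^esup>\<close>. By
  spectral calculus \<open>\<Delta>\<^bsup>1/2\<^esup> A\<^sub>n f \<longlonglongrightarrow> f\<close> in \<open>L\<^sup>2\<close>, so that \<open>\<nabla> A\<^sub>n f\<close> tends to the Riesz transform of \<open>f\<close>, and
  \<open>\<parallel>\<nabla> A\<^sub>n f\<parallel>\<^sub>2 \<le> C \<parallel>f\<parallel>\<^sub>2\<close>. It remains to bound \<open>\<nabla> A\<^sub>n\<close> on \<open>L\<^sup>p\<close>, uniformly in \<open>n\<close>, on functions with finite support.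

  At height \<open>\<theta>\<close>, the set where the maximal function of \<open>f\<close> exceeds \<open>\<theta>\<close> is covered by balls
  \<open>B(i, 2 r\<^sub>i)\<close> with \<open>B(i, r\<^sub>i)\<close> disjoint, and \<open>f = g + \<Sum> b\<^sub>i\<close> with \<open>\<bar>g\<bar> \<le> \<theta>\<close> and \<open>b\<^sub>i\<close> the restriction of \<open>f\<close>
  to a piece of \<open>B(i, 2 r\<^sub>i)\<close>; no cancellation of \<open>b\<^sub>i\<close> is needed. With \<open>k\<^sub>i \<approx> r\<^sub>i\<^sup>\<beta>\<close>, the \<open>L\<^sup>2\<close> bound handles \<open>g\<close>
  and \<open>\<Sum> P\<^bsup>k\<^sub>i\<^esup> b\<^sub>i\<close>, the \<open>L\<^sup>2\<close> norm of the latter being controlled by duality with the maximal function,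
  while \<open>A\<^sub>n (I - P\<^bsup>k\<^sub>i\<^esup>) b\<^sub>i\<close> is controlled away from \<open>B(i, 4 r\<^sub>i)\<close> by the estimate
  \<open>\<Sum>\<^bsub>d(x, y) \<ge> r\<^esub> \<nabla>p\<^sub>l(\<cdot>, y)(x) m(x) \<le> C l\<^bsup>-1/2\<^esup> exp (- c r / l\<^bsup>1/\<beta>\<^esup>)\<close>. The factor \<open>l\<^bsup>-1/2\<^esup>\<close> comes from analyticity on
  \<open>L\<^sup>2\<close> alone: the squared differences of \<open>u = p\<^sub>l(\<cdot>, y)\<close> along the edges are compared with the convexity
  defect of \<open>t\<^bsup>3/2\<^esup>\<close>, whose sum over the graph is \<open>(3/2) \<langle>\<surd>u, \<Delta>u\<rangle>\<close>. Integration of the resulting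
  distributional inequality over \<open>\<theta>\<close> yields the bound on \<open>L\<^sup>p\<close>.\<close>

section \<open>The spectral theorem\<close>

subsection \<open>Square integrable functions\<close>

text \<open>The kernel at time \<open>l\<close> decays at scale \<open>l powr (1/\<beta>)\<close>,
  which may be shorter than \<open>sqrt l\<close>. Integrating by parts against an exponential
  weight of that scale would give a factor \<open>l powr (- 1/\<beta>)\<close> instead of
  \<open>l powr (- 1/2)\<close>. The convexity defect keeps the weight out of the energy: by
  Cauchy-Schwarz the sum of the gradient is bounded by the geometric mean of a sum of
  \<open>sqrt u\<close>, which carries the whole spatial decay and is summed by doubling, and of an
  unweighted sum of defects. The exponent 3/2 is chosen because its derivative is a multiple of
  \<open>sqrt u\<close>, which has norm at most 1 in \<open>L^2\<close> as \<open>u\<close> has mass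
  at most 1; so only the \<open>L^2\<close> norm of the Laplacian of \<open>u\<close> enters, and
  the volumes in the two sums cancel. The spectral theorem stands first because the Riesz transform
  is defined through a chosen spectral resolution; it is derived from Hausdorff's moment problem for
  the functional \<open><p(T) x, x>\<close> on polynomials. Analyticity has a second use: it
  excludes the eigenvalue 2 of the Laplacian, so the spectral measures live on the open interval
  where the binomial series is summed.\<close>

definition sqi :: "'a measure \<Rightarrow> ('a \<Rightarrow> real) \<Rightarrow> bool" where
  "sqi M f \<longleftrightarrow> f \<in> borel_measurable M \<and> integrable M (\<lambda>x. (f x)\<^sup>2)"

text \<open>Divergent Bochner integrals have the value 0, so this behaves as a norm only together
  with \<open>sqi\<close>.\<close>

definition l2n :: "'a measure \<Rightarrow> ('a \<Rightarrow> real) \<Rightarrow> real" where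
  "l2n M f = sqrt (\<integral>x. (f x)\<^sup>2 \<partial>M)"

lemma l2n_nonneg [simp]: "0 \<le> l2n M f"
  by (simp add: l2n_def)

lemma l2n_sq: "(l2n M f)\<^sup>2 = (\<integral>x. (f x)\<^sup>2 \<partial>M)"
  by (simp add: l2n_def)

lemma sqi_mult:
  assumes "sqi M f" "sqi M g" shows "integrable M (\<lambda>x. f x * g x)"
proof (rule Bochner_Integration.integrable_bound)
  show "integrable M (\<lambda>x. (f x)\<^sup>2 + (g x)\<^sup>2)"
    using assms by (auto simp: sqi_def)
  show "(\<lambda>x. f x * g x) \<in> borel_measurable M"
    using assms by (auto simp: sqi_def)
  have "\<bar>a * b\<bar> \<le> a\<^sup>2 + b\<^sup>2" for a b :: real
    using sum_squares_bound[of "\<bar>a\<bar>" "\<bar>b\<bar>"] mult_nonneg_nonneg[OF abs_ge_zero[of a] abs_ge_zero[of b]]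
    unfolding abs_mult power2_abs by linarith
  then show "AE x in M. norm (f x * g x) \<le> norm ((f x)\<^sup>2 + (g x)\<^sup>2)"
    by auto
qed

lemma sqi_cmult: "sqi M f \<Longrightarrow> sqi M (\<lambda>x. c * f x)"
  by (auto simp: sqi_def power_mult_distrib)

lemma sqi_add:
  assumes "sqi M f" "sqi M g" shows "sqi M (\<lambda>x. f x + g x)"
proof -
  have "integrable M (\<lambda>x. (f x)\<^sup>2 + (g x)\<^sup>2 + 2 * (f x * g x))"
    using assms sqi_mult[OF assms] by (auto simp: sqi_def)
  then show ?thesis using assms by (auto simp: sqi_def power2_sum mult.assoc)
qed

lemma sqi_diff: "sqi M f \<Longrightarrow> sqi M g \<Longrightarrow> sqi M (\<lambda>x. f x - g x)"
  using sqi_add[of M f "\<lambda>x. (-1) * g x"] sqi_cmult[of M g "-1"] by simp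

lemma (in finite_measure) sqi_bounded:
  assumes "f \<in> borel_measurable M" "AE x in M. \<bar>f x\<bar> \<le> B"
  shows "sqi M f"
proof -
  have "AE x in M. norm ((f x)\<^sup>2) \<le> B\<^sup>2"
    using assms(2) by eventually_elim (metis abs_ge_zero norm_power power_mono real_norm_def)
  then show ?thesis
    using assms by (auto simp: sqi_def intro!: integrable_const_bound)
qed

text \<open>The integral of \<open>(s f - t g)^2\<close> is nonnegative; its expansion at
  \<open>s = l2n M g\<close>, \<open>t = l2n M f\<close> gives the bound after division by the
  product of the norms. If one norm vanishes, \<open>f g\<close> vanishes almost everywhere.\<close>

lemma sqi_Cauchy_Schwarz:
  assumes "sqi M f" "sqi M g"
  shows "(\<integral>x. f x * g x \<partial>M) \<le> l2n M f * l2n M g"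
proof -
  let ?a = "l2n M f" and ?b = "l2n M g"
  note i = sqi_mult[OF assms] and f = sqi_mult[OF assms(1,1)] and g = sqi_mult[OF assms(2,2)]
  have *: "0 \<le> (\<integral>x. (s * f x - t * g x)\<^sup>2 \<partial>M)" for s t by simp
  have eq: "(\<integral>x. (s * f x - t * g x)\<^sup>2 \<partial>M) = s\<^sup>2 * ?a\<^sup>2 - 2 * s * t * (\<integral>x. f x * g x \<partial>M) + t\<^sup>2 * ?b\<^sup>2" for s t
  proof -
    have "(\<lambda>x. (s * f x - t * g x)\<^sup>2) = (\<lambda>x. s\<^sup>2 * (f x * f x) - 2 * s * t * (f x * g x) + t\<^sup>2 * (g x * g x))"
      by (auto simp: power2_eq_square algebra_simps)
    then show ?thesis
      using i f g by (simp add: l2n_sq power2_eq_square[of "f _"] power2_eq_square[of "g _"])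
  qed
  show ?thesis
  proof (cases "?a = 0 \<or> ?b = 0")
    case True
    then have "AE x in M. f x * g x = 0"
    proof
      assume "?a = 0"
      then have "(\<integral>x. (f x)\<^sup>2 \<partial>M) = 0" using l2n_sq[of M f] by simp
      then have "AE x in M. (f x)\<^sup>2 = 0"
        using assms by (subst (asm) integral_nonneg_eq_0_iff_AE) (auto simp: sqi_def)
      then show ?thesis by auto
    next
      assume "?b = 0"
      then have "(\<integral>x. (g x)\<^sup>2 \<partial>M) = 0" using l2n_sq[of M g] by simp
      then have "AE x in M. (g x)\<^sup>2 = 0"
        using assms by (subst (asm) integral_nonneg_eq_0_iff_AE) (auto simp: sqi_def)
      then show ?thesis by auto
    qed
    then have "(\<integral>x. f x * g x \<partial>M) = 0"
      using integral_cong_AE[of "\<lambda>x. f x * g x" M "\<lambda>x. 0"] i by auto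
    then show ?thesis by simp
  next
    case False
    then have pos: "?a > 0" "?b > 0" using l2n_nonneg[of M f] l2n_nonneg[of M g] by linarith+
    have "0 \<le> ?b\<^sup>2 * ?a\<^sup>2 - 2 * ?b * ?a * (\<integral>x. f x * g x \<partial>M) + ?a\<^sup>2 * ?b\<^sup>2"
      using *[of ?b ?a] by (simp add: eq)
    then have "(?a * ?b) * (\<integral>x. f x * g x \<partial>M) \<le> (?a * ?b) * (?a * ?b)"
      by (simp add: power2_eq_square algebra_simps)
    then show ?thesis using pos by (simp add: mult_le_cancel_left)
  qed
qed

lemma l2n_triangle:
  assumes "sqi M f" "sqi M g" shows "l2n M (\<lambda>x. f x + g x) \<le> l2n M f + l2n M g"
proof -
  have "(\<integral>x. (f x + g x)\<^sup>2 \<partial>M) = (l2n M f)\<^sup>2 + 2 * (\<integral>x. f x * g x \<partial>M) + (l2n M g)\<^sup>2"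
    using sqi_mult[OF assms] assms by (simp add: power2_sum l2n_sq sqi_def mult.assoc)
  also have "\<dots> \<le> (l2n M f + l2n M g)\<^sup>2"
    using sqi_Cauchy_Schwarz[OF assms] by (simp add: power2_sum)
  finally show ?thesis unfolding l2n_def[of M "\<lambda>x. f x + g x"]
    using l2n_nonneg[of M f] l2n_nonneg[of M g] real_le_lsqrt by (meson add_nonneg_nonneg)
qed

lemma l2n_cmult: "l2n M (\<lambda>x. c * f x) = \<bar>c\<bar> * l2n M f"
  by (simp add: l2n_def power_mult_distrib real_sqrt_mult)

lemma l2n_diff_commute: "l2n M (\<lambda>x. f x - g x) = l2n M (\<lambda>x. g x - f x)"
  by (simp add: l2n_def power2_commute)

lemma l2n_triangle_diff:
  assumes "sqi M f" "sqi M g" "sqi M h"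
  shows "l2n M (\<lambda>x. f x - h x) \<le> l2n M (\<lambda>x. f x - g x) + l2n M (\<lambda>x. g x - h x)"
  using l2n_triangle[OF sqi_diff[OF assms(1,2)] sqi_diff[OF assms(2,3)]] by simp

lemma l2n_diff_ge:
  assumes "sqi M f" "sqi M g" shows "\<bar>l2n M f - l2n M g\<bar> \<le> l2n M (\<lambda>x. f x - g x)"
  using l2n_triangle[OF sqi_diff[OF assms] assms(2)]
    l2n_triangle[OF sqi_diff[OF assms(2,1)] assms(1)] l2n_diff_commute[of M f g] by simp

lemma l2n_tendsto:
  assumes "\<And>n. sqi M (s n)" "sqi M f" "(\<lambda>n. l2n M (\<lambda>x. s n x - f x)) \<longlonglongrightarrow> 0"
  shows "(\<lambda>n. l2n M (s n)) \<longlonglongrightarrow> l2n M f"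
proof -
  have "(\<lambda>n. l2n M (s n) - l2n M f) \<longlonglongrightarrow> 0"
    by (rule Lim_null_comparison[OF _ assms(3)]) (use l2n_diff_ge[OF assms(1,2)] in auto)
  then show ?thesis by (simp add: LIM_zero_iff)
qed

lemma l2n_dominated:
  assumes "\<And>n. s n \<in> borel_measurable M" "f \<in> borel_measurable M" "integrable M w"
    and "\<And>n. AE x in M. (s n x - f x)\<^sup>2 \<le> w x" and "AE x in M. (\<lambda>n. s n x) \<longlonglongrightarrow> f x"
  shows "(\<lambda>n. l2n M (\<lambda>x. s n x - f x)) \<longlonglongrightarrow> 0"
proof -
  have "(\<lambda>n. \<integral>x. (s n x - f x)\<^sup>2 \<partial>M) \<longlonglongrightarrow> (\<integral>x. 0 \<partial>M)"
  proof (rule integral_dominated_convergence[where w=w])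
    show "AE x in M. (\<lambda>n. (s n x - f x)\<^sup>2) \<longlonglongrightarrow> 0"
      using assms(5) by eventually_elim (auto intro!: tendsto_eq_intros)
  qed (use assms in auto)
  then have "(\<lambda>n. sqrt (\<integral>x. (s n x - f x)\<^sup>2 \<partial>M)) \<longlonglongrightarrow> sqrt 0"
    by (intro tendsto_real_sqrt) simp
  then show ?thesis by (simp add: l2n_def)
qed

subsection \<open>Symmetric operators and their polynomials\<close>

definition symmetric_op :: "('h::real_inner \<Rightarrow> 'h) \<Rightarrow> bool" where
  "symmetric_op T \<longleftrightarrow> bounded_linear T \<and> (\<forall>x y. inner (T x) y = inner x (T y))"

text \<open>Horner's scheme for \<open>p(T) x\<close>, which keeps the proofs inductive on
  \<open>pCons\<close> and avoids iterates of \<open>T\<close>.\<close>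

definition poly_op :: "('h::real_vector \<Rightarrow> 'h) \<Rightarrow> real poly \<Rightarrow> 'h \<Rightarrow> 'h" where
  "poly_op T p = fold_coeffs (\<lambda>a f x. a *\<^sub>R x + T (f x)) p (\<lambda>x. 0)"

lemma poly_op_0 [simp]: "poly_op T 0 x = 0"
  by (simp add: poly_op_def)

text \<open>Linearity enters through \<open>T 0 = 0\<close>: \<open>pCons 0 0\<close> is the zero
  polynomial, on which the fold is empty.\<close>

lemma poly_op_pCons:
  assumes "linear T" shows "poly_op T (pCons a p) x = a *\<^sub>R x + T (poly_op T p x)"
  by (cases "p = 0 \<and> a = 0") (auto simp: poly_op_def linear_0[OF assms])

lemma poly_op_add: "linear T \<Longrightarrow> poly_op T (p + q) x = poly_op T p x + poly_op T q x"
  by (induction p q rule: poly_induct2) (auto simp: poly_op_pCons linear_add algebra_simps)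

lemma poly_op_smult: "linear T \<Longrightarrow> poly_op T (smult c p) x = c *\<^sub>R poly_op T p x"
  by (induction p) (auto simp: poly_op_pCons linear_cmul algebra_simps)

lemma poly_op_diff: "linear T \<Longrightarrow> poly_op T (p - q) x = poly_op T p x - poly_op T q x"
  using poly_op_add[of T "p - q" q x] by simp

lemma poly_op_sum: "linear T \<Longrightarrow> poly_op T (\<Sum>i\<in>I. f i) x = (\<Sum>i\<in>I. poly_op T (f i) x)"
  by (induction I rule: infinite_finite_induct) (auto simp: poly_op_add)

lemma poly_op_mult: "linear T \<Longrightarrow> poly_op T (p * q) x = poly_op T p (poly_op T q x)"
  by (induction p) (auto simp: poly_op_pCons poly_op_add poly_op_smult)

lemma poly_op_linear: "linear T \<Longrightarrow> linear (poly_op T p)"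
proof (induction p)
  case 0
  then show ?case by (simp add: linear_iff)
next
  case (pCons a p)
  then show ?case by (simp add: linear_iff poly_op_pCons algebra_simps)
qed

lemma poly_op_bounded_linear: "bounded_linear T \<Longrightarrow> bounded_linear (poly_op T p)"
proof (induction p)
  case 0
  then show ?case by (simp add: poly_op_def bounded_linear_zero)
next
  case (pCons a p)
  have "bounded_linear (\<lambda>x. a *\<^sub>R x + T (poly_op T p x))"
    using pCons by (intro bounded_linear_add bounded_linear_scaleR_right
        bounded_linear_compose[of T "poly_op T p"]) auto
  then show ?case
    using poly_op_pCons[OF bounded_linear.linear[OF pCons.prems], of a p] by presburger
qed

lemma poly_op_const [simp]: "linear T \<Longrightarrow> poly_op T [:c:] x = c *\<^sub>R x"
  by (simp add: poly_op_pCons linear_0)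

lemma poly_op_1 [simp]: "linear T \<Longrightarrow> poly_op T 1 x = x"
  by (simp add: one_pCons)

lemma poly_op_X [simp]: "linear T \<Longrightarrow> poly_op T [:0, 1:] x = T x"
  by (simp add: poly_op_pCons linear_0)

lemma poly_op_commute:
  assumes "linear T" "linear J" "\<And>x. J (T x) = T (J x)"
  shows "J (poly_op T p x) = poly_op T p (J x)"
  by (induction p) (auto simp: poly_op_pCons assms linear_0 linear_add linear_cmul)

lemma poly_op_symmetric:
  assumes "symmetric_op T" shows "inner (poly_op T p x) y = inner x (poly_op T p y)"
proof -
  have lin: "linear T" using assms by (simp add: symmetric_op_def bounded_linear.linear)
  show ?thesis
  proof (induction p arbitrary: y)
    case (pCons a p)
    have "inner (T (poly_op T p x)) y = inner (poly_op T p x) (T y)"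
      using assms by (simp add: symmetric_op_def)
    also have "\<dots> = inner x (T (poly_op T p y))"
      using pCons poly_op_commute[OF lin lin, of p y] by simp
    finally show ?case using lin by (simp add: poly_op_pCons inner_add)
  qed simp
qed

text \<open>The source of the isometries below: symmetry moves one factor \<open>p(T)\<close>
  across, so norms of \<open>p(T) x\<close> are values of the functional
  \<open>p \<mapsto> <p(T) x, x>\<close>.\<close>

lemma poly_op_norm_sq:
  assumes "symmetric_op T" shows "(norm (poly_op T p x))\<^sup>2 = inner (poly_op T (p * p) x) x"
proof -
  have lin: "linear T" using assms by (simp add: symmetric_op_def bounded_linear.linear)
  show ?thesis
    by (simp add: power2_norm_eq_inner poly_op_mult[OF lin] poly_op_symmetric[OF assms])
qed

subsection \<open>Hausdorff moments\<close>

text \<open>Positivity of \<open>T^i (1 - T)^j\<close> without a square root of \<open>T\<close>. By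
  the parities of \<open>i\<close> and \<open>j\<close> the polynomial is \<open>q q\<close>,
  \<open>q X q\<close>, \<open>q Y q\<close> or \<open>q X Y q\<close>, where \<open>X\<close> and
  \<open>Y\<close> stand for \<open>T\<close> and \<open>1 - T\<close>; the first is a square, and
  the next two are the hypotheses at the vector \<open>q(T) x\<close>.\<close>

lemma bernstein_op_nonneg:
  fixes T :: "'h::real_inner \<Rightarrow> 'h"
  assumes T: "symmetric_op T" and pos: "\<And>x. 0 \<le> inner (T x) x" and le: "\<And>x. inner (T x) x \<le> inner x x"
  shows "0 \<le> inner (poly_op T ([:0,1:] ^ i * [:1,-1:] ^ j) x) x"
proof -
  have lin: "linear T" using T by (simp add: symmetric_op_def bounded_linear.linear)
  define X Y :: "real poly" where "X = [:0,1:]" and "Y = [:1,-1:]"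
  have XY1: "X + Y = 1" by (simp add: X_def Y_def one_pCons)
  have opX: "poly_op T X z = T z" and opY: "poly_op T Y z = z - T z" for z
    using lin by (simp_all add: X_def Y_def poly_op_pCons linear_0 linear_neg)
  have sq: "0 \<le> inner (poly_op T (p * p) x) x" for p
    by (simp flip: poly_op_norm_sq[OF T])
  have SX: "0 \<le> inner (poly_op T (p * (X * p)) x) x" for p
    using pos[of "poly_op T p x"] lin by (simp add: poly_op_mult poly_op_symmetric[OF T, of p] opX)
  have SY: "0 \<le> inner (poly_op T (p * (Y * p)) x) x" for p
    using le[of "poly_op T p x"] lin
    by (simp add: poly_op_mult poly_op_symmetric[OF T, of p] inner_diff_left opY)
  have SXY: "0 \<le> inner (poly_op T (p * (X * (Y * p))) x) x" for p
  proof -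
    \<comment> \<open>The mixed case: multiplication by \<open>X + Y = 1\<close> turns
      \<open>X Y\<close> into \<open>X Y X + Y X Y\<close>, which reduces it to the two preceding
      cases.\<close>
    have "p * (X * (Y * p)) = (X + Y) * (p * (X * (Y * p)))" by (simp only: XY1 mult_1)
    also have "\<dots> = (X * p) * (Y * (X * p)) + (Y * p) * (X * (Y * p))"
      by (simp add: algebra_simps)
    finally show ?thesis
      using SX[of "Y * p"] SY[of "X * p"] by (simp only: poly_op_add[OF lin] inner_add_left)
  qed
  define a b where "a = i div 2" and "b = j div 2"
  let ?q = "X ^ a * Y ^ b"
  have "i = a + a \<or> i = Suc (a + a)" "j = b + b \<or> j = Suc (b + b)" unfolding a_def b_def by presburger+
  then have "X ^ i * Y ^ j \<in> {?q * ?q, ?q * (X * ?q), ?q * (Y * ?q), ?q * (X * (Y * ?q))}"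
    by (elim disjE) (simp_all only: insert_iff power_add power_Suc mult_ac simp_thms)
  then have "0 \<le> inner (poly_op T (X ^ i * Y ^ j) x) x"
    using sq SX SY SXY by auto
  then show ?thesis by (simp add: X_def Y_def)
qed

text \<open>Multiply by \<open>(s + t)^(n-k) = 1\<close>, expand, and use
  \<open>C(n,k) C(n-k,i) = C(n,k+i) C(k+i,k)\<close>. This expresses moments by Bernstein weights:
  \<open>j choose k\<close> is a factorial moment of the node \<open>j\<close>.\<close>

lemma power_eq_bernstein_sum:
  fixes s t :: "'a::comm_ring_1"
  assumes "s + t = 1" "k \<le> n"
  shows "of_nat (n choose k) * s ^ k = (\<Sum>j\<le>n. of_nat ((n choose j) * (j choose k)) * (s ^ j * t ^ (n - j)))"
proof -
  have "s ^ k = s ^ k * (s + t) ^ (n - k)" using assms by simp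
  also have "\<dots> = (\<Sum>i\<le>n-k. of_nat ((n - k) choose i) * (s ^ (k + i) * t ^ (n - k - i)))"
    by (simp add: binomial_ring sum_distrib_left power_add mult_ac)
  finally have "of_nat (n choose k) * s ^ k
     = (\<Sum>i\<le>n-k. of_nat ((n choose k) * ((n - k) choose i)) * (s ^ (k + i) * t ^ (n - k - i)))"
    by (simp add: sum_distrib_left mult_ac)
  also have "\<dots> = (\<Sum>i\<le>n-k. of_nat ((n choose (k + i)) * ((k + i) choose k)) * (s ^ (k + i) * t ^ (n - (k + i))))"
  proof (rule sum.cong[OF refl])
    fix i assume "i \<in> {..n-k}"
    then have "k \<le> k + i" "k + i \<le> n" using assms(2) by auto
    from choose_mult[OF this] show "of_nat ((n choose k) * ((n - k) choose i)) * (s ^ (k + i) * t ^ (n - k - i))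
       = of_nat ((n choose (k + i)) * ((k + i) choose k)) * (s ^ (k + i) * t ^ (n - (k + i)))"
      by simp
  qed
  also have "\<dots> = (\<Sum>j=k..n. of_nat ((n choose j) * (j choose k)) * (s ^ j * t ^ (n - j)))"
    by (rule sum.reindex_bij_witness[of _ "\<lambda>j. j - k" "\<lambda>i. k + i"]) (use assms in auto)
  also have "\<dots> = (\<Sum>j\<le>n. of_nat ((n choose j) * (j choose k)) * (s ^ j * t ^ (n - j)))"
    by (rule sum.mono_neutral_left) (auto simp: binomial_eq_0)
  finally show ?thesis .
qed

text \<open>The ratio is a product of \<open>k\<close> factors \<open>(j - i)/(n - i)\<close>,
  compared one by one with \<open>j/n\<close>. Since \<open>n - i\<close> is at least
  \<open>n/2\<close>, each comparison costs at most \<open>2 k / n\<close>, and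
  \<open>n >= 2 k\<close> keeps the factors of modulus at most 1 even when
  \<open>j < i\<close>.\<close>

lemma choose_ratio_approx:
  assumes n: "n \<ge> 2 * k" "n > 0" and j: "j \<le> n"
  shows "\<bar>real (j choose k) / real (n choose k) - (real j / real n) ^ k\<bar> \<le> 2 * real k ^ 2 / real n"
proof -
  have "real (j choose k) / real (n choose k) = (\<Prod>i<k. (real j - real i) / (real n - real i))"
    by (simp add: binomial_gbinomial gbinomial_prod_rev prod_dividef atLeast0LessThan)
  moreover have "\<bar>(\<Prod>i<k. (real j - real i) / (real n - real i)) - (\<Prod>i<k. real j / real n)\<bar>
      \<le> (\<Sum>i<k. \<bar>(real j - real i) / (real n - real i) - real j / real n\<bar>)"
  proof (rule norm_prod_diff[where 'a=real, unfolded real_norm_def])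
    fix i assume i: "i \<in> {..<k}"
    then show "\<bar>(real j - real i) / (real n - real i)\<bar> \<le> 1"
      using n j by (auto simp: divide_simps abs_if)
    show "\<bar>real j / real n\<bar> \<le> 1" using n j by auto
  qed
  moreover have "\<bar>(real j - real i) / (real n - real i) - real j / real n\<bar> \<le> 2 * real k / real n" if i: "i < k" for i
  proof -
    have pos: "real n - real i \<ge> real n / 2" "real n > 0" "real n - real i > 0" using n i by auto
    have eq: "(real j - real i) / (real n - real i) - real j / real n = - (real i / (real n - real i)) * ((real n - real j) / real n)"
      using pos by (simp add: field_simps)
    have a: "real i / (real n - real i) \<le> real k / (real n / 2)"
      using pos i by (intro frac_le) auto
    have b: "(real n - real j) / real n \<le> 1" "0 \<le> (real n - real j) / real n" using pos j by auto
    have "real i / (real n - real i) * ((real n - real j) / real n) \<le> (real k / (real n / 2)) * 1"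
      using a b pos by (intro mult_mono) auto
    also have "\<dots> = 2 * real k / real n" by simp
    finally have c: "real i / (real n - real i) * ((real n - real j) / real n) \<le> 2 * real k / real n" .
    have d: "0 \<le> real i / (real n - real i) * ((real n - real j) / real n)" using pos b by (intro mult_nonneg_nonneg) auto
    from c show ?thesis unfolding eq mult_minus_left abs_minus_cancel abs_of_nonneg[OF d] .
  qed
  then have "(\<Sum>i<k. \<bar>(real j - real i) / (real n - real i) - real j / real n\<bar>) \<le> (\<Sum>i<k. 2 * real k / real n)"
    by (intro sum_mono) auto
  ultimately show ?thesis by (simp add: power2_eq_square mult_ac)
qed

text \<open>Hausdorff's moment theorem. The Bernstein weights \<open>w n j\<close>, placed at the
  nodes \<open>j/n\<close>, form probability measures on \<open>[0,1]\<close>; a weak limit along a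
  subsequence has the moments \<open><T^k x, x>\<close>, because the factorial moments computed in
  \<open>mom\<close> differ from the powers \<open>(j/n)^k\<close> by \<open>O(1/n)\<close>.\<close>

lemma moment_measure_unit:
  fixes T :: "'h::real_inner \<Rightarrow> 'h"
  assumes T: "symmetric_op T" and pos: "\<And>x. 0 \<le> inner (T x) x" and le: "\<And>x. inner (T x) x \<le> inner x x"
    and x: "inner x x = 1"
  shows "\<exists>M. finite_measure M \<and> sets M = sets borel \<and> (AE t in M. 0 \<le> t \<and> t \<le> 1) \<and>
     (\<forall>p. inner (poly_op T p x) x = (\<integral>t. poly p t \<partial>M))"
proof -
  have lin: "linear T" using T by (simp add: symmetric_op_def bounded_linear.linear)
  define X Y :: "real poly" where "X = [:0,1:]" and "Y = [:1,-1:]"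
  have XY1: "X + Y = 1" by (simp add: X_def Y_def one_pCons)
  define L where "L p = inner (poly_op T p x) x" for p
  have L_sum: "L (\<Sum>i\<in>I. f i) = (\<Sum>i\<in>I. L (f i))" for I :: "nat set" and f
    by (simp add: L_def poly_op_sum lin inner_sum_left)
  have L_smult: "L (smult c p) = c * L p" for c p by (simp add: L_def poly_op_smult lin)
  have L_of_nat: "L (of_nat c * p) = real c * L p" for c p
    by (simp add: of_nat_poly L_smult)
  define w where "w n j = L (smult (real (n choose j)) (X ^ j * Y ^ (n - j)))" for n j
  have w_nonneg: "0 \<le> w n j" for n j
    using bernstein_op_nonneg[OF assms(1-3), where i = j and j = "n - j" and x = x] by (simp add: w_def L_smult) (simp add: L_def X_def Y_def)
  have mom: "real (n choose k) * L (X ^ k) = (\<Sum>j\<le>n. real (j choose k) * w n j)" if "k \<le> n" for n k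
  proof -
    have "real (n choose k) * L (X ^ k) = L (of_nat (n choose k) * X ^ k)" by (simp add: L_of_nat)
    also have "\<dots> = L (\<Sum>j\<le>n. of_nat ((n choose j) * (j choose k)) * (X ^ j * Y ^ (n - j)))"
      using power_eq_bernstein_sum[OF XY1 that] by simp
    also have "\<dots> = (\<Sum>j\<le>n. real (j choose k) * w n j)"
      unfolding L_sum L_of_nat w_def L_smult by (simp add: mult_ac)
    finally show ?thesis .
  qed
  have sum_w: "(\<Sum>j\<le>n. w n j) = 1" for n
    using mom[of 0 n] x by (simp add: L_def lin)
  \<comment> \<open>The index is shifted so that the denominator of the nodes is never 0.\<close>
  define M where "M n = distr (point_measure {..Suc n} (\<lambda>j. ennreal (w (Suc n) j))) borel (\<lambda>j. real j / real (Suc n))" for n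
  have M_real: "real_distribution (M n)" for n
  proof -
    have "prob_space (point_measure {..Suc n} (\<lambda>j. ennreal (w (Suc n) j)))"
      by (rule prob_spaceI)
        (auto simp: space_point_measure emeasure_point_measure_finite w_nonneg sum_w sum_ennreal simp del: sum.atMost_Suc)
    then show ?thesis unfolding M_def
      by (intro prob_space.real_distribution_distr) auto
  qed
  have M_int: "(\<integral>t. f t \<partial>M n) = (\<Sum>j\<le>Suc n. w (Suc n) j * f (real j / real (Suc n)))"
    if "f \<in> borel_measurable borel" for f :: "real \<Rightarrow> real" and n
    unfolding M_def using that
    by (subst integral_distr) (auto simp: lebesgue_integral_point_measure_finite w_nonneg)
  have "tight M"
    unfolding tight_def
  proof (intro conjI allI impI)
    fix \<epsilon> :: real assume "\<epsilon> > 0"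
    \<comment> \<open>Tightness is stated with half-open intervals, so the left end lies below 0 in
      order to keep the node 0.\<close>
    have "measure (M n) {-1<..1} = 1" for n
    proof -
      interpret real_distribution "M n" by (rule M_real)
      have "measure (M n) {-1<..1} = (\<integral>t. indicator {-1<..1} t \<partial>M n)" by simp
      also have "\<dots> = (\<Sum>j\<le>Suc n. w (Suc n) j)"
        by (subst M_int) (auto intro!: sum.cong simp: indicator_def divide_simps)
      finally show ?thesis by (simp add: sum_w del: sum.atMost_Suc)
    qed
    then show "\<exists>a b. a < b \<and> (\<forall>n. 1 - \<epsilon> < measure (M n) {a<..b})"
      using \<open>\<epsilon> > 0\<close> by (intro exI[of _ "-1"] exI[of _ 1]) auto
  qed (rule M_real)
  from tight_imp_convergent_subsubsequence[OF this, of id]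
  obtain r N where r: "strict_mono (r :: nat \<Rightarrow> nat)" and N: "real_distribution N" and conv: "weak_conv_m (M \<circ> r) N"
    by (auto simp: strict_mono_def)
  interpret N: real_distribution N by fact
  have lim: "(\<lambda>n. \<integral>t. f t \<partial>M (r n)) \<longlonglongrightarrow> (\<integral>t. f t \<partial>N)"
    if "\<And>x. isCont f x" "\<And>x. \<bar>f x\<bar> \<le> B" for f :: "real \<Rightarrow> real" and B
    using weak_conv_imp_integral_bdd_continuous_conv[of "M \<circ> r" N f B] M_real N conv that by (auto simp: o_def)
  \<comment> \<open>Weak convergence tests only bounded continuous functions; \<open>clamp\<close>
    makes the powers bounded without changing them on \<open>[0,1]\<close>, where all the measures
    \<open>M n\<close> live.\<close>
  define clamp where "clamp t = max 0 (min 1 t)" for t :: real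
  have clamp: "isCont clamp t" "0 \<le> clamp t" "clamp t \<le> 1" for t
    unfolding clamp_def by (auto intro!: continuous_intros)
  have [measurable]: "clamp \<in> borel_measurable borel" unfolding clamp_def by measurable
  have AE: "AE t in N. 0 \<le> t \<and> t \<le> 1"
  proof -
    \<comment> \<open>A bounded continuous function vanishing exactly on \<open>[0,1]\<close>: its
      integral is 0 for each \<open>M n\<close>, hence for the limit.\<close>
    define f where "f t = min 1 \<bar>t - clamp t\<bar>" for t
    have [measurable]: "f \<in> borel_measurable borel" unfolding f_def by measurable
    have "isCont f t" for t unfolding f_def using clamp(1) by (intro continuous_intros) auto
    then have "(\<lambda>n. \<integral>t. f t \<partial>M (r n)) \<longlonglongrightarrow> (\<integral>t. f t \<partial>N)"
      by (rule lim[of _ 1]) (auto simp: f_def)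
    moreover have "(\<integral>t. f t \<partial>M n) = 0" for n
      by (subst M_int) (auto intro!: sum.neutral simp: f_def clamp_def divide_simps min_def max_def)
    ultimately have "(\<integral>t. f t \<partial>N) = 0" by (simp add: LIMSEQ_const_iff)
    moreover have "integrable N f" by (rule N.integrable_const_bound[where B=1]) (auto simp: f_def)
    ultimately have "AE t in N. f t = 0"
      by (subst (asm) integral_nonneg_eq_0_iff_AE) (auto simp: f_def)
    then show ?thesis by eventually_elim (auto simp: f_def clamp_def min_def max_def split: if_splits)
  qed
  have mono: "L (X ^ k) = (\<integral>t. t ^ k \<partial>N)" for k
  proof -
    have cm: "(\<lambda>n. \<integral>t. clamp t ^ k \<partial>M (r n)) \<longlonglongrightarrow> (\<integral>t. clamp t ^ k \<partial>N)"
    proof (rule lim[of _ 1])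
      show "isCont (\<lambda>t. clamp t ^ k) t" for t using clamp(1) by (intro continuous_intros) auto
      show "\<bar>clamp t ^ k\<bar> \<le> 1" for t
        using clamp(2)[of t] clamp(3)[of t] by (simp add: power_abs power_le_one)
    qed
    have M_eq: "(\<integral>t. clamp t ^ k \<partial>M n) = (\<Sum>j\<le>Suc n. w (Suc n) j * (real j / real (Suc n)) ^ k)" for n
      by (subst M_int) (auto intro!: sum.cong simp: clamp_def divide_simps min_def max_def)
    have bound: "\<bar>L (X ^ k) - (\<integral>t. clamp t ^ k \<partial>M n)\<bar> \<le> 2 * real k ^ 2 / real (Suc n)" if "Suc n \<ge> 2 * k" for n
    proof -
      have kn: "k \<le> Suc n" using that by simp
      then have "real (Suc n choose k) > 0" by (simp add: zero_less_binomial)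
      then have "L (X ^ k) = (\<Sum>j\<le>Suc n. w (Suc n) j * (real (j choose k) / real (Suc n choose k)))"
        using mom[OF kn] by (simp add: field_simps sum_divide_distrib[symmetric] del: sum.atMost_Suc)
      then have "L (X ^ k) - (\<integral>t. clamp t ^ k \<partial>M n)
          = (\<Sum>j\<le>Suc n. w (Suc n) j * (real (j choose k) / real (Suc n choose k) - (real j / real (Suc n)) ^ k))"
        unfolding M_eq right_diff_distrib sum_subtractf by simp
      also have "\<bar>\<dots>\<bar> \<le> (\<Sum>j\<le>Suc n. w (Suc n) j * (2 * real k ^ 2 / real (Suc n)))"
      proof (rule order_trans[OF sum_abs sum_mono])
        fix j assume "j \<in> {..Suc n}"
        then show "\<bar>w (Suc n) j * (real (j choose k) / real (Suc n choose k) - (real j / real (Suc n)) ^ k)\<bar>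
          \<le> w (Suc n) j * (2 * real k ^ 2 / real (Suc n))"
          unfolding abs_mult abs_of_nonneg[OF w_nonneg]
          by (intro mult_left_mono w_nonneg choose_ratio_approx) (use that in auto)
      qed
      also have "\<dots> = (2 * real k ^ 2 / real (Suc n))"
        unfolding sum_distrib_right[symmetric] sum_w by simp
      finally show ?thesis .
    qed
    have "(\<lambda>n. 2 * real k ^ 2 / real (Suc n)) \<longlonglongrightarrow> 0"
      by (rule LIMSEQ_Suc) (rule lim_const_over_n)
    then have "(\<lambda>n. L (X ^ k) - (\<integral>t. clamp t ^ k \<partial>M n)) \<longlonglongrightarrow> 0"
      by (rule Lim_null_comparison[rotated])
        (use bound in \<open>auto simp: eventually_sequentially intro!: exI[of _ "2 * k"]\<close>)
    from tendsto_diff[OF tendsto_const[of "L (X ^ k)"] this]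
    have "(\<lambda>n. \<integral>t. clamp t ^ k \<partial>M n) \<longlonglongrightarrow> L (X ^ k)" by simp
    from LIMSEQ_subseq_LIMSEQ[OF this r]
    have "(\<integral>t. clamp t ^ k \<partial>N) = L (X ^ k)" using cm by (auto simp: o_def intro: LIMSEQ_unique)
    moreover have "(\<integral>t. clamp t ^ k \<partial>N) = (\<integral>t. t ^ k \<partial>N)"
    proof (rule integral_cong_AE)
      show "AE t in N. clamp t ^ k = t ^ k"
        using AE by eventually_elim (simp add: clamp_def)
    qed auto
    ultimately show ?thesis by simp
  qed
  have "L p = (\<integral>t. poly p t \<partial>N)" for p
  proof -
    have p: "p = (\<Sum>i\<le>degree p. smult (coeff p i) (X ^ i))"
      using poly_as_sum_of_monoms[of p] by (simp add: X_def monom_altdef)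
    have "AE t in N. norm (t ^ i) \<le> 1" for i
      using AE by eventually_elim (simp add: power_abs power_le_one)
    then have int: "integrable N (\<lambda>t. t ^ i)" for i
      by (intro N.integrable_const_bound[where B=1]) auto
    have "(\<integral>t. poly p t \<partial>N) = (\<integral>t. (\<Sum>i\<le>degree p. coeff p i * t ^ i) \<partial>N)" by (simp add: poly_altdef)
    also have "\<dots> = (\<Sum>i\<le>degree p. coeff p i * L (X ^ i))"
      using int by (simp add: mono)
    also have "\<dots> = L p" by (subst p) (simp only: L_sum L_smult)
    finally show ?thesis by simp
  qed
  then show ?thesis using AE N.finite_measure_axioms N.events_eq_borel unfolding L_def by blast
qed

lemma poly_borel [measurable]: "poly p \<in> borel_measurable (borel :: real measure)"
  by (intro borel_measurable_continuous_onI continuous_intros)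

text \<open>Normalize \<open>x\<close> and multiply the measure by the squared norm; the zero vector
  gets the null measure.\<close>

lemma moment_measure:
  fixes T :: "'h::real_inner \<Rightarrow> 'h"
  assumes T: "symmetric_op T" and pos: "\<And>x. 0 \<le> inner (T x) x" and le: "\<And>x. inner (T x) x \<le> inner x x"
  shows "\<exists>M. finite_measure M \<and> sets M = sets borel \<and> (AE t in M. 0 \<le> t \<and> t \<le> 1) \<and>
     (\<forall>p. inner (poly_op T p x) x = (\<integral>t. poly p t \<partial>M))"
proof (cases "x = 0")
  case True
  have lin: "linear T" using T by (simp add: symmetric_op_def bounded_linear.linear)
  have "AE t in null_measure borel. 0 \<le> t \<and> t \<le> (1::real)"
    by (rule AE_I'[of UNIV]) (auto simp: null_sets_def)
  then show ?thesis
    by (intro exI[of _ "null_measure borel"])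
      (auto simp: True linear_0[OF poly_op_linear[OF lin]] intro!: finite_measureI)
next
  case False
  have lin: "linear T" using T by (simp add: symmetric_op_def bounded_linear.linear)
  let ?y = "x /\<^sub>R norm x"
  have "inner ?y ?y = 1" using False by (simp add: dot_square_norm power2_eq_square)
  from moment_measure_unit[OF assms this] obtain M where M: "finite_measure M" "sets M = sets borel"
     "AE t in M. 0 \<le> t \<and> t \<le> 1" "\<And>p. inner (poly_op T p ?y) ?y = (\<integral>t. poly p t \<partial>M)" by auto
  interpret finite_measure M by fact
  have [measurable_cong]: "sets M = sets borel" by fact
  let ?c = "(norm x)\<^sup>2"
  let ?N = "density M (\<lambda>_. ennreal ?c)"
  have "finite_measure ?N"
    by (rule finite_measureI) (simp add: emeasure_density_const ennreal_mult_eq_top_iff)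
  moreover have "AE t in ?N. 0 \<le> t \<and> t \<le> 1" using M(3) by (subst AE_density) (auto elim!: eventually_mono)
  moreover have "inner (poly_op T p x) x = (\<integral>t. poly p t \<partial>?N)" for p
  proof -
    have "(\<integral>t. poly p t \<partial>?N) = ?c * (\<integral>t. poly p t \<partial>M)"
      by (subst integral_density) auto
    also have "\<dots> = inner (poly_op T p x) x"
      unfolding M(4)[symmetric] using False
      by (simp add: linear_cmul[OF poly_op_linear[OF lin]] power2_eq_square field_simps)
    finally show ?thesis by simp
  qed
  ultimately show ?thesis using M(2) by (intro exI[of _ ?N]) auto
qed

subsection \<open>Density of the polynomials\<close>

lemma polynomial_uniform_approx:
  fixes f :: "real \<Rightarrow> real"
  assumes "continuous_on {0..1} f" "0 < e"
  obtains p where "\<And>t. 0 \<le> t \<Longrightarrow> t \<le> 1 \<Longrightarrow> \<bar>poly p t - f t\<bar> < e"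
proof -
  obtain g where g: "real_polynomial_function g" "\<And>t. t \<in> {0..1} \<Longrightarrow> \<bar>f t - g t\<bar> < e"
    using Stone_Weierstrass_real_polynomial_function[OF compact_Icc assms] by blast
  obtain a n where a: "g = (\<lambda>t. \<Sum>i\<le>n. a i * t ^ i)"
    using g(1) real_polynomial_function_iff_sum by blast
  have "poly (\<Sum>i\<le>n. monom (a i) i) t = g t" for t
    by (simp add: a poly_sum poly_monom)
  then show ?thesis using g(2) by (intro that[of "\<Sum>i\<le>n. monom (a i) i"]) (auto simp: abs_minus_commute)
qed

definition unit_measure :: "real measure \<Rightarrow> bool" where
  "unit_measure M \<longleftrightarrow> finite_measure M \<and> sets M = sets borel \<and> (AE t in M. 0 \<le> t \<and> t \<le> 1)"

lemma unit_measure_sqi: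
  assumes "unit_measure M" "f \<in> borel_measurable borel" "\<And>t. 0 \<le> t \<Longrightarrow> t \<le> 1 \<Longrightarrow> \<bar>f t\<bar> \<le> B"
  shows "sqi M f"
proof -
  interpret finite_measure M using assms by (simp add: unit_measure_def)
  have [measurable_cong]: "sets M = sets borel" using assms by (simp add: unit_measure_def)
  show ?thesis
  proof (rule sqi_bounded)
    have "AE t in M. 0 \<le> t \<and> t \<le> 1" using assms by (simp add: unit_measure_def)
    then show "AE t in M. \<bar>f t\<bar> \<le> B" by eventually_elim (use assms in auto)
  qed (use assms in auto)
qed

lemma poly_bounded_unit:
  fixes p :: "real poly"
  obtains B where "\<And>t. 0 \<le> t \<Longrightarrow> t \<le> 1 \<Longrightarrow> \<bar>poly p t\<bar> \<le> B"
proof -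
  have "bounded (poly p ` {0..1})"
    by (intro compact_imp_bounded compact_continuous_image continuous_intros) auto
  then show ?thesis using that by (fastforce simp: bounded_iff)
qed

lemma unit_measure_sqi_poly:
  assumes "unit_measure M" shows "sqi M (poly p)"
proof -
  obtain B where "\<And>t. 0 \<le> t \<Longrightarrow> t \<le> 1 \<Longrightarrow> \<bar>poly p t\<bar> \<le> B" using poly_bounded_unit by blast
  then show ?thesis by (intro unit_measure_sqi[OF assms, where B=B]) auto
qed

lemma unit_measure_sqi_indicator:
  assumes "unit_measure M" "A \<in> sets borel" shows "sqi M (indicator A)"
  by (rule unit_measure_sqi[OF assms(1), where B=1]) (use assms in auto)

lemma l2n_unit_le:
  assumes M: "unit_measure M" and "f \<in> borel_measurable borel" "\<And>t. 0 \<le> t \<Longrightarrow> t \<le> 1 \<Longrightarrow> \<bar>f t\<bar> \<le> B" "0 \<le> B"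
  shows "l2n M f \<le> B * sqrt (measure M UNIV)"
proof -
  interpret finite_measure M using assms by (simp add: unit_measure_def)
  have s: "space M = UNIV" using M sets_eq_imp_space_eq[of M borel] by (simp add: unit_measure_def)
  have "(\<integral>t. (f t)\<^sup>2 \<partial>M) \<le> (\<integral>t. B\<^sup>2 \<partial>M)"
  proof (rule integral_mono_AE)
    show "integrable M (\<lambda>t. (f t)\<^sup>2)" using unit_measure_sqi[OF M assms(2,3)] by (simp add: sqi_def)
    have "AE t in M. 0 \<le> t \<and> t \<le> 1" using M by (simp add: unit_measure_def)
    then show "AE t in M. (f t)\<^sup>2 \<le> B\<^sup>2"
      by eventually_elim (use assms(3,4) in \<open>simp flip: abs_le_square_iff\<close>)
  qed simp
  also have "\<dots> = B\<^sup>2 * measure M UNIV" using s by simp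
  finally have "l2n M f \<le> sqrt (B\<^sup>2 * measure M UNIV)" unfolding l2n_def by (rule real_sqrt_le_mono)
  then show ?thesis using assms by (simp add: real_sqrt_mult)
qed

text \<open>Several measures are treated at once because linearity and commutation of the spectral
  projections compare limits at different vectors along one sequence of polynomials. The sets with
  the approximation property contain the half-lines and are closed under complements and countable
  disjoint unions, so they include all Borel sets.\<close>

lemma indicator_poly_approx:
  fixes M :: "'i \<Rightarrow> real measure"
  assumes I: "finite I" and M: "\<And>i. i \<in> I \<Longrightarrow> unit_measure (M i)" and A: "A \<in> sets borel" and "0 < e"
  shows "\<exists>p. (\<Sum>i\<in>I. l2n (M i) (\<lambda>t. poly p t - indicator A t)) < e"
proof -
  \<comment> \<open>One seminorm for the whole family; the triangle inequality and dominated
    convergence pass to it termwise.\<close>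
  define L where "L f = (\<Sum>i\<in>I. l2n (M i) f)" for f
  have L_triangle: "L (\<lambda>t. f t + g t) \<le> L f + L g"
    if "\<And>i. i \<in> I \<Longrightarrow> sqi (M i) f" "\<And>i. i \<in> I \<Longrightarrow> sqi (M i) g" for f g
    unfolding L_def sum.distrib[symmetric] by (intro sum_mono l2n_triangle that)
  have L_dominated: "(\<lambda>n. L (\<lambda>t. s n t - f t)) \<longlonglongrightarrow> 0"
    if s: "\<And>n. s n \<in> borel_measurable borel" "f \<in> borel_measurable borel"
      "\<And>n t. \<bar>s n t - f t\<bar> \<le> 1" "\<And>t. (\<lambda>n. s n t) \<longlonglongrightarrow> f t" for s f
    unfolding L_def
  proof (rule tendsto_null_sum)
    fix i assume i: "i \<in> I"
    interpret finite_measure "M i" using M[OF i] by (simp add: unit_measure_def)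
    have [measurable_cong]: "sets (M i) = sets borel" using M[OF i] by (simp add: unit_measure_def)
    show "(\<lambda>n. l2n (M i) (\<lambda>t. s n t - f t)) \<longlonglongrightarrow> 0"
      by (rule l2n_dominated[where w="\<lambda>_. 1"]) (use s in \<open>auto simp: abs_square_le_1\<close>)
  qed
  have L_half: "\<exists>n. L (s n) < e / 2" if "(\<lambda>n. L (s n)) \<longlonglongrightarrow> 0" "e > 0" for s :: "nat \<Rightarrow> real \<Rightarrow> real" and e
    using order_tendstoD(2)[OF that(1), of "e/2"] that(2) by (auto simp: eventually_sequentially)
  have L_join: "\<exists>p. L (\<lambda>t. poly p t - f t) < e"
    if "L (\<lambda>t. poly p t - g t) < e / 2" "L (\<lambda>t. g t - f t) < e / 2"
      "\<And>t. \<bar>f t\<bar> \<le> 1" "\<And>t. \<bar>g t\<bar> \<le> 1" "f \<in> borel_measurable borel" "g \<in> borel_measurable borel" for p f g e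
  proof -
    have "L (\<lambda>t. (poly p t - g t) + (g t - f t)) \<le> L (\<lambda>t. poly p t - g t) + L (\<lambda>t. g t - f t)"
      by (intro L_triangle sqi_diff unit_measure_sqi_poly M unit_measure_sqi[where B=1] that)
    then show ?thesis using that(1,2) by (intro exI[of _ p]) simp
  qed
  define P where "P A \<longleftrightarrow> (\<forall>e>0. \<exists>p. L (\<lambda>t. poly p t - indicator A t) < e)" for A
  have cont: "\<exists>p. L (\<lambda>t. poly p t - f t) < e"
    if "continuous_on UNIV f" "e > 0" for f :: "real \<Rightarrow> real" and e
  proof -
    let ?m = "(\<Sum>i\<in>I. sqrt (measure (M i) UNIV)) + 1"
    have m: "?m > 0" by (intro add_nonneg_pos sum_nonneg) auto
    have "continuous_on {0..1} f" "0 < e / ?m"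
      using that m by (auto intro: continuous_on_subset)
    from polynomial_uniform_approx[OF this]
    obtain p where p: "\<And>t. 0 \<le> t \<Longrightarrow> t \<le> 1 \<Longrightarrow> \<bar>poly p t - f t\<bar> < e / ?m" by blast
    have "L (\<lambda>t. poly p t - f t) \<le> (\<Sum>i\<in>I. (e / ?m) * sqrt (measure (M i) UNIV))"
      unfolding L_def
      by (intro sum_mono l2n_unit_le M)
        (use p that m in \<open>auto intro!: borel_measurable_continuous_onI continuous_intros less_imp_le divide_pos_pos\<close>)
    also have "\<dots> = (e / ?m) * (\<Sum>i\<in>I. sqrt (measure (M i) UNIV))" by (simp add: sum_distrib_left)
    also have "\<dots> < (e / ?m) * ?m" using that m by (intro mult_strict_left_mono) auto
    also have "\<dots> = e" using m by simp
    finally show ?thesis by blast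
  qed
  have *: "P A" if "A \<in> sigma_sets UNIV (range (\<lambda>a. {..a::real}))" for A
  proof (rule sigma_sets_induct_disjoint[OF _ _ that])
    show "Int_stable (range (\<lambda>a. {..a::real}))" by (auto simp: Int_stable_def)
    show "P A" if "A \<in> range (\<lambda>a. {..a::real})" for A
      unfolding P_def
    proof (intro allI impI)
      fix e :: real assume e: "e > 0"
      from that obtain a where A: "A = {..a}" by auto
      \<comment> \<open>For positive \<open>n\<close>, a ramp equal to 1 on the half-line and
        falling to 0 over a length \<open>1/n\<close> beyond \<open>a\<close>.\<close>
      define f where "f n t = max 0 (min 1 (1 - real n * (t - a)))" for n t
      have fc: "continuous_on UNIV (f n)" for n unfolding f_def by (intro continuous_intros)
      have fb: "0 \<le> f n t" "f n t \<le> 1" for n t by (auto simp: f_def)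
      have fm: "f n \<in> borel_measurable borel" for n
        by (rule borel_measurable_continuous_onI[OF fc])
      have "(\<lambda>n. L (\<lambda>t. f n t - indicator A t)) \<longlonglongrightarrow> 0"
      proof (rule L_dominated)
        show "\<bar>f n t - indicator A t\<bar> \<le> 1" for n t
          using fb[of n t] by (auto simp: indicator_def)
        show "(\<lambda>n. f n t) \<longlonglongrightarrow> indicator A t" for t
        proof (cases "t \<le> a")
          case True
          then have "f n t = 1" for n unfolding f_def by (auto simp: max_def min_def mult_nonneg_nonpos)
          then show ?thesis using True A by simp
        next
          case False
          obtain N where N: "real N * (t - a) > 1" using False reals_Archimedean3[of "t - a"] by auto
          have "f n t = 0" if "n \<ge> N" for n
          proof -
            have "real N * (t - a) \<le> real n * (t - a)" using that False by (intro mult_right_mono) auto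
            then show ?thesis using N unfolding f_def by auto
          qed
          then show ?thesis using False A
            by (intro tendsto_eventually) (auto simp: eventually_sequentially indicator_def intro!: exI[of _ N])
        qed
      qed (use A fm in auto)
      from L_half[OF this e] obtain n where n: "L (\<lambda>t. f n t - indicator A t) < e / 2" by auto
      obtain p where p: "L (\<lambda>t. poly p t - f n t) < e / 2" using cont[OF fc, of "e/2" n] e by auto
      show "\<exists>p. L (\<lambda>t. poly p t - indicator A t) < e"
        by (rule L_join[OF p n]) (use fb fm A in auto)
    qed
    show "P {}" unfolding P_def by (auto intro!: exI[of _ 0] simp: l2n_def L_def)
    show "P (UNIV - A)" if "P A" for A
      unfolding P_def
    proof (intro allI impI)
      fix e :: real assume "e > 0"
      then obtain p where "L (\<lambda>t. poly p t - indicator A t) < e" using \<open>P A\<close> by (auto simp: P_def)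
      moreover have "(\<lambda>t. poly (1 - p) t - indicator (UNIV - A) t) = (\<lambda>t. (-1) * (poly p t - indicator A t))"
        by (auto simp: indicator_def)
      then have "L (\<lambda>t. poly (1 - p) t - indicator (UNIV - A) t) = L (\<lambda>t. poly p t - indicator A t)"
        unfolding L_def by (simp only: l2n_cmult) simp
      ultimately show "\<exists>p. L (\<lambda>t. poly p t - indicator (UNIV - A) t) < e" by metis
    qed
    show "P (\<Union>i. A i)" if "disjoint_family A" and Ai: "range A \<subseteq> sigma_sets UNIV (range (\<lambda>a. {..a::real}))"
        and PA: "\<And>i. P (A i)" for A :: "nat \<Rightarrow> real set"
      unfolding P_def
    proof (intro allI impI)
      fix e :: real assume e: "e > 0"
      have [measurable]: "A i \<in> sets borel" for i
        using Ai by (auto simp: borel_eq_atMost sets_measure_of)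
      let ?U = "\<lambda>n. \<Union>i<n. A i"
      have "(\<lambda>n. L (\<lambda>t. indicator (?U n) t - indicator (\<Union>i. A i) t)) \<longlonglongrightarrow> 0"
      proof (rule L_dominated)
        show "(\<lambda>n. indicator (?U n) t) \<longlonglongrightarrow> (indicator (\<Union>i. A i) t :: real)" for t
          by (rule LIMSEQ_indicator_UN)
      qed (auto simp: indicator_def)
      from L_half[OF this e] obtain n where n: "L (\<lambda>t. indicator (?U n) t - indicator (\<Union>i. A i) t) < e / 2" by auto
      \<comment> \<open>Disjointness adds the indicators, and the admissible error is halved between
        the polynomial for the union so far and the one for the new set.\<close>
      have fin: "\<forall>e>0. \<exists>p. L (\<lambda>t. poly p t - indicator (?U m) t) < e" for m
      proof (induction m)
        case 0
        then show ?case by (auto intro!: exI[of _ 0] simp: l2n_def L_def)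
      next
        case (Suc m)
        show ?case
        proof (intro allI impI)
          fix e :: real assume "e > 0"
          then have e2: "e / 2 > 0" by simp
          obtain p where p: "L (\<lambda>t. poly p t - indicator (?U m) t) < e / 2"
            using Suc[rule_format, OF e2] by auto
          obtain q where q: "L (\<lambda>t. poly q t - indicator (A m) t) < e / 2"
            using PA[of m, unfolded P_def, rule_format, OF e2] by auto
          note pq = p q
          have "A i \<inter> A m = {}" if "i < m" for i
            using disjoint_family_onD[OF \<open>disjoint_family A\<close>, of i m] that by auto
          then have d: "?U m \<inter> A m = {}" by auto
          have u: "?U (Suc m) = ?U m \<union> A m" by (auto simp: less_Suc_eq)
          have "indicator (?U (Suc m)) t = indicator (?U m) t + (indicator (A m) t :: real)" for t
            unfolding u using d by (rule indicator_add[symmetric])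
          then have eq: "(\<lambda>t. poly (p + q) t - indicator (?U (Suc m)) t)
             = (\<lambda>t. (poly p t - indicator (?U m) t) + (poly q t - indicator (A m) t))"
            by auto
          have "L (\<lambda>t. poly (p + q) t - indicator (?U (Suc m)) t) \<le>
              L (\<lambda>t. poly p t - indicator (?U m) t) + L (\<lambda>t. poly q t - indicator (A m) t)"
            unfolding eq
            by (intro L_triangle sqi_diff unit_measure_sqi_poly unit_measure_sqi_indicator M) measurable
          then show "\<exists>p. L (\<lambda>t. poly p t - indicator (?U (Suc m)) t) < e"
            using pq by (intro exI[of _ "p + q"]) linarith
        qed
      qed
      from this[rule_format, of "e / 2" n] e
      obtain p where p: "L (\<lambda>t. poly p t - indicator (?U n) t) < e / 2" by auto
      show "\<exists>p. L (\<lambda>t. poly p t - indicator (\<Union>i. A i) t) < e"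
        by (rule L_join[OF p n]) (auto simp: indicator_def)
    qed
  qed auto
  have "A \<in> sigma_sets UNIV (range (\<lambda>a. {..a::real}))"
    using A by (simp add: borel_eq_atMost)
  then show ?thesis using * \<open>e > 0\<close> unfolding P_def L_def by blast
qed

subsection \<open>Projection valued measures and the spectral theorem\<close>

text \<open>The notion \<open>projection_valued_measure\<close> on an abstract real Hilbert space.
  Idempotence is the intersection rule for \<open>A = B\<close>. Complex linearity cannot be
  expressed here; it returns through commutation with the multiplications by complex
  scalars.\<close>

definition pvm :: "(real set \<Rightarrow> 'h \<Rightarrow> 'h::real_inner) \<Rightarrow> bool" where
  "pvm E \<longleftrightarrow> (\<forall>A\<in>sets borel. symmetric_op (E A)) \<and> (\<forall>x. E UNIV x = x) \<and>
     (\<forall>A\<in>sets borel. \<forall>B\<in>sets borel. \<forall>x. E (A \<inter> B) x = E A (E B x)) \<and>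
     (\<forall>A :: nat \<Rightarrow> real set. range A \<subseteq> sets borel \<longrightarrow> disjoint_family A \<longrightarrow>
        (\<forall>x. (\<lambda>n. \<Sum>i<n. E (A i) x) \<longlonglongrightarrow> E (\<Union>i. A i) x))"

definition spec_measure :: "(real set \<Rightarrow> 'h \<Rightarrow> 'h::real_inner) \<Rightarrow> 'h \<Rightarrow> real measure" where
  "spec_measure E x = measure_of UNIV (sets borel) (\<lambda>A. ennreal ((norm (E A x))\<^sup>2))"

definition simple_int :: "(real set \<Rightarrow> 'h \<Rightarrow> 'h::real_inner) \<Rightarrow> (real \<Rightarrow> real) \<Rightarrow> 'h \<Rightarrow> 'h" where
  "simple_int E s x = (\<Sum>c\<in>range s. c *\<^sub>R E (s -` {c}) x)"

definition spec_int :: "(real set \<Rightarrow> 'h \<Rightarrow> 'h::real_inner) \<Rightarrow> (real \<Rightarrow> real) \<Rightarrow> 'h \<Rightarrow> 'h \<Rightarrow> bool" where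
  "spec_int E \<phi> x y \<longleftrightarrow> \<phi> \<in> borel_measurable borel \<and>
     (\<exists>s :: nat \<Rightarrow> real \<Rightarrow> real. (\<forall>n. simple_function borel (s n)) \<and>
        (\<lambda>n. \<integral>\<^sup>+ t. ennreal (\<bar>\<phi> t - s n t\<bar>\<^sup>2) \<partial>spec_measure E x) \<longlonglongrightarrow> 0 \<and>
        (\<lambda>n. simple_int E (s n) x) \<longlonglongrightarrow> y)"

lemma nn_integral_sq_eq_l2n:
  assumes "sqi M f" shows "(\<integral>\<^sup>+x. ennreal (\<bar>f x\<bar>\<^sup>2) \<partial>M) = ennreal ((l2n M f)\<^sup>2)"
  using assms by (simp add: l2n_sq sqi_def nn_integral_eq_integral)

locale moment_family =
  fixes T :: "'h::{real_inner, complete_space} \<Rightarrow> 'h" and \<nu> :: "'h \<Rightarrow> real measure"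
  assumes T: "symmetric_op T" and \<nu>: "unit_measure (\<nu> x)"
    and moments: "inner (poly_op T p x) x = (\<integral>t. poly p t \<partial>\<nu> x)"
begin

lemma lin: "linear T"
  using T by (simp add: symmetric_op_def bounded_linear.linear)

text \<open>The isometry behind the functional calculus: both sides squared are
  \<open><p(T)^2 x, x>\<close>, the integral of \<open>p^2\<close>.\<close>

lemma norm_poly_op: "norm (poly_op T p x) = l2n (\<nu> x) (poly p)"
proof -
  have "(norm (poly_op T p x))\<^sup>2 = (l2n (\<nu> x) (poly p))\<^sup>2"
    unfolding poly_op_norm_sq[OF T] moments l2n_sq
    by (intro Bochner_Integration.integral_cong) (simp_all add: power2_eq_square)
  then show ?thesis by simp
qed

lemma norm_poly_op_diff: "norm (poly_op T p x - poly_op T q x) = l2n (\<nu> x) (\<lambda>t. poly p t - poly q t)"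
proof -
  have "poly (p - q) = (\<lambda>t. poly p t - poly q t)" by auto
  then show ?thesis using norm_poly_op[of "p - q" x] by (simp add: poly_op_diff[OF lin])
qed

text \<open>The graph of the functional calculus at a vector: the closure of the isometry
  \<open>p \<mapsto> p(T) x\<close> from the polynomials in \<open>L\<^sup>2(\<nu> x)\<close>.\<close>

definition calc :: "'h \<Rightarrow> (real \<Rightarrow> real) \<Rightarrow> 'h \<Rightarrow> bool" where
  "calc x \<phi> h \<longleftrightarrow> sqi (\<nu> x) \<phi> \<and> (\<exists>q. (\<lambda>n. l2n (\<nu> x) (\<lambda>t. poly (q n) t - \<phi> t)) \<longlonglongrightarrow> 0 \<and>
     (\<lambda>n. poly_op T (q n) x) \<longlonglongrightarrow> h)"

lemmas sqi_poly = unit_measure_sqi_poly[OF \<nu>]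
lemmas sqi_ind = unit_measure_sqi_indicator[OF \<nu>]

lemma calc_poly: "calc x (poly p) (poly_op T p x)"
  unfolding calc_def by (intro conjI sqi_poly exI[of _ "\<lambda>_. p"]) (simp_all add: l2n_def)

lemma calc_add:
  assumes "calc x \<phi> h" "calc x \<psi> k" shows "calc x (\<lambda>t. \<phi> t + \<psi> t) (h + k)"
proof -
  obtain q r where q: "(\<lambda>n. l2n (\<nu> x) (\<lambda>t. poly (q n) t - \<phi> t)) \<longlonglongrightarrow> 0" "(\<lambda>n. poly_op T (q n) x) \<longlonglongrightarrow> h"
    and r: "(\<lambda>n. l2n (\<nu> x) (\<lambda>t. poly (r n) t - \<psi> t)) \<longlonglongrightarrow> 0" "(\<lambda>n. poly_op T (r n) x) \<longlonglongrightarrow> k"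
    and s: "sqi (\<nu> x) \<phi>" "sqi (\<nu> x) \<psi>"
    using assms unfolding calc_def by blast
  have eq: "poly (q n + r n) t - (\<phi> t + \<psi> t) = (poly (q n) t - \<phi> t) + (poly (r n) t - \<psi> t)" for n t by simp
  have le: "l2n (\<nu> x) (\<lambda>t. poly (q n + r n) t - (\<phi> t + \<psi> t))
      \<le> l2n (\<nu> x) (\<lambda>t. poly (q n) t - \<phi> t) + l2n (\<nu> x) (\<lambda>t. poly (r n) t - \<psi> t)" for n
    unfolding eq by (intro l2n_triangle sqi_diff sqi_poly s)
  have "(\<lambda>n. l2n (\<nu> x) (\<lambda>t. poly (q n) t - \<phi> t) + l2n (\<nu> x) (\<lambda>t. poly (r n) t - \<psi> t)) \<longlonglongrightarrow> 0"
    using tendsto_add[OF q(1) r(1)] by simp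
  then have "(\<lambda>n. l2n (\<nu> x) (\<lambda>t. poly (q n + r n) t - (\<phi> t + \<psi> t))) \<longlonglongrightarrow> 0"
    by (rule Lim_null_comparison[rotated]) (use le in \<open>auto simp del: poly_add\<close>)
  moreover have "(\<lambda>n. poly_op T (q n + r n) x) \<longlonglongrightarrow> h + k"
    unfolding poly_op_add[OF lin] by (intro tendsto_add q r)
  ultimately show ?thesis using sqi_add[OF s] unfolding calc_def
    by (intro conjI exI[of _ "\<lambda>n. q n + r n"]) auto
qed

lemma calc_scale:
  assumes "calc x \<phi> h" shows "calc x (\<lambda>t. c * \<phi> t) (c *\<^sub>R h)"
proof -
  obtain q where q: "(\<lambda>n. l2n (\<nu> x) (\<lambda>t. poly (q n) t - \<phi> t)) \<longlonglongrightarrow> 0" "(\<lambda>n. poly_op T (q n) x) \<longlonglongrightarrow> h"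
    and s: "sqi (\<nu> x) \<phi>"
    using assms unfolding calc_def by blast
  have eq: "l2n (\<nu> x) (\<lambda>t. poly (smult c (q n)) t - c * \<phi> t) = \<bar>c\<bar> * l2n (\<nu> x) (\<lambda>t. poly (q n) t - \<phi> t)" for n
    unfolding l2n_cmult[symmetric] by (simp add: right_diff_distrib)
  have "(\<lambda>n. l2n (\<nu> x) (\<lambda>t. poly (smult c (q n)) t - c * \<phi> t)) \<longlonglongrightarrow> 0"
    unfolding eq using tendsto_mult_left[OF q(1), of "\<bar>c\<bar>"] by simp
  moreover have "(\<lambda>n. poly_op T (smult c (q n)) x) \<longlonglongrightarrow> c *\<^sub>R h"
    unfolding poly_op_smult[OF lin] by (intro tendsto_intros q)
  ultimately show ?thesis using sqi_cmult[OF s] unfolding calc_def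
    by (intro conjI exI[of _ "\<lambda>n. smult c (q n)"]) auto
qed

lemma calc_diff: "calc x \<phi> h \<Longrightarrow> calc x \<psi> k \<Longrightarrow> calc x (\<lambda>t. \<phi> t - \<psi> t) (h - k)"
  using calc_add[of x \<phi> h "\<lambda>t. (-1) * \<psi> t" "(-1) *\<^sub>R k"] calc_scale[of x \<psi> k "-1"] by simp

lemma calc_sum:
  assumes "finite I" "\<And>i. i \<in> I \<Longrightarrow> calc x (\<phi> i) (h i)"
  shows "calc x (\<lambda>t. \<Sum>i\<in>I. \<phi> i t) (\<Sum>i\<in>I. h i)"
  using assms
proof (induction I)
  case empty
  have "poly 0 = (\<lambda>t. 0::real)" by auto
  then show ?case using calc_poly[of x 0] by simp
next
  case (insert i I)
  then show ?case using calc_add[of x "\<phi> i" "h i" "\<lambda>t. \<Sum>i\<in>I. \<phi> i t"] by simp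
qed

text \<open>The isometry survives the limit; applied to differences, it makes the value of the
  calculus unique.\<close>

lemma calc_norm:
  assumes "calc x \<phi> h" shows "norm h = l2n (\<nu> x) \<phi>"
proof -
  obtain q where q: "(\<lambda>n. l2n (\<nu> x) (\<lambda>t. poly (q n) t - \<phi> t)) \<longlonglongrightarrow> 0" "(\<lambda>n. poly_op T (q n) x) \<longlonglongrightarrow> h"
    and s: "sqi (\<nu> x) \<phi>"
    using assms unfolding calc_def by blast
  have "(\<lambda>n. l2n (\<nu> x) (poly (q n))) \<longlonglongrightarrow> l2n (\<nu> x) \<phi>"
    by (rule l2n_tendsto[OF sqi_poly s q(1)])
  moreover have "(\<lambda>n. l2n (\<nu> x) (poly (q n))) \<longlonglongrightarrow> norm h"
    using tendsto_norm[OF q(2)] by (simp add: norm_poly_op)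
  ultimately show ?thesis by (rule LIMSEQ_unique[symmetric])
qed

lemma calc_unique: "calc x \<phi> h \<Longrightarrow> calc x \<phi> k \<Longrightarrow> h = k"
  using calc_norm[OF calc_diff, of x \<phi> h \<phi> k] by (simp add: l2n_def)

text \<open>The approximating polynomials are Cauchy in \<open>L^2(\<nu> x)\<close>, hence by the
  isometry their values at \<open>T\<close> are Cauchy in the Hilbert space, which is
  complete.\<close>

lemma calc_exists:
  assumes s: "sqi (\<nu> x) \<phi>" and q: "(\<lambda>n. l2n (\<nu> x) (\<lambda>t. poly (q n) t - \<phi> t)) \<longlonglongrightarrow> 0"
  obtains h where "(\<lambda>n. poly_op T (q n) x) \<longlonglongrightarrow> h" "calc x \<phi> h"
proof -
  have "Cauchy (\<lambda>n. poly_op T (q n) x)"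
  proof (rule metric_CauchyI)
    fix e :: real assume "e > 0"
    then obtain N where N: "\<And>n. n \<ge> N \<Longrightarrow> l2n (\<nu> x) (\<lambda>t. poly (q n) t - \<phi> t) < e / 2"
      using order_tendstoD(2)[OF q, of "e/2"] by (auto simp: eventually_sequentially)
    show "\<exists>M. \<forall>m\<ge>M. \<forall>n\<ge>M. dist (poly_op T (q m) x) (poly_op T (q n) x) < e"
    proof (intro exI allI impI)
      fix m n assume "m \<ge> N" "n \<ge> N"
      have "dist (poly_op T (q m) x) (poly_op T (q n) x) = l2n (\<nu> x) (\<lambda>t. poly (q m) t - poly (q n) t)"
        by (simp add: dist_norm norm_poly_op_diff)
      also have "\<dots> \<le> l2n (\<nu> x) (\<lambda>t. poly (q m) t - \<phi> t) + l2n (\<nu> x) (\<lambda>t. poly (q n) t - \<phi> t)"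
        using l2n_triangle_diff[OF sqi_poly s sqi_poly, of "q m" "q n"] by (subst (2) l2n_diff_commute)
      also have "\<dots> < e" using N[OF \<open>m \<ge> N\<close>] N[OF \<open>n \<ge> N\<close>] by simp
      finally show "dist (poly_op T (q m) x) (poly_op T (q n) x) < e" .
    qed
  qed
  then obtain h where "(\<lambda>n. poly_op T (q n) x) \<longlonglongrightarrow> h"
    using Cauchy_convergent_iff convergent_def by blast
  then show ?thesis using that assms unfolding calc_def by blast
qed

text \<open>A single sequence serving finitely many vectors makes identities between projections of
  different vectors limits of identities for polynomials.\<close>

lemma common_approx:
  assumes "finite X" "A \<in> sets borel"
  obtains q where "\<And>x. x \<in> X \<Longrightarrow> (\<lambda>n. l2n (\<nu> x) (\<lambda>t. poly (q n) t - indicator A t)) \<longlonglongrightarrow> 0"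
proof -
  have "\<forall>n. \<exists>p. (\<Sum>x\<in>X. l2n (\<nu> x) (\<lambda>t. poly p t - indicator A t)) < inverse (real (Suc n))"
    by (intro allI indicator_poly_approx assms \<nu>) simp
  then obtain q where q: "\<And>n. (\<Sum>x\<in>X. l2n (\<nu> x) (\<lambda>t. poly (q n) t - indicator A t)) < inverse (real (Suc n))"
    by metis
  show ?thesis
  proof
    fix x assume "x \<in> X"
    then have "l2n (\<nu> x) (\<lambda>t. poly (q n) t - indicator A t) \<le> (\<Sum>x\<in>X. l2n (\<nu> x) (\<lambda>t. poly (q n) t - indicator A t))" for n
      by (intro member_le_sum assms) auto
    with q have "l2n (\<nu> x) (\<lambda>t. poly (q n) t - indicator A t) \<le> inverse (real (Suc n))" for n
      by (meson less_imp_le order_trans)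
    then show "(\<lambda>n. l2n (\<nu> x) (\<lambda>t. poly (q n) t - indicator A t)) \<longlonglongrightarrow> 0"
      by (intro Lim_null_comparison[OF _ LIMSEQ_inverse_real_of_nat]) auto
  qed
qed

definition E :: "real set \<Rightarrow> 'h \<Rightarrow> 'h" where
  "E A x = (THE h. calc x (indicator A) h)"

lemma calc_E:
  assumes "A \<in> sets borel" shows "calc x (indicator A) (E A x)"
proof -
  obtain q where "(\<lambda>n. l2n (\<nu> x) (\<lambda>t. poly (q n) t - indicator A t)) \<longlonglongrightarrow> 0"
    using common_approx[OF finite.insertI[OF finite.emptyI] assms, of x] by blast
  from calc_exists[OF sqi_ind[OF assms] this] obtain h where h: "calc x (indicator A) h" by blast
  show ?thesis unfolding E_def by (rule theI[where P="calc x (indicator A)", OF h]) (rule calc_unique[OF _ h])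
qed

lemma E_tendsto:
  assumes "A \<in> sets borel" "(\<lambda>n. l2n (\<nu> x) (\<lambda>t. poly (q n) t - indicator A t)) \<longlonglongrightarrow> 0"
  shows "(\<lambda>n. poly_op T (q n) x) \<longlonglongrightarrow> E A x"
  using calc_exists[OF sqi_ind[OF assms(1)] assms(2)] calc_unique[OF calc_E[OF assms(1)]] by metis

text \<open>Along polynomials that approximate the indicator for both \<open>x\<close> and
  \<open>J x\<close>, pass to the limit in \<open>J (q(T) x) = q(T) (J x)\<close>.\<close>

lemma E_commute:
  assumes A: "A \<in> sets borel" and J: "bounded_linear J" "\<And>x. J (T x) = T (J x)"
  shows "J (E A x) = E A (J x)"
proof -
  obtain q where q: "\<And>y. y \<in> {x, J x} \<Longrightarrow> (\<lambda>n. l2n (\<nu> y) (\<lambda>t. poly (q n) t - indicator A t)) \<longlonglongrightarrow> 0"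
    using common_approx[of "{x, J x}", OF _ A] by blast
  have "(\<lambda>n. J (poly_op T (q n) x)) \<longlonglongrightarrow> J (E A x)"
    by (intro bounded_linear.tendsto[OF J(1)] E_tendsto A q) simp
  moreover have "(\<lambda>n. J (poly_op T (q n) x)) \<longlonglongrightarrow> E A (J x)"
    unfolding poly_op_commute[OF lin bounded_linear.linear[OF J(1)] J(2)]
    by (intro E_tendsto A q) simp
  ultimately show ?thesis by (rule LIMSEQ_unique)
qed

lemma norm_E_le: assumes "A \<in> sets borel" shows "norm (E A x) \<le> norm x"
proof -
  have "norm (E A x) = l2n (\<nu> x) (indicator A)" by (rule calc_norm[OF calc_E[OF assms]])
  also have "\<dots> \<le> l2n (\<nu> x) (poly 1)"
    unfolding l2n_def using sqi_ind[OF assms, of x] sqi_poly[of x 1]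
    by (intro real_sqrt_le_mono integral_mono) (auto simp: sqi_def indicator_def)
  also have "\<dots> = norm x" using norm_poly_op[of 1 x] by (simp add: lin)
  finally show ?thesis .
qed

lemma E_symmetric: assumes A: "A \<in> sets borel" shows "symmetric_op (E A)"
  unfolding symmetric_op_def
proof (intro conjI allI)
  show "bounded_linear (E A)"
  proof (rule bounded_linear_intro[where K=1])
    fix x y :: 'h and c :: real
    obtain q where q: "\<And>z. z \<in> {x, y, x + y, c *\<^sub>R x} \<Longrightarrow> (\<lambda>n. l2n (\<nu> z) (\<lambda>t. poly (q n) t - indicator A t)) \<longlonglongrightarrow> 0"
      using common_approx[of "{x, y, x + y, c *\<^sub>R x}", OF _ A] by blast
    have l: "linear (poly_op T p)" for p by (rule poly_op_linear[OF lin])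
    have "(\<lambda>n. poly_op T (q n) x + poly_op T (q n) y) \<longlonglongrightarrow> E A x + E A y"
      by (intro tendsto_add E_tendsto A q) auto
    moreover have "(\<lambda>n. poly_op T (q n) x + poly_op T (q n) y) \<longlonglongrightarrow> E A (x + y)"
      unfolding linear_add[OF l, symmetric] by (intro E_tendsto A q) auto
    ultimately show "E A (x + y) = E A x + E A y" by (rule LIMSEQ_unique[symmetric])
    have "(\<lambda>n. c *\<^sub>R poly_op T (q n) x) \<longlonglongrightarrow> c *\<^sub>R E A x"
      by (intro tendsto_intros E_tendsto A q) auto
    moreover have "(\<lambda>n. c *\<^sub>R poly_op T (q n) x) \<longlonglongrightarrow> E A (c *\<^sub>R x)"
      unfolding linear_cmul[OF l, symmetric] by (intro E_tendsto A q) auto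
    ultimately show "E A (c *\<^sub>R x) = c *\<^sub>R E A x" by (rule LIMSEQ_unique[symmetric])
  qed (use norm_E_le[OF A] in simp)
  fix x y :: 'h
  obtain q where q: "\<And>z. z \<in> {x, y} \<Longrightarrow> (\<lambda>n. l2n (\<nu> z) (\<lambda>t. poly (q n) t - indicator A t)) \<longlonglongrightarrow> 0"
    using common_approx[of "{x, y}", OF _ A] by blast
  have "(\<lambda>n. inner (poly_op T (q n) x) y) \<longlonglongrightarrow> inner (E A x) y"
    by (intro tendsto_intros E_tendsto A q) auto
  moreover have "(\<lambda>n. inner (poly_op T (q n) x) y) \<longlonglongrightarrow> inner x (E A y)"
    unfolding poly_op_symmetric[OF T] by (intro tendsto_intros E_tendsto A q) auto
  ultimately show "inner (E A x) y = inner x (E A y)" by (rule LIMSEQ_unique)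
qed

text \<open>Multiplication by \<open>q\<close> is bounded on \<open>L^2(\<nu> x)\<close>, since the
  measure lives on \<open>[0,1]\<close>.\<close>

lemma calc_mult_poly:
  assumes "calc x \<phi> h" "sqi (\<nu> x) (\<lambda>t. poly q t * \<phi> t)"
  shows "calc x (\<lambda>t. poly q t * \<phi> t) (poly_op T q h)"
proof -
  obtain p where p: "(\<lambda>n. l2n (\<nu> x) (\<lambda>t. poly (p n) t - \<phi> t)) \<longlonglongrightarrow> 0" "(\<lambda>n. poly_op T (p n) x) \<longlonglongrightarrow> h"
    and s: "sqi (\<nu> x) \<phi>"
    using assms unfolding calc_def by blast
  obtain B where B: "\<And>t. 0 \<le> t \<Longrightarrow> t \<le> 1 \<Longrightarrow> \<bar>poly q t\<bar> \<le> B" using poly_bounded_unit by blast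
  have B0: "0 \<le> B" using B[of 0] by simp
  have le: "l2n (\<nu> x) (\<lambda>t. poly (q * p n) t - poly q t * \<phi> t) \<le> B * l2n (\<nu> x) (\<lambda>t. poly (p n) t - \<phi> t)" for n
  proof -
    have s1: "sqi (\<nu> x) (\<lambda>t. poly (p n) t - \<phi> t)" by (intro sqi_diff sqi_poly s)
    have s2: "sqi (\<nu> x) (\<lambda>t. poly (q * p n) t - poly q t * \<phi> t)" by (intro sqi_diff sqi_poly assms)
    have "AE t in \<nu> x. 0 \<le> t \<and> t \<le> 1" using \<nu> by (simp add: unit_measure_def)
    then have "AE t in \<nu> x. (poly (q * p n) t - poly q t * \<phi> t)\<^sup>2 \<le> (B * (poly (p n) t - \<phi> t))\<^sup>2"
    proof eventually_elim
      case (elim t)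
      have "poly (q * p n) t - poly q t * \<phi> t = poly q t * (poly (p n) t - \<phi> t)" by (simp add: right_diff_distrib)
      then show ?case using B[of t] elim B0
        by (simp only: power_mult_distrib) (intro mult_right_mono, auto simp flip: abs_le_square_iff)
    qed
    then have "(\<integral>t. (poly (q * p n) t - poly q t * \<phi> t)\<^sup>2 \<partial>\<nu> x) \<le> (\<integral>t. (B * (poly (p n) t - \<phi> t))\<^sup>2 \<partial>\<nu> x)"
      using s2 sqi_cmult[OF s1, of B] by (intro integral_mono_AE) (auto simp: sqi_def)
    then have "l2n (\<nu> x) (\<lambda>t. poly (q * p n) t - poly q t * \<phi> t) \<le> l2n (\<nu> x) (\<lambda>t. B * (poly (p n) t - \<phi> t))"
      unfolding l2n_def by (rule real_sqrt_le_mono)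
    then show ?thesis using B0 by (simp add: l2n_cmult)
  qed
  have "(\<lambda>n. B * l2n (\<nu> x) (\<lambda>t. poly (p n) t - \<phi> t)) \<longlonglongrightarrow> 0" using tendsto_mult_left[OF p(1), of B] by simp
  then have "(\<lambda>n. l2n (\<nu> x) (\<lambda>t. poly (q * p n) t - poly q t * \<phi> t)) \<longlonglongrightarrow> 0"
    by (rule Lim_null_comparison[rotated]) (use le in \<open>auto simp del: poly_mult\<close>)
  moreover have "(\<lambda>n. poly_op T (q * p n) x) \<longlonglongrightarrow> poly_op T q h"
    unfolding poly_op_mult[OF lin]
    by (intro bounded_linear.tendsto[OF poly_op_bounded_linear] p) (use T in \<open>simp add: symmetric_op_def\<close>)
  ultimately show ?thesis using assms(2) unfolding calc_def
    by (intro conjI exI[of _ "\<lambda>n. q * p n"])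
qed

text \<open>Let \<open>q n\<close> approximate the indicator of \<open>B\<close>. Since
  \<open>E A\<close> commutes with polynomials in \<open>T\<close>, the projection by
  \<open>E A\<close> of \<open>q n\<close> at \<open>T\<close> applied to \<open>x\<close>
  represents \<open>q n\<close> times the indicator of \<open>A\<close>, and its distance to the
  indicator of the intersection is at most that of \<open>q n\<close> to the indicator of
  \<open>B\<close>.\<close>

lemma E_Int:
  assumes A: "A \<in> sets borel" and B: "B \<in> sets borel"
  shows "E (A \<inter> B) x = E A (E B x)"
proof -
  obtain q where q: "(\<lambda>n. l2n (\<nu> x) (\<lambda>t. poly (q n) t - indicator B t)) \<longlonglongrightarrow> 0"
    using common_approx[OF finite.insertI[OF finite.emptyI] B, of x] by blast
  have bl: "bounded_linear (E A)" using E_symmetric[OF A] by (simp add: symmetric_op_def)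
  have "(\<lambda>n. E A (poly_op T (q n) x)) \<longlonglongrightarrow> E A (E B x)"
    by (intro bounded_linear.tendsto[OF bl] E_tendsto B q)
  moreover have "(\<lambda>n. E A (poly_op T (q n) x)) \<longlonglongrightarrow> E (A \<inter> B) x"
  proof -
    have "norm (E A (poly_op T (q n) x) - E (A \<inter> B) x) \<le> l2n (\<nu> x) (\<lambda>t. poly (q n) t - indicator B t)" for n
    proof -
      have s: "sqi (\<nu> x) (\<lambda>t. poly (q n) t * indicator A t)"
      proof -
        obtain B where "\<And>t. 0 \<le> t \<Longrightarrow> t \<le> 1 \<Longrightarrow> \<bar>poly (q n) t\<bar> \<le> B" using poly_bounded_unit by blast
        then show ?thesis
          by (intro unit_measure_sqi[OF \<nu>, where B="\<bar>B\<bar>"]) (use A in \<open>fastforce simp: indicator_def\<close>)+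
      qed
      have Tq: "poly_op T (q n) (T y) = T (poly_op T (q n) y)" for y
        using poly_op_commute[OF lin lin refl, of "q n" y] by simp
      have bl: "bounded_linear (poly_op T (q n))" using T by (simp add: poly_op_bounded_linear symmetric_op_def)
      then have "E A (poly_op T (q n) x) = poly_op T (q n) (E A x)"
        using E_commute[where J="poly_op T (q n)", OF A bl Tq, of x] by simp
      then have "norm (E A (poly_op T (q n) x) - E (A \<inter> B) x)
          = l2n (\<nu> x) (\<lambda>t. poly (q n) t * indicator A t - indicator (A \<inter> B) t)"
        using calc_norm[OF calc_diff[OF calc_mult_poly[OF calc_E[OF A] s] calc_E[of "A \<inter> B"]]] A B by simp
      also have "\<dots> \<le> l2n (\<nu> x) (\<lambda>t. poly (q n) t - indicator B t)"
        unfolding l2n_def using sqi_diff[OF s sqi_ind[of "A \<inter> B"]] sqi_diff[OF sqi_poly sqi_ind[OF B], of x "q n"] A B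
        by (intro real_sqrt_le_mono integral_mono) (auto simp: sqi_def indicator_def)
      finally show ?thesis .
    qed
    then have "(\<lambda>n. E A (poly_op T (q n) x) - E (A \<inter> B) x) \<longlonglongrightarrow> 0"
      by (intro Lim_null_comparison[OF _ q]) auto
    then show ?thesis by (simp add: LIM_zero_iff)
  qed
  ultimately show ?thesis by (rule LIMSEQ_unique[symmetric])
qed

text \<open>By the isometry the norm of the remainder is the \<open>L^2(\<nu> x)\<close> norm of a
  difference of indicators, which tends to 0 by dominated convergence.\<close>

lemma E_countable_additive:
  assumes A: "range A \<subseteq> sets borel" "disjoint_family (A :: nat \<Rightarrow> real set)"
  shows "(\<lambda>n. \<Sum>i<n. E (A i) x) \<longlonglongrightarrow> E (\<Union>i. A i) x"
proof -
  interpret finite_measure "\<nu> x" using \<nu>[of x] by (simp add: unit_measure_def)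
  have [measurable_cong]: "sets (\<nu> x) = sets borel" using \<nu>[of x] by (simp add: unit_measure_def)
  have [measurable]: "A i \<in> sets borel" for i using A by auto
  have eq: "(\<Sum>i<n. indicator (A i) t) = (indicator (\<Union>i<n. A i) t :: real)" for n t
    using disjoint_family_on_mono[OF subset_UNIV A(2), of "{..<n}"]
    by (subst indicator_UN_disjoint) auto
  have norm: "norm ((\<Sum>i<n. E (A i) x) - E (\<Union>i. A i) x)
      = l2n (\<nu> x) (\<lambda>t. indicator (\<Union>i<n. A i) t - indicator (\<Union>i. A i) t)" for n
    unfolding eq[symmetric] by (intro calc_norm calc_diff calc_sum calc_E) auto
  have lim: "(\<lambda>n. l2n (\<nu> x) (\<lambda>t. indicator (\<Union>i<n. A i) t - indicator (\<Union>i. A i) t)) \<longlonglongrightarrow> 0"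
  proof (rule l2n_dominated[where w="\<lambda>_. 1"])
    show "AE t in \<nu> x. (\<lambda>n. indicator (\<Union>i<n. A i) t) \<longlonglongrightarrow> (indicator (\<Union>i. A i) t :: real)"
      by (intro AE_I2 LIMSEQ_indicator_UN)
  qed (auto simp: indicator_def)
  have "(\<lambda>n. (\<Sum>i<n. E (A i) x) - E (\<Union>i. A i) x) \<longlonglongrightarrow> 0"
    by (rule tendsto_norm_zero_cancel) (unfold norm, rule lim)
  then show ?thesis by (rule LIM_zero_cancel)
qed

lemma E_UNIV: "E UNIV x = x"
proof -
  have "poly 1 = (indicator UNIV :: real \<Rightarrow> real)" by auto
  then have "calc x (indicator UNIV) (poly_op T 1 x)"
    using calc_poly[of x 1] by simp
  then show ?thesis using calc_unique[OF calc_E] lin by fastforce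
qed

lemma emeasure_\<nu>: assumes "A \<in> sets borel" shows "emeasure (\<nu> x) A = ennreal ((norm (E A x))\<^sup>2)"
proof -
  interpret finite_measure "\<nu> x" using \<nu>[of x] by (simp add: unit_measure_def)
  have s: "sets (\<nu> x) = sets borel" using \<nu>[of x] by (simp add: unit_measure_def)
  have "(norm (E A x))\<^sup>2 = (\<integral>t. (indicator A t)\<^sup>2 \<partial>\<nu> x)"
    by (simp add: calc_norm[OF calc_E[OF assms]] l2n_sq)
  also have "\<dots> = (\<integral>t. indicator A t \<partial>\<nu> x)"
    by (intro Bochner_Integration.integral_cong) (auto simp: indicator_def)
  also have "\<dots> = measure (\<nu> x) A" using assms s sets_eq_imp_space_eq[OF s] by simp
  finally show ?thesis by (simp add: emeasure_eq_measure)
qed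

end

text \<open>The operator is rescaled to \<open>T / c\<close>, whose form lies between 0 and 1, and
  the resulting projections are transported along \<open>t \<mapsto> c t\<close>. The clause about
  \<open>J\<close> serves to recover complex linearity, with \<open>J\<close> the multiplication by
  a complex number.\<close>

theorem spectral_theorem:
  fixes T :: "'h::{real_inner, complete_space} \<Rightarrow> 'h"
  assumes T: "symmetric_op T" and c: "c > 0"
    and pos: "\<And>x. 0 \<le> inner (T x) x" and le: "\<And>x. inner (T x) x \<le> c * inner x x"
  shows "\<exists>E. pvm E \<and> (\<forall>x. spec_int E (\<lambda>t. t) x (T x)) \<and>
     (\<forall>J A x. bounded_linear J \<longrightarrow> (\<forall>x. J (T x) = T (J x)) \<longrightarrow> A \<in> sets borel \<longrightarrow> J (E A x) = E A (J x))"
proof -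
  define U where "U x = (1 / c) *\<^sub>R T x" for x
  have U: "symmetric_op U"
    using T unfolding symmetric_op_def U_def by (auto intro: bounded_linear_scaleR_right bounded_linear_const_scaleR)
  have "0 \<le> inner (U x) x" "inner (U x) x \<le> inner x x" for x
    using pos[of x] le[of x] c by (auto simp: U_def divide_simps mult.commute)
  from moment_measure[OF U this] have "\<forall>x. \<exists>M. unit_measure M \<and> (\<forall>p. inner (poly_op U p x) x = (\<integral>t. poly p t \<partial>M))"
    by (simp add: unit_measure_def conj_assoc)
  then obtain \<nu> where "\<And>x. unit_measure (\<nu> x)" "\<And>x p. inner (poly_op U p x) x = (\<integral>t. poly p t \<partial>\<nu> x)"
    by metis
  then interpret moment_family U \<nu> by unfold_locales (use U in auto)
  define F where "F A = E ((\<lambda>t. c * t) -` A)" for A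
  have vm: "(\<lambda>t. c * t) -` A \<in> sets borel" if "A \<in> sets borel" for A :: "real set"
    using measurable_sets[of "\<lambda>t. c * t" borel borel A] that by simp
  have "pvm F"
    unfolding pvm_def F_def
  proof (intro conjI ballI allI impI)
    fix A :: "nat \<Rightarrow> real set" and x assume A: "range A \<subseteq> sets borel" "disjoint_family A"
    then show "(\<lambda>n. \<Sum>i<n. E ((*) c -` A i) x) \<longlonglongrightarrow> E ((*) c -` \<Union> (range A)) x"
      unfolding vimage_UN by (intro E_countable_additive) (auto simp: disjoint_family_on_def intro!: vm)
  qed (auto intro!: E_symmetric vm E_Int E_UNIV simp: vimage_Int)
  moreover have "spec_int F (\<lambda>t. t) x (T x)" for x
  proof -
    \<comment> \<open>Rounds \<open>t / c\<close> down to a multiple of \<open>1 / (n + 1)\<close>.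
      The value 0 outside \<open>[0, c]\<close> keeps the range finite and is invisible to the
      measure.\<close>
    define s where "s n t = (if 0 \<le> t \<and> t \<le> c then c * real_of_int \<lfloor>(t / c) * real (Suc n)\<rfloor> / real (Suc n) else 0)" for n t
    interpret M: finite_measure "\<nu> x" using \<nu>[of x] by (simp add: unit_measure_def)
    have sb [measurable_cong]: "sets (\<nu> x) = sets borel" using \<nu>[of x] by (simp add: unit_measure_def)
    have [measurable]: "s n \<in> borel_measurable borel" for n unfolding s_def by measurable
    have s_range: "range (s n) \<subseteq> insert 0 ((\<lambda>i. c * real_of_int i / real (Suc n)) ` {0..int (Suc n)})" for n
    proof
      fix y assume "y \<in> range (s n)"
      then obtain t where y: "y = s n t" by auto
      show "y \<in> insert 0 ((\<lambda>i. c * real_of_int i / real (Suc n)) ` {0..int (Suc n)})"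
      proof (cases "0 \<le> t \<and> t \<le> c")
        case True
        then have "0 \<le> t / c" "t / c \<le> 1" using c by auto
        then have "0 \<le> t / c * real (Suc n)" "t / c * real (Suc n) \<le> 1 * real (Suc n)"
          by (intro mult_nonneg_nonneg mult_right_mono; simp)+
        then have "\<lfloor>t / c * real (Suc n)\<rfloor> \<in> {0..int (Suc n)}"
          using floor_mono[of "t / c * real (Suc n)" "1 * real (Suc n)"] by (simp del: of_nat_Suc)
        then show ?thesis using True unfolding y s_def by auto
      qed (auto simp: y s_def)
    qed
    have fin: "finite (range (s n))" for n
      by (rule finite_subset[OF s_range]) auto
    have sf: "simple_function borel (s n)" for n
      by (rule simple_function_borel_measurable) (use fin in auto)
    have approx: "\<bar>c * t - s n (c * t)\<bar> \<le> c / real (Suc n)" if "0 \<le> t" "t \<le> 1" for n t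
    proof -
      have "s n (c * t) = c * (real_of_int \<lfloor>t * real (Suc n)\<rfloor> / real (Suc n))"
        using that c unfolding s_def by (simp add: mult_le_cancel_left1)
      then have "c * t - s n (c * t) = c * ((t * real (Suc n) - real_of_int \<lfloor>t * real (Suc n)\<rfloor>) / real (Suc n))"
        by (simp add: diff_divide_distrib right_diff_distrib del: of_nat_Suc)
      moreover have "0 \<le> t * real (Suc n) - real_of_int \<lfloor>t * real (Suc n)\<rfloor>"
          "t * real (Suc n) - real_of_int \<lfloor>t * real (Suc n)\<rfloor> \<le> 1" by linarith+
      then have "0 \<le> (t * real (Suc n) - real_of_int \<lfloor>t * real (Suc n)\<rfloor>) / real (Suc n)"
          "(t * real (Suc n) - real_of_int \<lfloor>t * real (Suc n)\<rfloor>) / real (Suc n) \<le> 1 / real (Suc n)"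
        by (auto intro!: divide_right_mono simp del: of_nat_Suc)
      moreover have "c * u \<le> c / real (Suc n)" "\<bar>c * u\<bar> = c * u" if "0 \<le> u" "u \<le> 1 / real (Suc n)" for u
        using mult_left_mono[OF that(2), of c] that(1) c by (simp_all del: of_nat_Suc)
      ultimately show ?thesis by metis
    qed
    have mb: "(\<lambda>t. c * t - s n (c * t)) \<in> borel_measurable borel" for n by measurable
    have l2: "l2n (\<nu> x) (\<lambda>t. c * t - s n (c * t)) \<le> c / real (Suc n) * sqrt (measure (\<nu> x) UNIV)" for n
      using approx c by (intro l2n_unit_le[OF \<nu> mb]) auto
    have "(\<lambda>n. c / real (Suc n) * sqrt (measure (\<nu> x) UNIV)) \<longlonglongrightarrow> 0 * sqrt (measure (\<nu> x) UNIV)"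
      by (intro tendsto_mult tendsto_const LIMSEQ_Suc[OF lim_const_over_n])
    then have lim0: "(\<lambda>n. c / real (Suc n) * sqrt (measure (\<nu> x) UNIV)) \<longlonglongrightarrow> 0"
      by (simp only: mult_zero_left)
    have l2lim: "(\<lambda>n. l2n (\<nu> x) (\<lambda>t. c * t - s n (c * t))) \<longlonglongrightarrow> 0"
      by (rule Lim_null_comparison[OF always_eventually lim0])
        (simp only: real_norm_def abs_of_nonneg[OF l2n_nonneg] l2 simp_thms)
    have sqi_s: "sqi (\<nu> x) (\<lambda>t. c * t - s n (c * t))" for n
      by (rule unit_measure_sqi[OF \<nu> mb, where B="c / real (Suc n)"]) (use approx in auto)
    have spm: "spec_measure F x = distr (\<nu> x) borel (\<lambda>t. c * t)"
    proof -
      have "ennreal ((norm (F A x))\<^sup>2) = emeasure (distr (\<nu> x) borel (\<lambda>t. c * t)) A" if "A \<in> sets borel" for A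
        using that vm[OF that] sets_eq_imp_space_eq[OF sb]
        by (simp add: emeasure_distr F_def emeasure_\<nu>)
      then have "spec_measure F x = measure_of UNIV (sets borel) (emeasure (distr (\<nu> x) borel (\<lambda>t. c * t)))"
        unfolding spec_measure_def using sets.sigma_sets_eq[of "borel :: real measure"]
        by (intro measure_of_eq) auto
      also have "\<dots> = distr (\<nu> x) borel (\<lambda>t. c * t)"
        using measure_of_of_measure[of "distr (\<nu> x) borel (\<lambda>t. c * t)"] by simp
      finally show ?thesis .
    qed
    have "(\<integral>\<^sup>+ t. ennreal (\<bar>t - s n t\<bar>\<^sup>2) \<partial>spec_measure F x) = ennreal ((l2n (\<nu> x) (\<lambda>t. c * t - s n (c * t)))\<^sup>2)" for n
      unfolding spm nn_integral_sq_eq_l2n[OF sqi_s, symmetric] by (subst nn_integral_distr) auto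
    moreover have "(\<lambda>n. ennreal ((l2n (\<nu> x) (\<lambda>t. c * t - s n (c * t)))\<^sup>2)) \<longlonglongrightarrow> ennreal (0\<^sup>2)"
      by (intro tendsto_ennrealI tendsto_power l2lim)
    ultimately have 1: "(\<lambda>n. \<integral>\<^sup>+ t. ennreal (\<bar>t - s n t\<bar>\<^sup>2) \<partial>spec_measure F x) \<longlonglongrightarrow> 0" by simp
    have calc_s: "calc x (\<lambda>t. s n (c * t)) (simple_int F (s n) x)" for n
    proof -
      have "(\<lambda>t. s n (c * t)) = (\<lambda>t. \<Sum>d\<in>range (s n). d * indicator ((\<lambda>t. c * t) -` (s n -` {d})) t)"
      proof
        fix t
        have "(\<Sum>d\<in>range (s n). d * indicator ((\<lambda>t. c * t) -` (s n -` {d})) t) = (\<Sum>d\<in>{s n (c * t)}. d)"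
          using fin by (intro sum.mono_neutral_cong_right) (auto simp: indicator_def)
        then show "s n (c * t) = (\<Sum>d\<in>range (s n). d * indicator ((\<lambda>t. c * t) -` (s n -` {d})) t)" by simp
      qed
      moreover have "s n -` {d} \<in> sets borel" for d
        using measurable_sets[of "s n" borel borel "{d}"] by simp
      ultimately show ?thesis
        unfolding simple_int_def F_def by (auto intro!: calc_sum calc_scale calc_E vm fin)
    qed
    have "calc x (\<lambda>t. c * t) (T x)"
      using calc_scale[OF calc_poly[of x "[:0,1:]"], of c] c lin by (simp add: U_def)
    from calc_norm[OF calc_diff[OF this calc_s]]
    have nd: "norm (T x - simple_int F (s n) x) = l2n (\<nu> x) (\<lambda>t. c * t - s n (c * t))" for n .
    have "(\<lambda>n. T x - simple_int F (s n) x) \<longlonglongrightarrow> 0"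
      by (rule tendsto_norm_zero_cancel) (unfold nd, rule l2lim)
    from tendsto_diff[OF tendsto_const[of "T x"] this] have "(\<lambda>n. simple_int F (s n) x) \<longlonglongrightarrow> T x" by simp
    with 1 sf show ?thesis unfolding spec_int_def by auto
  qed
  moreover have "J (F A x) = F A (J x)" if J: "bounded_linear J" "\<forall>x. J (T x) = T (J x)" "A \<in> sets borel" for J A x
    unfolding F_def
    by (rule E_commute[OF vm J(1)]) (use J in \<open>auto simp: U_def linear_cmul bounded_linear.linear\<close>)
  ultimately show ?thesis by blast
qed

subsection \<open>Integration against a projection valued measure\<close>

lemma l2n_tendsto_0_le:
  assumes "\<And>n. l2n M (f n) \<le> g n" "g \<longlonglongrightarrow> 0" shows "(\<lambda>n::nat. l2n M (f n)) \<longlonglongrightarrow> 0"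
  by (rule tendsto_sandwich[OF _ _ tendsto_const assms(2)]) (intro always_eventually allI l2n_nonneg assms(1))+

locale projection_measure =
  fixes E :: "real set \<Rightarrow> 'h \<Rightarrow> 'h::{real_inner, complete_space}"
  assumes pvm: "pvm E"
begin

abbreviation "\<nu> \<equiv> spec_measure E"

lemma E_bl: "A \<in> sets borel \<Longrightarrow> bounded_linear (E A)"
  using pvm by (simp add: pvm_def symmetric_op_def)

lemma E_sym: "A \<in> sets borel \<Longrightarrow> inner (E A x) y = inner x (E A y)"
  using pvm by (simp add: pvm_def symmetric_op_def)

lemma E_Int: "A \<in> sets borel \<Longrightarrow> B \<in> sets borel \<Longrightarrow> E A (E B x) = E (A \<inter> B) x"
  using pvm by (simp add: pvm_def)

lemma E_UNIV [simp]: "E UNIV x = x"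
  using pvm by (simp add: pvm_def)

lemma E_sigma:
  "range A \<subseteq> sets borel \<Longrightarrow> disjoint_family A \<Longrightarrow> (\<lambda>n. \<Sum>i<n. E (A i) x) \<longlonglongrightarrow> E (\<Union>i. A i) x"
  for A :: "nat \<Rightarrow> real set"
  using pvm by (simp add: pvm_def)

text \<open>The partial sums for the constant family of empty sets are multiples \<open>n\<close> of
  this vector; they converge, so their increments tend to 0.\<close>

lemma E_empty [simp]: "E {} x = 0"
proof -
  have l: "(\<lambda>n. \<Sum>i<n. E {} x) \<longlonglongrightarrow> E {} x"
    using E_sigma[of "\<lambda>_. {}" x] by (simp add: disjoint_family_on_def)
  have "(\<lambda>n. (\<Sum>i<Suc n. E {} x) - (\<Sum>i<n. E {} x)) \<longlonglongrightarrow> E {} x - E {} x"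
    by (intro tendsto_diff l LIMSEQ_Suc[OF l])
  then have "(\<lambda>n::nat. E {} x) \<longlonglongrightarrow> 0"
    by (simp only: sum.lessThan_Suc add_diff_cancel_left' diff_self)
  then show ?thesis by (simp add: LIMSEQ_const_iff)
qed

lemma E_Un:
  assumes "A \<in> sets borel" "B \<in> sets borel" "A \<inter> B = {}"
  shows "E (A \<union> B) x = E A x + E B x"
proof -
  define F where "F i = (if i = 0 then A else if i = 1 then B else {})" for i :: nat
  have "(\<lambda>n. \<Sum>i<n. E (F i) x) \<longlonglongrightarrow> E (\<Union>i. F i) x"
    using assms by (intro E_sigma) (auto simp: F_def disjoint_family_on_def)
  moreover have "(\<Union>i. F i) = A \<union> B" by (auto simp: F_def split: if_splits)
  moreover have "(\<Sum>i<n. E (F i) x) = E A x + E B x" if "n \<ge> 2" for n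
  proof -
    have "(\<Sum>i<n. E (F i) x) = (\<Sum>i\<in>{0,1}. E (F i) x)"
      using that by (intro sum.mono_neutral_right) (auto simp: F_def)
    then show ?thesis by (simp add: F_def)
  qed
  then have "(\<lambda>n. \<Sum>i<n. E (F i) x) \<longlonglongrightarrow> E A x + E B x"
    by (intro tendsto_eventually) (auto simp: eventually_sequentially)
  ultimately show ?thesis using LIMSEQ_unique by metis
qed

lemma E_UN:
  assumes "finite I" "\<And>i. i \<in> I \<Longrightarrow> A i \<in> sets borel" "disjoint_family_on A I"
  shows "E (\<Union>i\<in>I. A i) x = (\<Sum>i\<in>I. E (A i) x)"
  using assms
proof (induction I)
  case (insert i I)
  have "A i \<inter> (\<Union>j\<in>I. A j) = {}" using insert.hyps insert.prems(2) by (fastforce simp: disjoint_family_on_def)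
  moreover have "(\<Union>j\<in>I. A j) \<in> sets borel" using insert by (intro sets.finite_UN) auto
  moreover have "disjoint_family_on A I" using insert.prems(2) by (rule disjoint_family_on_mono[rotated]) auto
  ultimately show ?case using insert by (simp add: E_Un)
qed simp

lemma norm_E_sq: "A \<in> sets borel \<Longrightarrow> (norm (E A x))\<^sup>2 = inner (E A x) x"
  by (simp add: power2_norm_eq_inner E_sym E_Int inner_commute)

lemma sets_\<nu> [simp, measurable_cong]: "sets (\<nu> x) = sets borel"
  by (simp add: spec_measure_def sets.sigma_sets_eq[of "borel :: real measure", simplified])

lemma space_\<nu> [simp]: "space (\<nu> x) = UNIV"
  by (simp add: spec_measure_def)

text \<open>Countable additivity is inherited because \<open>|E A x|^2 = <E A x, x>\<close> is
  linear in \<open>E A x\<close>.\<close>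

lemma emeasure_\<nu>: assumes "A \<in> sets borel" shows "emeasure (\<nu> x) A = ennreal ((norm (E A x))\<^sup>2)"
proof (rule emeasure_measure_of[OF spec_measure_def])
  show "countably_additive (sets (\<nu> x)) (\<lambda>A. ennreal ((norm (E A x))\<^sup>2))"
  proof (rule countably_additiveI)
    fix A :: "nat \<Rightarrow> real set" assume A: "range A \<subseteq> sets (\<nu> x)" "disjoint_family A"
    then have "(\<lambda>n. inner (\<Sum>i<n. E (A i) x) x) \<longlonglongrightarrow> inner (E (\<Union>i. A i) x) x"
      by (intro tendsto_inner tendsto_const E_sigma) auto
    then have "(\<lambda>i. (norm (E (A i) x))\<^sup>2) sums (norm (E (\<Union>i. A i) x))\<^sup>2"
      using A unfolding sums_def by (subst norm_E_sq, force)+ (simp add: inner_sum_left)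
    then show "(\<Sum>i. ennreal ((norm (E (A i) x))\<^sup>2)) = ennreal ((norm (E (\<Union> (range A)) x))\<^sup>2)"
      by (intro suminf_ennreal_eq) auto
  qed
qed (use assms in \<open>auto simp: positive_def\<close>)

lemma finite_\<nu>: "finite_measure (\<nu> x)"
  by (rule finite_measureI) (simp add: emeasure_\<nu>)

lemma measure_\<nu>: "A \<in> sets borel \<Longrightarrow> measure (\<nu> x) A = (norm (E A x))\<^sup>2"
  by (simp add: measure_def emeasure_\<nu>)

lemma simple_vimage: "simple_function borel s \<Longrightarrow> s -` {c} \<in> sets borel" for s :: "real \<Rightarrow> 'c"
  using simple_functionD(2)[of borel s "{c}"] by simp

lemma simple_range: "simple_function borel s \<Longrightarrow> finite (range s)" for s :: "real \<Rightarrow> 'c"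
  using simple_functionD(1)[of borel s] by simp

text \<open>Values of \<open>u\<close> with the same image under \<open>g\<close> are grouped by
  finite additivity. With \<open>u\<close> a pair of simple functions this puts both on a common
  partition, from which linearity follows.\<close>

lemma simple_int_comp:
  fixes u :: "real \<Rightarrow> 'c" and g :: "'c \<Rightarrow> real"
  assumes u: "simple_function borel u"
  shows "simple_int E (\<lambda>t. g (u t)) x = (\<Sum>z\<in>range u. g z *\<^sub>R E (u -` {z}) x)"
proof -
  note fin = simple_range[OF u] and m = simple_vimage[OF u]
  have eq: "E ((\<lambda>t. g (u t)) -` {c}) x = (\<Sum>z\<in>{z \<in> range u. g z = c}. E (u -` {z}) x)" for c
  proof -
    have "(\<lambda>t. g (u t)) -` {c} = (\<Union>z\<in>{z \<in> range u. g z = c}. u -` {z})" by auto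
    then show ?thesis using fin m by (simp add: E_UN disjoint_family_on_def) 
        (subst E_UN; auto simp: disjoint_family_on_def)
  qed
  have "simple_int E (\<lambda>t. g (u t)) x = (\<Sum>c\<in>g ` range u. \<Sum>z\<in>{z \<in> range u. g z = c}. g z *\<^sub>R E (u -` {z}) x)"
    unfolding simple_int_def eq by (auto simp: image_image scaleR_sum_right intro!: sum.cong)
  also have "\<dots> = (\<Sum>z\<in>range u. g z *\<^sub>R E (u -` {z}) x)"
    by (rule sum.image_gen[OF fin, symmetric])
  finally show ?thesis .
qed

lemma simple_int_linear:
  assumes s: "simple_function borel s" and r: "simple_function borel r"
  shows "simple_int E (\<lambda>t. a * s t + b * r t) x = a *\<^sub>R simple_int E s x + b *\<^sub>R simple_int E r x"
proof -
  have u: "simple_function borel (\<lambda>t. (s t, r t))" using s r by (rule simple_function_Pair)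
  show ?thesis
    using simple_int_comp[OF u, of "\<lambda>z. a * fst z + b * snd z" x] simple_int_comp[OF u, of fst x]
      simple_int_comp[OF u, of snd x]
    by (simp add: scaleR_add_left sum.distrib scaleR_sum_right)
qed

lemma simple_int_E:
  assumes s: "simple_function borel s" and B: "B \<in> sets borel"
  shows "E B (simple_int E s x) = simple_int E (\<lambda>t. indicator B t * s t) x"
proof -
  let ?u = "\<lambda>t. (indicator B t :: real, s t)"
  have u: "simple_function borel ?u" using s B by (intro simple_function_Pair simple_function_indicator) auto
  have "E B (simple_int E s x) = (\<Sum>z\<in>range ?u. snd z *\<^sub>R E B (E (?u -` {z}) x))"
    using simple_int_comp[OF u, of snd x] E_bl[OF B]
    by (simp add: linear_sum linear_cmul bounded_linear.linear)
  also have "\<dots> = (\<Sum>z\<in>range ?u. (fst z * snd z) *\<^sub>R E (?u -` {z}) x)"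
  proof (rule sum.cong[OF refl])
    fix z assume "z \<in> range ?u"
    then have "(fst z = 1 \<and> B \<inter> ?u -` {z} = ?u -` {z}) \<or> (fst z = 0 \<and> B \<inter> ?u -` {z} = {})"
      by (auto simp: indicator_def)
    then show "snd z *\<^sub>R E B (E (?u -` {z}) x) = (fst z * snd z) *\<^sub>R E (?u -` {z}) x"
      using E_Int[OF B simple_vimage[OF u]] by auto
  qed
  also have "\<dots> = simple_int E (\<lambda>t. indicator B t * s t) x"
    using simple_int_comp[OF u, of "\<lambda>z. fst z * snd z" x] by simp
  finally show ?thesis .
qed

lemma simple_sqi: assumes "simple_function borel s" shows "sqi (\<nu> x) s"
proof -
  interpret finite_measure "\<nu> x" by (rule finite_\<nu>)
  have "finite ((\<lambda>c. \<bar>c\<bar>) ` range s)" using simple_range[OF assms] by simp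
  then have "\<bar>s t\<bar> \<le> Max ((\<lambda>c. \<bar>c\<bar>) ` range s)" for t by (intro Max_ge) auto
  then show ?thesis
    using borel_measurable_simple_function[OF assms] by (intro sqi_bounded) auto
qed

text \<open>Projections of disjoint level sets have orthogonal ranges, so only the diagonal of the
  double sum remains.\<close>

lemma norm_simple_int:
  assumes s: "simple_function borel s" shows "norm (simple_int E s x) = l2n (\<nu> x) s"
proof -
  interpret finite_measure "\<nu> x" by (rule finite_\<nu>)
  note fin = simple_range[OF s] and m = simple_vimage[OF s]
  have o: "inner (E (s -` {c}) x) (E (s -` {d}) x) = (if c = d then (norm (E (s -` {c}) x))\<^sup>2 else 0)" for c d
  proof (cases "c = d")
    case False
    then have "s -` {d} \<inter> s -` {c} = {}" by auto
    then have "inner (E (s -` {d}) (E (s -` {c}) x)) x = 0" by (simp add: E_Int m)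
    with False show ?thesis using E_sym[OF m[of d]] by simp
  qed (simp add: power2_norm_eq_inner)
  have "(norm (simple_int E s x))\<^sup>2 = (\<Sum>c\<in>range s. \<Sum>d\<in>range s. c * (d * inner (E (s -` {d}) x) (E (s -` {c}) x)))"
    unfolding power2_norm_eq_inner simple_int_def by (simp add: inner_sum_left inner_sum_right sum_distrib_left)
  also have "\<dots> = (\<Sum>c\<in>range s. c\<^sup>2 * measure (\<nu> x) (s -` {c}))"
    unfolding o measure_\<nu>[OF m] using fin
    by (intro sum.cong refl) (simp add: if_distrib[of "\<lambda>u. _ * u"] sum.delta sum.delta' power2_eq_square cong: if_cong)
  also have "\<dots> = (\<integral>t. (\<Sum>c\<in>range s. c\<^sup>2 * indicator (s -` {c}) t) \<partial>\<nu> x)"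
    using m by (subst Bochner_Integration.integral_sum) (auto intro!: integrable_real_indicator simp: emeasure_\<nu>)
  also have "\<dots> = (\<integral>t. (s t)\<^sup>2 \<partial>\<nu> x)"
  proof (intro Bochner_Integration.integral_cong refl)
    fix t
    have "(\<Sum>c\<in>range s. c\<^sup>2 * indicator (s -` {c}) t) = (\<Sum>c\<in>{s t}. c\<^sup>2)"
      using fin by (intro sum.mono_neutral_cong_right) (auto simp: indicator_def)
    then show "(\<Sum>c\<in>range s. c\<^sup>2 * indicator (s -` {c}) t) = (s t)\<^sup>2" by simp
  qed
  finally show ?thesis unfolding l2n_def by (metis norm_ge_zero real_sqrt_unique)
qed

text \<open>Replaces the extended nonnegative integral of the definition by \<open>l2n\<close>.
  Square integrability of \<open>\<phi>\<close> is automatic: it lies at finite distance from a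
  simple function, and simple functions are square integrable.\<close>

lemma spec_int_iff:
  "spec_int E \<phi> x y \<longleftrightarrow> \<phi> \<in> borel_measurable borel \<and> sqi (\<nu> x) \<phi> \<and>
     (\<exists>s. (\<forall>n. simple_function borel (s n)) \<and> (\<lambda>n. l2n (\<nu> x) (\<lambda>t. \<phi> t - s n t)) \<longlonglongrightarrow> 0 \<and>
        (\<lambda>n. simple_int E (s n) x) \<longlonglongrightarrow> y)" (is "_ \<longleftrightarrow> ?r")
proof
  assume ?r
  then obtain s where p: "\<phi> \<in> borel_measurable borel" "sqi (\<nu> x) \<phi>" and s: "\<And>n. simple_function borel (s n)"
    and l: "(\<lambda>n. l2n (\<nu> x) (\<lambda>t. \<phi> t - s n t)) \<longlonglongrightarrow> 0" and y: "(\<lambda>n. simple_int E (s n) x) \<longlonglongrightarrow> y" by blast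
  have "(\<lambda>n. ennreal ((l2n (\<nu> x) (\<lambda>t. \<phi> t - s n t))\<^sup>2)) \<longlonglongrightarrow> ennreal (0\<^sup>2)"
    by (intro tendsto_ennrealI tendsto_power l)
  moreover have "(\<integral>\<^sup>+ t. ennreal (\<bar>\<phi> t - s n t\<bar>\<^sup>2) \<partial>\<nu> x) = ennreal ((l2n (\<nu> x) (\<lambda>t. \<phi> t - s n t))\<^sup>2)" for n
    by (rule nn_integral_sq_eq_l2n[OF sqi_diff[OF p(2) simple_sqi[OF s]]])
  ultimately have "(\<lambda>n. \<integral>\<^sup>+ t. ennreal (\<bar>\<phi> t - s n t\<bar>\<^sup>2) \<partial>\<nu> x) \<longlonglongrightarrow> 0" by simp
  then show "spec_int E \<phi> x y" unfolding spec_int_def using p(1) s y by blast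
next
  assume "spec_int E \<phi> x y"
  then obtain s where p: "\<phi> \<in> borel_measurable borel" and s: "\<And>n. simple_function borel (s n)"
    and l: "(\<lambda>n. \<integral>\<^sup>+ t. ennreal (\<bar>\<phi> t - s n t\<bar>\<^sup>2) \<partial>\<nu> x) \<longlonglongrightarrow> 0" and y: "(\<lambda>n. simple_int E (s n) x) \<longlonglongrightarrow> y"
    unfolding spec_int_def by blast
  have [measurable]: "s n \<in> borel_measurable borel" for n by (rule borel_measurable_simple_function[OF s])
  note [measurable] = p
  have "\<exists>N. (\<integral>\<^sup>+ t. ennreal (\<bar>\<phi> t - s N t\<bar>\<^sup>2) \<partial>\<nu> x) < 1"
    using order_tendstoD(2)[OF l, of 1] by (auto simp: eventually_sequentially)
  then obtain N where N: "(\<integral>\<^sup>+ t. ennreal (\<bar>\<phi> t - s N t\<bar>\<^sup>2) \<partial>\<nu> x) < 1" by blast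
  have "integrable (\<nu> x) (\<lambda>t. (\<phi> t - s N t)\<^sup>2)"
    by (rule integrableI_nonneg) (use N in \<open>auto intro: less_trans[OF _ ennreal_one_less_top]\<close>)
  then have "sqi (\<nu> x) (\<lambda>t. \<phi> t - s N t)" by (simp add: sqi_def)
  from sqi_add[OF this simple_sqi[OF s, of x N]] have q: "sqi (\<nu> x) \<phi>" by simp
  have "(\<lambda>n. ennreal ((l2n (\<nu> x) (\<lambda>t. \<phi> t - s n t))\<^sup>2)) \<longlonglongrightarrow> 0"
    using l unfolding nn_integral_sq_eq_l2n[OF sqi_diff[OF q simple_sqi[OF s]]] .
  then have "(\<lambda>n. (l2n (\<nu> x) (\<lambda>t. \<phi> t - s n t))\<^sup>2) \<longlonglongrightarrow> 0"
    by (subst (asm) tendsto_ennreal_iff[of _ _ 0, simplified]) auto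
  then have "(\<lambda>n. sqrt ((l2n (\<nu> x) (\<lambda>t. \<phi> t - s n t))\<^sup>2)) \<longlonglongrightarrow> sqrt 0" by (rule tendsto_real_sqrt)
  then show ?r using p q s y by auto
qed

lemma spec_int_sqi: "spec_int E \<phi> x y \<Longrightarrow> sqi (\<nu> x) \<phi>"
  by (simp add: spec_int_iff)

lemma spec_int_bm: "spec_int E \<phi> x y \<Longrightarrow> \<phi> \<in> borel_measurable borel"
  by (simp add: spec_int_iff)

lemma spec_int_simple: "simple_function borel s \<Longrightarrow> spec_int E s x (simple_int E s x)"
  unfolding spec_int_iff
  by (intro conjI simple_sqi borel_measurable_simple_function exI[of _ "\<lambda>_. s"]) (auto simp: l2n_def)

lemma spec_int_linear:
  assumes "spec_int E \<phi> x y" "spec_int E \<psi> x z"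
  shows "spec_int E (\<lambda>t. a * \<phi> t + b * \<psi> t) x (a *\<^sub>R y + b *\<^sub>R z)"
proof -
  obtain s where p: "\<phi> \<in> borel_measurable borel" "sqi (\<nu> x) \<phi>" and s: "\<And>n. simple_function borel (s n)"
    and sl: "(\<lambda>n. l2n (\<nu> x) (\<lambda>t. \<phi> t - s n t)) \<longlonglongrightarrow> 0" and y: "(\<lambda>n. simple_int E (s n) x) \<longlonglongrightarrow> y"
    using assms(1) unfolding spec_int_iff by blast
  obtain r where q: "\<psi> \<in> borel_measurable borel" "sqi (\<nu> x) \<psi>" and r: "\<And>n. simple_function borel (r n)"
    and rl: "(\<lambda>n. l2n (\<nu> x) (\<lambda>t. \<psi> t - r n t)) \<longlonglongrightarrow> 0" and z: "(\<lambda>n. simple_int E (r n) x) \<longlonglongrightarrow> z"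
    using assms(2) unfolding spec_int_iff by blast
  let ?u = "\<lambda>n t. a * s n t + b * r n t"
  have u: "simple_function borel (?u n)" for n
    using simple_function_compose2[OF s[of n] r[of n], of "\<lambda>c d. a * c + b * d"] by simp
  have eq: "(\<lambda>t. (a * \<phi> t + b * \<psi> t) - ?u n t) = (\<lambda>t. a * (\<phi> t - s n t) + b * (\<psi> t - r n t))" for n
    by (auto simp: algebra_simps)
  have le: "l2n (\<nu> x) (\<lambda>t. (a * \<phi> t + b * \<psi> t) - ?u n t) \<le> \<bar>a\<bar> * l2n (\<nu> x) (\<lambda>t. \<phi> t - s n t) + \<bar>b\<bar> * l2n (\<nu> x) (\<lambda>t. \<psi> t - r n t)" for n
    unfolding eq l2n_cmult[symmetric]
    by (intro l2n_triangle sqi_cmult sqi_diff p q simple_sqi s r)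
  have lim: "(\<lambda>n. \<bar>a\<bar> * l2n (\<nu> x) (\<lambda>t. \<phi> t - s n t) + \<bar>b\<bar> * l2n (\<nu> x) (\<lambda>t. \<psi> t - r n t)) \<longlonglongrightarrow> 0"
    using tendsto_add[OF tendsto_mult_left[OF sl, of "\<bar>a\<bar>"] tendsto_mult_left[OF rl, of "\<bar>b\<bar>"]] by simp
  have "(\<lambda>n. l2n (\<nu> x) (\<lambda>t. (a * \<phi> t + b * \<psi> t) - ?u n t)) \<longlonglongrightarrow> 0"
    by (rule l2n_tendsto_0_le[OF le lim])
  moreover have "(\<lambda>n. simple_int E (?u n) x) \<longlonglongrightarrow> a *\<^sub>R y + b *\<^sub>R z"
    unfolding simple_int_linear[OF s r] by (intro tendsto_intros y z)
  ultimately show ?thesis unfolding spec_int_iff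
    by (intro conjI exI[of _ ?u] sqi_add sqi_cmult p q allI u borel_measurable_add borel_measurable_times borel_measurable_const)
qed

lemma spec_int_diff: "spec_int E \<phi> x y \<Longrightarrow> spec_int E \<psi> x z \<Longrightarrow> spec_int E (\<lambda>t. \<phi> t - \<psi> t) x (y - z)"
  using spec_int_linear[of \<phi> x y \<psi> z 1 "-1"] by simp

lemma spec_int_norm:
  assumes "spec_int E \<phi> x y" shows "norm y = l2n (\<nu> x) \<phi>"
proof -
  obtain s where p: "sqi (\<nu> x) \<phi>" and s: "\<And>n. simple_function borel (s n)"
    and sl: "(\<lambda>n. l2n (\<nu> x) (\<lambda>t. \<phi> t - s n t)) \<longlonglongrightarrow> 0" and y: "(\<lambda>n. simple_int E (s n) x) \<longlonglongrightarrow> y"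
    using assms(1) unfolding spec_int_iff by blast
  have "(\<lambda>n. l2n (\<nu> x) (s n)) \<longlonglongrightarrow> l2n (\<nu> x) \<phi>"
    using sl by (intro l2n_tendsto p simple_sqi s) (simp add: l2n_diff_commute)
  moreover have "(\<lambda>n. l2n (\<nu> x) (s n)) \<longlonglongrightarrow> norm y"
    using tendsto_norm[OF y] by (simp add: norm_simple_int s)
  ultimately show ?thesis using LIMSEQ_unique by blast
qed

lemma spec_int_unique: "spec_int E \<phi> x y \<Longrightarrow> spec_int E \<phi> x z \<Longrightarrow> y = z"
  using spec_int_norm[OF spec_int_diff, of \<phi> x y \<phi> z] by (simp add: l2n_def)

text \<open>The simple functions do not depend on the vector, which lets the integrals at
  \<open>x\<close>, \<open>x'\<close> and \<open>x - x'\<close> be compared in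
  \<open>spec_int_diff_right\<close>.\<close>

lemma spec_int_approx:
  assumes [measurable]: "\<phi> \<in> borel_measurable borel"
  shows "\<exists>s. (\<forall>n. simple_function borel (s n)) \<and>
    (\<forall>x. sqi (\<nu> x) \<phi> \<longrightarrow> (\<lambda>n. l2n (\<nu> x) (\<lambda>t. \<phi> t - s n t)) \<longlonglongrightarrow> 0)"
proof -
  obtain s where s: "\<And>n. simple_function borel (s n)" and sl: "\<And>t. (\<lambda>n. s n t) \<longlonglongrightarrow> \<phi> t"
    and sb: "\<And>n t. norm (s n t) \<le> 2 * norm (\<phi> t)"
    using borel_measurable_implies_sequence_metric[OF assms(1), of 0] by (auto simp: dist_norm)
  have [measurable]: "s n \<in> borel_measurable borel" for n by (rule borel_measurable_simple_function[OF s])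
  have "(\<lambda>n. l2n (\<nu> x) (\<lambda>t. s n t - \<phi> t)) \<longlonglongrightarrow> 0" if p: "sqi (\<nu> x) \<phi>" for x
  proof (rule l2n_dominated[where w="\<lambda>t. 9 * (\<phi> t)\<^sup>2"])
    show "integrable (\<nu> x) (\<lambda>t. 9 * (\<phi> t)\<^sup>2)" using p by (auto simp: sqi_def)
    have "(s n t - \<phi> t)\<^sup>2 \<le> 9 * (\<phi> t)\<^sup>2" for n t
    proof -
      have "\<bar>s n t - \<phi> t\<bar> \<le> \<bar>3 * \<phi> t\<bar>" using sb[of n t] by (auto simp: abs_if split: if_splits)
      then have "(s n t - \<phi> t)\<^sup>2 \<le> (3 * \<phi> t)\<^sup>2" by (simp only: abs_le_square_iff)
      then show ?thesis by (simp add: power_mult_distrib)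
    qed
    then show "AE t in \<nu> x. (s n t - \<phi> t)\<^sup>2 \<le> 9 * (\<phi> t)\<^sup>2" for n by simp
  qed (use sl in auto)
  then show ?thesis using s by (auto simp: l2n_diff_commute[of _ \<phi>] intro!: exI[of _ s])
qed

lemma spec_int_exists:
  assumes [measurable]: "\<phi> \<in> borel_measurable borel" and p: "sqi (\<nu> x) \<phi>" shows "\<exists>y. spec_int E \<phi> x y"
proof -
  obtain s where s: "\<And>n. simple_function borel (s n)"
    and sl: "\<And>x. sqi (\<nu> x) \<phi> \<Longrightarrow> (\<lambda>n. l2n (\<nu> x) (\<lambda>t. \<phi> t - s n t)) \<longlonglongrightarrow> 0"
    using spec_int_approx[OF assms(1)] by blast
  have l: "(\<lambda>n. l2n (\<nu> x) (\<lambda>t. s n t - \<phi> t)) \<longlonglongrightarrow> 0" using sl[OF p] by (simp add: l2n_diff_commute)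
  have nd: "norm (simple_int E (s m) x - simple_int E (s n) x) = l2n (\<nu> x) (\<lambda>t. s m t - s n t)" for m n
    by (intro spec_int_norm spec_int_diff spec_int_simple s)
  have "Cauchy (\<lambda>n. simple_int E (s n) x)"
  proof (rule metric_CauchyI)
    fix e :: real assume "e > 0"
    then obtain N where N: "\<And>n. n \<ge> N \<Longrightarrow> l2n (\<nu> x) (\<lambda>t. s n t - \<phi> t) < e / 2"
      using order_tendstoD(2)[OF l, of "e/2"] by (auto simp: eventually_sequentially)
    show "\<exists>M. \<forall>m\<ge>M. \<forall>n\<ge>M. dist (simple_int E (s m) x) (simple_int E (s n) x) < e"
    proof (intro exI allI impI)
      fix m n assume "m \<ge> N" "n \<ge> N"
      have "l2n (\<nu> x) (\<lambda>t. s m t - s n t) \<le> l2n (\<nu> x) (\<lambda>t. s m t - \<phi> t) + l2n (\<nu> x) (\<lambda>t. s n t - \<phi> t)"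
        using l2n_triangle_diff[OF simple_sqi[OF s] p simple_sqi[OF s], of m n] by (subst (3) l2n_diff_commute)
      also have "\<dots> < e" using N[OF \<open>m \<ge> N\<close>] N[OF \<open>n \<ge> N\<close>] by simp
      finally show "dist (simple_int E (s m) x) (simple_int E (s n) x) < e" by (simp add: dist_norm nd)
    qed
  qed
  then obtain y where "(\<lambda>n. simple_int E (s n) x) \<longlonglongrightarrow> y"
    using Cauchy_convergent_iff convergent_def by blast
  moreover have "(\<lambda>n. l2n (\<nu> x) (\<lambda>t. \<phi> t - s n t)) \<longlonglongrightarrow> 0" using l by (simp add: l2n_diff_commute)
  ultimately show ?thesis unfolding spec_int_iff using assms s by blast
qed

lemma spec_int_approx_tendsto:
  assumes y: "spec_int E \<phi> x y" and s: "\<And>n. simple_function borel (s n)"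
    and l: "(\<lambda>n. l2n (\<nu> x) (\<lambda>t. \<phi> t - s n t)) \<longlonglongrightarrow> 0"
  shows "(\<lambda>n. simple_int E (s n) x) \<longlonglongrightarrow> y"
proof -
  have nd: "norm (y - simple_int E (s n) x) = l2n (\<nu> x) (\<lambda>t. \<phi> t - s n t)" for n
    by (intro spec_int_norm spec_int_diff y spec_int_simple s)
  have "(\<lambda>n. y - simple_int E (s n) x) \<longlonglongrightarrow> 0"
    by (rule tendsto_norm_zero_cancel) (unfold nd, rule l)
  from tendsto_diff[OF tendsto_const[of y] this] show ?thesis by simp
qed

lemma simple_int_diff_right:
  assumes s: "simple_function borel s"
  shows "simple_int E s (x - y) = simple_int E s x - simple_int E s y"
  unfolding simple_int_def sum_subtractf[symmetric] scaleR_diff_right[symmetric]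
  by (intro sum.cong refl arg_cong[where f="scaleR _"] linear_diff bounded_linear.linear E_bl simple_vimage[OF s])

lemma spec_int_diff_right:
  assumes "spec_int E \<phi> x y" "spec_int E \<phi> x' y'" "spec_int E \<phi> (x - x') z"
  shows "z = y - y'"
proof -
  obtain s where s: "\<And>n. simple_function borel (s n)"
    and l: "\<And>x. sqi (\<nu> x) \<phi> \<Longrightarrow> (\<lambda>n. l2n (\<nu> x) (\<lambda>t. \<phi> t - s n t)) \<longlonglongrightarrow> 0"
    using spec_int_approx[OF spec_int_bm[OF assms(1)]] by blast
  have "(\<lambda>n. simple_int E (s n) x - simple_int E (s n) x') \<longlonglongrightarrow> y - y'"
    by (intro tendsto_diff spec_int_approx_tendsto[OF assms(1) s] spec_int_approx_tendsto[OF assms(2) s] l spec_int_sqi[OF assms(1)] spec_int_sqi[OF assms(2)])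
  moreover have "(\<lambda>n. simple_int E (s n) (x - x')) \<longlonglongrightarrow> z"
    by (intro spec_int_approx_tendsto[OF assms(3) s] l spec_int_sqi[OF assms(3)])
  ultimately show ?thesis unfolding simple_int_diff_right[OF s] by (rule LIMSEQ_unique[rotated])
qed

text \<open>The integral of \<open>\<psi>\<close> exists by square integrability, and it differs
  from that of \<open>\<phi>\<close> by a vector of norm 0.\<close>

lemma spec_int_cong_AE:
  assumes y: "spec_int E \<phi> x y" and [measurable]: "\<psi> \<in> borel_measurable borel" and ae: "AE t in \<nu> x. \<phi> t = \<psi> t"
  shows "spec_int E \<psi> x y"
proof -
  note [measurable] = spec_int_bm[OF y]
  have "integrable (\<nu> x) (\<lambda>t. (\<psi> t)\<^sup>2)"
    using spec_int_sqi[OF y] unfolding sqi_def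
    by (elim conjE integrable_cong_AE_imp) (use ae in \<open>auto elim!: eventually_mono\<close>)
  then have "sqi (\<nu> x) \<psi>" by (simp add: sqi_def)
  then obtain z where z: "spec_int E \<psi> x z" using spec_int_exists assms by blast
  have "(\<integral>t. (\<phi> t - \<psi> t)\<^sup>2 \<partial>\<nu> x) = 0"
    by (rule integral_eq_zero_AE) (use ae in \<open>auto elim!: eventually_mono\<close>)
  then have "y = z" using spec_int_norm[OF spec_int_diff[OF y z]] by (simp add: l2n_def)
  then show ?thesis using z by simp
qed

lemma spec_int_one: "spec_int E (\<lambda>_. 1) x x"
  using spec_int_simple[of "\<lambda>_. 1" x] by (simp add: simple_int_def)

lemma spec_int_E:
  assumes "spec_int E \<phi> x y" and B: "B \<in> sets borel"
  shows "spec_int E (\<lambda>t. indicator B t * \<phi> t) x (E B y)"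
proof -
  obtain s where p: "\<phi> \<in> borel_measurable borel" "sqi (\<nu> x) \<phi>" and s: "\<And>n. simple_function borel (s n)"
    and sl: "(\<lambda>n. l2n (\<nu> x) (\<lambda>t. \<phi> t - s n t)) \<longlonglongrightarrow> 0" and y: "(\<lambda>n. simple_int E (s n) x) \<longlonglongrightarrow> y"
    using assms(1) unfolding spec_int_iff by blast
  note [measurable] = p(1) B
  have sqB: "sqi (\<nu> x) (\<lambda>t. indicator B t * f t)" if "sqi (\<nu> x) f" for f
  proof -
    have [measurable]: "f \<in> borel_measurable (\<nu> x)" using that by (simp add: sqi_def)
    have "integrable (\<nu> x) (\<lambda>t. (indicator B t * f t)\<^sup>2)"
      by (rule Bochner_Integration.integrable_bound[of _ "\<lambda>t. (f t)\<^sup>2"]) (use that in \<open>auto simp: sqi_def indicator_def\<close>)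
    then show ?thesis by (simp add: sqi_def)
  qed
  have u: "simple_function borel (\<lambda>t. indicator B t * s n t)" for n
    by (intro simple_function_mult simple_function_indicator s) auto
  have le: "l2n (\<nu> x) (\<lambda>t. indicator B t * \<phi> t - indicator B t * s n t) \<le> l2n (\<nu> x) (\<lambda>t. \<phi> t - s n t)" for n
    unfolding l2n_def right_diff_distrib[symmetric]
    using sqB[OF sqi_diff[OF p(2) simple_sqi[OF s]]] sqi_diff[OF p(2) simple_sqi[OF s]]
    by (intro real_sqrt_le_mono integral_mono) (auto simp: sqi_def indicator_def)
  have "(\<lambda>n. l2n (\<nu> x) (\<lambda>t. indicator B t * \<phi> t - indicator B t * s n t)) \<longlonglongrightarrow> 0"
    by (rule l2n_tendsto_0_le[OF le sl])
  moreover have "(\<lambda>n. simple_int E (\<lambda>t. indicator B t * s n t) x) \<longlonglongrightarrow> E B y"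
    unfolding simple_int_E[OF s B, symmetric] by (rule bounded_linear.tendsto[OF E_bl[OF B] y])
  moreover have "(\<lambda>t. indicator B t * \<phi> t) \<in> borel_measurable borel" by measurable
  ultimately show ?thesis unfolding spec_int_iff
    by (intro conjI exI[of _ "\<lambda>n t. indicator B t * s n t"] allI u sqB[OF p(2)])
qed

text \<open>On a Borel set \<open>B\<close> both sides are the squared norm of \<open>E B y\<close>,
  the spectral integral of \<open>\<phi>\<close> times the indicator of \<open>B\<close>.\<close>

lemma spec_measure_density:
  assumes y: "spec_int E \<phi> x y" shows "\<nu> y = density (\<nu> x) (\<lambda>t. ennreal ((\<phi> t)\<^sup>2))"
proof (rule measure_eqI)
  note [measurable] = spec_int_bm[OF y]
  fix B assume "B \<in> sets (\<nu> y)"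
  then have B[measurable]: "B \<in> sets borel" by simp
  have "emeasure (\<nu> y) B = ennreal ((l2n (\<nu> x) (\<lambda>t. indicator B t * \<phi> t))\<^sup>2)"
    using spec_int_norm[OF spec_int_E[OF y B]] by (simp add: emeasure_\<nu>)
  also have "\<dots> = (\<integral>\<^sup>+t. ennreal (\<bar>indicator B t * \<phi> t\<bar>\<^sup>2) \<partial>\<nu> x)"
    using spec_int_sqi[OF spec_int_E[OF y B]] by (rule nn_integral_sq_eq_l2n[symmetric])
  also have "\<dots> = (\<integral>\<^sup>+t. ennreal ((\<phi> t)\<^sup>2) * indicator B t \<partial>\<nu> x)"
    by (intro nn_integral_cong) (auto simp: indicator_def)
  also have "\<dots> = emeasure (density (\<nu> x) (\<lambda>t. ennreal ((\<phi> t)\<^sup>2))) B"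
    by (rule emeasure_density[symmetric]) auto
  finally show "emeasure (\<nu> y) B = emeasure (density (\<nu> x) (\<lambda>t. ennreal ((\<phi> t)\<^sup>2))) B" .
qed simp

lemma sqi_density:
  assumes y: "spec_int E \<phi> x y" and [measurable]: "\<psi> \<in> borel_measurable borel"
  shows "sqi (\<nu> y) \<psi> \<longleftrightarrow> sqi (\<nu> x) (\<lambda>t. \<psi> t * \<phi> t)" "l2n (\<nu> y) \<psi> = l2n (\<nu> x) (\<lambda>t. \<psi> t * \<phi> t)"
proof -
  note [measurable] = spec_int_bm[OF y]
  show "sqi (\<nu> y) \<psi> \<longleftrightarrow> sqi (\<nu> x) (\<lambda>t. \<psi> t * \<phi> t)"
    unfolding spec_measure_density[OF y] sqi_def
    by (subst integrable_density) (auto simp: power_mult_distrib mult.commute)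
  show "l2n (\<nu> y) \<psi> = l2n (\<nu> x) (\<lambda>t. \<psi> t * \<phi> t)"
    unfolding spec_measure_density[OF y] l2n_def
    by (subst integral_density) (auto simp: power_mult_distrib mult.commute)
qed

text \<open>The density formula carries simple approximations of \<open>\<psi>\<close> in
  \<open>L^2(\<nu> y)\<close> to approximations of the product in \<open>L^2(\<nu> x)\<close>, and
  it also shows that \<open>x\<close> lies in the domain of the product.\<close>

lemma spec_int_compose:
  assumes y: "spec_int E \<phi> x y" and z: "spec_int E \<psi> y z"
  shows "spec_int E (\<lambda>t. \<psi> t * \<phi> t) x z"
proof -
  obtain s where p: "\<psi> \<in> borel_measurable borel" "sqi (\<nu> y) \<psi>" and s: "\<And>n. simple_function borel (s n)"
    and sl: "(\<lambda>n. l2n (\<nu> y) (\<lambda>t. \<psi> t - s n t)) \<longlonglongrightarrow> 0" and zl: "(\<lambda>n. simple_int E (s n) y) \<longlonglongrightarrow> z"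
    using z unfolding spec_int_iff by blast
  note [measurable] = spec_int_bm[OF y] p(1)
  have [measurable]: "s n \<in> borel_measurable borel" for n by (rule borel_measurable_simple_function[OF s])
  have sum: "spec_int E (\<lambda>t. \<Sum>i\<in>I. f i t) x (\<Sum>i\<in>I. h i)"
    if "finite I" "\<And>i. i \<in> I \<Longrightarrow> spec_int E (f i) x (h i)" for I :: "real set" and f h
    using that
  proof (induction I)
    case empty
    then show ?case using spec_int_linear[OF spec_int_one spec_int_one, of 0 0] by simp
  next
    case (insert i I)
    then show ?case using spec_int_linear[of "f i" x "h i" "\<lambda>t. \<Sum>i\<in>I. f i t" "\<Sum>i\<in>I. h i" 1 1] by simp
  qed
  have s\<phi>: "spec_int E (\<lambda>t. s n t * \<phi> t) x (simple_int E (s n) y)" for n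
  proof -
    \<comment> \<open>The terms with coefficient 0 only give each summand the shape required by
      \<open>spec_int_linear\<close>.\<close>
    have f: "(\<lambda>t. s n t * \<phi> t) = (\<lambda>t. \<Sum>c\<in>range (s n). c * (indicator (s n -` {c}) t * \<phi> t) + 0 * (indicator (s n -` {c}) t * \<phi> t))"
    proof
      fix t
      have "(\<Sum>c\<in>range (s n). c * (indicator (s n -` {c}) t * \<phi> t)) = (\<Sum>c\<in>{s n t}. c * \<phi> t)"
        using simple_range[OF s] by (intro sum.mono_neutral_cong_right) (auto simp: indicator_def)
      then show "s n t * \<phi> t = (\<Sum>c\<in>range (s n). c * (indicator (s n -` {c}) t * \<phi> t) + 0 * (indicator (s n -` {c}) t * \<phi> t))" by simp
    qed
    have h: "simple_int E (s n) y = (\<Sum>c\<in>range (s n). c *\<^sub>R E (s n -` {c}) y + 0 *\<^sub>R E (s n -` {c}) y)"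
      by (simp add: simple_int_def)
    show ?thesis unfolding f h
      by (rule sum[OF simple_range[OF s] spec_int_linear[OF spec_int_E[OF y simple_vimage[OF s]] spec_int_E[OF y simple_vimage[OF s]]]])
  qed
  have "sqi (\<nu> x) (\<lambda>t. \<psi> t * \<phi> t)" using p sqi_density[OF y] by blast
  then obtain w where w: "spec_int E (\<lambda>t. \<psi> t * \<phi> t) x w"
    using spec_int_exists[of "\<lambda>t. \<psi> t * \<phi> t" x] by auto
  have nd: "norm (w - simple_int E (s n) y) = l2n (\<nu> y) (\<lambda>t. \<psi> t - s n t)" for n
    using spec_int_norm[OF spec_int_diff[OF w s\<phi>]] sqi_density(2)[OF y, of "\<lambda>t. \<psi> t - s n t"]
    by (simp add: left_diff_distrib)
  have "(\<lambda>n. w - simple_int E (s n) y) \<longlonglongrightarrow> 0"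
    by (rule tendsto_norm_zero_cancel) (unfold nd, rule sl)
  from tendsto_diff[OF tendsto_const[of w] this] have "(\<lambda>n. simple_int E (s n) y) \<longlonglongrightarrow> w" by simp
  then have "w = z" using zl LIMSEQ_unique by blast
  then show ?thesis using w by simp
qed

end

subsection \<open>Square roots through a spectral resolution\<close>

text \<open>The kernel conditions at both ends of the spectrum force every spectral measure onto the
  open interval from 0 to \<open>c\<close>.\<close>

locale resolution = projection_measure E
  for E :: "real set \<Rightarrow> 'h \<Rightarrow> 'h::{real_inner, complete_space}" +
  fixes T :: "'h \<Rightarrow> 'h" and c :: real
  assumes lin: "linear T" and res: "spec_int E (\<lambda>t. t) x (T x)"
    and pos: "0 \<le> inner (T x) x" and le: "inner (T x) x \<le> c * inner x x"
    and ker: "T x = 0 \<Longrightarrow> x = 0" and ker_c: "T x = c *\<^sub>R x \<Longrightarrow> x = 0"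
begin

text \<open>Polarization: \<open>4 <T x, x> = |T x + x|^2 - |T x - x|^2\<close>, and these squared
  norms are the integrals of \<open>(t + 1)^2\<close> and \<open>(t - 1)^2\<close>.\<close>

lemma inner_T: "integrable (\<nu> x) (\<lambda>t. t)" "inner (T x) x = (\<integral>t. t \<partial>\<nu> x)"
proof -
  interpret finite_measure "\<nu> x" by (rule finite_\<nu>)
  note q = spec_int_sqi[OF res[of x]] and o = spec_int_sqi[OF spec_int_one[of x]]
  show i: "integrable (\<nu> x) (\<lambda>t. t)" using sqi_mult[OF q o] by simp
  have i2: "integrable (\<nu> x) (\<lambda>t. t\<^sup>2)" using q by (simp add: sqi_def)
  have p: "(norm (T x + x))\<^sup>2 = (\<integral>t. (t + 1)\<^sup>2 \<partial>\<nu> x)"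
    using spec_int_norm[OF spec_int_linear[OF res[of x] spec_int_one, of 1 1]] by (simp add: l2n_sq)
  have m: "(norm (T x - x))\<^sup>2 = (\<integral>t. (t - 1)\<^sup>2 \<partial>\<nu> x)"
    using spec_int_norm[OF spec_int_diff[OF res[of x] spec_int_one]] by (simp add: l2n_sq)
  have "4 * inner (T x) x = (norm (T x + x))\<^sup>2 - (norm (T x - x))\<^sup>2"
    by (simp add: power2_norm_eq_inner inner_add inner_diff inner_commute)
  also have "\<dots> = (\<integral>t. (t + 1)\<^sup>2 - (t - 1)\<^sup>2 \<partial>\<nu> x)"
    unfolding p m using i i2 by (subst Bochner_Integration.integral_diff) (auto simp: power2_sum power2_diff)
  also have "\<dots> = (\<integral>t. 4 * t \<partial>\<nu> x)"
    by (intro Bochner_Integration.integral_cong) (auto simp: power2_eq_square algebra_simps)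
  finally show "inner (T x) x = (\<integral>t. t \<partial>\<nu> x)" by simp
qed

lemma AE_concentrated:
  assumes "A \<in> sets borel" shows "AE t in \<nu> (E A x). t \<in> A"
proof (rule AE_I'[of "- A"])
  show "- A \<in> null_sets (\<nu> (E A x))"
    using assms by (auto simp: null_sets_def emeasure_\<nu> E_Int Int_commute)
qed auto

lemma eq_0_of_AE_False: assumes "AE t in \<nu> x. False" shows "x = 0"
proof -
  have "emeasure (\<nu> x) (space (\<nu> x)) = 0" using assms by (simp add: AE_iff_null null_sets_def)
  then show ?thesis by (simp add: emeasure_\<nu>)
qed

lemma AE_of_E_zero:
  assumes "A \<in> sets borel" "E A x = 0" shows "AE t in \<nu> x. t \<notin> A"
  by (rule AE_I'[of A]) (use assms in \<open>auto simp: null_sets_def emeasure_\<nu>\<close>)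

text \<open>For \<open>y = E A x\<close> the measure \<open>\<nu> y\<close> sits on
  \<open>A\<close>, where the affine function is negative, while its integral is the nonnegative
  form at \<open>y\<close>; hence the measure is null. It is applied to \<open>t\<close> and to
  \<open>c - t\<close>.\<close>

lemma E_zero_of_sign:
  assumes A: "A \<in> sets borel" and neg: "\<And>t. t \<in> A \<Longrightarrow> a * t + b < 0"
    and nonneg: "\<And>x. 0 \<le> a * inner (T x) x + b * inner x x"
  shows "E A x = 0"
proof -
  define y where "y = E A x"
  interpret finite_measure "\<nu> y" by (rule finite_\<nu>)
  note i = inner_T(1)[of y]
  have "inner y y = (\<integral>t. 1 \<partial>\<nu> y)" by (simp add: measure_\<nu> power2_norm_eq_inner)
  then have "0 \<le> a * (\<integral>t. t \<partial>\<nu> y) + b * (\<integral>t. 1 \<partial>\<nu> y)" using nonneg[of y] by (simp add: inner_T(2))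
  moreover have "(\<integral>t. - (a * t + b) \<partial>\<nu> y) = - (a * (\<integral>t. t \<partial>\<nu> y) + b * (\<integral>t. 1 \<partial>\<nu> y))"
    using i by (simp add: mult.commute)
  ultimately have le0: "(\<integral>t. - (a * t + b) \<partial>\<nu> y) \<le> 0" by linarith
  have ae: "AE t in \<nu> y. a * t + b < 0"
    using AE_concentrated[OF A, of x] unfolding y_def by eventually_elim (rule neg)
  then have ae0: "AE t in \<nu> y. 0 \<le> - (a * t + b)" by eventually_elim simp
  from le0 integral_nonneg_AE[OF ae0] have "(\<integral>t. - (a * t + b) \<partial>\<nu> y) = 0" by linarith
  moreover have "integrable (\<nu> y) (\<lambda>t. - (a * t + b))" using i by auto
  ultimately have "AE t in \<nu> y. - (a * t + b) = 0"
    using integral_nonneg_eq_0_iff_AE[OF _ ae0] by blast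
  with ae have "AE t in \<nu> y. False" by eventually_elim auto
  then show ?thesis unfolding y_def[symmetric] by (rule eq_0_of_AE_False)
qed

text \<open>The squared norm of \<open>T y - a y\<close> is the integral of \<open>(t - a)^2\<close>
  against a measure concentrated at \<open>a\<close>.\<close>

lemma E_point: "T (E {a} x) = a *\<^sub>R E {a} x"
proof -
  define y where "y = E {a} x"
  have "spec_int E (\<lambda>t. t - a) y (T y - a *\<^sub>R y)"
    using spec_int_linear[OF res[of y] spec_int_one, of 1 "-a"] by simp
  then have "(norm (T y - a *\<^sub>R y))\<^sup>2 = (\<integral>t. (t - a)\<^sup>2 \<partial>\<nu> y)" by (simp add: spec_int_norm l2n_sq)
  also have "\<dots> = 0"
    by (rule integral_eq_zero_AE) (use AE_concentrated[of "{a}" x, folded y_def] in \<open>auto elim!: eventually_mono\<close>)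
  finally show ?thesis by (simp add: y_def)
qed

text \<open>Both endpoints matter: at 0 the function \<open>t powr (-1/2)\<close> does not invert
  the square root, and for \<open>c = 2\<close> the partial sums of the binomial series are
  controlled on the open interval from 0 to 2.\<close>

lemma AE_spectrum: "AE t in \<nu> x. 0 < t \<and> t < c"
proof -
  have "E {..<0} x = 0" by (rule E_zero_of_sign[of _ 1 0]) (use pos in auto)
  from AE_of_E_zero[OF _ this] have 1: "AE t in \<nu> x. t \<notin> {..<0}" by simp
  have "E {c<..} x = 0" by (rule E_zero_of_sign[of _ "-1" c]) (use le in auto)
  from AE_of_E_zero[OF _ this] have 2: "AE t in \<nu> x. t \<notin> {c<..}" by simp
  have "E {0} x = 0" by (rule ker) (simp add: E_point)
  from AE_of_E_zero[OF _ this] have 3: "AE t in \<nu> x. t \<notin> {0}" by simp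
  have "E {c} x = 0" by (rule ker_c) (rule E_point)
  from AE_of_E_zero[OF _ this] have 4: "AE t in \<nu> x. t \<notin> {c}" by simp
  from 1 2 3 4 show ?thesis by eventually_elim auto
qed

lemma sqi_spectrum:
  assumes "\<phi> \<in> borel_measurable borel" "\<And>t. 0 < t \<Longrightarrow> t < c \<Longrightarrow> \<bar>\<phi> t\<bar> \<le> B" shows "sqi (\<nu> x) \<phi>"
proof -
  interpret finite_measure "\<nu> x" by (rule finite_\<nu>)
  have "AE t in \<nu> x. \<bar>\<phi> t\<bar> \<le> B" using AE_spectrum by eventually_elim (use assms(2) in auto)
  then show ?thesis using assms(1) by (intro sqi_bounded) auto
qed

lemma sqrt_exists: "\<exists>y. spec_int E (\<lambda>t. t powr (1/2)) x y"
  by (intro spec_int_exists sqi_spectrum[where B="c powr (1/2)"]) (auto intro: powr_mono2)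

text \<open>By \<open>sqi_density\<close>, \<open>y\<close> belongs to the domain of
  \<open>t powr (-1/2)\<close> because the product of the two powers is 1 almost everywhere; the
  value follows from \<open>spec_int_compose\<close>.\<close>

lemma sqrt_inverse:
  assumes y: "spec_int E (\<lambda>t. t powr (1/2)) x y" shows "spec_int E (\<lambda>t. t powr (-1/2)) y x"
proof -
  have ae: "AE t in \<nu> x. t powr (-1/2) * t powr (1/2) = 1"
    using AE_spectrum by eventually_elim (simp add: powr_add[symmetric])
  have "spec_int E (\<lambda>t. t powr (-1/2) * t powr (1/2)) x x"
    by (rule spec_int_cong_AE[OF spec_int_one]) (use ae in \<open>auto elim!: eventually_mono\<close>)
  then have "sqi (\<nu> y) (\<lambda>t. t powr (-1/2))"
    using sqi_density(1)[OF y, of "\<lambda>t. t powr (-1/2)"] spec_int_sqi by auto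
  then obtain z where z: "spec_int E (\<lambda>t. t powr (-1/2)) y z"
    using spec_int_exists[of "\<lambda>t. t powr (-1/2)" y] by auto
  have "z = x"
    using spec_int_unique[OF spec_int_compose[OF y z] \<open>spec_int E (\<lambda>t. t powr (-1/2) * t powr (1/2)) x x\<close>] .
  then show ?thesis using z by simp
qed

lemma sqrt_norm:
  assumes y: "spec_int E (\<lambda>t. t powr (1/2)) x y" shows "(norm y)\<^sup>2 = inner (T x) x"
proof -
  have "(norm y)\<^sup>2 = (\<integral>t. (t powr (1/2))\<^sup>2 \<partial>\<nu> x)" by (simp add: spec_int_norm[OF y] l2n_sq)
  also have "\<dots> = (\<integral>t. t \<partial>\<nu> x)"
  proof (rule integral_cong_AE)
    show "AE t in \<nu> x. (t powr (1/2))\<^sup>2 = t"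
      using AE_spectrum by eventually_elim (simp add: powr_half_sqrt)
  qed auto
  finally show ?thesis by (simp add: inner_T)
qed

lemma spec_int_poly: "spec_int E (poly p) x (poly_op T p x)"
proof (induction p)
  case 0
  have "poly 0 = (\<lambda>t. 0 * 1 + 0 * (1::real))" by auto
  then show ?case using spec_int_linear[OF spec_int_one[of x] spec_int_one[of x], of 0 0] by simp
next
  case (pCons a p)
  have "spec_int E (\<lambda>t. a * 1 + 1 * (t * poly p t)) x (a *\<^sub>R x + 1 *\<^sub>R T (poly_op T p x))"
    by (intro spec_int_linear spec_int_one spec_int_compose[OF pCons(2) res])
  moreover have "poly (pCons a p) = (\<lambda>t. a * 1 + 1 * (t * poly p t))" by auto
  ultimately show ?case by (simp add: poly_op_pCons[OF lin])
qed

lemma sqrt_poly: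
  assumes y: "spec_int E (\<lambda>t. t powr (1/2)) (poly_op T p x) y"
  shows "spec_int E (\<lambda>t. t powr (1/2) * poly p t) x y"
  by (rule spec_int_compose[OF spec_int_poly y])

lemma sqrt_poly_bounded:
  assumes y: "spec_int E (\<lambda>t. t powr (1/2)) (poly_op T p x) y"
    and B: "\<And>t. 0 < t \<Longrightarrow> t < c \<Longrightarrow> \<bar>t powr (1/2) * poly p t\<bar> \<le> B" and "0 \<le> B"
  shows "norm y \<le> B * norm x"
proof -
  interpret finite_measure "\<nu> x" by (rule finite_\<nu>)
  note w = sqrt_poly[OF y]
  have "(norm y)\<^sup>2 = (\<integral>t. (t powr (1/2) * poly p t)\<^sup>2 \<partial>\<nu> x)" by (simp add: spec_int_norm[OF w] l2n_sq)
  also have "\<dots> \<le> (\<integral>t. B\<^sup>2 \<partial>\<nu> x)"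
  proof (rule integral_mono_AE)
    show "AE t in \<nu> x. (t powr (1/2) * poly p t)\<^sup>2 \<le> B\<^sup>2"
      using AE_spectrum by eventually_elim (use B \<open>0 \<le> B\<close> in \<open>simp flip: abs_le_square_iff\<close>)
  qed (use spec_int_sqi[OF w] in \<open>auto simp: sqi_def\<close>)
  also have "\<dots> = (B * norm x)\<^sup>2" by (simp add: measure_\<nu> power_mult_distrib)
  finally show ?thesis using \<open>0 \<le> B\<close> by (simp add: power2_le_iff_abs_le)
qed

text \<open>Dominated convergence in \<open>L^2(\<nu> x)\<close>; the uniform bound supplies the
  majorant \<open>(B + 1)^2\<close> for the squared differences.\<close>

lemma sqrt_poly_tendsto:
  assumes y: "\<And>n. spec_int E (\<lambda>t. t powr (1/2)) (poly_op T (p n) x) (y n)"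
    and B: "\<And>n t. 0 < t \<Longrightarrow> t < c \<Longrightarrow> \<bar>t powr (1/2) * poly (p n) t\<bar> \<le> B" and "0 \<le> B"
    and lim: "\<And>t. 0 < t \<Longrightarrow> t < c \<Longrightarrow> (\<lambda>n. t powr (1/2) * poly (p n) t) \<longlonglongrightarrow> 1"
  shows "y \<longlonglongrightarrow> x"
proof -
  interpret finite_measure "\<nu> x" by (rule finite_\<nu>)
  have eq: "norm (y n - x) = l2n (\<nu> x) (\<lambda>t. t powr (1/2) * poly (p n) t - 1)" for n
    by (intro spec_int_norm spec_int_diff sqrt_poly y spec_int_one)
  have l: "(\<lambda>n. l2n (\<nu> x) (\<lambda>t. t powr (1/2) * poly (p n) t - 1)) \<longlonglongrightarrow> 0"
  proof (rule l2n_dominated[where w="\<lambda>_. (B + 1)\<^sup>2"])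
    show "AE t in \<nu> x. (\<lambda>n. t powr (1/2) * poly (p n) t) \<longlonglongrightarrow> 1"
      using AE_spectrum by eventually_elim (use lim in auto)
    show "AE t in \<nu> x. (t powr (1/2) * poly (p n) t - 1)\<^sup>2 \<le> (B + 1)\<^sup>2" for n
      using AE_spectrum
    proof eventually_elim
      case (elim t)
      then have "\<bar>t powr (1/2) * poly (p n) t - 1\<bar> \<le> \<bar>B + 1\<bar>" using B[of t n] \<open>0 \<le> B\<close> by linarith
      then show ?case by (simp only: abs_le_square_iff)
    qed
  qed auto
  have "(\<lambda>n. y n - x) \<longlonglongrightarrow> 0" by (rule tendsto_norm_zero_cancel) (unfold eq, rule l)
  then show ?thesis by (rule LIM_zero_cancel)
qed

end

section \<open>The Hilbert space of square summable functions\<close>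

text \<open>\<open>Lp m 2\<close> is a set of functions, whereas the spectral theorem speaks of a
  type. This type provides the Hilbert space, the weight being absorbed into a factor
  \<open>sqrt (m x)\<close>. Its values are complex, but it is made a real vector space with the
  real part of the usual inner product.\<close>

typedef 'a ell2 = "{f :: 'a \<Rightarrow> complex. (\<lambda>x. (cmod (f x))\<^sup>2) summable_on UNIV}"
  morphisms ell2_fun Ell2 by (rule exI[of _ "\<lambda>_. 0"]) simp

lemma ell2_sq_summable: "(\<lambda>x. (cmod (ell2_fun f x))\<^sup>2) summable_on UNIV"
  using ell2_fun[of f] by simp

lemma ell2_eqI: "(\<And>x. ell2_fun f x = ell2_fun g x) \<Longrightarrow> f = g"
  by (metis ell2_fun_inject ext)

lemma sq_summable_add:
  fixes f g :: "'a \<Rightarrow> complex"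
  assumes "(\<lambda>x. (cmod (f x))\<^sup>2) summable_on A" "(\<lambda>x. (cmod (g x))\<^sup>2) summable_on A"
  shows "(\<lambda>x. (cmod (f x + g x))\<^sup>2) summable_on A"
proof (rule summable_on_comparison_test)
  show "(\<lambda>x. 2 * (cmod (f x))\<^sup>2 + 2 * (cmod (g x))\<^sup>2) summable_on A"
    by (intro summable_on_add summable_on_cmult_right assms)
  fix x
  have "(cmod (f x + g x))\<^sup>2 \<le> (cmod (f x) + cmod (g x))\<^sup>2" by (intro power_mono norm_triangle_ineq) auto
  also have "\<dots> \<le> 2 * (cmod (f x))\<^sup>2 + 2 * (cmod (g x))\<^sup>2"
    using sum_squares_bound[of "cmod (f x)" "cmod (g x)"] by (simp add: power2_sum)
  finally show "(cmod (f x + g x))\<^sup>2 \<le> 2 * (cmod (f x))\<^sup>2 + 2 * (cmod (g x))\<^sup>2" .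
qed auto

lemma sq_summable_scale:
  fixes f :: "'a \<Rightarrow> complex"
  assumes "(\<lambda>x. (cmod (f x))\<^sup>2) summable_on A" shows "(\<lambda>x. (cmod (c * f x))\<^sup>2) summable_on A"
  using summable_on_cmult_right[OF assms, of "(cmod c)\<^sup>2"] by (simp add: norm_mult power_mult_distrib)

lemma sq_summable_inner:
  fixes f g :: "'a \<Rightarrow> complex"
  assumes "(\<lambda>x. (cmod (f x))\<^sup>2) summable_on A" "(\<lambda>x. (cmod (g x))\<^sup>2) summable_on A"
  shows "(\<lambda>x. f x * cnj (g x)) summable_on A"
proof -
  have "(\<lambda>x. cmod (f x * cnj (g x))) summable_on A"
  proof (rule summable_on_comparison_test)
    show "(\<lambda>x. (cmod (f x))\<^sup>2 + (cmod (g x))\<^sup>2) summable_on A"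
      by (intro summable_on_add assms)
    show "cmod (f x * cnj (g x)) \<le> (cmod (f x))\<^sup>2 + (cmod (g x))\<^sup>2" for x
      using sum_squares_bound[of "cmod (f x)" "cmod (g x)"] mult_nonneg_nonneg[OF norm_ge_zero[of "f x"] norm_ge_zero[of "g x"]]
      unfolding norm_mult complex_mod_cnj by linarith
  qed auto
  then show ?thesis by (rule abs_summable_summable)
qed

lemma inner_complex_cnj: "inner z w = Re (z * cnj w)"
  by (simp add: inner_complex_def)

instantiation ell2 :: (type) real_vector
begin

definition "0 = Ell2 (\<lambda>_. 0)"
definition "f + g = Ell2 (\<lambda>x. ell2_fun f x + ell2_fun g x)"
definition "- f = Ell2 (\<lambda>x. - ell2_fun f x)"
definition "f - g = Ell2 (\<lambda>x. ell2_fun f x - ell2_fun g x)"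
definition "c *\<^sub>R f = Ell2 (\<lambda>x. c *\<^sub>R ell2_fun f x)"

lemma ell2_fun_simps:
  "ell2_fun 0 x = 0" "ell2_fun (f + g) x = ell2_fun f x + ell2_fun g x" "ell2_fun (- f) x = - ell2_fun f x"
  "ell2_fun (f - g) x = ell2_fun f x - ell2_fun g x" "ell2_fun (c *\<^sub>R f) x = c *\<^sub>R ell2_fun f x"
  using sq_summable_add[OF ell2_sq_summable[of f] ell2_sq_summable[of g]]
    sq_summable_add[OF ell2_sq_summable[of f] sq_summable_scale[OF ell2_sq_summable[of g], of "-1"]]
    ell2_sq_summable[of f] sq_summable_scale[OF ell2_sq_summable[of f], of "of_real c"]
  by (simp_all add: zero_ell2_def plus_ell2_def uminus_ell2_def minus_ell2_def scaleR_ell2_def Ell2_inverse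
      scaleR_conv_of_real)

instance
  by standard (auto intro!: ell2_eqI simp: ell2_fun_simps algebra_simps)

end

instantiation ell2 :: (type) real_inner
begin

definition "inner f g = (\<Sum>\<^sub>\<infinity>x. inner (ell2_fun f x) (ell2_fun g x))"
definition norm_ell2_def: "norm (f :: 'a ell2) = sqrt (inner f f)"
definition "sgn f = f /\<^sub>R norm (f :: 'a ell2)"
definition "dist f g = norm (f - g :: 'a ell2)"
definition [code del]: "(uniformity :: ('a ell2 \<times> 'a ell2) filter) = (INF e\<in>{0 <..}. principal {(x, y). dist x y < e})"
definition [code del]: "open (U :: 'a ell2 set) = (\<forall>x\<in>U. eventually (\<lambda>(x', y). x' = x \<longrightarrow> y \<in> U) uniformity)"

lemma ell2_inner_summable: "(\<lambda>x. inner (ell2_fun f x) (ell2_fun g x)) summable_on UNIV"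
  unfolding inner_complex_cnj by (intro summable_on_Re sq_summable_inner ell2_sq_summable)

instance
proof
  fix f g h :: "'a ell2" and a b :: real
  show "inner f g = inner g f" by (simp add: inner_ell2_def inner_commute)
  show "inner (f + g) h = inner f h + inner g h"
    by (simp add: inner_ell2_def ell2_fun_simps inner_add_left infsum_add ell2_inner_summable)
  show "inner (a *\<^sub>R f) g = a * inner f g"
    by (simp add: inner_ell2_def ell2_fun_simps infsum_cmult_right ell2_inner_summable)
  show "0 \<le> inner f f" by (simp add: inner_ell2_def infsum_nonneg)
  show "(inner f f = 0) = (f = 0)"
  proof
    assume "inner f f = 0"
    then have "inner (ell2_fun f x) (ell2_fun f x) = 0" for x
      using nonneg_infsum_le_0D[of "\<lambda>x. inner (ell2_fun f x) (ell2_fun f x)" UNIV x] ell2_inner_summable[of f f]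
      by (simp add: inner_ell2_def)
    then show "f = 0" by (auto intro!: ell2_eqI simp: ell2_fun_simps)
  qed (simp add: inner_ell2_def ell2_fun_simps)
qed (simp_all add: norm_ell2_def sgn_ell2_def dist_ell2_def uniformity_ell2_def open_ell2_def)

end

lemma norm_ell2_sq: "(norm f)\<^sup>2 = (\<Sum>\<^sub>\<infinity>x. (cmod (ell2_fun f x))\<^sup>2)" for f :: "'a ell2"
  unfolding power2_norm_eq_inner inner_ell2_def by (simp add: power2_norm_eq_inner)

lemma ell2_sum_le: "finite F \<Longrightarrow> (\<Sum>x\<in>F. (cmod (ell2_fun f x))\<^sup>2) \<le> (norm f)\<^sup>2" for f :: "'a ell2"
  unfolding norm_ell2_sq by (rule finite_sum_le_infsum) (auto intro: ell2_sq_summable)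

lemma ell2_norm_leI:
  assumes "\<And>F. finite F \<Longrightarrow> (\<Sum>x\<in>F. (cmod (ell2_fun f x))\<^sup>2) \<le> B\<^sup>2" "0 \<le> B" shows "norm (f :: 'a ell2) \<le> B"
proof -
  have "(norm f)\<^sup>2 \<le> B\<^sup>2" unfolding norm_ell2_sq
    by (rule infsum_le_finite_sums) (use assms ell2_sq_summable in auto)
  then show ?thesis using assms(2) power2_le_imp_le by blast
qed

lemma ell2_coord_le: "cmod (ell2_fun f x) \<le> norm (f :: 'a ell2)"
  using ell2_sum_le[of "{x}" f] power2_le_imp_le[of "cmod (ell2_fun f x)" "norm f"] by simp

text \<open>Coordinates converge; the Cauchy estimate on finite sets passes to the coordinatewise
  limit and shows both that it is square summable and that the convergence is in norm.\<close>

instance ell2 :: (type) complete_space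
proof
  fix X :: "nat \<Rightarrow> 'a ell2" assume X: "Cauchy X"
  have "Cauchy (\<lambda>n. ell2_fun (X n) x)" for x
  proof (rule metric_CauchyI)
    fix e :: real assume "e > 0"
    then obtain N where N: "\<And>m n. m \<ge> N \<Longrightarrow> n \<ge> N \<Longrightarrow> dist (X m) (X n) < e" using X by (meson metric_CauchyD)
    have "dist (ell2_fun (X m) x) (ell2_fun (X n) x) < e" if "m \<ge> N" "n \<ge> N" for m n
      using N[OF that] ell2_coord_le[of "X m - X n" x] by (simp add: dist_norm ell2_fun_simps)
    then show "\<exists>M. \<forall>m\<ge>M. \<forall>n\<ge>M. dist (ell2_fun (X m) x) (ell2_fun (X n) x) < e" by blast
  qed
  then have "\<exists>L. (\<lambda>n. ell2_fun (X n) x) \<longlonglongrightarrow> L" for x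
    using Cauchy_convergent_iff convergent_def by blast
  then obtain L where L: "\<And>x. (\<lambda>n. ell2_fun (X n) x) \<longlonglongrightarrow> L x" by metis
  have bound: "(\<Sum>x\<in>F. (cmod (ell2_fun (X m) x - L x))\<^sup>2) \<le> e\<^sup>2"
    if N: "\<And>m n. m \<ge> N \<Longrightarrow> n \<ge> N \<Longrightarrow> dist (X m) (X n) < e" and "m \<ge> N" "finite F" for F m N e
  proof (rule LIMSEQ_le_const2)
    show "(\<lambda>n. \<Sum>x\<in>F. (cmod (ell2_fun (X m) x - ell2_fun (X n) x))\<^sup>2) \<longlonglongrightarrow> (\<Sum>x\<in>F. (cmod (ell2_fun (X m) x - L x))\<^sup>2)"
      by (intro tendsto_intros L)
    have "(\<Sum>x\<in>F. (cmod (ell2_fun (X m) x - ell2_fun (X n) x))\<^sup>2) \<le> e\<^sup>2" if "n \<ge> N" for n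
    proof -
      have "(\<Sum>x\<in>F. (cmod (ell2_fun (X m) x - ell2_fun (X n) x))\<^sup>2) \<le> (norm (X m - X n))\<^sup>2"
        using ell2_sum_le[OF \<open>finite F\<close>, of "X m - X n"] by (simp add: ell2_fun_simps)
      also have "\<dots> \<le> e\<^sup>2" using N[OF \<open>m \<ge> N\<close> that] by (intro power_mono) (auto simp: dist_norm)
      finally show ?thesis .
    qed
    then show "\<exists>N. \<forall>n\<ge>N. (\<Sum>x\<in>F. (cmod (ell2_fun (X m) x - ell2_fun (X n) x))\<^sup>2) \<le> e\<^sup>2" by blast
  qed
  obtain N1 where N1: "\<And>m n. m \<ge> N1 \<Longrightarrow> n \<ge> N1 \<Longrightarrow> dist (X m) (X n) < 1" using X metric_CauchyD[OF X, of 1] by auto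
  have "(\<lambda>x. (cmod (ell2_fun (X N1) x - L x))\<^sup>2) summable_on UNIV"
    by (rule nonneg_bdd_above_summable_on) (use bound[OF N1 order_refl] in \<open>auto intro!: bdd_aboveI\<close>)
  from sq_summable_add[OF ell2_sq_summable[of "X N1"] sq_summable_scale[OF this, of "-1"]]
  have "(\<lambda>x. (cmod (L x))\<^sup>2) summable_on UNIV" by simp
  then have Ls: "ell2_fun (Ell2 L) = L" by (simp add: Ell2_inverse)
  have "X \<longlonglongrightarrow> Ell2 L"
  proof (rule metric_LIMSEQ_I)
    fix e :: real assume e: "e > 0"
    then obtain N where N: "\<And>m n. m \<ge> N \<Longrightarrow> n \<ge> N \<Longrightarrow> dist (X m) (X n) < e / 2" 
      using metric_CauchyD[OF X, of "e/2"] by auto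
    have "norm (X m - Ell2 L) \<le> e / 2" if "m \<ge> N" for m
      by (rule ell2_norm_leI) (use bound[OF N that] e in \<open>auto simp: ell2_fun_simps Ls\<close>)
    then show "\<exists>no. \<forall>n\<ge>no. dist (X n) (Ell2 L) < e" using e by (force simp: dist_norm)
  qed
  then show "convergent X" by (auto simp: convergent_def)
qed

text \<open>Complex scalars act as bounded operators, the type itself being only a real vector
  space.\<close>

definition ell2_cmult :: "complex \<Rightarrow> 'a ell2 \<Rightarrow> 'a ell2" where
  "ell2_cmult c f = Ell2 (\<lambda>x. c * ell2_fun f x)"

lemma ell2_fun_cmult: "ell2_fun (ell2_cmult c f) x = c * ell2_fun f x"
  using sq_summable_scale[OF ell2_sq_summable[of f], of c] by (simp add: ell2_cmult_def Ell2_inverse)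

lemma norm_ell2_cmult: "norm (ell2_cmult c f) = cmod c * norm f"
proof -
  have "(norm (ell2_cmult c f))\<^sup>2 = (cmod c * norm f)\<^sup>2"
    unfolding norm_ell2_sq power_mult_distrib
    by (simp add: ell2_fun_cmult norm_mult power_mult_distrib infsum_cmult_right ell2_sq_summable)
  then show ?thesis by simp
qed

lemma bounded_linear_ell2_cmult: "bounded_linear (ell2_cmult c)"
  by (rule bounded_linear_intro[where K="cmod c"])
    (auto intro!: ell2_eqI simp: ell2_fun_cmult ell2_fun_simps norm_ell2_cmult scaleR_conv_of_real algebra_simps)

subsection \<open>Weighted square summable functions\<close>

locale weighted_l2 =
  fixes m :: "'a \<Rightarrow> real"
  assumes m_pos: "0 < m x"
begin

lemma Lp2_iff: "f \<in> Lp m 2 \<longleftrightarrow> (\<lambda>x. (norm (f x))\<^sup>2 * m x) summable_on UNIV"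
  by (simp add: Lp_def)

lemma Lp2_norm_sq: "(Lp_norm m 2 f)\<^sup>2 = (\<Sum>\<^sub>\<infinity>x. (norm (f x))\<^sup>2 * m x)"
proof -
  have "0 \<le> (\<Sum>\<^sub>\<infinity>x. (norm (f x))\<^sup>2 * m x)" using m_pos by (intro infsum_nonneg mult_nonneg_nonneg) (auto intro: less_imp_le)
  then show ?thesis by (simp add: Lp_norm_def powr_half_sqrt)
qed

lemma Lp_norm_nonneg [simp]: "0 \<le> Lp_norm m p f"
  by (simp add: Lp_norm_def)

definition emb :: "('a \<Rightarrow> complex) \<Rightarrow> 'a ell2" where
  "emb f = Ell2 (\<lambda>x. f x * of_real (sqrt (m x)))"

definition unemb :: "'a ell2 \<Rightarrow> 'a \<Rightarrow> complex" where
  "unemb h = (\<lambda>x. ell2_fun h x / of_real (sqrt (m x)))"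

lemma weight_sq: "(cmod (z * of_real (sqrt (m x))))\<^sup>2 = (cmod z)\<^sup>2 * m x"
  using m_pos[of x] by (simp add: norm_mult power_mult_distrib)

lemma ell2_fun_emb: "f \<in> Lp m 2 \<Longrightarrow> ell2_fun (emb f) x = f x * of_real (sqrt (m x))"
  unfolding emb_def by (subst Ell2_inverse) (auto simp: weight_sq Lp2_iff)

lemma unemb_emb [simp]: "f \<in> Lp m 2 \<Longrightarrow> unemb (emb f) = f"
  using m_pos by (auto simp: unemb_def ell2_fun_emb less_imp_neq[symmetric])

lemma unemb_Lp [simp]: "unemb h \<in> Lp m 2"
proof -
  have "(norm (unemb h x))\<^sup>2 * m x = (cmod (ell2_fun h x))\<^sup>2" for x
    using m_pos[of x] by (simp add: unemb_def norm_divide power_divide)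
  then show ?thesis by (simp add: Lp2_iff ell2_sq_summable)
qed

lemma emb_unemb [simp]: "emb (unemb h) = h"
  using m_pos by (intro ell2_eqI, subst ell2_fun_emb[OF unemb_Lp]) (simp add: unemb_def less_imp_neq[symmetric])

lemma emb_inject: "f \<in> Lp m 2 \<Longrightarrow> g \<in> Lp m 2 \<Longrightarrow> emb f = emb g \<Longrightarrow> f = g"
  using unemb_emb by metis

lemma emb_linear:
  assumes "f \<in> Lp m 2" "g \<in> Lp m 2"
  shows "(\<lambda>x. a * f x + b * g x) \<in> Lp m 2" "emb (\<lambda>x. a * f x + b * g x) = ell2_cmult a (emb f) + ell2_cmult b (emb g)"
proof -
  have eq: "(\<lambda>x. a * f x + b * g x) = unemb (ell2_cmult a (emb f) + ell2_cmult b (emb g))"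
    using m_pos assms by (auto simp: unemb_def ell2_fun_simps ell2_fun_cmult ell2_fun_emb add_divide_distrib less_imp_neq[symmetric])
  show "(\<lambda>x. a * f x + b * g x) \<in> Lp m 2" unfolding eq by simp
  show "emb (\<lambda>x. a * f x + b * g x) = ell2_cmult a (emb f) + ell2_cmult b (emb g)" unfolding eq by simp
qed

lemma ell2_cmult_one [simp]: "ell2_cmult 1 f = f" "ell2_cmult (-1) f = - f" "ell2_cmult 0 f = 0" "ell2_cmult (of_real c) f = c *\<^sub>R f"
  by (auto intro!: ell2_eqI simp: ell2_fun_cmult ell2_fun_simps scaleR_conv_of_real)

lemma Lp_zero [simp]: "(\<lambda>x. 0) \<in> Lp m 2" by (simp add: Lp2_iff)

lemma emb_zero [simp]: "emb (\<lambda>x. 0) = 0" by (intro ell2_eqI) (simp add: ell2_fun_emb ell2_fun_simps)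

lemma emb_diff:
  assumes "f \<in> Lp m 2" "g \<in> Lp m 2"
  shows "(\<lambda>x. f x - g x) \<in> Lp m 2" "emb (\<lambda>x. f x - g x) = emb f - emb g"
  using emb_linear[OF assms, of 1 "-1"] by simp_all

lemma emb_sum:
  assumes "finite I" "\<And>i. i \<in> I \<Longrightarrow> f i \<in> Lp m 2"
  shows "(\<lambda>x. \<Sum>i\<in>I. c i * f i x) \<in> Lp m 2 \<and> emb (\<lambda>x. \<Sum>i\<in>I. c i * f i x) = (\<Sum>i\<in>I. ell2_cmult (c i) (emb (f i)))"
  using assms
proof (induction I)
  case (insert i I)
  then show ?case using emb_linear[of "f i" "\<lambda>x. \<Sum>i\<in>I. c i * f i x" "c i" 1] by simp
qed simp

lemma norm_emb: assumes "f \<in> Lp m 2" shows "norm (emb f) = Lp_norm m 2 f"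
proof -
  have "(norm (emb f))\<^sup>2 = (Lp_norm m 2 f)\<^sup>2"
    by (simp add: norm_ell2_sq Lp2_norm_sq ell2_fun_emb assms weight_sq)
  then show ?thesis by simp
qed

lemma L2_summable:
  assumes "f \<in> Lp m 2" "g \<in> Lp m 2" shows "(\<lambda>x. f x * cnj (g x) * of_real (m x)) summable_on UNIV"
proof -
  have w: "f x * cnj (g x) * of_real (m x) = ell2_fun (emb f) x * cnj (ell2_fun (emb g) x)" for x
  proof -
    have "complex_of_real (m x) = of_real (sqrt (m x)) * of_real (sqrt (m x))"
      using m_pos[of x] by (simp flip: of_real_mult)
    then show ?thesis by (simp add: ell2_fun_emb assms mult_ac)
  qed
  show ?thesis unfolding w by (intro sq_summable_inner ell2_sq_summable)
qed

lemma L2_inner_emb: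
  assumes "f \<in> Lp m 2" "g \<in> Lp m 2" shows "Re (L2_inner m f g) = inner (emb f) (emb g)"
proof -
  have w: "f x * cnj (g x) * of_real (m x) = ell2_fun (emb f) x * cnj (ell2_fun (emb g) x)" for x
  proof -
    have "complex_of_real (m x) = of_real (sqrt (m x)) * of_real (sqrt (m x))"
      using m_pos[of x] by (simp flip: of_real_mult)
    then show ?thesis by (simp add: ell2_fun_emb assms mult_ac)
  qed
  have "(\<lambda>x. ell2_fun (emb f) x * cnj (ell2_fun (emb g) x)) summable_on UNIV"
    using L2_summable[OF assms] by (simp only: w)
  then show ?thesis
    unfolding L2_inner_def w inner_ell2_def inner_complex_cnj by (rule infsum_Re[symmetric])
qed

text \<open>The real inner product sees the imaginary part after multiplication of the second
  argument by \<open>\<i>\<close>.\<close>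

lemma L2_inner_imaginary:
  assumes "f \<in> Lp m 2" "g \<in> Lp m 2" shows "Im (L2_inner m f g) = inner (emb f) (ell2_cmult \<i> (emb g))"
proof -
  have "L2_inner m f (\<lambda>x. \<i> * g x + 0 * g x) = - \<i> * L2_inner m f g"
    unfolding L2_inner_def infsum_cmult_right'[symmetric] by (intro infsum_cong) (simp add: mult_ac)
  then have "Im (L2_inner m f g) = Re (L2_inner m f (\<lambda>x. \<i> * g x + 0 * g x))" by simp
  also have "\<dots> = inner (emb f) (ell2_cmult \<i> (emb g))"
    using emb_linear[OF assms(2,2), of \<i> 0] by (subst L2_inner_emb) (use assms in auto)
  finally show ?thesis .
qed

lemma Lp_tendsto_emb:
  assumes "\<And>n. u n \<in> Lp m 2" "f \<in> Lp m 2"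
  shows "Lp_tendsto m 2 u f \<longleftrightarrow> (\<lambda>n. emb (u n)) \<longlonglongrightarrow> emb f"
proof -
  have "Lp_norm m 2 (\<lambda>x. u n x - f x) = norm (emb (u n) - emb f)" for n
    using emb_diff[OF assms] by (simp flip: norm_emb)
  then show ?thesis
    using emb_diff(1)[OF assms] LIM_zero_iff[of "\<lambda>n. emb (u n)" "emb f"] 
    by (simp add: Lp_tendsto_def tendsto_norm_zero_iff)
qed

text \<open>The bridge between functions in \<open>Lp m 2\<close> and the type \<open>ell2\<close>;
  outside Borel sets and outside \<open>Lp m 2\<close> nothing is required.\<close>

definition lifts :: "(real set \<Rightarrow> ('a \<Rightarrow> complex) \<Rightarrow> ('a \<Rightarrow> complex)) \<Rightarrow> (real set \<Rightarrow> 'a ell2 \<Rightarrow> 'a ell2) \<Rightarrow> bool" where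
  "lifts E F \<longleftrightarrow> (\<forall>A\<in>sets borel. \<forall>f\<in>Lp m 2. E A f \<in> Lp m 2 \<and> emb (E A f) = F A (emb f))"

text \<open>Scalar measures, simple integrals and convergence all correspond under
  \<open>emb\<close>, which is an isometry on \<open>Lp m 2\<close>.\<close>

lemma has_spectral_integral_lifts:
  assumes EF: "lifts E F" and f: "f \<in> Lp m 2" and g: "g \<in> Lp m 2"
  shows "has_spectral_integral m E \<phi> f g \<longleftrightarrow> spec_int F \<phi> (emb f) (emb g)"
proof -
  have "scalar_spectral_measure m E f = spec_measure F (emb f)"
    unfolding scalar_spectral_measure_def spec_measure_def
    by (rule measure_of_eq) (use EF f in \<open>auto simp: lifts_def norm_emb[symmetric] sets.sigma_sets_eq[of "borel :: real measure", simplified]\<close>)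
  moreover have "simple_spectral_integral E s f \<in> Lp m 2 \<and> emb (simple_spectral_integral E s f) = simple_int F s (emb f)"
    if s: "simple_function borel s" for s
  proof -
    have "s -` {c} \<in> sets borel" for c using simple_functionD(2)[OF s, of "{c}"] by simp
    moreover have "finite (range s)" using simple_functionD(1)[OF s] by simp
    ultimately show ?thesis
      using emb_sum[of "range s" "\<lambda>c. E (s -` {c}) f" of_real] EF f
      by (simp add: simple_spectral_integral_def simple_int_def lifts_def)
  qed
  moreover from this have "Lp_tendsto m 2 (\<lambda>n. simple_spectral_integral E (s n) f) g
      \<longleftrightarrow> (\<lambda>n. simple_int F (s n) (emb f)) \<longlonglongrightarrow> emb g" if "\<forall>n. simple_function borel (s n)" for s
    using that g Lp_tendsto_emb[of "\<lambda>n. simple_spectral_integral E (s n) f" g] by simp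
  ultimately show ?thesis
    unfolding has_spectral_integral_def spec_int_def using f g by auto
qed

end

section \<open>Positive operators on the weighted space and their square roots\<close>

locale psd_operator = weighted_l2 m for m :: "'a \<Rightarrow> real" +
  fixes L :: "('a \<Rightarrow> complex) \<Rightarrow> ('a \<Rightarrow> complex)" and c :: real
  assumes c_pos: "0 < c"
    and L_Lp: "f \<in> Lp m 2 \<Longrightarrow> L f \<in> Lp m 2"
    and L_linear: "f \<in> Lp m 2 \<Longrightarrow> g \<in> Lp m 2 \<Longrightarrow> L (\<lambda>x. a * f x + b * g x) = (\<lambda>x. a * L f x + b * L g x)"
    and L_bounded: "\<exists>K. \<forall>f\<in>Lp m 2. Lp_norm m 2 (L f) \<le> K * Lp_norm m 2 f"
    and L_sym: "f \<in> Lp m 2 \<Longrightarrow> g \<in> Lp m 2 \<Longrightarrow> L2_inner m (L f) g = L2_inner m f (L g)"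
    and L_pos: "f \<in> Lp m 2 \<Longrightarrow> 0 \<le> Re (L2_inner m (L f) f)"
    and L_le: "f \<in> Lp m 2 \<Longrightarrow> Re (L2_inner m (L f) f) \<le> c * (Lp_norm m 2 f)\<^sup>2"
    and L_ker: "f \<in> Lp m 2 \<Longrightarrow> L f = (\<lambda>x. 0) \<Longrightarrow> f = (\<lambda>x. 0)"
    and L_ker_c: "f \<in> Lp m 2 \<Longrightarrow> L f = (\<lambda>x. of_real c * f x) \<Longrightarrow> f = (\<lambda>x. 0)"
begin

definition T :: "'a ell2 \<Rightarrow> 'a ell2" where
  "T h = emb (L (unemb h))"

lemma T_emb: "f \<in> Lp m 2 \<Longrightarrow> T (emb f) = emb (L f)"
  by (simp add: T_def)

lemma T_cmult: "T (ell2_cmult a h + ell2_cmult b k) = ell2_cmult a (T h) + ell2_cmult b (T k)"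
proof -
  have eq: "ell2_cmult a h + ell2_cmult b k = emb (\<lambda>x. a * unemb h x + b * unemb k x)"
    by (simp add: emb_linear)
  have "T (ell2_cmult a h + ell2_cmult b k) = emb (L (\<lambda>x. a * unemb h x + b * unemb k x))"
    unfolding eq by (intro T_emb emb_linear) simp_all
  then have "T (ell2_cmult a h + ell2_cmult b k) = emb (\<lambda>x. a * L (unemb h) x + b * L (unemb k) x)"
    by (simp add: L_linear)
  then show ?thesis by (simp add: emb_linear L_Lp T_def)
qed

lemma T_cmult': "T (ell2_cmult a h) = ell2_cmult a (T h)"
  using T_cmult[of a h 0 h] by simp

lemma T_inner: "inner (T h) k = Re (L2_inner m (L (unemb h)) (unemb k))"
  by (simp add: T_def L2_inner_emb L_Lp)

lemma T_sym: "symmetric_op T"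
  unfolding symmetric_op_def
proof (intro conjI allI)
  obtain K where K: "\<And>f. f \<in> Lp m 2 \<Longrightarrow> Lp_norm m 2 (L f) \<le> K * Lp_norm m 2 f" using L_bounded by auto
  show "bounded_linear T"
  proof (rule bounded_linear_intro[where K=K])
    show "norm (T h) \<le> norm h * K" for h
      using K[of "unemb h"] by (simp add: T_def L_Lp norm_emb mult.commute flip: norm_emb[of "unemb h"])
    show "T (h + k) = T h + T k" for h k using T_cmult[of 1 h 1 k] by simp
    show "T (r *\<^sub>R h) = r *\<^sub>R T h" for r h using T_cmult'[of "of_real r" h] by simp
  qed
  show "inner (T h) k = inner h (T k)" for h k
    unfolding T_inner using L_sym[of "unemb h" "unemb k"] L2_inner_emb[of "unemb h" "L (unemb k)"] by (simp add: L_Lp T_def)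
qed

lemma T_lin: "linear T"
  using T_sym by (simp add: symmetric_op_def bounded_linear.linear)

lemma T_pos: "0 \<le> inner (T h) h" "inner (T h) h \<le> c * inner h h"
  using L_pos[of "unemb h"] L_le[of "unemb h"]
  by (simp_all add: T_inner flip: power2_norm_eq_inner norm_emb)

lemma T_ker: "T h = 0 \<Longrightarrow> h = 0"
  using L_ker[of "unemb h"] emb_inject[of "L (unemb h)" "\<lambda>x. 0"] emb_unemb[of h] emb_zero
  by (simp add: T_def L_Lp)

lemma T_ker_c: "T h = c *\<^sub>R h \<Longrightarrow> h = 0"
proof -
  assume h: "T h = c *\<^sub>R h"
  have e: "emb (\<lambda>x. of_real c * unemb h x) = c *\<^sub>R h" "(\<lambda>x. of_real c * unemb h x) \<in> Lp m 2"
    using emb_linear[of "unemb h" "unemb h" "of_real c" 0] by simp_all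
  then have "L (unemb h) = (\<lambda>x. of_real c * unemb h x)"
    using h by (intro emb_inject) (simp_all add: L_Lp T_def)
  from L_ker_c[OF _ this] have "unemb h = (\<lambda>x. 0)" by simp
  then show "h = 0" using emb_unemb[of h] emb_zero by simp
qed

text \<open>\<open>T\<close> commutes with complex scalars, hence so do its spectral projections;
  this gives back complex linearity and the imaginary part of symmetry, which the real Hilbert space
  does not see.\<close>

lemma resolution_exists: "\<exists>E. is_spectral_resolution m L E"
proof -
  obtain F where F: "pvm F" "\<And>h. spec_int F (\<lambda>t. t) h (T h)"
    "\<And>J A h. bounded_linear J \<Longrightarrow> (\<And>h. J (T h) = T (J h)) \<Longrightarrow> A \<in> sets borel \<Longrightarrow> J (F A h) = F A (J h)"
    using spectral_theorem[OF T_sym c_pos T_pos] by blast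
  interpret projection_measure F by unfold_locales (rule F(1))
  have cm: "ell2_cmult a (F A h) = F A (ell2_cmult a h)" if "A \<in> sets borel" for a A h
    by (rule F(3)[OF bounded_linear_ell2_cmult _ that]) (simp add: T_cmult')
  define E where "E A f = unemb (F A (emb f))" for A f
  have E: "E A f \<in> Lp m 2" "emb (E A f) = F A (emb f)" for A f by (simp_all add: E_def)
  have lifts: "lifts E F" by (simp add: lifts_def E)
  have op: "orth_projection m (E A)" if A: "A \<in> sets borel" for A
    unfolding orth_projection_def
  proof (intro conjI ballI allI)
    fix f g :: "'a \<Rightarrow> complex" and a b assume f: "f \<in> Lp m 2" and g: "g \<in> Lp m 2"
    show "E A (\<lambda>x. a * f x + b * g x) = (\<lambda>x. a * E A f x + b * E A g x)"
      by (rule emb_inject)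
        (simp_all add: E emb_linear f g cm A bounded_linear.linear[OF E_bl[OF A], THEN linear_add])
    show "L2_inner m (E A f) g = L2_inner m f (E A g)"
    proof (rule complex_eqI)
      show "Re (L2_inner m (E A f) g) = Re (L2_inner m f (E A g))"
        by (simp add: L2_inner_emb E f g E_sym A)
      show "Im (L2_inner m (E A f) g) = Im (L2_inner m f (E A g))"
        by (simp add: L2_inner_imaginary E f g E_sym A cm)
    qed
  next
    fix f show "E A (E A f) = E A f" by (rule emb_inject) (simp_all add: E E_Int A)
  qed (rule E)
  have "projection_valued_measure m E"
    unfolding projection_valued_measure_def
  proof (intro conjI ballI allI impI op)
    fix A :: "nat \<Rightarrow> real set" and f assume A: "range A \<subseteq> sets borel" "disjoint_family A"
    have "(\<lambda>x. \<Sum>i<n. E (A i) f x) \<in> Lp m 2 \<and> emb (\<lambda>x. \<Sum>i<n. E (A i) f x) = (\<Sum>i<n. F (A i) (emb f))" for n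
      using emb_sum[of "{..<n}" "\<lambda>i. E (A i) f" "\<lambda>_. 1"] E by simp
    then show "Lp_tendsto m 2 (\<lambda>n x. \<Sum>i<n. E (A i) f x) (E (\<Union> (range A)) f)"
      using E_sigma[OF A, of "emb f"] by (subst Lp_tendsto_emb) (simp_all add: E)
  qed (simp_all add: E_def E_Int)
  moreover have "has_spectral_integral m E (\<lambda>t. t) f (L f)" if "f \<in> Lp m 2" for f
    using F(2)[of "emb f"] that by (simp add: has_spectral_integral_lifts[OF lifts] L_Lp T_emb)
  ultimately show ?thesis unfolding is_spectral_resolution_def by blast
qed

text \<open>Transport in the opposite direction. What follows concerns the resolution selected by
  the choice operator, about which only \<open>is_spectral_resolution\<close> is known.\<close>

definition R :: "real set \<Rightarrow> 'a ell2 \<Rightarrow> 'a ell2" where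
  "R A h = emb (spectral_resolution m L A (unemb h))"

lemma resolution: "is_spectral_resolution m L (spectral_resolution m L)"
  unfolding spectral_resolution_def by (rule someI_ex[OF resolution_exists])

lemma op: "A \<in> sets borel \<Longrightarrow> orth_projection m (spectral_resolution m L A)"
  using resolution by (simp add: is_spectral_resolution_def projection_valued_measure_def)

lemma lifts_R: "lifts (spectral_resolution m L) R"
  using op by (auto simp: lifts_def R_def orth_projection_def)

lemma pvm_R: "pvm R"
  unfolding pvm_def
proof (intro conjI ballI allI impI)
  let ?E = "spectral_resolution m L"
  have pv: "projection_valued_measure m ?E" using resolution by (simp add: is_spectral_resolution_def)
  have Lp: "?E A f \<in> Lp m 2" if "A \<in> sets borel" "f \<in> Lp m 2" for A f
    using op[OF that(1)] that(2) by (simp add: orth_projection_def)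
  have R_emb: "R A (emb f) = emb (?E A f)" if "f \<in> Lp m 2" for A f
    using that by (simp add: R_def)
  show "R UNIV h = h" for h
    using pv by (simp add: R_def projection_valued_measure_def)
  show "R (A \<inter> B) h = R A (R B h)" if "A \<in> sets borel" "B \<in> sets borel" for A B h
    using pv that Lp by (simp add: R_def projection_valued_measure_def)
  show "(\<lambda>n. \<Sum>i<n. R (A i) h) \<longlonglongrightarrow> R (\<Union>i. A i) h"
    if A: "range A \<subseteq> sets borel" "disjoint_family A" for A :: "nat \<Rightarrow> real set" and h
  proof -
    have Ai: "A i \<in> sets borel" for i using A by auto
    have "Lp_tendsto m 2 (\<lambda>n x. \<Sum>i<n. ?E (A i) (unemb h) x) (?E (\<Union>i. A i) (unemb h))"
      using pv A by (simp add: projection_valued_measure_def)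
    moreover have "(\<lambda>x. \<Sum>i<n. ?E (A i) (unemb h) x) \<in> Lp m 2 \<and>
        emb (\<lambda>x. \<Sum>i<n. ?E (A i) (unemb h) x) = (\<Sum>i<n. R (A i) h)" for n
      using emb_sum[of "{..<n}" "\<lambda>i. ?E (A i) (unemb h)" "\<lambda>_. 1"] Lp[OF Ai] by (simp add: R_def)
    moreover have "?E (\<Union>i. A i) (unemb h) \<in> Lp m 2" by (intro Lp) (use Ai in auto)
    ultimately show ?thesis by (simp add: Lp_tendsto_emb R_def)
  qed
  fix A :: "real set" assume A: "A \<in> sets borel"
  have sym: "inner (R A h) k = inner h (R A k)" for h k
    using op[OF A] L2_inner_emb[of "?E A (unemb h)" "unemb k"] L2_inner_emb[of "unemb h" "?E A (unemb k)"]
    by (simp add: R_def Lp[OF A] orth_projection_def)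
  have cm: "R A (ell2_cmult a h + ell2_cmult b k) = ell2_cmult a (R A h) + ell2_cmult b (R A k)" for a b h k
  proof -
    have eq: "ell2_cmult a h + ell2_cmult b k = emb (\<lambda>x. a * unemb h x + b * unemb k x)"
      by (simp add: emb_linear)
    have "R A (ell2_cmult a h + ell2_cmult b k) = emb (?E A (\<lambda>x. a * unemb h x + b * unemb k x))"
      unfolding eq by (intro R_emb emb_linear) simp_all
    then have "R A (ell2_cmult a h + ell2_cmult b k) = emb (\<lambda>x. a * ?E A (unemb h) x + b * ?E A (unemb k) x)"
      using op[OF A] by (simp add: orth_projection_def)
    then show ?thesis by (simp add: emb_linear Lp[OF A] R_def)
  qed
  have idem: "R A (R A h) = R A h" for h
    using op[OF A] by (simp add: R_def Lp[OF A] orth_projection_def)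
  show "symmetric_op (R A)"
    unfolding symmetric_op_def
  proof (intro conjI allI sym bounded_linear_intro[where K=1])
    fix h k :: "'a ell2" and r :: real
    show "R A (h + k) = R A h + R A k" using cm[of 1 h 1 k] by simp
    show "R A (r *\<^sub>R h) = r *\<^sub>R R A h" using cm[of "of_real r" h 0 h] by simp
    \<comment> \<open>Symmetry and idempotence give \<open>|R A h|^2 = <R A h, h>\<close>, hence the
      norm bound 1.\<close>
    have "norm (R A h) * norm (R A h) = inner (R A h) h"
      using sym[of "R A h" h] idem[of h] by (simp add: norm_eq_sqrt_inner)
    also have "\<dots> \<le> norm (R A h) * norm h" by (rule norm_cauchy_schwarz)
    finally show "norm (R A h) \<le> norm h * 1" by (cases "norm (R A h) = 0") auto
  qed
qed

sublocale res: resolution R T c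
proof unfold_locales
  show "spec_int R (\<lambda>t. t) h (T h)" for h
    using resolution has_spectral_integral_lifts[OF lifts_R, of "unemb h" "L (unemb h)" "\<lambda>t. t"]
    by (simp add: is_spectral_resolution_def L_Lp T_def)
qed (auto intro: pvm_R T_pos T_ker T_ker_c simp: linear_add[OF T_lin] linear_cmul[OF T_lin])

text \<open>The definite description is resolved by uniqueness of spectral integrals.\<close>

lemma spectral_fun_eq:
  assumes "spec_int R \<phi> (emb f) (emb g)" "f \<in> Lp m 2" "g \<in> Lp m 2"
  shows "spectral_fun m L \<phi> f = g"
  unfolding spectral_fun_def
proof (rule the_equality)
  show "has_spectral_integral m (spectral_resolution m L) \<phi> f g"
    using assms by (simp add: has_spectral_integral_lifts[OF lifts_R])
  fix h assume h: "has_spectral_integral m (spectral_resolution m L) \<phi> f h"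
  then have "h \<in> Lp m 2" by (simp add: has_spectral_integral_def)
  with h assms have "spec_int R \<phi> (emb f) (emb h)" by (simp add: has_spectral_integral_lifts[OF lifts_R])
  from res.spec_int_unique[OF this assms(1)] show "h = g"
    using \<open>h \<in> Lp m 2\<close> assms(3) by (rule emb_inject[rotated 2])
qed

text \<open>The square root of \<open>L\<close>; for the Laplacian it is
  \<open>laplacian_powr\<close> with exponent 1/2.\<close>

definition S :: "('a \<Rightarrow> complex) \<Rightarrow> ('a \<Rightarrow> complex)" where
  "S = spectral_fun m L (\<lambda>t. t powr (1/2))"

lemma S_spec: 
  assumes "f \<in> Lp m 2"
  shows "S f \<in> Lp m 2" "spec_int R (\<lambda>t. t powr (1/2)) (emb f) (emb (S f))"
proof -
  obtain y where y: "spec_int R (\<lambda>t. t powr (1/2)) (emb f) y" using res.sqrt_exists by blast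
  then have "S f = unemb y" unfolding S_def using assms by (intro spectral_fun_eq) auto
  then show "S f \<in> Lp m 2" "spec_int R (\<lambda>t. t powr (1/2)) (emb f) (emb (S f))" using y by auto
qed

lemma S_inverse:
  assumes "f \<in> Lp m 2" shows "spectral_fun m L (\<lambda>t. t powr (-1/2)) (S f) = f"
  by (intro spectral_fun_eq res.sqrt_inverse S_spec assms)

lemma S_norm:
  assumes "f \<in> Lp m 2" shows "(Lp_norm m 2 (S f))\<^sup>2 = Re (L2_inner m (L f) f)"
  using res.sqrt_norm[OF S_spec(2)[OF assms]] assms
  by (simp add: norm_emb S_spec T_emb L2_inner_emb L_Lp)

lemma S_poly_bounded:
  assumes "f \<in> Lp m 2" "g \<in> Lp m 2" "emb g = poly_op T p (emb f)"
    and "\<And>t. 0 < t \<Longrightarrow> t < c \<Longrightarrow> \<bar>t powr (1/2) * poly p t\<bar> \<le> B" "0 \<le> B"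
  shows "Lp_norm m 2 (S g) \<le> B * Lp_norm m 2 f"
  using res.sqrt_poly_bounded[of p "emb f" "emb (S g)" B] S_spec[OF assms(2)] assms
  by (simp add: norm_emb)

lemma S_poly_tendsto:
  assumes "f \<in> Lp m 2" "\<And>n. g n \<in> Lp m 2" "\<And>n. emb (g n) = poly_op T (p n) (emb f)"
    and "\<And>n t. 0 < t \<Longrightarrow> t < c \<Longrightarrow> \<bar>t powr (1/2) * poly (p n) t\<bar> \<le> B" "0 \<le> B"
    and "\<And>t. 0 < t \<Longrightarrow> t < c \<Longrightarrow> (\<lambda>n. t powr (1/2) * poly (p n) t) \<longlonglongrightarrow> 1"
  shows "Lp_tendsto m 2 (\<lambda>n. S (g n)) f"
  unfolding Lp_tendsto_emb[OF S_spec(1)[OF assms(2)] assms(1)]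
  by (rule res.sqrt_poly_tendsto[where p=p and B=B]) (use assms S_spec(2)[OF assms(2)] in auto)

end

context weighted_l2
begin

lemma L2_inner_diff:
  assumes "f \<in> Lp m 2" "g \<in> Lp m 2" "h \<in> Lp m 2"
  shows "L2_inner m (\<lambda>x. f x - g x) h = L2_inner m f h - L2_inner m g h"
    "L2_inner m h (\<lambda>x. f x - g x) = L2_inner m h f - L2_inner m h g"
proof -
  have infsum_diff: "(\<Sum>\<^sub>\<infinity>x. u x - v x) = (\<Sum>\<^sub>\<infinity>x. u x) - (\<Sum>\<^sub>\<infinity>x. v x)"
    if "u summable_on UNIV" "v summable_on UNIV" for u v :: "'a \<Rightarrow> complex"
    using infsum_add[of u UNIV "\<lambda>x. - v x"] that by (simp add: summable_on_uminus infsum_uminus)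
  show "L2_inner m (\<lambda>x. f x - g x) h = L2_inner m f h - L2_inner m g h"
    unfolding L2_inner_def infsum_diff[OF L2_summable[OF assms(1,3)] L2_summable[OF assms(2,3)], symmetric]
    by (intro infsum_cong) (simp add: left_diff_distrib)
  show "L2_inner m h (\<lambda>x. f x - g x) = L2_inner m h f - L2_inner m h g"
    unfolding L2_inner_def infsum_diff[OF L2_summable[OF assms(3,1)] L2_summable[OF assms(3,2)], symmetric]
    by (intro infsum_cong) (simp add: algebra_simps)
qed

lemma Lp_norm_cmult:
  assumes "f \<in> Lp m 2"
  shows "(\<lambda>x. a * f x) \<in> Lp m 2" "Lp_norm m 2 (\<lambda>x. a * f x) = cmod a * Lp_norm m 2 f"
proof -
  show *: "(\<lambda>x. a * f x) \<in> Lp m 2" using emb_linear(1)[OF assms assms, of a 0] by simp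
  show "Lp_norm m 2 (\<lambda>x. a * f x) = cmod a * Lp_norm m 2 f"
    using norm_emb[OF *] emb_linear(2)[OF assms assms, of a 0] by (simp add: norm_ell2_cmult norm_emb assms)
qed

lemma Lp_norm_eq_0: "f \<in> Lp m 2 \<Longrightarrow> Lp_norm m 2 f = 0 \<Longrightarrow> f = (\<lambda>x. 0)"
  for f :: "'a \<Rightarrow> complex"
  using norm_emb[of f] by (intro emb_inject) auto

lemma Lp_of_real: "(\<lambda>x. complex_of_real (h x)) \<in> Lp m q \<longleftrightarrow> h \<in> Lp m q"
    and Lp_norm_of_real: "Lp_norm m q (\<lambda>x. complex_of_real (h x)) = Lp_norm m q h"
  by (simp_all add: Lp_def Lp_norm_def)

lemma Lp_tendsto_of_real:
  "Lp_tendsto m 2 (\<lambda>n x. complex_of_real (u n x)) (\<lambda>x. complex_of_real (h x)) \<longleftrightarrow> Lp_tendsto m 2 u h"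
  unfolding Lp_tendsto_def of_real_diff[symmetric] Lp_of_real Lp_norm_of_real ..

end

lemma (in psd_operator) emb_S_diff:
  assumes "f \<in> Lp m 2" "g \<in> Lp m 2" shows "emb (S (\<lambda>x. f x - g x)) = emb (S f) - emb (S g)"
  using res.spec_int_diff_right[OF S_spec(2)[OF assms(1)] S_spec(2)[OF assms(2)]]
    S_spec(2)[OF emb_diff(1)[OF assms]] emb_diff(2)[OF assms] by simp

section \<open>Weighted graphs\<close>

locale wgraph =
  fixes \<mu> :: "'a \<Rightarrow> 'a \<Rightarrow> real"
  assumes wg: "weighted_graph \<mu>"
begin

abbreviation "m \<equiv> vmass \<mu>"
abbreviation "d \<equiv> gdist \<mu>"

definition nb :: "'a \<Rightarrow> 'a set" where "nb x = {y. adj \<mu> x y}"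

lemma \<mu>_sym: "\<mu> x y = \<mu> y x" and \<mu>_nonneg [simp]: "0 \<le> \<mu> x y"
  using wg by (auto simp: weighted_graph_def)

lemma adj_sym: "adj \<mu> x y \<longleftrightarrow> adj \<mu> y x"
  using \<mu>_sym[of x y] by (simp add: adj_def)

lemma nb_sym: "y \<in> nb x \<longleftrightarrow> x \<in> nb y"
  using adj_sym by (simp add: nb_def)

lemma \<mu>_pos: "y \<in> nb x \<Longrightarrow> 0 < \<mu> x y" and \<mu>_zero: "y \<notin> nb x \<Longrightarrow> \<mu> x y = 0"
  using \<mu>_nonneg[of x y] by (auto simp: nb_def adj_def simp del: \<mu>_nonneg)

lemma obtain_degree: obtains N :: nat where "\<And>x. finite (nb x) \<and> card (nb x) \<le> N"
proof -
  obtain N where N: "\<And>x. finite ({y. adj \<mu> y x} \<union> {x})" "\<And>x. card ({y. adj \<mu> y x} \<union> {x}) \<le> N"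
    using wg unfolding weighted_graph_def by blast
  have "nb x \<subseteq> {y. adj \<mu> y x} \<union> {x}" for x using adj_sym by (auto simp: nb_def)
  then have "finite (nb x) \<and> card (nb x) \<le> N" for x
    using N card_mono[OF N(1), of "nb x" x] finite_subset[OF _ N(1)] order_trans by meson
  then show ?thesis using that by blast
qed

lemma finite_nb [simp]: "finite (nb x)"
  using obtain_degree by blast

lemma m_eq: "m x = (\<Sum>y\<in>nb x. \<mu> x y)"
  using adj_sym by (simp add: vmass_def nb_def)

abbreviation "rel \<equiv> {(x, y). adj \<mu> x y}"

text \<open>Walks become powers of the adjacency relation, so that concatenation and reversal reduce
  to facts about relation powers.\<close>

lemma walk_iff: "(\<exists>w. walk \<mu> n w x y) \<longleftrightarrow> (x, y) \<in> rel ^^ n"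
proof -
  have "(\<forall>i\<in>{1..n}. adj \<mu> (w (i - 1)) (w i)) \<longleftrightarrow> (\<forall>i<n. adj \<mu> (w i) (w (Suc i)))" for w
  proof
    assume *: "\<forall>i\<in>{1..n}. adj \<mu> (w (i - 1)) (w i)"
    show "\<forall>i<n. adj \<mu> (w i) (w (Suc i))"
    proof (intro allI impI)
      fix i assume "i < n"
      then show "adj \<mu> (w i) (w (Suc i))" using bspec[OF *, of "Suc i"] by simp
    qed
  next
    assume *: "\<forall>i<n. adj \<mu> (w i) (w (Suc i))"
    show "\<forall>i\<in>{1..n}. adj \<mu> (w (i - 1)) (w i)"
    proof
      fix i assume "i \<in> {1..n}"
      then have "i - 1 < n" "Suc (i - 1) = i" by auto
      then show "adj \<mu> (w (i - 1)) (w i)" using *[rule_format, of "i - 1"] by simp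
    qed
  qed
  then show ?thesis unfolding walk_def relpow_fun_conv by simp
qed

lemma d_relpow: "(x, y) \<in> rel ^^ d x y"
proof -
  have "\<exists>n. (x, y) \<in> rel ^^ n" using wg walk_iff by (auto simp: weighted_graph_def)
  then show ?thesis unfolding gdist_def walk_iff by (rule LeastI_ex)
qed

lemma d_le: "(x, y) \<in> rel ^^ n \<Longrightarrow> d x y \<le> n"
  unfolding gdist_def walk_iff by (rule Least_le)

lemma d_self [simp]: "d x x = 0"
  using d_le[of x x 0] by simp

lemma d_zero: "d x y = 0 \<longleftrightarrow> x = y"
  using d_relpow[of x y] by auto

lemma d_sym: "d x y = d y x"
proof -
  have "(y, x) \<in> rel ^^ n" if "(x, y) \<in> rel ^^ n" for n x y
    using that
  proof (induction n arbitrary: y)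
    case (Suc n)
    then obtain z where "(x, z) \<in> rel ^^ n" "(z, y) \<in> rel" by auto
    then have "(y, z) \<in> rel" "(z, x) \<in> rel ^^ n" using Suc.IH adj_sym by auto
    then show ?case by (rule relpow_Suc_I2)
  qed simp
  then show ?thesis by (metis d_le d_relpow le_antisym)
qed

lemma d_triangle: "d x z \<le> d x y + d y z"
  by (rule d_le) (use d_relpow[of x y] d_relpow[of y z] relpow_add in blast)

lemma d_nb: "y \<in> nb x \<Longrightarrow> d x y \<le> 1"
  using d_le[of x y 1] by (simp add: nb_def)

lemma d_Suc: assumes "d x y = Suc n" obtains z where "y \<in> nb z" "d x z = n"
proof -
  obtain z where z: "(x, z) \<in> rel ^^ n" "(z, y) \<in> rel"
    using d_relpow[of x y] assms by auto
  have "d x z \<le> n" using z d_le by blast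
  moreover have "Suc n \<le> d x z + d z y" using d_triangle[of x y z] assms by simp
  moreover have "d z y \<le> 1" using z d_nb by (simp add: nb_def)
  ultimately show ?thesis using that[of z] z by (simp add: nb_def)
qed

lemma finite_dball: "finite {y. d x y \<le> n}"
proof (induction n)
  case 0
  have "{y. d x y \<le> 0} = {x}" using d_zero by auto
  then show ?case by simp
next
  case (Suc n)
  have "{y. d x y \<le> Suc n} \<subseteq> {y. d x y \<le> n} \<union> (\<Union>z\<in>{y. d x y \<le> n}. nb z)"
  proof
    fix y assume y: "y \<in> {y. d x y \<le> Suc n}"
    show "y \<in> {y. d x y \<le> n} \<union> (\<Union>z\<in>{y. d x y \<le> n}. nb z)"
    proof (cases "d x y = Suc n")
      case True
      then obtain z where "y \<in> nb z" "d x z = n" by (rule d_Suc)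
      then show ?thesis by auto
    qed (use y in auto)
  qed
  moreover have "finite ({y. d x y \<le> n} \<union> (\<Union>z\<in>{y. d x y \<le> n}. nb z))" using Suc by simp
  ultimately show ?case by (rule finite_subset)
qed

text \<open>If no vertex had distance \<open>n\<close>, stepping back along a shortest path from a
  farther vertex would produce one; so all distances would be below \<open>n\<close>, and the
  infinite graph would be a finite ball.\<close>

lemma exists_at_distance: "\<exists>z. d x z = n"
proof (rule ccontr)
  assume no: "\<nexists>z. d x z = n"
  have "d x y < n" for y
  proof (rule ccontr)
    assume "\<not> d x y < n"
    then have "n \<le> d x y" by simp
    then have "\<exists>z. d x z = n"
    proof (induction "d x y - n" arbitrary: y)
      case (Suc k)
      then obtain j where j: "d x y = Suc j" by (cases "d x y") auto
      obtain z where z: "d x z = j" by (rule d_Suc[OF j])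
      show ?case by (rule Suc.hyps(1)[of z]) (use z j Suc.hyps(2) in auto)
    qed auto
    with no show False by simp
  qed
  then have "UNIV = {y. d x y \<le> n}" by (auto simp: less_imp_le)
  then have "finite (UNIV :: 'a set)" using finite_dball[of x n] by simp
  then show False using wg by (simp add: weighted_graph_def)
qed

lemma m_pos: "0 < m x"
proof -
  obtain z where z: "d x z = 1" using exists_at_distance by blast
  then have "z \<in> nb x" using d_relpow[of x z] by (simp add: nb_def)
  then have "0 < \<mu> x z" "\<mu> x z \<le> m x"
    unfolding m_eq by (auto intro: \<mu>_pos member_le_sum)
  then show ?thesis by simp
qed

lemma m_nonneg [simp]: "0 \<le> m x" and m_nz [simp]: "m x \<noteq> 0"
  using m_pos[of x] by auto

sublocale weighted_l2 m
  by unfold_locales (rule m_pos)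

subsection \<open>Balls and volumes\<close>

abbreviation "B \<equiv> gball \<mu>"
abbreviation "V \<equiv> gvolume \<mu>"

lemma in_B: "y \<in> B x r \<longleftrightarrow> real (d x y) < r"
  by (simp add: gball_def)

lemma finite_B [simp]: "finite (B x r)"
  by (rule finite_subset[OF _ finite_dball[of x "nat \<lceil>r\<rceil>"]]) (auto simp: in_B; linarith)

lemma V_mono_set: "finite F \<Longrightarrow> B x r \<subseteq> F \<Longrightarrow> V x r \<le> sum m F"
  unfolding gvolume_def by (intro sum_mono2) auto

lemma B_subset: "real (d x y) + r \<le> s \<Longrightarrow> B x r \<subseteq> B y s"
proof
  fix z assume "real (d x y) + r \<le> s" "z \<in> B x r"
  then show "z \<in> B y s" using d_triangle[of y z x] d_sym[of x y] by (simp add: in_B)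
qed

lemma V_le: "real (d x y) + r \<le> s \<Longrightarrow> V x r \<le> V y s"
  unfolding gvolume_def[of \<mu> y] by (intro V_mono_set B_subset) auto

lemma V_mono: "r \<le> s \<Longrightarrow> V x r \<le> V x s"
  using V_le[of x x] by simp

lemma m_le_V: "0 < r \<Longrightarrow> m x \<le> V x r"
  unfolding gvolume_def by (rule member_le_sum) (auto simp: in_B)

lemma V_pos: "0 < r \<Longrightarrow> 0 < V x r"
  using m_pos[of x] m_le_V[of r x] by linarith

lemma V_nonneg [simp]: "0 \<le> V x r"
  by (simp add: gvolume_def sum_nonneg)

text \<open>Distances are integers and the inequality defining a ball is strict, so radii with the
  same ceiling give the same ball.\<close>

lemma V_ceiling: "V x r = V x (real_of_int \<lceil>r\<rceil>)"
proof -
  have "real n < r \<longleftrightarrow> real n < real_of_int \<lceil>r\<rceil>" for n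
    by (metis less_ceiling_iff of_int_less_iff of_int_of_nat_eq)
  then have "B x r = B x (real_of_int \<lceil>r\<rceil>)" by (simp add: gball_def)
  then show ?thesis by (simp add: gvolume_def)
qed

subsection \<open>The Markov operator\<close>

text \<open>The Markov operator as a finite sum, over any real vector space: it is applied to
  complex functions, to their moduli and to real kernels.\<close>

definition mk :: "('a \<Rightarrow> 'b::real_vector) \<Rightarrow> 'a \<Rightarrow> 'b" where
  "mk f x = (\<Sum>y\<in>nb x. (\<mu> x y / m x) *\<^sub>R f y)"

lemma infsum_nb:
  assumes "\<And>y. y \<notin> nb x \<Longrightarrow> f y = 0" shows "infsum f UNIV = (\<Sum>y\<in>nb x. f y)"
proof -
  have "infsum f UNIV = infsum f (nb x)" by (rule infsum_cong_neutral) (use assms in auto)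
  then show ?thesis by simp
qed

lemma markov_eq: "markov \<mu> f = mk f"
proof
  fix x
  have "markov \<mu> f x = (\<Sum>y\<in>nb x. of_real (pker \<mu> x y) * f y * of_real (m y))"
    unfolding markov_def by (rule infsum_nb) (simp add: pker_def \<mu>_zero)
  also have "\<dots> = mk f x"
    unfolding mk_def by (intro sum.cong refl) (simp add: pker_def scaleR_conv_of_real)
  finally show "markov \<mu> f x = mk f x" .
qed

lemma laplacian_eq: "laplacian \<mu> f = (\<lambda>x. f x - mk f x)"
  by (simp add: laplacian_def markov_eq)

lemma pker_iter_Suc: "pker_iter \<mu> (Suc k) x y = mk (\<lambda>z. pker_iter \<mu> k z y) x"
proof -
  have "pker_iter \<mu> (Suc k) x y = (\<Sum>z\<in>nb x. pker \<mu> x z * pker_iter \<mu> k z y * m z)"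
    by (simp, rule infsum_nb) (simp add: pker_def \<mu>_zero)
  also have "\<dots> = mk (\<lambda>z. pker_iter \<mu> k z y) x"
    unfolding mk_def by (intro sum.cong refl) (simp add: pker_def)
  finally show ?thesis .
qed

abbreviation "p \<equiv> pker_iter \<mu>"

lemma p_iter: "(\<lambda>x. p k x y) = (mk ^^ k) (\<lambda>x. p 0 x y)"
proof (induction k)
  case (Suc k)
  have "(\<lambda>x. p (Suc k) x y) = mk (\<lambda>z. p k z y)" by (intro ext pker_iter_Suc)
  then show ?case by (simp only: Suc funpow.simps o_apply)
qed (simp only: funpow_0)

lemma gradient_sq: "(gradient \<mu> f x)\<^sup>2 = (\<Sum>y\<in>nb x. \<mu> x y / m x * (cmod (f x - f y))\<^sup>2)"
proof -
  have "(\<Sum>\<^sub>\<infinity>y. pker \<mu> x y * (cmod (f x - f y))\<^sup>2 * m y) = (\<Sum>y\<in>nb x. pker \<mu> x y * (cmod (f x - f y))\<^sup>2 * m y)"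
    by (rule infsum_nb) (simp add: pker_def \<mu>_zero)
  also have "\<dots> = (\<Sum>y\<in>nb x. \<mu> x y / m x * (cmod (f x - f y))\<^sup>2)"
    by (intro sum.cong refl) (simp add: pker_def)
  finally show ?thesis unfolding gradient_def by (simp add: sum_nonneg)
qed

lemma gradient_nonneg [simp]: "0 \<le> gradient \<mu> f x"
  unfolding gradient_def
  by (intro real_sqrt_ge_zero infsum_nonneg mult_nonneg_nonneg) (auto simp: pker_def)

text \<open>As a Euclidean norm over the neighbours, the gradient obeys Minkowski's inequality,
  which gives its sublinearity.\<close>

lemma gradient_L2: "gradient \<mu> f x = L2_set (\<lambda>y. sqrt (\<mu> x y / m x) * cmod (f x - f y)) (nb x)"
proof -
  have "gradient \<mu> f x = sqrt ((gradient \<mu> f x)\<^sup>2)" by simp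
  then show ?thesis unfolding gradient_sq L2_set_def by (simp add: power_mult_distrib)
qed

lemma gradient_sum_le:
  assumes "finite I"
  shows "gradient \<mu> (\<lambda>x. \<Sum>i\<in>I. c i * f i x) x \<le> (\<Sum>i\<in>I. cmod (c i) * gradient \<mu> (f i) x)"
proof -
  have add: "gradient \<mu> (\<lambda>x. f x + g x) x \<le> gradient \<mu> f x + gradient \<mu> g x" for f g
  proof -
    have "gradient \<mu> (\<lambda>x. f x + g x) x \<le> L2_set (\<lambda>y. sqrt (\<mu> x y / m x) * cmod (f x - f y) + sqrt (\<mu> x y / m x) * cmod (g x - g y)) (nb x)"
      unfolding gradient_L2 distrib_left[symmetric]
    proof (rule L2_set_mono)
      fix y
      have "cmod (f x + g x - (f y + g y)) \<le> cmod (f x - f y) + cmod (g x - g y)"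
        using norm_triangle_ineq[of "f x - f y" "g x - g y"] by (simp add: algebra_simps)
      then show "sqrt (\<mu> x y / m x) * cmod (f x + g x - (f y + g y)) \<le> sqrt (\<mu> x y / m x) * (cmod (f x - f y) + cmod (g x - g y))"
        by (intro mult_left_mono) auto
    qed auto
    also have "\<dots> \<le> gradient \<mu> f x + gradient \<mu> g x" unfolding gradient_L2 by (rule L2_set_triangle_ineq)
    finally show ?thesis .
  qed
  have scale: "gradient \<mu> (\<lambda>x. c * f x) x = cmod c * gradient \<mu> f x" for c f
  proof -
    have "gradient \<mu> (\<lambda>x. c * f x) x = L2_set (\<lambda>y. cmod c * (sqrt (\<mu> x y / m x) * cmod (f x - f y))) (nb x)"
      unfolding gradient_L2 by (intro L2_set_cong refl) (simp flip: right_diff_distrib add: norm_mult)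
    then show ?thesis unfolding gradient_L2 by (simp add: L2_set_right_distrib)
  qed
  show ?thesis using assms
  proof (induction I)
    case empty
    have "gradient \<mu> (\<lambda>x. 0 * f undefined x) x = 0" unfolding scale by simp
    then show ?case by simp
  next
    case (insert i I)
    show ?case
      using add[of "\<lambda>x. c i * f i x" "\<lambda>x. \<Sum>i\<in>I. c i * f i x"] insert by (simp add: scale)
  qed
qed

lemma gradient_add_le: "gradient \<mu> (\<lambda>x. f x + g x) x \<le> gradient \<mu> f x + gradient \<mu> g x"
  using gradient_sum_le[of "{True, False}" "\<lambda>_. 1" "\<lambda>b. if b then f else g" x] by simp

lemma gradient_diff_le: "\<bar>gradient \<mu> f x - gradient \<mu> g x\<bar> \<le> gradient \<mu> (\<lambda>x. f x - g x) x"
proof -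
  have "gradient \<mu> (\<lambda>x. f x - g x) x = gradient \<mu> (\<lambda>x. g x - f x) x" 
    unfolding gradient_L2 by (intro L2_set_cong refl, subst norm_minus_cancel[symmetric]) (simp add: algebra_simps)
  then show ?thesis
    using gradient_add_le[of "\<lambda>x. f x - g x" g x] gradient_add_le[of "\<lambda>x. g x - f x" f x] by simp
qed

lemma mk_sum: "mk (\<lambda>x. \<Sum>i\<in>I. f i x) = (\<lambda>x. \<Sum>i\<in>I. mk (f i) x)"
  unfolding mk_def by (simp add: scaleR_sum_right sum.swap[of _ I])

lemma iter_mk_sum: "(mk ^^ k) (\<lambda>x. \<Sum>i\<in>I. f i x) = (\<lambda>x. \<Sum>i\<in>I. (mk ^^ k) (f i) x)"
  by (induction k) (simp_all add: mk_sum)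

lemma iter_mk_mult: "(mk ^^ k) (\<lambda>x. f x * c) = (\<lambda>x. (mk ^^ k) f x * c)" for f :: "'a \<Rightarrow> 'b::real_algebra"
proof (induction k)
  case (Suc k)
  have "mk (\<lambda>x. g x * c) = (\<lambda>x. mk g x * c)" for g
    by (rule ext) (simp add: mk_def sum_distrib_right)
  then show ?case using Suc by simp
qed simp

lemma iter_mk_of_real: "(mk ^^ k) (\<lambda>x. of_real (f x) :: 'b::real_algebra_1) = (\<lambda>x. of_real ((mk ^^ k) f x))"
proof (induction k)
  case (Suc k)
  have "mk (\<lambda>x. of_real (g x) :: 'b) = (\<lambda>x. of_real (mk g x))" for g :: "'a \<Rightarrow> real"
  proof
    show "mk (\<lambda>x. of_real (g x) :: 'b) x = of_real (mk g x)" for x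
      unfolding mk_def of_real_sum by (intro sum.cong refl) (simp add: scaleR_conv_of_real flip: of_real_mult)
  qed
  then show ?case using Suc by simp
qed simp

lemma mk_one: "mk (\<lambda>_. 1 :: real) x = 1"
  unfolding mk_def m_eq[of x] using m_pos[of x] by (simp flip: sum_divide_distrib add: m_eq)

lemma mk_mono: "(\<And>y. f y \<le> g y) \<Longrightarrow> mk f x \<le> mk g x" for f :: "'a \<Rightarrow> real"
  unfolding mk_def by (intro sum_mono scaleR_left_mono) simp_all

lemma mk_nonneg: "(\<And>y. 0 \<le> f y) \<Longrightarrow> 0 \<le> mk f x" for f :: "'a \<Rightarrow> real"
  unfolding mk_def by (intro sum_nonneg) simp

lemma p_nonneg [simp]: "0 \<le> p k x y"
proof (induction k arbitrary: x)
  case (Suc k)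
  then show ?case unfolding pker_iter_Suc by (intro mk_nonneg)
qed simp

text \<open>Finite propagation speed: one application of \<open>mk\<close> reads only values at
  distance at most 1.\<close>

lemma iter_mk_local:
  assumes "\<And>y. d x y \<le> k \<Longrightarrow> f y = g y" shows "(mk ^^ k) f x = (mk ^^ k) g x"
  using assms
proof (induction k arbitrary: x)
  case (Suc k)
  have "(mk ^^ k) f y = (mk ^^ k) g y" if "y \<in> nb x" for y
  proof (rule Suc.IH)
    fix z assume "d y z \<le> k"
    then show "f z = g z" using d_triangle[of x z y] d_nb[OF that] by (intro Suc.prems) simp
  qed
  then show ?case unfolding funpow.simps o_apply mk_def[of "(mk ^^ k) _"] by simp
qed simp

lemma p_zero: "d x y > k \<Longrightarrow> p k x y = 0"
proof -
  assume "d x y > k"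
  then have "(mk ^^ k) (\<lambda>x. p 0 x y) x = (mk ^^ k) (\<lambda>_. 0) x"
    by (intro iter_mk_local) auto
  moreover have "(mk ^^ k) (\<lambda>_. 0 :: real) x = 0" using iter_mk_mult[of k "\<lambda>_. 0 :: real" 0] by (simp add: fun_eq_iff)
  ultimately show ?thesis using p_iter[of k y] by (metis (no_types))
qed

lemma iter_mk_kernel:
  fixes f :: "'a \<Rightarrow> 'b::real_algebra_1"
  assumes "finite F" "\<And>y. y \<notin> F \<Longrightarrow> f y = 0"
  shows "(mk ^^ k) f x = (\<Sum>y\<in>F. of_real (p k x y * m y) * f y)"
proof -
  have "f = (\<lambda>x. \<Sum>y\<in>F. of_real (p 0 x y) * (of_real (m y) * f y))"
  proof
    fix x
    have "(\<Sum>y\<in>F. of_real (p 0 x y) * (of_real (m y) * f y)) = (\<Sum>y\<in>F. if y = x then f y else 0)"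
      by (intro sum.cong refl) (simp flip: of_real_mult mult.assoc)
    then show "f x = (\<Sum>y\<in>F. of_real (p 0 x y) * (of_real (m y) * f y))" using assms by simp
  qed
  then have "(mk ^^ k) f x = (mk ^^ k) (\<lambda>x. \<Sum>y\<in>F. of_real (p 0 x y) * (of_real (m y) * f y)) x" by simp
  also have "\<dots> = (\<Sum>y\<in>F. of_real (p k x y) * (of_real (m y) * f y))"
    unfolding iter_mk_sum iter_mk_mult iter_mk_of_real p_iter[of k, THEN fun_cong] by simp
  finally show ?thesis by (simp add: mult.assoc)
qed

subsection \<open>The Markov operator on square summable functions\<close>

text \<open>Exchange of the two sums together with symmetry of the weight; the right side runs over
  the neighbours because these are the points that the averages read.\<close>

lemma sum_mk_le:
  fixes f :: "'a \<Rightarrow> real"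
  assumes f: "\<And>y. 0 \<le> f y" and F: "finite F"
  shows "(\<Sum>x\<in>F. mk f x * m x) \<le> (\<Sum>y\<in>(\<Union>x\<in>F. nb x). f y * m y)"
proof -
  let ?G = "\<Union>x\<in>F. nb x"
  have G: "finite ?G" using F by simp
  have "(\<Sum>x\<in>F. mk f x * m x) = (\<Sum>x\<in>F. \<Sum>y\<in>nb x. \<mu> x y * f y)"
    unfolding mk_def by (intro sum.cong refl) (simp add: sum_distrib_right)
  also have "\<dots> = (\<Sum>x\<in>F. \<Sum>y\<in>?G. \<mu> x y * f y)"
    using G by (intro sum.cong refl sum.mono_neutral_left) (auto simp: \<mu>_zero)
  also have "\<dots> = (\<Sum>y\<in>?G. \<Sum>x\<in>F. \<mu> x y * f y)" by (rule sum.swap)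
  also have "\<dots> \<le> (\<Sum>y\<in>?G. f y * m y)"
  proof (rule sum_mono)
    fix y
    have "(\<Sum>x\<in>F. \<mu> x y) = (\<Sum>x\<in>F \<inter> nb y. \<mu> y x)"
      using F by (simp add: \<mu>_sym[of _ y]) (intro sum.mono_neutral_right; auto simp: \<mu>_zero)
    also have "\<dots> \<le> m y" unfolding m_eq by (intro sum_mono2) auto
    finally show "(\<Sum>x\<in>F. \<mu> x y * f y) \<le> f y * m y"
      using mult_right_mono[OF _ f[of y], of "\<Sum>x\<in>F. \<mu> x y" "m y"] by (simp add: sum_distrib_right sum_distrib_left mult.commute)
  qed
  finally show ?thesis .
qed

text \<open>Jensen's inequality for the square, by Cauchy-Schwarz with weights of total mass
  1.\<close>

lemma cmod_mk_sq: "(cmod (mk f x))\<^sup>2 \<le> mk (\<lambda>y. (cmod (f y))\<^sup>2) x"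
proof -
  have w: "(\<Sum>y\<in>nb x. \<mu> x y / m x) = 1" using mk_one[of x] by (simp add: mk_def)
  have "cmod (mk f x) \<le> (\<Sum>y\<in>nb x. \<mu> x y / m x * cmod (f y))"
    unfolding mk_def by (rule order_trans[OF norm_sum]) (simp add: scaleR_conv_of_real norm_mult norm_divide)
  also have "\<dots> = (\<Sum>y\<in>nb x. sqrt (\<mu> x y / m x) * (sqrt (\<mu> x y / m x) * cmod (f y)))"
    by (intro sum.cong refl) (simp flip: mult.assoc)
  also have "\<dots> \<le> L2_set (\<lambda>y. sqrt (\<mu> x y / m x)) (nb x) * L2_set (\<lambda>y. sqrt (\<mu> x y / m x) * cmod (f y)) (nb x)"
    by (rule order_trans[OF _ L2_set_mult_ineq]) simp
  also have "L2_set (\<lambda>y. sqrt (\<mu> x y / m x)) (nb x) = 1" by (simp add: L2_set_def w)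
  finally have "cmod (mk f x) \<le> L2_set (\<lambda>y. sqrt (\<mu> x y / m x) * cmod (f y)) (nb x)" by simp
  then have "(cmod (mk f x))\<^sup>2 \<le> (L2_set (\<lambda>y. sqrt (\<mu> x y / m x) * cmod (f y)) (nb x))\<^sup>2" by (intro power_mono) auto
  also have "\<dots> = mk (\<lambda>y. (cmod (f y))\<^sup>2) x"
    unfolding L2_set_def mk_def by (subst real_sqrt_pow2) (auto intro!: sum_nonneg simp: power_mult_distrib)
  finally show ?thesis .
qed

lemma Lp2_sum_le: "f \<in> Lp m 2 \<Longrightarrow> finite F \<Longrightarrow> (\<Sum>x\<in>F. (norm (f x))\<^sup>2 * m x) \<le> (Lp_norm m 2 f)\<^sup>2"
  unfolding Lp2_norm_sq Lp2_iff by (rule finite_sum_le_infsum) auto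

lemma Lp2_leI:
  assumes "\<And>F. finite F \<Longrightarrow> (\<Sum>x\<in>F. (norm (f x))\<^sup>2 * m x) \<le> b\<^sup>2" "0 \<le> b"
  shows "f \<in> Lp m 2" "Lp_norm m 2 f \<le> b"
proof -
  show f: "f \<in> Lp m 2" unfolding Lp2_iff
    by (rule nonneg_bdd_above_summable_on) (use assms in \<open>auto intro!: bdd_aboveI\<close>)
  have "(Lp_norm m 2 f)\<^sup>2 \<le> b\<^sup>2" unfolding Lp2_norm_sq
    by (rule infsum_le_finite_sums) (use f assms in \<open>auto simp: Lp2_iff\<close>)
  then show "Lp_norm m 2 f \<le> b" using assms(2) power2_le_imp_le by blast
qed

lemma mk_Lp:
  fixes f :: "'a \<Rightarrow> complex"
  assumes f: "f \<in> Lp m 2" shows "mk f \<in> Lp m 2" "Lp_norm m 2 (mk f) \<le> Lp_norm m 2 f"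
proof -
  have "(\<Sum>x\<in>F. (norm (mk f x))\<^sup>2 * m x) \<le> (Lp_norm m 2 f)\<^sup>2" if "finite F" for F
  proof -
    have "(\<Sum>x\<in>F. (norm (mk f x))\<^sup>2 * m x) \<le> (\<Sum>x\<in>F. mk (\<lambda>y. (cmod (f y))\<^sup>2) x * m x)"
      by (intro sum_mono mult_right_mono cmod_mk_sq) auto
    also have "\<dots> \<le> (\<Sum>y\<in>(\<Union>x\<in>F. nb x). (cmod (f y))\<^sup>2 * m y)"
      by (rule sum_mk_le[OF _ that]) simp
    also have "\<dots> \<le> (Lp_norm m 2 f)\<^sup>2" by (rule Lp2_sum_le[OF f]) (use that in simp)
    finally show ?thesis .
  qed
  from Lp2_leI[OF this] show "mk f \<in> Lp m 2" "Lp_norm m 2 (mk f) \<le> Lp_norm m 2 f" by simp_all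
qed

lemma iter_mk_Lp:
  fixes f :: "'a \<Rightarrow> complex"
  assumes f: "f \<in> Lp m 2" shows "(mk ^^ k) f \<in> Lp m 2 \<and> Lp_norm m 2 ((mk ^^ k) f) \<le> Lp_norm m 2 f"
  by (induction k) (use f mk_Lp order_trans in force)+

text \<open>Fubini for \<open>\<mu> x y * f y * cnj (g x)\<close>, which is absolutely summable: its
  modulus is at most \<open>\<mu> x y\<close> times \<open>|f y|^2 + |g x|^2\<close>, and these two
  double sums are the squared norms.\<close>

lemma mk_inner:
  fixes f g :: "'a \<Rightarrow> complex"
  assumes f: "f \<in> Lp m 2" and g: "g \<in> Lp m 2"
  shows "L2_inner m (mk f) g = L2_inner m f (mk g)"
proof -
  have sq: "(\<lambda>(x, y). \<mu> x y * (cmod (g x))\<^sup>2) summable_on UNIV \<times> UNIV" if "g \<in> Lp m 2" for g :: "'a \<Rightarrow> complex"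
  proof (rule summable_on_SigmaI[where g="\<lambda>x. (cmod (g x))\<^sup>2 * m x"])
    show "((\<lambda>y. case (x, y) of (x, y) \<Rightarrow> \<mu> x y * (cmod (g x))\<^sup>2) has_sum (cmod (g x))\<^sup>2 * m x) UNIV" for x
    proof -
      have "((\<lambda>y. \<mu> x y * (cmod (g x))\<^sup>2) has_sum (\<Sum>y\<in>nb x. \<mu> x y * (cmod (g x))\<^sup>2)) (nb x)" by (rule has_sum_finite) simp
      also have "?this \<longleftrightarrow> ((\<lambda>y. \<mu> x y * (cmod (g x))\<^sup>2) has_sum (\<Sum>y\<in>nb x. \<mu> x y * (cmod (g x))\<^sup>2)) UNIV"
        by (rule has_sum_cong_neutral) (auto simp: \<mu>_zero)
      finally show ?thesis by (simp add: m_eq sum_distrib_right mult.commute[of _ "sum _ _"])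
    qed
    show "(\<lambda>x. (cmod (g x))\<^sup>2 * m x) summable_on UNIV" using that by (simp add: Lp2_iff)
  qed auto
  have sw: "(\<lambda>(x, y). \<mu> x y * (cmod (f y))\<^sup>2) summable_on UNIV \<times> UNIV"
  proof -
    have "((\<lambda>(x, y). \<mu> x y * (cmod (f x))\<^sup>2) \<circ> prod.swap) summable_on UNIV \<times> UNIV"
      using sq[OF f] by (subst summable_on_reindex[symmetric]) (simp_all add: inj_on_def product_swap)
    then show ?thesis by (simp add: o_def case_prod_unfold \<mu>_sym[of "snd _" "fst _"])
  qed
  have ab: "(\<lambda>(x, y). cmod (of_real (\<mu> x y) * (f y * cnj (g x)))) summable_on UNIV \<times> UNIV"
  proof (rule summable_on_comparison_test)
    show "(\<lambda>z. (case z of (x, y) \<Rightarrow> \<mu> x y * (cmod (f y))\<^sup>2) + (case z of (x, y) \<Rightarrow> \<mu> x y * (cmod (g x))\<^sup>2)) summable_on UNIV \<times> UNIV"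
      by (rule summable_on_add[OF sw sq[OF g]])
    have "cmod a * cmod b \<le> (cmod a)\<^sup>2 + (cmod b)\<^sup>2" for a b
      using sum_squares_bound[of "cmod a" "cmod b"] mult_nonneg_nonneg[OF norm_ge_zero[of a] norm_ge_zero[of b]] by linarith
    then show "(case z of (x, y) \<Rightarrow> cmod (of_real (\<mu> x y) * (f y * cnj (g x))))
      \<le> (case z of (x, y) \<Rightarrow> \<mu> x y * (cmod (f y))\<^sup>2) + (case z of (x, y) \<Rightarrow> \<mu> x y * (cmod (g x))\<^sup>2)" for z
      by (cases z) (simp add: norm_mult mult_left_mono flip: distrib_left)
  qed auto
  have sum: "(\<lambda>(x, y). of_real (\<mu> x y) * (f y * cnj (g x))) summable_on UNIV \<times> UNIV"
  proof (rule abs_summable_summable)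
    show "(\<lambda>z. cmod (case z of (x, y) \<Rightarrow> of_real (\<mu> x y) * (f y * cnj (g x)))) summable_on UNIV \<times> UNIV"
      using ab by (simp add: case_prod_unfold)
  qed
  have 1: "mk f x * cnj (g x) * of_real (m x) = (\<Sum>\<^sub>\<infinity>y. of_real (\<mu> x y) * (f y * cnj (g x)))" for x
    by (subst infsum_nb[of x]) (auto simp: \<mu>_zero mk_def scaleR_conv_of_real sum_distrib_right intro!: sum.cong)
  have 2: "f y * cnj (mk g y) * of_real (m y) = (\<Sum>\<^sub>\<infinity>x. of_real (\<mu> x y) * (f y * cnj (g x)))" for y
    by (subst infsum_nb[of y]) (auto simp: \<mu>_sym[of _ y] \<mu>_zero mk_def scaleR_conv_of_real sum_distrib_right sum_distrib_left intro!: sum.cong)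
  show ?thesis unfolding L2_inner_def 1 2
    by (rule infsum_swap_banach) (use sum in simp)
qed

text \<open>Expanding the square gives the pointwise identity
  \<open>|grad f|^2 + 2 Re (P f * cnj f) = |f|^2 + P |f|^2\<close>; the last term is then summed
  with \<open>sum_mk_le\<close>.\<close>

lemma sum_gradient_le:
  fixes f :: "'a \<Rightarrow> complex"
  assumes f: "f \<in> Lp m 2" and F: "finite F"
  shows "(\<Sum>x\<in>F. (gradient \<mu> f x)\<^sup>2 * m x) + (\<Sum>x\<in>F. 2 * Re (mk f x * cnj (f x)) * m x)
     \<le> (\<Sum>x\<in>F. (cmod (f x))\<^sup>2 * m x) + (Lp_norm m 2 f)\<^sup>2"
proof -
  have "(gradient \<mu> f x)\<^sup>2 * m x + 2 * Re (mk f x * cnj (f x)) * m x = (cmod (f x))\<^sup>2 * m x + mk (\<lambda>y. (cmod (f y))\<^sup>2) x * m x" for x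
  proof -
    have e: "\<mu> x y / m x * (cmod (f x - f y))\<^sup>2 = \<mu> x y / m x * (cmod (f x))\<^sup>2 + \<mu> x y / m x * (cmod (f y))\<^sup>2
        - 2 * Re (((\<mu> x y / m x) *\<^sub>R f y) * cnj (f x))" for y
      by (simp add: cmod_power2 power2_diff algebra_simps add_divide_distrib diff_divide_distrib)
    have "(gradient \<mu> f x)\<^sup>2 = (\<Sum>y\<in>nb x. \<mu> x y / m x) * (cmod (f x))\<^sup>2 + mk (\<lambda>y. (cmod (f y))\<^sup>2) x - 2 * Re (mk f x * cnj (f x))"
      unfolding gradient_sq e
      by (simp add: sum.distrib sum_subtractf mk_def sum_distrib_left sum_distrib_right del: of_real_divide)
    also have "(\<Sum>y\<in>nb x. \<mu> x y / m x) = 1" using mk_one[of x] by (simp add: mk_def)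
    finally have "(gradient \<mu> f x)\<^sup>2 + 2 * Re (mk f x * cnj (f x)) = (cmod (f x))\<^sup>2 + mk (\<lambda>y. (cmod (f y))\<^sup>2) x" by simp
    then show ?thesis by (simp only: distrib_right[symmetric])
  qed
  then have "(\<Sum>x\<in>F. (gradient \<mu> f x)\<^sup>2 * m x) + (\<Sum>x\<in>F. 2 * Re (mk f x * cnj (f x)) * m x)
      = (\<Sum>x\<in>F. (cmod (f x))\<^sup>2 * m x) + (\<Sum>x\<in>F. mk (\<lambda>y. (cmod (f y))\<^sup>2) x * m x)"
    by (simp flip: sum.distrib)
  moreover have "(\<Sum>x\<in>F. mk (\<lambda>y. (cmod (f y))\<^sup>2) x * m x) \<le> (Lp_norm m 2 f)\<^sup>2"
    using sum_mk_le[of "\<lambda>y. (cmod (f y))\<^sup>2" F] Lp2_sum_le[OF f, of "\<Union>x\<in>F. nb x"] F by simp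
  ultimately show ?thesis by simp
qed

lemma laplacian_Lp: "f \<in> Lp m 2 \<Longrightarrow> laplacian \<mu> f \<in> Lp m 2"
  unfolding laplacian_eq by (intro emb_diff mk_Lp)

lemma laplacian_norm_le:
  assumes f: "f \<in> Lp m 2" shows "Lp_norm m 2 (laplacian \<mu> f) \<le> 2 * Lp_norm m 2 f"
proof -
  have "Lp_norm m 2 (laplacian \<mu> f) = norm (emb f - emb (mk f))"
    using emb_diff[OF f mk_Lp(1)[OF f]] by (simp add: laplacian_eq flip: norm_emb)
  also have "\<dots> \<le> norm (emb f) + norm (emb (mk f))" by (rule norm_triangle_ineq4)
  also have "\<dots> \<le> 2 * Lp_norm m 2 f" using mk_Lp[OF f] f by (simp add: norm_emb)
  finally show ?thesis .
qed

lemma laplacian_inner: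
  assumes f: "f \<in> Lp m 2"
  shows "Re (L2_inner m (laplacian \<mu> f) f) = (Lp_norm m 2 f)\<^sup>2 - inner (emb (mk f)) (emb f)"
  unfolding L2_inner_emb[OF laplacian_Lp[OF f] f] unfolding laplacian_eq emb_diff(2)[OF f mk_Lp(1)[OF f]]
  by (simp add: inner_diff_left norm_emb f flip: power2_norm_eq_inner)

lemma gradient_energy:
  fixes f :: "'a \<Rightarrow> complex"
  assumes f: "f \<in> Lp m 2"
  shows "gradient \<mu> f \<in> Lp m 2" "(Lp_norm m 2 (gradient \<mu> f))\<^sup>2 \<le> 2 * Re (L2_inner m (laplacian \<mu> f) f)"
proof -
  let ?n = "(Lp_norm m 2 f)\<^sup>2"
  let ?h = "\<lambda>x. Re (mk f x * cnj (f x)) * m x"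
  have hs: "(?h has_sum inner (emb (mk f)) (emb f)) UNIV"
  proof -
    have "?h x = inner (ell2_fun (emb (mk f)) x) (ell2_fun (emb f) x)" for x
      using m_pos[of x] by (simp add: ell2_fun_emb f mk_Lp(1)[OF f] inner_complex_cnj algebra_simps)
    then show ?thesis using ell2_inner_summable[of "emb (mk f)" "emb f"] unfolding inner_ell2_def by simp
  qed
  let ?I = "inner (emb (mk f)) (emb f)"
  have bound: "(\<Sum>x\<in>F. (gradient \<mu> f x)\<^sup>2 * m x) \<le> 2 * (?n - ?I)" if F: "finite F" for F
  proof (rule field_le_epsilon)
    fix e :: real assume e: "e > 0"
    \<comment> \<open>The finite set is enlarged until the cross term is within \<open>e / 2\<close>
      of its total; enlarging it can only increase the sum of squared gradients.\<close>
    have "eventually (\<lambda>G. dist (sum ?h G) ?I < e / 2) (finite_subsets_at_top UNIV)"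
      using hs e by (intro tendstoD) (auto simp: has_sum_def)
    then obtain G0 where G0: "finite G0" "\<And>G. finite G \<Longrightarrow> G0 \<subseteq> G \<Longrightarrow> dist (sum ?h G) ?I < e / 2"
      unfolding eventually_finite_subsets_at_top by auto
    let ?G = "F \<union> G0"
    have G: "finite ?G" using F G0(1) by simp
    have "(\<Sum>x\<in>F. (gradient \<mu> f x)\<^sup>2 * m x) \<le> (\<Sum>x\<in>?G. (gradient \<mu> f x)\<^sup>2 * m x)"
      using G by (intro sum_mono2) auto
    also have "\<dots> \<le> (\<Sum>x\<in>?G. (cmod (f x))\<^sup>2 * m x) + ?n - 2 * sum ?h ?G"
      using sum_gradient_le[OF f G] by (simp only: sum_distrib_left mult.assoc)
    also have "(\<Sum>x\<in>?G. (cmod (f x))\<^sup>2 * m x) \<le> ?n" by (rule Lp2_sum_le[OF f G])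
    also have "?n + ?n - 2 * sum ?h ?G \<le> 2 * (?n - ?I) + e"
      using G0(2)[OF G] by (simp add: dist_real_def abs_if split: if_splits)
    finally show "(\<Sum>x\<in>F. (gradient \<mu> f x)\<^sup>2 * m x) \<le> 2 * (?n - ?I) + e" by simp
  qed
  have nn: "0 \<le> 2 * (?n - ?I)" using bound[of "{}"] by simp
  have *: "(\<Sum>x\<in>F. (norm (gradient \<mu> f x))\<^sup>2 * m x) \<le> (sqrt (2 * (?n - ?I)))\<^sup>2" if "finite F" for F
    using bound[OF that] nn by simp
  show "gradient \<mu> f \<in> Lp m 2" using Lp2_leI(1)[OF *] nn by simp
  have "Lp_norm m 2 (gradient \<mu> f) \<le> sqrt (2 * (?n - ?I))" using Lp2_leI(2)[OF *] nn by simp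
  then have "(Lp_norm m 2 (gradient \<mu> f))\<^sup>2 \<le> (sqrt (2 * (?n - ?I)))\<^sup>2" by (intro power_mono) auto
  then show "(Lp_norm m 2 (gradient \<mu> f))\<^sup>2 \<le> 2 * Re (L2_inner m (laplacian \<mu> f) f)"
    using nn by (simp add: laplacian_inner[OF f])
qed

text \<open>Self-adjointness of the iterates, tested on the normalized point masses
  \<open>\<delta> z\<close>: the inner product with \<open>\<delta> z\<close> evaluates a function
  at \<open>z\<close>.\<close>

lemma p_sym: "p k x y = p k y x"
proof -
  define \<delta> where "\<delta> z w = complex_of_real (p 0 w z)" for z w
  have fin: "f \<in> Lp m 2" if "finite {x. f x \<noteq> 0}" for f :: "'a \<Rightarrow> complex"
  proof -
    have "(\<lambda>x. (norm (f x))\<^sup>2 * m x) summable_on UNIV \<longleftrightarrow> (\<lambda>x. (norm (f x))\<^sup>2 * m x) summable_on {x. f x \<noteq> 0}"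
      by (rule summable_on_cong_neutral) auto
    then show ?thesis using that by (simp add: Lp2_iff)
  qed
  have \<delta>: "\<delta> z \<in> Lp m 2" for z
    by (rule fin, rule finite_subset[of _ "{z}"]) (auto simp: \<delta>_def)
  have it: "(mk ^^ k) (\<delta> z) w = of_real (p k w z)" for k z w
  proof -
    have "\<delta> z = (\<lambda>w. of_real (p 0 w z))" by (rule ext) (rule \<delta>_def)
    then show ?thesis using p_iter[of k z, THEN fun_cong, of w] by (simp only: iter_mk_of_real)
  qed
  have inn: "L2_inner m f (\<delta> z) = f z" for f z
  proof -
    have "L2_inner m f (\<delta> z) = (\<Sum>\<^sub>\<infinity>w\<in>{z}. f w * cnj (\<delta> z w) * of_real (m w))"
      unfolding L2_inner_def by (rule infsum_cong_neutral) (auto simp: \<delta>_def)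
    then show ?thesis by (simp add: \<delta>_def)
  qed
  have self: "L2_inner m ((mk ^^ k) f) g = L2_inner m f ((mk ^^ k) g)" if "f \<in> Lp m 2" "g \<in> Lp m 2" for f g :: "'a \<Rightarrow> complex" and k
    using that
  proof (induction k arbitrary: g)
    case (Suc k)
    have "L2_inner m ((mk ^^ Suc k) f) g = L2_inner m ((mk ^^ k) f) (mk g)"
      using mk_inner[of "(mk ^^ k) f" g] iter_mk_Lp Suc.prems by simp
    then show ?case using Suc mk_Lp by (simp add: funpow_swap1)
  qed simp
  have "L2_inner m (\<delta> y) ((mk ^^ k) (\<delta> x)) = of_real (p k y x)"
  proof -
    have "L2_inner m (\<delta> y) ((mk ^^ k) (\<delta> x)) = (\<Sum>\<^sub>\<infinity>w\<in>{y}. \<delta> y w * cnj ((mk ^^ k) (\<delta> x) w) * of_real (m w))"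
      unfolding L2_inner_def by (rule infsum_cong_neutral) (auto simp: \<delta>_def)
    then show ?thesis by (simp add: it) (simp add: \<delta>_def)
  qed
  moreover have "L2_inner m ((mk ^^ k) (\<delta> y)) (\<delta> x) = of_real (p k x y)" by (simp add: inn it)
  ultimately show ?thesis using self[OF \<delta> \<delta>] by simp
qed

end

section \<open>Gradient estimates for the heat kernel\<close>

subsection \<open>Elementary inequalities\<close>

text \<open>By \<open>exp x >= (x / N)^N\<close>, with \<open>N\<close> chosen so that
  \<open>2 A < 2^N\<close>, the double exponential beats the geometric growth by a factor
  \<open>2^j\<close>.\<close>

lemma double_exp_summable:
  fixes b A :: real
  assumes "b > 0" "A \<ge> 1" shows "summable (\<lambda>j. exp (- b * 2 ^ j) * A ^ j)"
proof -
  obtain N where N: "2 * A < 2 ^ N" using real_arch_pow[of 2 "2 * A"] by auto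
  have N0: "N > 0" using N assms by (cases N) auto
  have bound: "exp (- b * 2 ^ j) * A ^ j \<le> (real N / b) ^ N * (1 / 2) ^ j" for j
  proof -
    have "b * 2 ^ j / real N \<le> exp (b * 2 ^ j / real N)"
      using exp_ge_add_one_self[of "b * 2 ^ j / real N"] by linarith
    then have "(b * 2 ^ j / real N) ^ N \<le> exp (b * 2 ^ j / real N) ^ N"
      using assms by (intro power_mono) auto
    also have "\<dots> = exp (b * 2 ^ j)" using N0 by (simp flip: exp_of_nat_mult)
    finally have "1 / exp (b * 2 ^ j) \<le> 1 / (b * 2 ^ j / real N) ^ N"
      using assms N0 by (intro divide_left_mono) auto
    then have "exp (- b * 2 ^ j) \<le> (real N / b) ^ N * (1 / 2 ^ N) ^ j"
      by (simp add: exp_minus inverse_eq_divide power_divide power_mult_distrib flip: power_mult) (simp add: mult.commute)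
    then have "exp (- b * 2 ^ j) * A ^ j \<le> (real N / b) ^ N * (1 / 2 ^ N) ^ j * A ^ j"
      using assms by (intro mult_right_mono) auto
    also have "\<dots> = (real N / b) ^ N * (A / 2 ^ N) ^ j" by (simp add: power_divide)
    also have "\<dots> \<le> (real N / b) ^ N * (1 / 2) ^ j"
      using N assms by (intro mult_left_mono power_mono) (auto simp: field_simps)
    finally show ?thesis .
  qed
  show ?thesis
  proof (rule summable_comparison_test')
    show "summable (\<lambda>j. (real N / b) ^ N * (1 / 2) ^ j)" by (intro summable_mult summable_geometric) simp
    show "norm (exp (- b * 2 ^ j) * A ^ j) \<le> (real N / b) ^ N * (1 / 2) ^ j" for j
      using bound[of j] assms by simp
  qed
qed

text \<open>Raise \<open>c x / s <= exp (c x / s)\<close> to the power \<open>s\<close>.\<close>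

lemma powr_exp_bounded:
  fixes c s :: real
  assumes "c > 0" "s > 0" shows "\<exists>K>0. \<forall>x>0. x powr s * exp (- c * x) \<le> K"
proof (intro exI conjI allI impI)
  show "(s / c) powr s > 0" using assms by simp
  fix x :: real assume x: "x > 0"
  have "c * x / s \<le> exp (c * x / s)" using exp_ge_add_one_self[of "c * x / s"] by linarith
  then have "(c * x / s) powr s \<le> exp (c * x / s) powr s" using assms x by (intro powr_mono2) auto
  also have "\<dots> = exp (c * x)" using assms by (simp add: powr_def)
  finally have "(c * x / s) powr s * (s / c) powr s \<le> exp (c * x) * (s / c) powr s" by (intro mult_right_mono) auto
  moreover have "(c * x / s) powr s * (s / c) powr s = x powr s"
    using assms x by (simp flip: powr_mult)
  ultimately have "x powr s * exp (- c * x) \<le> exp (c * x) * (s / c) powr s * exp (- c * x)"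
    by (intro mult_right_mono) auto
  also have "\<dots> = (s / c) powr s" by (simp add: exp_minus field_simps)
  finally show "x powr s * exp (- c * x) \<le> (s / c) powr s" .
qed

text \<open>The convexity defect of \<open>t \<mapsto> t\<^bsup>3/2\<^esup>\<close>.\<close>

definition defect :: "real \<Rightarrow> real \<Rightarrow> real" where
  "defect a b = b * sqrt b - a * sqrt a - 3 / 2 * sqrt a * (b - a)"

text \<open>In the variables \<open>sqrt a\<close> and \<open>sqrt b\<close> the defect is a cubic
  with a double root on the diagonal.\<close>

lemma defect_eq:
  assumes "0 \<le> a" "0 \<le> b" shows "defect a b = (sqrt b - sqrt a)\<^sup>2 * (sqrt b + sqrt a / 2)"
proof -
  define \<alpha> \<gamma> where "\<alpha> = sqrt a" and "\<gamma> = sqrt b"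
  have "a = \<alpha> * \<alpha>" "b = \<gamma> * \<gamma>" using assms by (simp_all add: \<alpha>_def \<gamma>_def)
  then show ?thesis
    unfolding defect_def \<alpha>_def[symmetric] \<gamma>_def[symmetric]
    by (simp add: power2_eq_square field_simps)
qed

lemma defect_nonneg: "0 \<le> a \<Longrightarrow> 0 \<le> b \<Longrightarrow> 0 \<le> defect a b"
  by (simp add: defect_eq)

lemma defect_zero [simp]: "defect 0 0 = 0"
  by (simp add: defect_def)

text \<open>With \<open>\<alpha> = sqrt a\<close> and \<open>\<gamma> = sqrt b\<close> the left side
  is \<open>(\<gamma> - \<alpha>)^2 (\<alpha> + \<gamma>)^2\<close>, and one factor
  \<open>\<alpha> + \<gamma>\<close> is at most twice the factor
  \<open>\<gamma> + \<alpha> / 2\<close> of the defect.\<close>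

lemma sq_diff_le_defect:
  assumes "0 \<le> a" "0 \<le> b" shows "(b - a)\<^sup>2 \<le> 2 * (sqrt a + sqrt b) * defect a b"
proof -
  define \<alpha> \<gamma> where "\<alpha> = sqrt a" and "\<gamma> = sqrt b"
  have e: "a = \<alpha> * \<alpha>" "b = \<gamma> * \<gamma>" and pos: "0 \<le> \<alpha>" "0 \<le> \<gamma>" using assms by (simp_all add: \<alpha>_def \<gamma>_def)
  have "(b - a)\<^sup>2 = (\<gamma> - \<alpha>)\<^sup>2 * ((\<alpha> + \<gamma>) * (\<alpha> + \<gamma>))"
    unfolding e by (simp add: power2_eq_square algebra_simps)
  also have "\<dots> \<le> (\<gamma> - \<alpha>)\<^sup>2 * ((\<alpha> + \<gamma>) * (2 * (\<gamma> + \<alpha> / 2)))"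
    using pos by (intro mult_left_mono) auto
  also have "\<dots> = 2 * (\<alpha> + \<gamma>) * ((\<gamma> - \<alpha>)\<^sup>2 * (\<gamma> + \<alpha> / 2))" by (simp only: mult_ac)
  finally show ?thesis unfolding defect_eq[OF assms] \<alpha>_def[symmetric] \<gamma>_def[symmetric] .
qed

subsection \<open>Coefficients of the inverse square root\<close>

text \<open>These are \<open>binomial(2 l, l) / 4^l\<close>, the Taylor coefficients of
  \<open>(1 - x)^(-1/2)\<close>; the recursion yields their monotonicity and size directly.\<close>

fun isqrt_coeff :: "nat \<Rightarrow> real" where
  "isqrt_coeff 0 = 1"
| "isqrt_coeff (Suc l) = isqrt_coeff l * ((2 * real l + 1) / (2 * real l + 2))"

lemma isqrt_coeff_pos: "0 < isqrt_coeff l"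
  by (induction l) auto

text \<open>The induction step is \<open>(2 l + 1)(2 l + 3) <= (2 l + 2)^2\<close>.\<close>

lemma isqrt_coeff_sq: "(isqrt_coeff l)\<^sup>2 * (2 * real l + 1) \<le> 1"
proof (induction l)
  case (Suc l)
  have "(2 * real l + 1) * (2 * real l + 3) \<le> (2 * real l + 2)\<^sup>2" by (simp add: power2_eq_square algebra_simps)
  then have "(2 * real l + 1) * (2 * real l + 3) / (2 * real l + 2)\<^sup>2 \<le> 1" by (simp add: divide_le_eq_1)
  then have "(isqrt_coeff l)\<^sup>2 * (2 * real l + 1) * ((2 * real l + 1) * (2 * real l + 3) / (2 * real l + 2)\<^sup>2) \<le> 1 * 1"
    using Suc by (intro mult_mono) auto
  moreover have e: "2 * real (Suc l) + 1 = 2 * real l + 3" by simp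
  have "(isqrt_coeff (Suc l))\<^sup>2 * (2 * real (Suc l) + 1)
      = (isqrt_coeff l)\<^sup>2 * (2 * real l + 1) * ((2 * real l + 1) * (2 * real l + 3) / (2 * real l + 2)\<^sup>2)"
    unfolding isqrt_coeff.simps e power_mult_distrib power_divide
    by (simp only: power2_eq_square times_divide_eq_left times_divide_eq_right mult_ac)
  ultimately show ?case by simp
qed simp

lemma isqrt_coeff_le: "isqrt_coeff l \<le> 1 / sqrt (2 * real l + 1)"
proof -
  have "(isqrt_coeff l)\<^sup>2 \<le> (1 / sqrt (2 * real l + 1))\<^sup>2"
    using isqrt_coeff_sq[of l] by (simp add: power_divide field_simps)
  then show ?thesis by (rule power2_le_imp_le) simp
qed

lemma isqrt_coeff_le': assumes "l \<ge> 1" shows "isqrt_coeff l \<le> 1 / sqrt (real l)"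
  by (rule order_trans[OF isqrt_coeff_le]) (use assms in \<open>intro divide_left_mono real_sqrt_le_mono mult_pos_pos; simp\<close>)

lemma isqrt_coeff_step: "isqrt_coeff l - isqrt_coeff (Suc l) = isqrt_coeff l / (2 * real l + 2)"
  by (simp add: field_simps)

lemma isqrt_coeff_antimono: "j \<le> l \<Longrightarrow> isqrt_coeff l \<le> isqrt_coeff j"
proof (rule lift_Suc_antimono_le)
  show "isqrt_coeff (Suc l) \<le> isqrt_coeff l" for l
    using isqrt_coeff_step[of l] isqrt_coeff_pos[of l] divide_nonneg_nonneg[of "isqrt_coeff l" "2 * real l + 2"] by linarith
qed

text \<open>Telescoping: one step of the sequence loses \<open>isqrt_coeff l / (2 l + 2)\<close>, of
  order \<open>l powr (-3/2)\<close>.\<close>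

lemma isqrt_coeff_diff:
  assumes "j \<ge> 1" shows "isqrt_coeff j - isqrt_coeff (j + k) \<le> real k / (2 * real j * sqrt (real j))"
proof -
  have "isqrt_coeff j - isqrt_coeff (j + k) = (\<Sum>i<k. isqrt_coeff (j + i) - isqrt_coeff (Suc (j + i)))"
    by (induction k) auto
  also have "\<dots> \<le> (\<Sum>i<k. 1 / (2 * real j * sqrt (real j)))"
  proof (rule sum_mono)
    fix i
    have "isqrt_coeff (j + i) \<le> 1 / sqrt (real j)"
      using isqrt_coeff_le'[OF assms] isqrt_coeff_antimono[of j "j + i"] by simp
    then have "isqrt_coeff (j + i) / (2 * real (j + i) + 2) \<le> (1 / sqrt (real j)) / (2 * real j)"
      using assms by (intro frac_le) auto
    then show "isqrt_coeff (j + i) - isqrt_coeff (Suc (j + i)) \<le> 1 / (2 * real j * sqrt (real j))"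
      unfolding isqrt_coeff_step by (simp add: mult.commute)
  qed
  also have "\<dots> = real k / (2 * real j * sqrt (real j))" by simp
  finally show ?thesis .
qed

text \<open>Comparison with the telescoping sum of \<open>2 (sqrt (k + 1) - sqrt k)\<close>.\<close>

lemma isqrt_coeff_sum: "(\<Sum>j<k. isqrt_coeff j) \<le> 2 * sqrt (real k)"
proof (induction k)
  case (Suc k)
  have "isqrt_coeff k \<le> 2 * (sqrt (real k + 1) - sqrt (real k))"
  proof -
    let ?s = "sqrt (real k + 1)" and ?t = "sqrt (real k)"
    have st: "?s * ?s = real k + 1" "?t * ?t = real k" "0 < ?s" "0 \<le> ?t" by auto
    have "(?s + ?t)\<^sup>2 \<le> (2 * sqrt (2 * real k + 1))\<^sup>2"
    proof -
      have "2 * (?s * ?t) \<le> ?s * ?s + ?t * ?t" using sum_squares_bound[of ?s ?t] by (simp add: power2_eq_square)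
      then show ?thesis using st by (simp add: power2_eq_square algebra_simps)
    qed
    then have le: "?s + ?t \<le> 2 * sqrt (2 * real k + 1)" by (rule power2_le_imp_le) simp
    have "(?s - ?t) * (?s + ?t) = 1" using st by (simp add: algebra_simps)
    moreover have "?s + ?t \<noteq> 0" using st by linarith
    ultimately have "1 / (?s + ?t) = ?s - ?t" by (metis nonzero_divide_eq_eq)
    moreover have "1 / (2 * sqrt (2 * real k + 1)) \<le> 1 / (?s + ?t)"
      using le st by (intro divide_left_mono mult_pos_pos) (auto intro: add_pos_nonneg)
    ultimately have "1 / sqrt (2 * real k + 1) \<le> 2 * (?s - ?t)" by simp
    then show ?thesis using isqrt_coeff_le[of k] by linarith
  qed
  then show ?case using Suc by (simp add: add.commute)
qed simp

lemma isqrt_coeff_gbinomial: "isqrt_coeff l = (-1) ^ l * ((-1/2) gchoose l)"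
proof (induction l)
  case (Suc l)
  have "(-1/2 :: real) * ((-1/2) gchoose l) = real l * ((-1/2) gchoose l) + real (Suc l) * ((-1/2) gchoose Suc l)"
    by (rule gbinomial_mult_1)
  then have *: "((-1/2 :: real) gchoose Suc l) = (-1/2 - real l) * ((-1/2) gchoose l) / real (Suc l)"
    by (simp add: field_simps)
  show ?case unfolding isqrt_coeff.simps Suc * by (simp add: divide_simps) (simp add: algebra_simps)
qed simp

lemma isqrt_coeff_sums:
  assumes "\<bar>x\<bar> < 1" shows "(\<lambda>l. isqrt_coeff l * x ^ l) sums ((1 - x) powr (-1/2))"
proof -
  have "isqrt_coeff l * x ^ l = ((-1/2) gchoose l) * (- x) ^ l" for l
    by (simp add: isqrt_coeff_gbinomial power_minus[of x])
  then show ?thesis using gen_binomial_real[of "- x" "-1/2"] assms by simp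
qed

text \<open>The induction peels off the first term and subtracts the tail, which obeys the same
  bounds with \<open>b 1\<close> in place of \<open>b 0\<close>.\<close>

lemma alternating_sum_bounds:
  fixes b :: "nat \<Rightarrow> real"
  assumes "\<And>l. 0 \<le> b l" "\<And>l. b (Suc l) \<le> b l"
  shows "0 \<le> (\<Sum>l\<le>n. (-1) ^ l * b l) \<and> (\<Sum>l\<le>n. (-1) ^ l * b l) \<le> b 0"
  using assms
proof (induction n arbitrary: b)
  case (Suc n)
  have "(\<Sum>l\<le>Suc n. (-1) ^ l * b l) = b 0 - (\<Sum>l\<le>n. (-1) ^ l * b (Suc l))"
    by (simp only: sum.atMost_Suc_shift) (simp add: sum_negf)
  moreover have "0 \<le> (\<Sum>l\<le>n. (-1) ^ l * b (Suc l)) \<and> (\<Sum>l\<le>n. (-1) ^ l * b (Suc l)) \<le> b (Suc 0)"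
    by (rule Suc.IH) (rule Suc.prems)+
  ultimately show ?case using Suc.prems(2)[of 0] by linarith
qed simp

text \<open>The partial sum of the series as a polynomial in the Laplacian: \<open>[:1, -1:]\<close>
  evaluates to \<open>1 - t\<close>, that is, to the Markov operator.\<close>

definition isqrt_poly :: "nat \<Rightarrow> real poly" where
  "isqrt_poly n = (\<Sum>l\<le>n. smult (isqrt_coeff l) ([:1, -1:] ^ l))"

lemma poly_isqrt_poly: "poly (isqrt_poly n) t = (\<Sum>l\<le>n. isqrt_coeff l * (1 - t) ^ l)"
  by (simp add: isqrt_poly_def poly_sum poly_power)

lemma isqrt_poly_tendsto:
  assumes "0 < t" "t < 2" shows "(\<lambda>n. t powr (1/2) * poly (isqrt_poly n) t) \<longlonglongrightarrow> 1"
proof -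
  have "(\<lambda>n. \<Sum>l\<le>n. isqrt_coeff l * (1 - t) ^ l) \<longlonglongrightarrow> t powr (-1/2)"
    using isqrt_coeff_sums[of "1 - t"] assms by (simp add: sums_def_le)
  then have "(\<lambda>n. t powr (1/2) * poly (isqrt_poly n) t) \<longlonglongrightarrow> t powr (1/2) * t powr (-1/2)"
    unfolding poly_isqrt_poly by (rule tendsto_mult_left)
  also have "t powr (1/2) * t powr (-1/2) = 1" using assms by (simp flip: powr_add)
  finally show ?thesis .
qed

text \<open>For \<open>t <= 1\<close> the terms are nonnegative and the partial sum is at most the
  full series. For \<open>t > 1\<close> the signs alternate with decreasing moduli, so the sum lies
  between 0 and its first term, and \<open>sqrt t\<close> is at most 2.\<close>

lemma isqrt_poly_bounded:
  assumes "0 < t" "t < 2" shows "\<bar>t powr (1/2) * poly (isqrt_poly n) t\<bar> \<le> 2"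
proof (cases "t \<le> 1")
  case True
  have s: "(\<lambda>l. isqrt_coeff l * (1 - t) ^ l) sums (t powr (-1/2))"
    using isqrt_coeff_sums[of "1 - t"] assms by simp
  have p: "0 \<le> isqrt_coeff l * (1 - t) ^ l" for l using isqrt_coeff_pos[of l] True by simp
  have "poly (isqrt_poly n) t \<le> t powr (-1/2)"
    unfolding poly_isqrt_poly sums_unique[OF s] using s p by (intro sum_le_suminf) (auto simp: sums_iff)
  then have "t powr (1/2) * poly (isqrt_poly n) t \<le> t powr (1/2) * t powr (-1/2)" by (rule mult_left_mono) simp
  also have "\<dots> = 1" using assms by (simp flip: powr_add)
  finally have "t powr (1/2) * poly (isqrt_poly n) t \<le> 1" .
  moreover have "0 \<le> poly (isqrt_poly n) t" unfolding poly_isqrt_poly by (intro sum_nonneg p)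
  ultimately show ?thesis by simp
next
  case False
  define b where "b l = isqrt_coeff l * (t - 1) ^ l" for l
  have e: "poly (isqrt_poly n) t = (\<Sum>l\<le>n. (-1) ^ l * b l)"
    unfolding poly_isqrt_poly b_def
    by (intro sum.cong refl) (metis (no_types) minus_diff_eq mult.left_commute power_minus)
  have "0 \<le> (\<Sum>l\<le>n. (-1) ^ l * b l) \<and> (\<Sum>l\<le>n. (-1) ^ l * b l) \<le> b 0"
  proof (rule alternating_sum_bounds)
    fix l
    show "0 \<le> b l" using isqrt_coeff_pos[of l] False by (simp add: b_def)
    have "(t - 1) ^ Suc l \<le> (t - 1) ^ l" using False assms by (intro power_decreasing) auto
    then show "b (Suc l) \<le> b l"
      unfolding b_def using isqrt_coeff_antimono[of l "Suc l"] isqrt_coeff_pos[of l] False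
      by (intro mult_mono) auto
  qed
  then have p: "0 \<le> poly (isqrt_poly n) t" "poly (isqrt_poly n) t \<le> 1" by (simp_all add: e b_def)
  have "t powr (1/2) \<le> 4 powr (1/2)" using assms by (intro powr_mono2) auto
  then have "t powr (1/2) \<le> 2" by (simp add: powr_half_sqrt)
  then have "t powr (1/2) * poly (isqrt_poly n) t \<le> 2 * 1" using p by (intro mult_mono) auto
  then show ?thesis using p by simp
qed

text \<open>Coefficient of \<open>P\<^bsup>l\<^esup>\<close> in \<open>(\<Sum>l\<le>n. a\<^sub>l P\<^bsup>l\<^esup>) (I - P\<^bsup>k\<^esup>)\<close>, where \<open>a\<^sub>l\<close> are the coefficients of \<open>(1 - t)\<^bsup>-1/2\<^esup>\<close>.\<close>

definition diff_coeff :: "nat \<Rightarrow> nat \<Rightarrow> nat \<Rightarrow> real" where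
  "diff_coeff n k l = (if l \<le> n then isqrt_coeff l else 0) - (if k \<le> l then isqrt_coeff (l - k) else 0)"

text \<open>Telescoping with \<open>1 / l^2 <= 1 / (l - 1) - 1 / l\<close>, started at
  \<open>l = 2 k\<close>.\<close>

lemma sum_inverse_squares: 
  assumes "k \<ge> 1" shows "(\<Sum>l=2*k..n. 1 / (real l)\<^sup>2) \<le> 1 / real k"
proof -
  have ind: "(\<Sum>l=2*k..<i. 1 / (real l)\<^sup>2) \<le> 1 / (2 * real k - 1) - 1 / (real i - 1)" if "2 * k \<le> i" for i
    using that
  proof (induction i rule: dec_induct)
    case (step i)
    have i: "real i \<ge> 2" using step(1) assms by linarith
    have "1 / (real i)\<^sup>2 \<le> 1 / (real i - 1) - 1 / real i"
      using i by (simp add: field_simps power2_eq_square)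
    then show ?case using step by simp
  qed simp
  have *: "(\<Sum>l=2*k..<n+1. 1 / (real l)\<^sup>2) \<le> 1 / (2 * real k - 1)" if "2 * k \<le> n + 1"
  proof -
    have "0 \<le> 1 / (real (n + 1) - 1)" by simp
    then show ?thesis using ind[OF that] by linarith
  qed
  have "1 / (2 * real k - 1) \<le> 1 / real k" using assms by (intro divide_left_mono) auto
  moreover have "{2*k..<n+1} = {2*k..n}" by auto
  moreover have "\<not> 2 * k \<le> n + 1 \<Longrightarrow> {2*k..n} = {}" by auto
  ultimately show ?thesis using * assms by (cases "2 * k \<le> n + 1") auto
qed

text \<open>Three ranges, each contributing at most 2. For \<open>l < 2 k\<close> the coefficient is
  at most \<open>isqrt_coeff (l - k)\<close>, and these sum to order \<open>sqrt k\<close>. For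
  \<open>2 k <= l <= n\<close> the two coefficients nearly cancel and leave order
  \<open>k * l powr (-3/2)\<close>. For larger \<open>l > n\<close> only the shifted coefficient
  remains, but there are at most \<open>k\<close> such indices and each term is at most
  \<open>1 / k\<close>.\<close>

lemma diff_coeff_sum:
  assumes k: "k \<ge> 1"
  shows "(\<Sum>l=k..n+k. \<bar>diff_coeff n k l\<bar> / sqrt (real l)) \<le> 6"
proof -
  let ?a = isqrt_coeff
  have le: "\<bar>diff_coeff n k l\<bar> \<le> ?a (l - k)" if "k \<le> l" for l
    using isqrt_coeff_pos[of l] isqrt_coeff_pos[of "l - k"] isqrt_coeff_antimono[of "l - k" l] that
    by (auto simp: diff_coeff_def)
  have half: "real l / 2 \<le> real (l - k)" "1 \<le> l - k" if "2 * k \<le> l" for l using that k by auto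
  have I: "(\<Sum>l=k..<2*k. \<bar>diff_coeff n k l\<bar> / sqrt (real l)) \<le> 2"
  proof -
    have "(\<Sum>l=k..<2*k. \<bar>diff_coeff n k l\<bar> / sqrt (real l)) \<le> (\<Sum>l=k..<2*k. ?a (l - k) / sqrt (real k))"
      using le k isqrt_coeff_pos by (intro sum_mono frac_le) (auto intro: less_imp_le)
    also have "\<dots> = (\<Sum>j<k. ?a j / sqrt (real k))"
      by (rule sum.reindex_bij_witness[of _ "\<lambda>j. j + k" "\<lambda>l. l - k"]) auto
    also have "\<dots> \<le> 2 * sqrt (real k) / sqrt (real k)"
      unfolding sum_divide_distrib[symmetric] by (intro divide_right_mono isqrt_coeff_sum) simp
    finally show ?thesis using k by simp
  qed
  have II: "(\<Sum>l=2*k..n. \<bar>diff_coeff n k l\<bar> / sqrt (real l)) \<le> 2"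
  proof -
    have "\<bar>diff_coeff n k l\<bar> / sqrt (real l) \<le> 2 * real k * (1 / (real l)\<^sup>2)" if l: "2 * k \<le> l" "l \<le> n" for l
    proof -
      let ?j = "l - k"
      note j = half[OF l(1)]
      have l0: "real l > 0" using l k by simp
      have "\<bar>diff_coeff n k l\<bar> = ?a ?j - ?a (?j + k)"
        using l isqrt_coeff_antimono[of ?j l] by (simp add: diff_coeff_def)
      also have "\<dots> \<le> real k / (2 * real ?j * sqrt (real ?j))" by (rule isqrt_coeff_diff[OF j(2)])
      also have "\<dots> \<le> real k / (2 * (real l / 2) * sqrt (real l / 4))"
        using j l0 by (intro divide_left_mono mult_mono real_sqrt_le_mono mult_pos_pos) auto
      also have "\<dots> = 2 * real k / (real l * sqrt (real l))" using l0 by (simp add: real_sqrt_divide field_simps)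
      finally have "\<bar>diff_coeff n k l\<bar> / sqrt (real l) \<le> 2 * real k / (real l * sqrt (real l)) / sqrt (real l)"
        by (intro divide_right_mono) auto
      also have "\<dots> = 2 * real k * (1 / (real l)\<^sup>2)" using l0 by (simp add: power2_eq_square)
      finally show ?thesis .
    qed
    then have "(\<Sum>l=2*k..n. \<bar>diff_coeff n k l\<bar> / sqrt (real l)) \<le> (\<Sum>l=2*k..n. 2 * real k * (1 / (real l)\<^sup>2))"
      by (intro sum_mono) auto
    also have "\<dots> \<le> 2 * real k * (1 / real k)"
      unfolding sum_distrib_left[symmetric] by (intro mult_left_mono sum_inverse_squares k) simp
    finally show ?thesis using k by simp
  qed
  have III: "(\<Sum>l=max (2*k) (n+1)..n+k. \<bar>diff_coeff n k l\<bar> / sqrt (real l)) \<le> 2"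
  proof -
    have "\<bar>diff_coeff n k l\<bar> / sqrt (real l) \<le> 1 / real k" if l: "2 * k \<le> l" for l
    proof -
      note j = half[OF l]
      have l0: "real l > 0" using l k by simp
      have "\<bar>diff_coeff n k l\<bar> \<le> ?a (l - k)" using le l by simp
      also have "\<dots> \<le> 1 / sqrt (real (l - k))" by (rule isqrt_coeff_le'[OF j(2)])
      also have "\<dots> \<le> 1 / sqrt (real l / 4)" using j l0 by (intro divide_left_mono real_sqrt_le_mono mult_pos_pos) auto
      also have "\<dots> = 2 / sqrt (real l)" by (simp add: real_sqrt_divide)
      finally have "\<bar>diff_coeff n k l\<bar> / sqrt (real l) \<le> 2 / sqrt (real l) / sqrt (real l)" by (intro divide_right_mono) auto
      also have "\<dots> = 2 / real l" by simp
      also have "\<dots> \<le> 2 / (2 * real k)" using l k by (intro divide_left_mono) auto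
      finally show ?thesis by simp
    qed
    then have "(\<Sum>l=max (2*k) (n+1)..n+k. \<bar>diff_coeff n k l\<bar> / sqrt (real l)) \<le> (\<Sum>l=max (2*k) (n+1)..n+k. 1 / real k)"
      by (intro sum_mono) auto
    also have "\<dots> \<le> real k * (1 / real k)" unfolding sum_constant by (intro mult_right_mono) auto
    finally show ?thesis using k by simp
  qed
  have "(\<Sum>l=k..n+k. \<bar>diff_coeff n k l\<bar> / sqrt (real l))
     \<le> (\<Sum>l\<in>{k..<2*k} \<union> {2*k..n} \<union> {max (2*k) (n+1)..n+k}. \<bar>diff_coeff n k l\<bar> / sqrt (real l))"
    by (intro sum_mono2) auto
  also have "\<dots> = (\<Sum>l=k..<2*k. \<bar>diff_coeff n k l\<bar> / sqrt (real l)) + (\<Sum>l=2*k..n. \<bar>diff_coeff n k l\<bar> / sqrt (real l))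
      + (\<Sum>l=max (2*k) (n+1)..n+k. \<bar>diff_coeff n k l\<bar> / sqrt (real l))"
    by (subst sum.union_disjoint, auto)+
  finally show ?thesis using I II III by linarith
qed

subsection \<open>Heat kernel estimates\<close>

text \<open>\<open>D >= 1\<close> is achieved by enlarging the doubling constant, and analyticity is
  put in the form of a norm inequality for single functions.\<close>

locale sub_gaussian_graph = wgraph \<mu> for \<mu> :: "'a \<Rightarrow> 'a \<Rightarrow> real" +
  fixes \<beta> D C c C' :: real
  assumes \<beta>: "\<beta> \<ge> 2" and D: "D \<ge> 1" and C: "C > 0" and c: "c > 0" and C': "C' > 0"
    and doubling: "r \<ge> 1 \<Longrightarrow> gvolume \<mu> x (2 * real r) \<le> D * gvolume \<mu> x (real r)"
    and sub_gaussian: "k \<ge> 1 \<Longrightarrow> pker_iter \<mu> k x y \<le> C / gvolume \<mu> x (real k powr (1 / \<beta>))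
                   * exp (- c * (real (gdist \<mu> x y) powr \<beta> / real k) powr (1 / (\<beta> - 1)))"
    and analytic: "k \<ge> 1 \<Longrightarrow> f \<in> Lp (vmass \<mu>) 2 \<Longrightarrow>
       Lp_norm (vmass \<mu>) 2 (laplacian \<mu> ((mk ^^ k) f)) \<le> C' / real k * Lp_norm (vmass \<mu>) 2 f"
begin

text \<open>The radius is rounded up to an integer \<open>n\<close>, where the hypothesis applies
  and \<open>V x n = V x r\<close>.\<close>

lemma V_double: assumes "0 < r" shows "V x (2 * r) \<le> D * V x r"
proof -
  define n where "n = nat \<lceil>r\<rceil>"
  have n: "n \<ge> 1" "r \<le> real n" "real n = real_of_int \<lceil>r\<rceil>" using assms by (auto simp: n_def; linarith)+
  have "V x (2 * r) \<le> V x (2 * real n)" using n by (intro V_mono) simp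
  also have "\<dots> \<le> D * V x (real n)" by (rule doubling[OF n(1)])
  also have "V x (real n) = V x r" using V_ceiling[of x r] n(3) by simp
  finally show ?thesis .
qed

lemma V_double_pow: assumes "0 < r" shows "V x (2 ^ j * r) \<le> D ^ j * V x r"
proof (induction j)
  case (Suc j)
  have "V x (2 ^ Suc j * r) \<le> D * V x (2 ^ j * r)" using V_double[of "2 ^ j * r" x] assms by (simp add: mult.assoc)
  also have "\<dots> \<le> D * (D ^ j * V x r)" using Suc D by (intro mult_left_mono) auto
  finally show ?case by (simp add: mult.assoc)
qed simp

text \<open>A ball of radius \<open>3 r\<close> about \<open>x\<close> contains, besides
  \<open>B x r\<close>, a disjoint ball of radius \<open>r\<close> about a point at distance
  \<open>2 r\<close>, whose volume is at least \<open>V x r / D^2\<close> by doubling. Tripling the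
  radius thus multiplies the volume by at least \<open>1 + 1 / D^2\<close>.\<close>

lemma V_unbounded: "\<exists>n::nat. M < V x (real n)"
proof -
  let ?q = "1 + 1 / D ^ 2"
  have grow: "?q * V x (real r) \<le> V x (real (3 * r))" if r: "r \<ge> 1" for r :: nat
  proof -
    obtain z where z: "d x z = 2 * r" using exists_at_distance by blast
    have "V x (real r) \<le> V z (2 ^ 2 * real r)" using z by (intro V_le) simp
    also have "\<dots> \<le> D ^ 2 * V z (real r)" by (rule V_double_pow) (use r in simp)
    finally have 1: "V x (real r) / D ^ 2 \<le> V z (real r)" using D by (simp add: divide_le_eq mult.commute)
    have disj: "B x (real r) \<inter> B z (real r) = {}"
    proof (rule ccontr)
      assume "B x (real r) \<inter> B z (real r) \<noteq> {}"
      then obtain w where "d x w < r" "d z w < r" by (auto simp: in_B)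
      then show False using z d_triangle[of x z w] d_sym[of w z] by simp
    qed
    have "V x (real r) + V z (real r) = sum m (B x (real r) \<union> B z (real r))"
      using disj by (simp add: gvolume_def sum.union_disjoint)
    also have "\<dots> \<le> V x (real (3 * r))"
      unfolding gvolume_def
    proof (rule sum_mono2)
      show "B x (real r) \<union> B z (real r) \<subseteq> B x (real (3 * r))"
        using B_subset[of x x "real r" "real (3 * r)"] B_subset[of z x "real r" "real (3 * r)"] z d_sym[of z x] by auto
    qed auto
    finally show ?thesis using 1 by (simp add: distrib_right)
  qed
  have "?q ^ n * m x \<le> V x (real (3 ^ n))" for n
  proof (induction n)
    case 0
    then show ?case using m_le_V[of 1 x] by simp
  next
    case (Suc n)
    have "?q ^ Suc n * m x = ?q * (?q ^ n * m x)" by (simp only: power_Suc mult.assoc)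
    also have "\<dots> \<le> ?q * V x (real (3 ^ n))" using Suc D by (intro mult_left_mono) auto
    also have "\<dots> \<le> V x (real (3 ^ Suc n))" using grow[of "3 ^ n"] by simp
    finally show ?case .
  qed
  moreover obtain n where "M / m x < ?q ^ n" using real_arch_pow[of ?q "M / m x"] D by auto
  then have "M < ?q ^ n * m x" using m_pos[of x] by (simp add: divide_less_eq)
  ultimately show ?thesis by (meson less_le_trans)
qed

text \<open>Dyadic annuli: exponential decay beats polynomial growth of the masses of balls.\<close>

lemma annuli:
  assumes b: "b > 0"
  shows "\<exists>K>0. \<forall>g y R F a. (\<forall>z. 0 \<le> g z) \<longrightarrow> R > 0 \<longrightarrow> finite F \<longrightarrow> 0 \<le> a \<longrightarrow>
    (\<forall>j::nat. (\<Sum>z\<in>F \<inter> B y (2 ^ j * R). g z) \<le> a * D ^ j) \<longrightarrow>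
    (\<Sum>z\<in>F. exp (- b * real (d y z) / R) * g z) \<le> K * (a :: real)"
proof -
  \<comment> \<open>On the annulus with index \<open>j >= 1\<close> the distance is at least
    \<open>2^(j-1) R\<close>, so \<open>exp (- (b/2) 2^j)\<close> bounds the weight; the factor
    \<open>exp (b / 2)\<close> makes \<open>w 0 = 1\<close> for the inner ball.\<close>
  define w where "w j = exp (b / 2) * exp (- (b / 2) * 2 ^ j)" for j :: nat
  have sm: "summable (\<lambda>j. w j * D ^ j)"
    unfolding w_def mult.assoc using b D by (intro summable_mult double_exp_summable) auto
  have w_pos: "0 < w j" for j by (simp add: w_def)
  show ?thesis
  proof (intro exI[of _ "\<Sum>j. w j * D ^ j"] conjI allI impI)
    show "0 < (\<Sum>j. w j * D ^ j)" using sm w_pos D by (intro suminf_pos) auto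
    fix g :: "'a \<Rightarrow> real" and y R F a
    assume g: "\<forall>z. 0 \<le> g z" and R: "R > 0" and F: "finite F" and a: "(0::real) \<le> a"
      and H: "\<forall>j::nat. (\<Sum>z\<in>F \<inter> B y (2 ^ j * R). g z) \<le> a * D ^ j"
    have ex: "\<exists>j::nat. real (d y z) < 2 ^ j * R" for z
    proof -
      obtain j where "real (d y z) / R < 2 ^ j" using real_arch_pow[of 2] by auto
      then show ?thesis using R by (auto simp: divide_less_eq)
    qed
    define jj where "jj z = (LEAST j::nat. real (d y z) < 2 ^ j * R)" for z
    have jj: "real (d y z) < 2 ^ jj z * R" for z unfolding jj_def by (rule LeastI_ex[OF ex])
    have ew: "exp (- b * real (d y z) / R) \<le> w (jj z)" for z
    proof (cases "jj z")
      case 0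
      have "w (jj z) = 1" by (simp add: w_def 0 flip: exp_add)
      then show ?thesis using b R by simp
    next
      case (Suc i)
      have "\<not> real (d y z) < 2 ^ i * R" using not_less_Least[of i "\<lambda>j. real (d y z) < 2 ^ j * R"] Suc by (simp add: jj_def)
      then have "2 ^ i \<le> real (d y z) / R" using R by (simp add: pos_le_divide_eq)
      then have "b * 2 ^ i \<le> b * (real (d y z) / R)" using b by (intro mult_left_mono) auto
      then have "exp (- b * real (d y z) / R) \<le> exp (b / 2 + - (b / 2) * 2 ^ jj z)"
        using b by (simp add: Suc)
      then show ?thesis unfolding w_def exp_add .
    qed
    define J where "J = Suc (Max (insert 0 (jj ` F)))"
    have J: "jj z < J" if "z \<in> F" for z
      unfolding J_def using F that by (intro le_imp_less_Suc Max_ge) auto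
    have "(\<Sum>z\<in>F. exp (- b * real (d y z) / R) * g z) \<le> (\<Sum>z\<in>F. \<Sum>j<J. if z \<in> B y (2 ^ j * R) then w j * g z else 0)"
    proof (rule sum_mono)
      fix z assume z: "z \<in> F"
      have "exp (- b * real (d y z) / R) * g z \<le> w (jj z) * g z" using g ew by (intro mult_right_mono) auto
      also have "\<dots> = (if z \<in> B y (2 ^ jj z * R) then w (jj z) * g z else 0)" using jj by (simp add: in_B)
      also have "\<dots> \<le> (\<Sum>j<J. if z \<in> B y (2 ^ j * R) then w j * g z else 0)"
        using J[OF z] g w_pos by (intro member_le_sum) (auto intro!: mult_nonneg_nonneg less_imp_le[OF w_pos])
      finally show "exp (- b * real (d y z) / R) * g z \<le> (\<Sum>j<J. if z \<in> B y (2 ^ j * R) then w j * g z else 0)" .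
    qed
    also have "\<dots> = (\<Sum>j<J. \<Sum>z\<in>F. if z \<in> B y (2 ^ j * R) then w j * g z else 0)" by (rule sum.swap)
    also have "\<dots> = (\<Sum>j<J. w j * (\<Sum>z\<in>F \<inter> B y (2 ^ j * R). g z))"
      using F by (simp add: sum.inter_restrict sum_distrib_left if_distrib[of "\<lambda>u. _ * u"] cong: if_cong)
    also have "\<dots> \<le> (\<Sum>j<J. w j * (a * D ^ j))"
      using H w_pos by (intro sum_mono mult_left_mono) (auto intro: less_imp_le)
    also have "\<dots> = (\<Sum>j<J. w j * D ^ j) * a"
      unfolding sum_distrib_right by (intro sum.cong refl) (simp only: mult_ac)
    also have "\<dots> \<le> (\<Sum>j. w j * D ^ j) * a"
      using a w_pos D by (intro mult_right_mono sum_le_suminf sm) (auto intro!: mult_nonneg_nonneg less_imp_le[OF w_pos])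
    finally show "(\<Sum>z\<in>F. exp (- b * real (d y z) / R) * g z) \<le> (\<Sum>j. w j * D ^ j) * a" .
  qed
qed

lemma volume_annuli:
  assumes b: "b > 0"
  obtains K where "K > 0" "\<And>y R F. R > 0 \<Longrightarrow> finite F \<Longrightarrow>
    (\<Sum>z\<in>F. exp (- b * real (d y z) / R) * m z) \<le> K * V y R"
proof -
  obtain K where K: "K > 0" "\<forall>g y R F a. (\<forall>z. 0 \<le> g z) \<longrightarrow> R > 0 \<longrightarrow> finite F \<longrightarrow> 0 \<le> a \<longrightarrow>
    (\<forall>j::nat. (\<Sum>z\<in>F \<inter> B y (2 ^ j * R). g z) \<le> a * D ^ j) \<longrightarrow>
    (\<Sum>z\<in>F. exp (- b * real (d y z) / R) * g z) \<le> K * (a :: real)" using annuli[OF b] by auto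
  show ?thesis
  proof (rule that[OF K(1)])
    fix y R F assume R: "(R::real) > 0" and F: "finite (F :: 'a set)"
    show "(\<Sum>z\<in>F. exp (- b * real (d y z) / R) * m z) \<le> K * V y R"
    proof (rule K(2)[rule_format, OF _ R F])
      fix j :: nat
      have "(\<Sum>z\<in>F \<inter> B y (2 ^ j * R). m z) \<le> V y (2 ^ j * R)" unfolding gvolume_def by (intro sum_mono2) auto
      also have "\<dots> \<le> V y R * D ^ j" using V_double_pow[OF R, of y j] by (simp add: mult.commute)
      finally show "(\<Sum>z\<in>F \<inter> B y (2 ^ j * R). m z) \<le> V y R * D ^ j" .
    qed auto
  qed
qed

section \<open>Kernel bounds at the diffusive scale\<close>

definition rad :: "nat \<Rightarrow> real" where "rad l = real l powr (1 / \<beta>)"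

lemma rad_ge_1: "l \<ge> 1 \<Longrightarrow> 1 \<le> rad l"
  unfolding rad_def using \<beta> by (intro ge_one_powr_ge_zero) auto

lemma rad_pos: "l \<ge> 1 \<Longrightarrow> 0 < rad l"
  using rad_ge_1 by force

lemma rad_double: assumes "j \<ge> 1" "l \<le> 2 * j" shows "rad l \<le> 2 * rad j"
proof -
  have "rad l \<le> (2 * real j) powr (1 / \<beta>)" unfolding rad_def using assms \<beta> by (intro powr_mono2) auto
  also have "\<dots> = 2 powr (1 / \<beta>) * rad j" by (simp add: rad_def powr_mult)
  also have "2 powr (1 / \<beta>) \<le> 2 powr (1::real)" using \<beta> by (intro powr_mono) auto
  then have "2 powr (1 / \<beta>) * rad j \<le> 2 * rad j" using rad_pos[OF assms(1)] by (intro mult_right_mono) auto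
  finally show ?thesis .
qed

text \<open>With \<open>\<tau> = d x y / rad l\<close> the exponent is
  \<open>\<tau> powr (\<beta> / (\<beta> - 1))\<close>, which is at least \<open>\<tau> - 1\<close>.
  Simple exponential decay at scale \<open>rad l\<close> is what the later sums use, at the price of
  the factor \<open>exp c\<close>.\<close>

lemma kernel_le:
  assumes l: "l \<ge> 1"
  shows "p l x y \<le> C * exp c / V x (rad l) * exp (- c * real (d x y) / rad l)"
proof -
  define \<tau> where "\<tau> = real (d x y) / rad l"
  have \<tau>: "0 \<le> \<tau>" using rad_pos[OF l] by (simp add: \<tau>_def)
  have "real (d x y) powr \<beta> / real l = \<tau> powr \<beta>"
    using l \<beta> by (simp add: \<tau>_def powr_divide rad_def powr_powr)
  then have e: "(real (d x y) powr \<beta> / real l) powr (1 / (\<beta> - 1)) = \<tau> powr (\<beta> / (\<beta> - 1))"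
    by (simp add: powr_powr)
  have "\<tau> - 1 \<le> \<tau> powr (\<beta> / (\<beta> - 1))"
  proof (cases "\<tau> \<ge> 1")
    case True
    have "\<tau> powr 1 \<le> \<tau> powr (\<beta> / (\<beta> - 1))" using True \<beta> by (intro powr_mono) auto
    then show ?thesis using True by simp
  next
    case False
    then show ?thesis using powr_ge_zero[of \<tau> "\<beta> / (\<beta> - 1)"] by linarith
  qed
  then have "c * (\<tau> - 1) \<le> c * \<tau> powr (\<beta> / (\<beta> - 1))" using c by (intro mult_left_mono) auto
  then have "exp (- c * \<tau> powr (\<beta> / (\<beta> - 1))) \<le> exp (c + - c * \<tau>)" by (simp add: algebra_simps)
  also have "\<dots> = exp c * exp (- c * \<tau>)" by (rule exp_add)
  finally have "C / V x (rad l) * exp (- c * \<tau> powr (\<beta> / (\<beta> - 1))) \<le> C / V x (rad l) * (exp c * exp (- c * \<tau>))"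
    using C V_nonneg by (intro mult_left_mono) auto
  then have "p l x y \<le> C / V x (rad l) * (exp c * exp (- c * \<tau>))"
    using sub_gaussian[OF l, of x y] unfolding e rad_def[symmetric] by linarith
  then show ?thesis by (simp add: \<tau>_def)
qed

lemma kernel_le': "l \<ge> 1 \<Longrightarrow> p l x y \<le> C * exp c / V x (rad l)"
proof -
  assume l: "l \<ge> 1"
  have "C * exp c / V x (rad l) * exp (- c * real (d x y) / rad l) \<le> C * exp c / V x (rad l) * 1"
    using C c rad_pos[OF l] by (intro mult_left_mono) auto
  then show ?thesis using kernel_le[OF l, of x y] by linarith
qed

lemma iter_mk_le_1: "(\<And>x. f x \<le> 1) \<Longrightarrow> (mk ^^ k) f x \<le> (1::real)"
proof (induction k arbitrary: x)
  case (Suc k)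
  have "mk ((mk ^^ k) f) x \<le> mk (\<lambda>_. 1) x" by (rule mk_mono) (rule Suc.IH[OF Suc.prems])
  then show ?case by (simp add: mk_one)
qed auto

text \<open>By symmetry of the kernel this is an iterate of an indicator, and averages preserve the
  bound 1.\<close>

lemma sum_kernel_le: assumes "finite F" shows "(\<Sum>x\<in>F. p l x y * m x) \<le> 1"
proof -
  have "(mk ^^ l) (indicator F :: 'a \<Rightarrow> real) y = (\<Sum>x\<in>F. p l y x * m x * indicator F x)"
    using iter_mk_kernel[OF assms, of "indicator F :: 'a \<Rightarrow> real" l y] by simp
  also have "\<dots> = (\<Sum>x\<in>F. p l x y * m x)" by (intro sum.cong) (auto simp: p_sym[of l y])
  finally show ?thesis using iter_mk_le_1[of "indicator F" l y] by (simp add: indicator_def)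
qed

definition heat :: "nat \<Rightarrow> 'a \<Rightarrow> 'a \<Rightarrow> complex" where
  "heat l y = (\<lambda>x. complex_of_real (p l x y))"

lemma heat_iter: "(mk ^^ k) (heat l y) = heat (k + l) y"
proof -
  have "heat l y = (mk ^^ l) (heat 0 y)" for l
    unfolding heat_def iter_mk_of_real p_iter[symmetric] ..
  then show ?thesis by (metis funpow_add o_apply)
qed

text \<open>In the square of the kernel one factor is bounded by its supremum and the other has mass
  at most 1.\<close>

lemma heat_norm: 
  assumes l: "l \<ge> 1" 
  shows "heat l y \<in> Lp m 2" "Lp_norm m 2 (heat l y) \<le> sqrt (C * exp c / V y (rad l))"
proof -
  have nn: "0 \<le> C * exp c / V y (rad l)" using C by simp
  have "(\<Sum>x\<in>F. (norm (heat l y x))\<^sup>2 * m x) \<le> (sqrt (C * exp c / V y (rad l)))\<^sup>2" if F: "finite F" for F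
  proof -
    have "(\<Sum>x\<in>F. (norm (heat l y x))\<^sup>2 * m x) = (\<Sum>x\<in>F. p l x y * (p l x y * m x))"
      by (simp add: heat_def power2_eq_square mult.assoc)
    also have "\<dots> \<le> (\<Sum>x\<in>F. C * exp c / V y (rad l) * (p l x y * m x))"
      by (intro sum_mono mult_right_mono) (use kernel_le'[OF l, of y] p_sym[of l y] in auto)
    also have "\<dots> = C * exp c / V y (rad l) * (\<Sum>x\<in>F. p l x y * m x)" by (simp add: sum_distrib_left)
    also have "\<dots> \<le> C * exp c / V y (rad l) * 1" by (intro mult_left_mono sum_kernel_le F nn)
    finally show ?thesis using nn by simp
  qed
  from Lp2_leI[OF this] show "heat l y \<in> Lp m 2" "Lp_norm m 2 (heat l y) \<le> sqrt (C * exp c / V y (rad l))"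
    using nn by simp_all
qed

text \<open>About half of the steps, \<open>j = l div 2\<close>, are spent on analyticity and give
  \<open>1 / l\<close>; the remaining \<open>i\<close> steps give the norm of the kernel, of order
  \<open>1 / sqrt V\<close>. For \<open>l = 1\<close> no step is left for analyticity, and the norm
  bound 2 of the Laplacian serves instead.\<close>

lemma laplacian_heat_norm:
  obtains K where "K > 0" "\<And>l y. l \<ge> 1 \<Longrightarrow> Lp_norm m 2 (laplacian \<mu> (heat l y)) \<le> K / (real l * sqrt (V y (rad l)))"
proof -
  let ?A = "sqrt (C * exp c)"
  let ?K = "2 * ?A + 3 * C' * (?A * sqrt D)"
  have A: "?A > 0" using C by simp
  show ?thesis
  proof (rule that[of ?K])
    show "?K > 0" using A C' D by (intro add_pos_nonneg) auto
    fix l y assume l: "(l::nat) \<ge> 1"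
    have Vp: "0 < sqrt (V y (rad l))" using V_pos[OF rad_pos[OF l]] by simp
    show "Lp_norm m 2 (laplacian \<mu> (heat l y)) \<le> ?K / (real l * sqrt (V y (rad l)))"
    proof (cases "l = 1")
      case True
      have "Lp_norm m 2 (laplacian \<mu> (heat l y)) \<le> 2 * Lp_norm m 2 (heat l y)"
        by (rule laplacian_norm_le[OF heat_norm(1)[OF l]])
      also have "\<dots> \<le> 2 * sqrt (C * exp c / V y (rad l))" using heat_norm(2)[OF l] by simp
      also have "\<dots> = 2 * ?A / (real l * sqrt (V y (rad l)))" by (simp add: True real_sqrt_divide)
      also have "\<dots> \<le> ?K / (real l * sqrt (V y (rad l)))"
        using A C' D l Vp by (intro divide_right_mono) auto
      finally show ?thesis .
    next
      case False
      define j where "j = l div 2"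
      define i where "i = l - j"
      have "l \<le> 3 * j" unfolding j_def using l False by presburger
      then have ij: "j \<ge> 1" "i \<ge> 1" "l \<le> 2 * i" "real l \<le> 3 * real j" "j + i = l"
        using l False by (auto simp: j_def i_def)
      have "V y (rad l) \<le> V y (2 * rad i)" by (intro V_mono rad_double ij)
      also have "\<dots> \<le> D * V y (rad i)" by (rule V_double[OF rad_pos[OF ij(2)]])
      finally have Vl: "V y (rad l) / D \<le> V y (rad i)" using D by (simp add: divide_le_eq mult.commute)
      have Vlp: "0 < V y (rad l)" using V_pos[OF rad_pos[OF l]] .
      have "heat l y = (mk ^^ j) (heat i y)" using heat_iter[of j i y] ij(5) by simp
      then have "Lp_norm m 2 (laplacian \<mu> (heat l y)) \<le> C' / real j * Lp_norm m 2 (heat i y)"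
        using analytic[OF ij(1) heat_norm(1)[OF ij(2)]] by simp
      also have "\<dots> \<le> C' / (real l / 3) * sqrt (C * exp c / (V y (rad l) / D))"
      proof (intro mult_mono)
        show "C' / real j \<le> C' / (real l / 3)" using C' ij l by (intro divide_left_mono) auto
        have "sqrt (C * exp c / V y (rad i)) \<le> sqrt (C * exp c / (V y (rad l) / D))"
          using C D Vl Vlp by (intro real_sqrt_le_mono divide_left_mono mult_pos_pos) (auto intro: less_le_trans[OF _ Vl])
        then show "Lp_norm m 2 (heat i y) \<le> sqrt (C * exp c / (V y (rad l) / D))"
          using heat_norm(2)[OF ij(2), of y] by linarith
      qed (use C' l in auto)
      also have "\<dots> = 3 * C' * (?A * sqrt D) / (real l * sqrt (V y (rad l)))"
        by (simp add: real_sqrt_divide real_sqrt_mult)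
      also have "\<dots> \<le> ?K / (real l * sqrt (V y (rad l)))"
        using A C' D l Vp by (intro divide_right_mono) auto
      finally show ?thesis .
    qed
  qed
qed

end

text \<open>Summing the convexity defects over the graph leaves \<open>(3/2) \<Sum> m \<surd>u \<Delta>u\<close>, because the
  contributions of \<open>\<Delta>(u\<^bsup>3/2\<^esup>)\<close> cancel.\<close>

lemma (in wgraph) sum_defect_le:
  fixes u :: "'a \<Rightarrow> real"
  assumes u: "\<And>x. 0 \<le> u x" and F0: "finite F0" "\<And>x. x \<notin> F0 \<Longrightarrow> u x = 0" and A: "finite A"
  shows "(\<Sum>x\<in>A. \<Sum>y\<in>nb x. \<mu> x y * defect (u x) (u y)) \<le> 3 / 2 * (\<Sum>x\<in>F0. sqrt (u x) * (u x - mk u x) * m x)"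
proof -
  \<comment> \<open>Contains the neighbours of the support, so edges leaving \<open>G\<close> join
    two points where \<open>u\<close> vanishes and have defect 0.\<close>
  define G where "G = A \<union> F0 \<union> (\<Union>x\<in>F0. nb x)"
  have G: "finite G" using A F0 by (simp add: G_def)
  have nn: "0 \<le> \<mu> x y * defect (u x) (u y)" for x y using u by (intro mult_nonneg_nonneg defect_nonneg) auto
  have eq: "(\<Sum>y\<in>nb x. \<mu> x y * defect (u x) (u y)) = (\<Sum>y\<in>G. \<mu> x y * defect (u x) (u y))" if "x \<in> G" for x
  proof -
    have "(\<Sum>y\<in>nb x. \<mu> x y * defect (u x) (u y)) = (\<Sum>y\<in>nb x \<union> G. \<mu> x y * defect (u x) (u y))"
      using G by (intro sum.mono_neutral_left) (auto simp: \<mu>_zero)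
    also have "\<dots> = (\<Sum>y\<in>G. \<mu> x y * defect (u x) (u y))"
    proof (rule sum.mono_neutral_right)
      show "\<forall>y\<in>nb x \<union> G - G. \<mu> x y * defect (u x) (u y) = 0"
      proof
        fix y assume y: "y \<in> nb x \<union> G - G"
        then have "x \<notin> F0" "y \<notin> F0" by (auto simp: G_def)
        then show "\<mu> x y * defect (u x) (u y) = 0" using F0(2) by simp
      qed
    qed (use G in auto)
    finally show ?thesis .
  qed
  have "(\<Sum>x\<in>A. \<Sum>y\<in>nb x. \<mu> x y * defect (u x) (u y)) \<le> (\<Sum>x\<in>G. \<Sum>y\<in>nb x. \<mu> x y * defect (u x) (u y))"
    using G nn by (intro sum_mono2 sum_nonneg) (auto simp: G_def)
  also have "\<dots> = (\<Sum>x\<in>G. \<Sum>y\<in>G. \<mu> x y * defect (u x) (u y))" by (intro sum.cong refl eq)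
  also have "\<dots> = (\<Sum>x\<in>G. \<Sum>y\<in>G. \<mu> x y * (u y * sqrt (u y))) - (\<Sum>x\<in>G. \<Sum>y\<in>G. \<mu> x y * (u x * sqrt (u x)))
      - 3 / 2 * (\<Sum>x\<in>G. \<Sum>y\<in>G. \<mu> x y * (sqrt (u x) * (u y - u x)))"
  proof -
    have "\<mu> x y * defect (u x) (u y) = \<mu> x y * (u y * sqrt (u y)) - \<mu> x y * (u x * sqrt (u x))
        - 3 / 2 * (\<mu> x y * (sqrt (u x) * (u y - u x)))" for x y
      by (simp add: defect_def field_simps)
    then show ?thesis unfolding sum_distrib_left by (simp only: sum_subtractf)
  qed
  also have "(\<Sum>x\<in>G. \<Sum>y\<in>G. \<mu> x y * (u y * sqrt (u y))) = (\<Sum>x\<in>G. \<Sum>y\<in>G. \<mu> x y * (u x * sqrt (u x)))"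
    by (subst sum.swap) (simp add: \<mu>_sym)
  also have "(\<Sum>x\<in>G. \<Sum>y\<in>G. \<mu> x y * (sqrt (u x) * (u y - u x))) = (\<Sum>x\<in>F0. - (sqrt (u x) * (u x - mk u x) * m x))"
  proof (rule sum.mono_neutral_cong_right)
    show "\<forall>x\<in>G - F0. (\<Sum>y\<in>G. \<mu> x y * (sqrt (u x) * (u y - u x))) = 0" using F0(2) by simp
    fix x assume x: "x \<in> F0"
    have "(\<Sum>y\<in>G. \<mu> x y * (sqrt (u x) * (u y - u x))) = (\<Sum>y\<in>nb x. \<mu> x y * (sqrt (u x) * (u y - u x)))"
      using G x by (intro sum.mono_neutral_right) (auto simp: \<mu>_zero G_def)
    also have "\<dots> = sqrt (u x) * (\<Sum>y\<in>nb x. \<mu> x y * (u y - u x))" by (simp add: sum_distrib_left mult_ac)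
    also have "(\<Sum>y\<in>nb x. \<mu> x y * (u y - u x)) = m x * mk u x - m x * u x"
      by (simp add: right_diff_distrib sum_subtractf mk_def sum_distrib_left) (simp add: m_eq sum_distrib_right)
    finally show "(\<Sum>y\<in>G. \<mu> x y * (sqrt (u x) * (u y - u x))) = - (sqrt (u x) * (u x - mk u x) * m x)"
      by (simp add: algebra_simps)
  qed (use G in \<open>auto simp: G_def\<close>)
  finally show ?thesis by (simp add: sum_negf)
qed

section \<open>The gradient of the heat kernel away from its pole\<close>

context sub_gaussian_graph
begin

text \<open>Cauchy-Schwarz splits the sum into the sum of \<open>m x * W x\<close>, with
  \<open>W\<close> built from \<open>sqrt u\<close> and of order
  \<open>sqrt v * exp (- (c/4) r / rad l)\<close>, and the sum of the defects, of order
  \<open>1 / (l * sqrt v)\<close>. In the product of the square roots the volume \<open>v\<close>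
  cancels and \<open>1 / sqrt l\<close> remains.\<close>

lemma gradient_heat_sum:
  "\<exists>K>0. \<exists>b>0. \<forall>l y r A. l \<ge> 1 \<longrightarrow> finite A \<longrightarrow> (\<forall>x\<in>A. r \<le> real (d x y)) \<longrightarrow>
      (\<Sum>x\<in>A. gradient \<mu> (heat l y) x * m x) \<le> K / sqrt (real l) * exp (- b * r / rad l)"
proof -
  obtain N where N: "\<And>x. finite (nb x) \<and> card (nb x) \<le> N" by (rule obtain_degree, rule that)
  obtain K1 where K1: "K1 > 0" "\<And>l y. l \<ge> 1 \<Longrightarrow> Lp_norm m 2 (laplacian \<mu> (heat l y)) \<le> K1 / (real l * sqrt (V y (rad l)))"
    by (rule laplacian_heat_norm, rule that)
  have c4: "c / 4 > 0" using c by simp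
  obtain K2 where K2: "K2 > 0" "\<And>y R F. R > 0 \<Longrightarrow> finite F \<Longrightarrow>
    (\<Sum>z\<in>F. exp (- (c / 4) * real (d y z) / R) * m z) \<le> K2 * V y R" by (rule volume_annuli[OF c4], rule that)
  define W0 where "W0 = (real N + 1) * (exp (c / 2) * sqrt (C * exp c))"
  have W0: "W0 > 0" using C by (simp add: W0_def)
  let ?K = "sqrt (2 * (W0 * K2)) * sqrt (3 / 2 * K1)"
  show ?thesis
  proof (rule exI[of _ ?K], rule conjI[rotated], rule exI[of _ "c / 8"], intro conjI allI impI)
    show "?K > 0" "c / 8 > 0" using W0 K1(1) K2(1) c by auto
    fix l y r A assume l: "(l::nat) \<ge> 1" and A: "finite A" and r': "\<forall>x\<in>A. r \<le> real (d x y)"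
    note r = bspec[OF r']
    define R where "R = rad l"
    have R: "R \<ge> 1" using rad_ge_1[OF l] by (simp add: R_def)
    define v where "v = V y R"
    have v: "v > 0" unfolding v_def using R by (intro V_pos) simp
    define u where "u x = p l x y" for x
    have u0: "0 \<le> u x" for x by (simp add: u_def)
    define F0 where "F0 = {x. d y x \<le> l}"
    have F0: "finite F0" "\<And>x. x \<notin> F0 \<Longrightarrow> u x = 0"
      using finite_dball[of y l] by (auto simp: F0_def u_def d_sym[of y] intro!: p_zero)
    \<comment> \<open>One factor majorizing \<open>sqrt (u x) + sqrt (u z)\<close> for every edge at
      \<open>x\<close>, so that it can be taken out of the sum over neighbours; the degree bound
      \<open>N\<close> controls its size.\<close>
    define W where "W x = sqrt (u x) + (\<Sum>z\<in>nb x. sqrt (u z))" for x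
    define Df where "Df x = (\<Sum>z\<in>nb x. \<mu> x z * defect (u x) (u z))" for x
    have Df0: "0 \<le> Df x" for x unfolding Df_def using u0 by (intro sum_nonneg mult_nonneg_nonneg defect_nonneg) auto
    have W_nonneg: "0 \<le> W x" for x unfolding W_def using u0 by (intro add_nonneg_nonneg sum_nonneg) auto
    have grad: "gradient \<mu> (heat l y) x * m x \<le> sqrt (2 * (m x * W x)) * sqrt (Df x)" for x
    proof -
      have "(gradient \<mu> (heat l y) x * m x)\<^sup>2 = m x * (\<Sum>z\<in>nb x. \<mu> x z * (u z - u x)\<^sup>2)"
        unfolding power_mult_distrib gradient_sq
        by (simp add: heat_def u_def power2_eq_square[of "m x"] sum_distrib_left sum_distrib_right cmod_power2 power2_commute mult_ac flip: of_real_diff)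
      also have "\<dots> \<le> m x * (\<Sum>z\<in>nb x. \<mu> x z * (2 * W x * defect (u x) (u z)))"
      proof (intro mult_left_mono sum_mono)
        fix z assume z: "z \<in> nb x"
        have "sqrt (u z) \<le> (\<Sum>z\<in>nb x. sqrt (u z))" using z u0 by (intro member_le_sum) auto
        then have "sqrt (u x) + sqrt (u z) \<le> W x" by (simp add: W_def)
        then have "2 * (sqrt (u x) + sqrt (u z)) * defect (u x) (u z) \<le> 2 * W x * defect (u x) (u z)"
          using u0 by (intro mult_right_mono defect_nonneg) auto
        then show "(u z - u x)\<^sup>2 \<le> 2 * W x * defect (u x) (u z)"
          using sq_diff_le_defect[OF u0 u0, of z x] by linarith
      qed auto
      also have "\<dots> = 2 * (m x * W x) * Df x" by (simp add: Df_def sum_distrib_left mult_ac)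
      finally have "(gradient \<mu> (heat l y) x * m x)\<^sup>2 \<le> (sqrt (2 * (m x * W x)) * sqrt (Df x))\<^sup>2"
        using W_nonneg[of x] Df0[of x] by (simp add: power_mult_distrib)
      then show ?thesis by (rule power2_le_imp_le) (use W_nonneg Df0 in auto)
    qed
    \<comment> \<open>A neighbour \<open>z\<close> of \<open>x\<close> is at most 1 closer to
      \<open>y\<close>, and \<open>1 <= R\<close>, so replacing its distance by that of
      \<open>x\<close> costs only the factor \<open>exp (c / 2)\<close>.\<close>
    have sqrt_u: "sqrt (u z) \<le> exp (c / 2) * sqrt (C * exp c) / sqrt v * exp (- (c / 2) * real (d y x) / R)"
      if z: "d y x \<le> d y z + 1" for x z
    proof -
      have "u z \<le> C * exp c / v * exp (- c * real (d y z) / R)"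
        using kernel_le[OF l, of y z] p_sym[of l y z] by (simp add: u_def v_def R_def)
      also have "\<dots> \<le> C * exp c / v * exp (c + - c * real (d y x) / R)"
      proof (intro mult_left_mono)
        have "real (d y x) \<le> real (d y z) + R" using z R by simp
        then have "c * real (d y x) / R \<le> c * (real (d y z) + R) / R" using c R by (intro divide_right_mono mult_left_mono) auto
        also have "\<dots> = c * real (d y z) / R + c" using R by (simp add: field_simps)
        finally show "exp (- c * real (d y z) / R) \<le> exp (c + - c * real (d y x) / R)" by simp
      qed (use C v in auto)
      also have "\<dots> = (exp (c / 2) * sqrt (C * exp c) / sqrt v * exp (- (c / 2) * real (d y x) / R))\<^sup>2"
      proof -
        have "exp (c + - c * real (d y x) / R) = (exp (c / 2) * exp (- (c / 2) * real (d y x) / R))\<^sup>2"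
          by (simp add: power_mult_distrib flip: exp_add exp_double) 
        then show ?thesis using C v by (simp add: power_mult_distrib power_divide)
      qed
      finally have "sqrt (u z) \<le> sqrt ((exp (c / 2) * sqrt (C * exp c) / sqrt v * exp (- (c / 2) * real (d y x) / R))\<^sup>2)"
        by (rule real_sqrt_le_mono)
      then show ?thesis using C v by simp
    qed
    have W_le: "W x \<le> W0 / sqrt v * exp (- (c / 2) * real (d y x) / R)" for x
    proof -
      let ?e = "exp (c / 2) * sqrt (C * exp c) / sqrt v * exp (- (c / 2) * real (d y x) / R)"
      have e0: "0 \<le> ?e" using C v by simp
      have "W x \<le> ?e + (\<Sum>z\<in>nb x. ?e)"
        unfolding W_def
      proof (intro add_mono sum_mono sqrt_u)
        fix z assume "z \<in> nb x"
        then have "x \<in> nb z" by (simp add: nb_sym)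
        then show "d y x \<le> d y z + 1" using d_triangle[of y x z] d_nb[of x z] by linarith
      qed simp
      also have "\<dots> = (1 + real (card (nb x))) * ?e" by (simp only: sum_constant distrib_right mult_1)
      also have "\<dots> \<le> (real N + 1) * ?e" using N[of x] e0 by (intro mult_right_mono) auto
      also have "\<dots> = W0 / sqrt v * exp (- (c / 2) * real (d y x) / R)" by (simp add: W0_def)
      finally show ?thesis .
    qed
    \<comment> \<open>Of the rate \<open>c / 2\<close>, one half produces the factor in
      \<open>r\<close>; the other half makes the sum over the graph comparable to
      \<open>v\<close>.\<close>
    have sumW: "(\<Sum>x\<in>A. m x * W x) \<le> W0 * K2 * sqrt v * exp (- (c / 4) * r / R)"
    proof -
      have "(\<Sum>x\<in>A. m x * W x) \<le> (\<Sum>x\<in>A. W0 / sqrt v * exp (- (c / 4) * r / R) * (exp (- (c / 4) * real (d y x) / R) * m x))"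
      proof (rule sum_mono)
        fix x assume x: "x \<in> A"
        have "c / 4 * r / R \<le> c / 4 * real (d y x) / R" using r[OF x] c R d_sym[of x y] by (intro divide_right_mono mult_left_mono) auto
        then have "- (c / 2) * real (d y x) / R \<le> - (c / 4) * r / R + - (c / 4) * real (d y x) / R" by (simp add: field_simps)
        then have "exp (- (c / 2) * real (d y x) / R) \<le> exp (- (c / 4) * r / R) * exp (- (c / 4) * real (d y x) / R)"
          unfolding exp_add[symmetric] by simp
        then have "W0 / sqrt v * exp (- (c / 2) * real (d y x) / R) \<le> W0 / sqrt v * (exp (- (c / 4) * r / R) * exp (- (c / 4) * real (d y x) / R))"
          using W0 v by (intro mult_left_mono) auto
        then have "W x \<le> W0 / sqrt v * (exp (- (c / 4) * r / R) * exp (- (c / 4) * real (d y x) / R))"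
          using W_le[of x] by linarith
        then have "m x * W x \<le> m x * (W0 / sqrt v * (exp (- (c / 4) * r / R) * exp (- (c / 4) * real (d y x) / R)))"
          by (intro mult_left_mono) auto
        then show "m x * W x \<le> W0 / sqrt v * exp (- (c / 4) * r / R) * (exp (- (c / 4) * real (d y x) / R) * m x)"
          by (simp only: mult_ac)
      qed
      also have "\<dots> = W0 / sqrt v * exp (- (c / 4) * r / R) * (\<Sum>x\<in>A. exp (- (c / 4) * real (d y x) / R) * m x)"
        by (simp add: sum_distrib_left)
      also have "\<dots> \<le> W0 / sqrt v * exp (- (c / 4) * r / R) * (K2 * v)"
        unfolding v_def using W0 R A by (intro mult_left_mono K2(2)) auto
      also have "\<dots> = W0 * K2 * (v / sqrt v) * exp (- (c / 4) * r / R)" by simp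
      also have "v / sqrt v = sqrt v" using v by (simp add: real_div_sqrt)
      finally show ?thesis .
    qed
    \<comment> \<open>Cauchy-Schwarz pairs \<open>sqrt u\<close>, of norm at most 1, with the
      Laplacian of the kernel.\<close>
    have sumD: "(\<Sum>x\<in>A. Df x) \<le> 3 / 2 * K1 / (real l * sqrt v)"
    proof -
      have "(\<Sum>x\<in>A. Df x) \<le> 3 / 2 * (\<Sum>x\<in>F0. sqrt (u x) * (u x - mk u x) * m x)"
        unfolding Df_def by (rule sum_defect_le[OF u0 F0 A])
      also have "(\<Sum>x\<in>F0. sqrt (u x) * (u x - mk u x) * m x)
          \<le> (\<Sum>x\<in>F0. \<bar>sqrt (u x * m x)\<bar> * \<bar>(u x - mk u x) * sqrt (m x)\<bar>)"
      proof (rule sum_mono)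
        fix x
        have "sqrt (u x) * (u x - mk u x) * m x = sqrt (u x * m x) * ((u x - mk u x) * sqrt (m x))"
          using m_pos[of x] by (simp add: real_sqrt_mult)
        also have "\<dots> \<le> \<bar>sqrt (u x * m x)\<bar> * \<bar>(u x - mk u x) * sqrt (m x)\<bar>"
          unfolding abs_mult[symmetric] by simp
        finally show "sqrt (u x) * (u x - mk u x) * m x \<le> \<bar>sqrt (u x * m x)\<bar> * \<bar>(u x - mk u x) * sqrt (m x)\<bar>" .
      qed
      also have "\<dots> \<le> L2_set (\<lambda>x. sqrt (u x * m x)) F0 * L2_set (\<lambda>x. (u x - mk u x) * sqrt (m x)) F0"
        by (rule L2_set_mult_ineq)
      also have "\<dots> \<le> 1 * (K1 / (real l * sqrt v))"
      proof (intro mult_mono)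
        show "L2_set (\<lambda>x. sqrt (u x * m x)) F0 \<le> 1"
          using sum_kernel_le[OF F0(1), of l y] u0 by (simp add: L2_set_def u_def)
        have lap: "laplacian \<mu> (heat l y) x = of_real (u x - mk u x)" for x
          using iter_mk_of_real[of 1 u, where 'b=complex, THEN fun_cong, of x] by (simp add: laplacian_eq heat_def u_def[abs_def])
        have "(\<Sum>x\<in>F0. ((u x - mk u x) * sqrt (m x))\<^sup>2) = (\<Sum>x\<in>F0. (norm (laplacian \<mu> (heat l y) x))\<^sup>2 * m x)"
          unfolding lap norm_of_real by (simp add: power_mult_distrib)
        also have "\<dots> \<le> (Lp_norm m 2 (laplacian \<mu> (heat l y)))\<^sup>2"
          by (rule Lp2_sum_le[OF laplacian_Lp[OF heat_norm(1)[OF l]] F0(1)])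
        finally have "L2_set (\<lambda>x. (u x - mk u x) * sqrt (m x)) F0 \<le> Lp_norm m 2 (laplacian \<mu> (heat l y))"
          unfolding L2_set_def by (rule real_le_lsqrt[rotated]) simp
        then show "L2_set (\<lambda>x. (u x - mk u x) * sqrt (m x)) F0 \<le> K1 / (real l * sqrt v)"
          using K1(2)[OF l, of y] by (simp add: v_def R_def)
      qed auto
      finally show ?thesis by simp
    qed
    have "(\<Sum>x\<in>A. gradient \<mu> (heat l y) x * m x) \<le> (\<Sum>x\<in>A. \<bar>sqrt (2 * (m x * W x))\<bar> * \<bar>sqrt (Df x)\<bar>)"
      using grad W_nonneg Df0 by (intro sum_mono) simp
    also have "\<dots> \<le> L2_set (\<lambda>x. sqrt (2 * (m x * W x))) A * L2_set (\<lambda>x. sqrt (Df x)) A"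
      by (rule L2_set_mult_ineq)
    also have "\<dots> = sqrt (2 * (\<Sum>x\<in>A. m x * W x)) * sqrt (\<Sum>x\<in>A. Df x)"
      using W_nonneg Df0 by (simp add: L2_set_def sum_distrib_left)
    also have "\<dots> \<le> sqrt (2 * (W0 * K2 * sqrt v * exp (- (c / 4) * r / R))) * sqrt (3 / 2 * K1 / (real l * sqrt v))"
      using sumW sumD Df0 W0 W_nonneg K2(1) v by (intro mult_mono real_sqrt_le_mono) (auto intro!: sum_nonneg)
    \<comment> \<open>The square root halves the rate once more, from \<open>c / 4\<close> to
      \<open>c / 8\<close>.\<close>
    also have "\<dots> = ?K / sqrt (real l) * exp (- (c / 8) * r / R)"
    proof -
      have "exp (- (c / 4) * r / R) = (exp (- (c / 8) * r / R))\<^sup>2" by (simp flip: exp_double)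
      then have "2 * (W0 * K2 * sqrt v * exp (- (c / 4) * r / R)) * (3 / 2 * K1 / (real l * sqrt v))
         = (2 * (W0 * K2)) * (3 / 2 * K1) / real l * (exp (- (c / 8) * r / R))\<^sup>2"
        using v by simp
      then have "sqrt (2 * (W0 * K2 * sqrt v * exp (- (c / 4) * r / R))) * sqrt (3 / 2 * K1 / (real l * sqrt v))
          = sqrt ((2 * (W0 * K2)) * (3 / 2 * K1) / real l * (exp (- (c / 8) * r / R))\<^sup>2)"
        by (simp only: real_sqrt_mult[symmetric])
      moreover have "sqrt (P * Q / L * e\<^sup>2) = sqrt P * sqrt Q / sqrt L * e" if "e > 0" for P Q L e :: real
        using that by (simp add: real_sqrt_mult real_sqrt_divide)
      ultimately show ?thesis by (metis exp_gt_zero)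
    qed
    finally show "(\<Sum>x\<in>A. gradient \<mu> (heat l y) x * m x) \<le> ?K / sqrt (real l) * exp (- (c / 8) * r / rad l)"
      by (simp add: R_def)
  qed
qed

definition steps :: "real \<Rightarrow> nat" where "steps r = nat \<lceil>r powr \<beta>\<rceil>"

lemma steps:
  assumes "r \<ge> 1"
  shows "steps r \<ge> 1" "r powr \<beta> \<le> real (steps r)" "real (steps r) \<le> 2 * r powr \<beta>" "r \<le> rad (steps r)" "rad (steps r) \<le> 2 * r"
proof -
  have 1: "1 \<le> r powr \<beta>" using assms \<beta> by (intro ge_one_powr_ge_zero) auto
  show s1: "steps r \<ge> 1" and s2: "r powr \<beta> \<le> real (steps r)" and s3: "real (steps r) \<le> 2 * r powr \<beta>"
    using 1 by (auto simp: steps_def; linarith)+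
  have inv: "(r powr \<beta>) powr (1 / \<beta>) = r" using assms \<beta> by (simp add: powr_powr)
  have "(r powr \<beta>) powr (1 / \<beta>) \<le> rad (steps r)" unfolding rad_def using s2 \<beta> 1 by (intro powr_mono2) auto
  then show "r \<le> rad (steps r)" by (simp only: inv)
  have "rad (steps r) \<le> (2 * r powr \<beta>) powr (1 / \<beta>)" unfolding rad_def using s3 \<beta> by (intro powr_mono2) auto
  also have "\<dots> = 2 powr (1 / \<beta>) * r" using 1 inv by (simp add: powr_mult)
  also have "\<dots> \<le> 2 powr 1 * r" using assms \<beta> by (intro mult_right_mono powr_mono) auto
  finally show "rad (steps r) \<le> 2 * r" by simp
qed

text \<open>\<open>steps r\<close> is a time whose diffusive radius is comparable to
  \<open>r\<close>. Each of the earlier times \<open>l\<close> contributes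
  \<open>O(1 / steps r)\<close>, because the kernel has not yet spread that far:
  \<open>(r / rad l) powr \<beta>\<close> is absorbed by the exponential. From
  \<open>steps r\<close> on only the factor \<open>1 / sqrt l\<close> is used, together with
  \<open>diff_coeff_sum\<close>.\<close>

lemma off_diagonal_sum:
  "\<exists>K>0. \<forall>n y r A. r \<ge> 1 \<longrightarrow> finite A \<longrightarrow> (\<forall>x\<in>A. 2 * r \<le> real (d x y)) \<longrightarrow>
      (\<Sum>l\<le>n + steps r. \<bar>diff_coeff n (steps r) l\<bar> * (\<Sum>x\<in>A. gradient \<mu> (heat l y) x * m x)) \<le> K"
proof -
  obtain K1 b where K1: "K1 > 0" "b > 0" and est': "\<forall>l y r A. l \<ge> 1 \<longrightarrow> finite A \<longrightarrow> (\<forall>x\<in>A. r \<le> real (d x y)) \<longrightarrow>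
      (\<Sum>x\<in>A. gradient \<mu> (heat l y) x * m x) \<le> K1 / sqrt (real l) * exp (- b * r / rad l)"
    using gradient_heat_sum by auto
  note est = est'[rule_format]
  obtain K2 where K2: "K2 > 0" "\<And>x. x > 0 \<Longrightarrow> x powr \<beta> * exp (- b * x) \<le> K2"
    using powr_exp_bounded[OF K1(2), of \<beta>] \<beta> by auto
  show ?thesis
  proof (intro exI[of _ "2 * K1 * K2 + 6 * K1"] conjI allI impI)
    show "2 * K1 * K2 + 6 * K1 > 0" using K1 K2 by (intro add_pos_pos) auto
    fix n y r A assume r: "(r::real) \<ge> 1" and A: "finite A" and far': "\<forall>x\<in>A. 2 * r \<le> real (d x y)"
    note far = bspec[OF far']
    define k where "k = steps r"
    note k = steps[OF r, folded k_def]
    define G where "G l = (\<Sum>x\<in>A. gradient \<mu> (heat l y) x * m x)" for l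
    \<comment> \<open>The time \<open>l = 0\<close> lies outside the kernel estimate; a point mass
      has zero gradient at distance at least 2, and here the distance is at least
      \<open>2 r\<close>.\<close>
    have G0: "G 0 = 0"
      unfolding G_def
    proof (intro sum.neutral ballI)
      fix x assume x: "x \<in> A"
      have "(gradient \<mu> (heat 0 y) x)\<^sup>2 = 0"
        unfolding gradient_sq
      proof (intro sum.neutral ballI)
        fix z assume z: "z \<in> nb x"
        have "d x y \<ge> 2" using far[OF x] r by linarith
        then have "x \<noteq> y" "z \<noteq> y" using d_nb[OF z] by auto
        then show "\<mu> x z / m x * (cmod (heat 0 y x - heat 0 y z))\<^sup>2 = 0" by (simp add: heat_def)
      qed
      then show "gradient \<mu> (heat 0 y) x * m x = 0" by simp
    qed
    have G_le: "G l \<le> K1 / sqrt (real l)" if "l \<ge> 1" for l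
    proof -
      have "G l \<le> K1 / sqrt (real l) * exp (- b * (2 * r) / rad l)" unfolding G_def by (rule est[OF that A far])
      also have "\<dots> \<le> K1 / sqrt (real l) * 1" using K1 r rad_pos[OF that] by (intro mult_left_mono) auto
      finally show ?thesis by simp
    qed
    have small: "\<bar>diff_coeff n k l\<bar> * G l \<le> 2 * K1 * K2 / real k" if l: "l < k" for l
    proof (cases "l = 0")
      case False
      then have l1: "l \<ge> 1" by simp
      have "\<bar>diff_coeff n k l\<bar> \<le> 1 / sqrt (real l)"
        using isqrt_coeff_le'[OF l1] isqrt_coeff_pos[of l] l by (simp add: diff_coeff_def)
      moreover have "G l \<le> K1 / sqrt (real l) * (K2 * (real l / r powr \<beta>))"
      proof -
        have x0: "r / rad l > 0" using r rad_pos[OF l1] by simp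
        have e: "exp (- b * r / rad l) \<le> K2 * (real l / r powr \<beta>)"
        proof -
          have "(r / rad l) powr \<beta> = r powr \<beta> / real l" using r \<beta> l1 by (simp add: powr_divide rad_def powr_powr)
          then have "r powr \<beta> / real l * exp (- b * (r / rad l)) \<le> K2" using K2(2)[OF x0] by simp
          then show ?thesis using r l1 by (simp add: field_simps)
        qed
        have "G l \<le> K1 / sqrt (real l) * exp (- b * r / rad l)"
          unfolding G_def using far r by (intro est[OF l1 A]) force
        also have "\<dots> \<le> K1 / sqrt (real l) * (K2 * (real l / r powr \<beta>))"
          using K1 by (intro mult_left_mono e) auto
        finally show ?thesis .
      qed
      ultimately have "\<bar>diff_coeff n k l\<bar> * G l \<le> 1 / sqrt (real l) * (K1 / sqrt (real l) * (K2 * (real l / r powr \<beta>)))"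
        by (intro mult_mono) (auto simp: G_def intro!: sum_nonneg)
      also have "\<dots> = K1 * K2 / r powr \<beta>" using l1 by (simp add: mult.assoc[symmetric])
      also have "\<dots> \<le> K1 * K2 / (real k / 2)" using K1 K2 k r by (intro divide_left_mono mult_pos_pos) auto
      finally show ?thesis by (simp add: mult_ac)
    qed (use G0 K1 K2 in simp)
    have "(\<Sum>l\<le>n+k. \<bar>diff_coeff n k l\<bar> * G l) = (\<Sum>l\<in>{..<k} \<union> {k..n+k}. \<bar>diff_coeff n k l\<bar> * G l)"
      by (intro sum.cong) auto
    also have "\<dots> = (\<Sum>l<k. \<bar>diff_coeff n k l\<bar> * G l) + (\<Sum>l=k..n+k. \<bar>diff_coeff n k l\<bar> * G l)"
      by (rule sum.union_disjoint) auto
    also have "(\<Sum>l<k. \<bar>diff_coeff n k l\<bar> * G l) \<le> (\<Sum>l<k. 2 * K1 * K2 / real k)" by (intro sum_mono small) auto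
    also have "\<dots> = 2 * K1 * K2" using k by simp
    also have "(\<Sum>l=k..n+k. \<bar>diff_coeff n k l\<bar> * G l) \<le> (\<Sum>l=k..n+k. K1 * (\<bar>diff_coeff n k l\<bar> / sqrt (real l)))"
    proof (rule sum_mono)
      fix l assume "l \<in> {k..n+k}"
      then have "\<bar>diff_coeff n k l\<bar> * G l \<le> \<bar>diff_coeff n k l\<bar> * (K1 / sqrt (real l))"
        using k by (intro mult_left_mono G_le) auto
      then show "\<bar>diff_coeff n k l\<bar> * G l \<le> K1 * (\<bar>diff_coeff n k l\<bar> / sqrt (real l))" by (simp add: mult.commute)
    qed
    also have "\<dots> \<le> K1 * 6"
      unfolding sum_distrib_left[symmetric] using K1 k by (intro mult_left_mono diff_coeff_sum) auto
    finally show "(\<Sum>l\<le>n + steps r. \<bar>diff_coeff n (steps r) l\<bar> * (\<Sum>x\<in>A. gradient \<mu> (heat l y) x * m x)) \<le> 2 * K1 * K2 + 6 * K1"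
      by (simp add: G_def k_def)
  qed
qed

end

section \<open>Layer cake interpolation\<close>

lemma has_integral_layer:
  fixes a p :: real
  assumes "0 \<le> a" "0 < p"
  shows "((\<lambda>t. p * t powr (p - 1) * (if t < a then 1 else 0)) has_integral a powr p) {0..}"
proof -
  have "((\<lambda>t. p * t powr (p - 1)) has_integral p * (a powr (p - 1 + 1) / (p - 1 + 1))) {0..a}"
    using assms by (intro has_integral_mult_right has_integral_powr_from_0) auto
  then have "((\<lambda>t. p * t powr (p - 1)) has_integral a powr p) {0..a}" using assms by simp
  then have "((\<lambda>t. p * t powr (p - 1) * (if t < a then 1 else 0)) has_integral a powr p) {0..a}"
    by (rule has_integral_spike_finite[of "{a}", rotated 2]) auto
  then show ?thesis
  proof (subst has_integral_restrict_UNIV[symmetric], subst (asm) has_integral_restrict_UNIV[symmetric])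
    assume "((\<lambda>t. if t \<in> {0..a} then p * t powr (p - 1) * (if t < a then 1 else 0) else 0) has_integral a powr p) UNIV"
    moreover have "(\<lambda>t. if t \<in> {0..a} then p * t powr (p - 1) * (if t < a then 1 else 0) else 0)
      = (\<lambda>t. if t \<in> {0..} then p * t powr (p - 1) * (if t < a then 1 else 0) else 0)"
      using assms by (auto simp: fun_eq_iff)
    ultimately show "((\<lambda>t. if t \<in> {0..} then p * t powr (p - 1) * (if t < a then 1 else 0) else 0) has_integral a powr p) UNIV"
      by simp
  qed
qed

text \<open>The minimum is \<open>b / t\<close> below \<open>b\<close> and
  \<open>(b / t) powr q\<close> above. Convergence at 0 comes from \<open>p > 1\<close> and at
  infinity from \<open>p < q\<close>; these pieces are the two terms of the constant.\<close>

lemma has_integral_min_powr: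
  fixes b p q :: real
  assumes "0 \<le> b" "1 < p" "p < q"
  shows "((\<lambda>t. p * t powr (p - 1) * min (b / t) ((b / t) powr q)) has_integral
     (p / (p - 1) + p / (q - p)) * b powr p) {0..}"
proof (cases "b = 0")
  case True
  then show ?thesis using assms by simp
next
  case False
  then have b: "b > 0" using assms by simp
  let ?f = "\<lambda>t. p * t powr (p - 1) * min (b / t) ((b / t) powr q)"
  have le: "(b / t) powr q \<ge> b / t" if "0 < t" "t \<le> b" for t
    using powr_mono[of 1 q "b / t"] that assms by simp
  have ge: "(b / t) powr q \<le> b / t" if "b \<le> t" for t
    using powr_mono'[of 1 q "b / t"] that assms b by simp
  have "((\<lambda>t. (p * b) * t powr (p - 2)) has_integral (p * b) * (b powr (p - 2 + 1) / (p - 2 + 1))) {0..b}"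
    using assms by (intro has_integral_mult_right has_integral_powr_from_0) auto
  then have 1: "(?f has_integral (p * b) * (b powr (p - 2 + 1) / (p - 2 + 1))) {0..b}"
  proof (rule has_integral_eq[rotated])
    fix t assume t: "t \<in> {0..b}"
    show "(p * b) * t powr (p - 2) = ?f t"
    proof (cases "t = 0")
      case False
      then have t0: "t > 0" using t by simp
      have "t powr (p - 1) = t powr (p - 2) * t" using t0 powr_add[of t "p - 2" 1] by simp
      then show ?thesis using t0 t le[of t] by (simp add: min_absorb1)
    qed simp
  qed
  have "((\<lambda>t. (p * b powr q) * t powr (p - 1 - q)) has_integral (p * b powr q) * (- (b powr (p - 1 - q + 1)) / (p - 1 - q + 1))) {b..}"
    using assms b by (intro has_integral_mult_right has_integral_powr_to_inf) auto
  then have 2: "(?f has_integral (p * b powr q) * (- (b powr (p - 1 - q + 1)) / (p - 1 - q + 1))) {b..}"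
  proof (rule has_integral_eq[rotated])
    fix t assume t: "t \<in> {b..}"
    have "t powr (p - 1) * (b / t) powr q = b powr q * t powr (p - 1 - q)"
      using t b by (simp add: powr_divide powr_diff)
    then show "(p * b powr q) * t powr (p - 1 - q) = ?f t"
      using t ge[of t] by (simp add: min_absorb2 mult.assoc)
  qed
  have u: "{0..b} \<union> {b..} = {0..}" "{0..b} \<inter> {b..} = {b}" using b by auto
  have "(?f has_integral (p * b) * (b powr (p - 2 + 1) / (p - 2 + 1)) + (p * b powr q) * (- (b powr (p - 1 - q + 1)) / (p - 1 - q + 1))) {0..}"
    using has_integral_Un[OF 1 2] unfolding u by simp
  moreover have e1: "(p * b) * (b powr (p - 2 + 1) / (p - 2 + 1)) = p / (p - 1) * b powr p"
    using b powr_add[of b 1 "p - 1"] by simp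
  moreover have e2: "(p * b powr q) * (- (b powr (p - 1 - q + 1)) / (p - 1 - q + 1)) = p / (q - p) * b powr p"
  proof -
    have "b powr q * b powr (p - q) = b powr p" using b by (simp flip: powr_add)
    moreover have "- (b powr (p - q)) / (p - q) = b powr (p - q) / (q - p)"
      using assms by (simp add: field_simps)
    ultimately show ?thesis by (simp add: algebra_simps)
  qed
  ultimately show ?thesis by (simp only: distrib_right)
qed

text \<open>Marcinkiewicz interpolation in one step: the distributional inequality is integrated
  against \<open>p * t powr (p - 1)\<close>. The minimum encodes a bound of exponent 1 for the
  values above \<open>t\<close> and of exponent \<open>q\<close> for those below.\<close>

lemma layer_cake:
  fixes w A :: "'x \<Rightarrow> real" and v b :: "'y \<Rightarrow> real" and p q K :: real
  assumes X: "finite X" and Y: "finite Y" and pq: "1 < p" "p < q"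
    and A: "\<And>x. x \<in> X \<Longrightarrow> 0 \<le> A x" and b: "\<And>y. y \<in> Y \<Longrightarrow> 0 \<le> b y"
    and H: "\<And>t. t > 0 \<Longrightarrow> (\<Sum>x\<in>X. w x * (if t < A x then 1 else 0)) \<le> K * (\<Sum>y\<in>Y. v y * min (b y / t) ((b y / t) powr q))"
  shows "(\<Sum>x\<in>X. w x * A x powr p) \<le> K * (p / (p - 1) + p / (q - p)) * (\<Sum>y\<in>Y. v y * b y powr p)"
proof -
  have 1: "((\<lambda>t. \<Sum>x\<in>X. w x * (p * t powr (p - 1) * (if t < A x then 1 else 0))) has_integral (\<Sum>x\<in>X. w x * A x powr p)) {0..}"
    using A pq by (intro has_integral_sum X has_integral_mult_right has_integral_layer) auto
  have 2: "((\<lambda>t. \<Sum>y\<in>Y. (K * v y) * (p * t powr (p - 1) * min (b y / t) ((b y / t) powr q)))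
      has_integral (\<Sum>y\<in>Y. (K * v y) * ((p / (p - 1) + p / (q - p)) * b y powr p))) {0..}"
    using b pq by (intro has_integral_sum Y has_integral_mult_right has_integral_min_powr) auto
  have "(\<Sum>x\<in>X. w x * A x powr p) \<le> (\<Sum>y\<in>Y. (K * v y) * ((p / (p - 1) + p / (q - p)) * b y powr p))"
  proof (rule has_integral_le[OF 1 2])
    fix t :: real assume "t \<in> {0..}"
    show "(\<Sum>x\<in>X. w x * (p * t powr (p - 1) * (if t < A x then 1 else 0)))
       \<le> (\<Sum>y\<in>Y. (K * v y) * (p * t powr (p - 1) * min (b y / t) ((b y / t) powr q)))"
    proof (cases "t = 0")
      case False
      then have "t > 0" using \<open>t \<in> {0..}\<close> by simp
      have "p * t powr (p - 1) * (\<Sum>x\<in>X. w x * (if t < A x then 1 else 0))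
          \<le> p * t powr (p - 1) * (K * (\<Sum>y\<in>Y. v y * min (b y / t) ((b y / t) powr q)))"
        using H[OF \<open>t > 0\<close>] pq by (intro mult_left_mono) auto
      moreover have "p * t powr (p - 1) * (\<Sum>x\<in>X. w x * (if t < A x then 1 else 0))
          = (\<Sum>x\<in>X. w x * (p * t powr (p - 1) * (if t < A x then 1 else 0)))"
        unfolding sum_distrib_left by (intro sum.cong refl) (simp only: mult_ac)
      moreover have "p * t powr (p - 1) * (K * (\<Sum>y\<in>Y. v y * min (b y / t) ((b y / t) powr q)))
          = (\<Sum>y\<in>Y. (K * v y) * (p * t powr (p - 1) * min (b y / t) ((b y / t) powr q)))"
        unfolding sum_distrib_left by (intro sum.cong refl) (simp only: mult_ac)
      ultimately show ?thesis by linarith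
    qed simp
  qed
  also have "\<dots> = K * (p / (p - 1) + p / (q - p)) * (\<Sum>y\<in>Y. v y * b y powr p)"
    unfolding sum_distrib_left by (intro sum.cong refl) (simp only: mult_ac)
  finally show ?thesis .
qed

text \<open>For \<open>s\<close> above 1/2, \<open>s powr (q - 1)\<close> is at least
  \<open>2 powr (1 - q)\<close>.\<close>

lemma truncation_le_min:
  fixes s q :: real
  assumes "0 \<le> s" "1 \<le> q" shows "(if 1 / 2 < s then s else 0) \<le> 2 powr q * min s (s powr q)"
proof (cases "1 / 2 < s")
  case True
  have "s powr (q - 1) \<ge> (1 / 2) powr (q - 1)" using True assms by (intro powr_mono2) auto
  then have "2 powr q * s powr (q - 1) \<ge> 2 powr q * (1 / 2) powr (q - 1)" by (intro mult_left_mono) auto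
  moreover have "2 powr q * (1 / 2) powr (q - 1) = (2::real)"
    by (simp add: powr_divide powr_diff)
  moreover have "s powr q = s * s powr (q - 1)" using True powr_add[of s 1 "q - 1"] by simp
  ultimately have "s \<le> 2 powr q * s powr q"
    using True mult_left_mono[of 1 "2 powr q * s powr (q - 1)" s] by (simp add: mult_ac)
  moreover have "1 \<le> 2 powr q" using assms by (intro ge_one_powr_ge_zero) auto
  then have "s \<le> 2 powr q * s" using True mult_right_mono[of 1 "2 powr q" s] by simp
  ultimately show ?thesis using True by (simp add: min_def)
qed (use assms in simp)

lemma sum_Union_le:
  fixes f :: "'a \<Rightarrow> real"
  assumes "finite I" "\<And>i. i \<in> I \<Longrightarrow> finite (A i)" "\<And>x. 0 \<le> f x"
  shows "sum f (\<Union>i\<in>I. A i) \<le> (\<Sum>i\<in>I. sum f (A i))"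
  using assms
proof (induction I)
  case (insert i I)
  have "sum f (A i \<union> (\<Union>i\<in>I. A i)) \<le> sum f (A i) + sum f (\<Union>i\<in>I. A i)"
    using insert by (subst sum.union_inter[symmetric, of "A i"]) (auto intro!: sum_nonneg)
  then show ?case using insert by simp
qed simp

section \<open>The maximal function and the covering argument\<close>

context sub_gaussian_graph
begin

definition mass :: "('a \<Rightarrow> real) \<Rightarrow> 'a \<Rightarrow> real \<Rightarrow> real" where
  "mass \<phi> x r = (\<Sum>z\<in>B x r. \<phi> z * m z)"

text \<open>Integer radii at least 1: the smallest ball is the point itself, and a bounded nonempty
  set of heavy radii has a maximum.\<close>

definition heavy :: "('a \<Rightarrow> real) \<Rightarrow> real \<Rightarrow> 'a \<Rightarrow> nat \<Rightarrow> bool" where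
  "heavy \<phi> \<theta> x r \<longleftrightarrow> r \<ge> 1 \<and> \<theta> * V x (real r) < mass \<phi> x (real r)"

lemma mass_nonneg: "(\<And>x. 0 \<le> \<phi> x) \<Longrightarrow> 0 \<le> mass \<phi> x r"
  unfolding mass_def by (intro sum_nonneg) auto

lemma mass_mono: "(\<And>x. 0 \<le> \<phi> x) \<Longrightarrow> B x r \<subseteq> B y s \<Longrightarrow> mass \<phi> x r \<le> mass \<phi> y s"
  unfolding mass_def by (intro sum_mono2) auto

text \<open>A heavy ball meets the support at some \<open>z\<close>, and its volume, hence by
  doubling \<open>V z r\<close>, is bounded in terms of the total mass. Volumes are unbounded, so
  \<open>r\<close> is bounded, uniformly over the finite support.\<close>

lemma heavy_bounded:
  assumes \<phi>: "\<And>x. 0 \<le> \<phi> x" and S: "finite S" "\<And>x. x \<notin> S \<Longrightarrow> \<phi> x = 0" and \<theta>: "0 < \<theta>"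
  shows "\<exists>n. \<forall>x r. heavy \<phi> \<theta> x r \<longrightarrow> r < n \<and> (\<exists>z\<in>S. d z x < n)"
proof -
  define M where "M = D * (\<Sum>z\<in>S. \<phi> z * m z) / \<theta>"
  obtain N where N: "\<And>z. M < V z (real (N z))" using V_unbounded by metis
  define n where "n = Suc (Max (insert 0 (N ` S)))"
  have n: "N z < n" if "z \<in> S" for z unfolding n_def using S(1) that by (intro le_imp_less_Suc Max_ge) auto
  show ?thesis
  proof (intro exI[of _ n] allI impI)
    fix x r assume h: "heavy \<phi> \<theta> x r"
    then have r: "r \<ge> 1" and gt: "\<theta> * V x (real r) < mass \<phi> x (real r)" by (auto simp: heavy_def)
    have "0 < mass \<phi> x (real r)" using gt \<theta> V_pos[of "real r" x] r by (smt (verit) mult_pos_pos of_nat_0_less_iff less_le_trans zero_less_one)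
    then obtain z where z: "z \<in> B x (real r)" "\<phi> z \<noteq> 0" unfolding mass_def
      by (metis (no_types, lifting) less_irrefl mult_zero_left sum.neutral)
    have zS: "z \<in> S" using z S by auto
    have dz: "d x z < r" using z by (simp add: in_B)
    have "mass \<phi> x (real r) \<le> (\<Sum>z\<in>S. \<phi> z * m z)"
    proof -
      have "mass \<phi> x (real r) = (\<Sum>z\<in>B x (real r) \<inter> S. \<phi> z * m z)"
        unfolding mass_def using S by (intro sum.mono_neutral_right) auto
      also have "\<dots> \<le> (\<Sum>z\<in>S. \<phi> z * m z)" using S \<phi> by (intro sum_mono2) auto
      finally show ?thesis .
    qed
    then have "V x (real r) < (\<Sum>z\<in>S. \<phi> z * m z) / \<theta>" using gt \<theta> by (simp add: less_divide_eq mult.commute)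
    moreover have "V z (real r) \<le> V x (2 * real r)" using dz d_sym[of x z] by (intro V_le) simp
    moreover have "V x (2 * real r) \<le> D * V x (real r)" using r by (intro V_double) simp
    ultimately have "V z (real r) < M"
      unfolding M_def using D mult_strict_left_mono[of "V x (real r)" "(\<Sum>z\<in>S. \<phi> z * m z) / \<theta>" D] by simp
    then have "\<not> real (N z) \<le> real r" using N[of z] V_mono[of "real (N z)" "real r" z] by linarith
    then have "r < n" using n[OF zS] by simp
    then show "r < n \<and> (\<exists>z\<in>S. d z x < n)" using zS dz d_sym[of x z] by (auto intro!: bexI[of _ z])
  qed
qed

text \<open>Greedy choice: keep a ball of largest radius, discard the balls that meet it, and
  recurse.\<close>

lemma vitali:
  assumes "finite \<Omega>" "\<And>x. x \<in> \<Omega> \<Longrightarrow> \<rho> x \<ge> (1::nat)"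
  shows "\<exists>I\<subseteq>\<Omega>. (\<forall>i\<in>I. \<forall>j\<in>I. i \<noteq> j \<longrightarrow> B i (real (\<rho> i)) \<inter> B j (real (\<rho> j)) = {}) \<and>
    (\<forall>x\<in>\<Omega>. \<exists>i\<in>I. \<rho> x \<le> \<rho> i \<and> B x (real (\<rho> x)) \<inter> B i (real (\<rho> i)) \<noteq> {})"
  using assms
proof (induction "card \<Omega>" arbitrary: \<Omega> rule: less_induct)
  case less
  let ?b = "\<lambda>x. B x (real (\<rho> x))"
  show ?case
  proof (cases "\<Omega> = {}")
    case False
    have "Max (\<rho> ` \<Omega>) \<in> \<rho> ` \<Omega>" using False less.prems(1) by (intro Max_in) auto
    then obtain x0 where "x0 \<in> \<Omega>" "\<rho> x0 = Max (\<rho> ` \<Omega>)" by auto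
    then have x0: "x0 \<in> \<Omega>" "\<And>x. x \<in> \<Omega> \<Longrightarrow> \<rho> x \<le> \<rho> x0" using less.prems(1) by auto
    define \<Omega>' where "\<Omega>' = {x \<in> \<Omega>. ?b x \<inter> ?b x0 = {}}"
    have ne: "x0 \<in> ?b x0" using less.prems(2)[OF x0(1)] by (simp add: in_B)
    then have "x0 \<notin> \<Omega>'" by (auto simp: \<Omega>'_def)
    then have "\<Omega>' \<subset> \<Omega>" using x0(1) by (auto simp: \<Omega>'_def)
    then have "card \<Omega>' < card \<Omega>" using less.prems(1) by (rule psubset_card_mono[rotated])
    moreover have "finite \<Omega>'" "\<And>x. x \<in> \<Omega>' \<Longrightarrow> \<rho> x \<ge> 1" using less.prems by (auto simp: \<Omega>'_def)
    ultimately obtain I where I: "I \<subseteq> \<Omega>'" "\<forall>i\<in>I. \<forall>j\<in>I. i \<noteq> j \<longrightarrow> ?b i \<inter> ?b j = {}"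
      "\<forall>x\<in>\<Omega>'. \<exists>i\<in>I. \<rho> x \<le> \<rho> i \<and> ?b x \<inter> ?b i \<noteq> {}"
      using less.hyps[of \<Omega>'] by blast
    show ?thesis
    proof (intro exI[of _ "insert x0 I"] conjI ballI impI)
      show "insert x0 I \<subseteq> \<Omega>" using I(1) x0(1) by (auto simp: \<Omega>'_def)
      fix i j assume ij: "i \<in> insert x0 I" "j \<in> insert x0 I" "i \<noteq> j"
      have "?b k \<inter> ?b x0 = {}" if "k \<in> I" for k using I(1) that by (auto simp: \<Omega>'_def)
      moreover have "?b i \<inter> ?b j = {}" if "i \<in> I" "j \<in> I" using I(2) that ij(3) by blast
      ultimately show "?b i \<inter> ?b j = {}" using ij Int_commute by (metis insertE)
    next
      fix x assume x: "x \<in> \<Omega>"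
      show "\<exists>i\<in>insert x0 I. \<rho> x \<le> \<rho> i \<and> ?b x \<inter> ?b i \<noteq> {}"
      proof (cases "x \<in> \<Omega>'")
        case True
        then show ?thesis using I(3) by auto
      next
        case False
        then show ?thesis using x x0(2)[OF x] by (auto simp: \<Omega>'_def)
      qed
    qed
  qed (auto intro!: exI[of _ "{}"])
qed

text \<open>The radii are the largest ones with average above \<open>\<theta>\<close>, so that averages over larger balls are
  at most \<open>\<theta>\<close>.\<close>

definition covering :: "('a \<Rightarrow> real) \<Rightarrow> real \<Rightarrow> 'a set \<Rightarrow> ('a \<Rightarrow> nat) \<Rightarrow> ('a \<Rightarrow> 'a set) \<Rightarrow> bool" where
  "covering \<phi> \<theta> I r Q \<longleftrightarrow> finite I \<and> (\<forall>i\<in>I. heavy \<phi> \<theta> i (r i)) \<and>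
     (\<forall>i\<in>I. \<forall>R>r i. mass \<phi> i (real R) \<le> \<theta> * V i (real R)) \<and>
     disjoint_family_on (\<lambda>i. B i (real (r i))) I \<and> disjoint_family_on Q I \<and>
     (\<forall>i\<in>I. Q i \<subseteq> B i (2 * real (r i))) \<and> (\<Union>i\<in>I. Q i) = {x. \<exists>r. heavy \<phi> \<theta> x r}"

text \<open>Each point with a heavy ball is assigned by \<open>sel\<close> to a chosen ball that
  meets its own ball and has no smaller radius; hence the point lies within twice the chosen radius.
  The fibres of \<open>sel\<close> are the disjoint pieces \<open>Q\<close>.\<close>

lemma covering_exists:
  assumes \<phi>: "\<And>x. 0 \<le> \<phi> x" and S: "finite S" "\<And>x. x \<notin> S \<Longrightarrow> \<phi> x = 0" and \<theta>: "0 < \<theta>"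
  shows "\<exists>I r Q. covering \<phi> \<theta> I r Q"
proof -
  obtain n where n: "\<And>x r. heavy \<phi> \<theta> x r \<Longrightarrow> r < n \<and> (\<exists>z\<in>S. d z x < n)"
    using heavy_bounded[where \<phi>=\<phi> and S=S, OF \<phi> S \<theta>] by blast
  define \<Omega> where "\<Omega> = {x. \<exists>r. heavy \<phi> \<theta> x r}"
  have "\<Omega> \<subseteq> (\<Union>z\<in>S. {x. d z x \<le> n})"
  proof
    fix x assume "x \<in> \<Omega>"
    then obtain r where "heavy \<phi> \<theta> x r" by (auto simp: \<Omega>_def)
    from n[OF this] obtain z where "z \<in> S" "d z x < n" by auto
    then show "x \<in> (\<Union>z\<in>S. {x. d z x \<le> n})" by (intro UN_I[of z]) (simp_all add: d_sym)
  qed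
  then have fin: "finite \<Omega>" by (rule finite_subset) (use S finite_dball in auto)
  define \<rho> where "\<rho> x = Max {r. heavy \<phi> \<theta> x r}" for x
  have finr: "finite {r. heavy \<phi> \<theta> x r}" for x
    by (rule finite_subset[of _ "{..<n}"]) (use n in auto)
  have \<rho>: "heavy \<phi> \<theta> x (\<rho> x)" if "x \<in> \<Omega>" for x
    using Max_in[OF finr, of x] that by (auto simp: \<rho>_def \<Omega>_def)
  have \<rho>_max: "r \<le> \<rho> x" if "heavy \<phi> \<theta> x r" for x r
    unfolding \<rho>_def using finr that by (intro Max_ge) auto
  obtain I where I: "I \<subseteq> \<Omega>" "\<forall>i\<in>I. \<forall>j\<in>I. i \<noteq> j \<longrightarrow> B i (real (\<rho> i)) \<inter> B j (real (\<rho> j)) = {}"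
    "\<forall>x\<in>\<Omega>. \<exists>i\<in>I. \<rho> x \<le> \<rho> i \<and> B x (real (\<rho> x)) \<inter> B i (real (\<rho> i)) \<noteq> {}"
    using vitali[OF fin, of \<rho>] \<rho> by (auto simp: heavy_def)
  then obtain sel where sel: "\<And>x. x \<in> \<Omega> \<Longrightarrow> sel x \<in> I \<and> \<rho> x \<le> \<rho> (sel x) \<and> B x (real (\<rho> x)) \<inter> B (sel x) (real (\<rho> (sel x))) \<noteq> {}"
    by metis
  define Q where "Q i = {x \<in> \<Omega>. sel x = i}" for i
  have "covering \<phi> \<theta> I \<rho> Q"
    unfolding covering_def
  proof (intro conjI ballI allI impI)
    show "finite I" using I(1) fin by (rule finite_subset)
    show "heavy \<phi> \<theta> i (\<rho> i)" if "i \<in> I" for i using that I(1) \<rho> by auto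
    show "mass \<phi> i (real R) \<le> \<theta> * V i (real R)" if "i \<in> I" "R > \<rho> i" for i R
    proof (rule ccontr)
      assume "\<not> ?thesis"
      then have "heavy \<phi> \<theta> i R" using that by (simp add: heavy_def)
      then show False using \<rho>_max that(2) by fastforce
    qed
    show "disjoint_family_on (\<lambda>i. B i (real (\<rho> i))) I" using I(2) by (auto simp: disjoint_family_on_def)
    show "disjoint_family_on Q I" by (auto simp: disjoint_family_on_def Q_def)
    show "(\<Union>i\<in>I. Q i) = {x. \<exists>r. heavy \<phi> \<theta> x r}" using sel by (auto simp: Q_def \<Omega>_def)
    show "Q i \<subseteq> B i (2 * real (\<rho> i))" if "i \<in> I" for i
    proof
      fix x assume "x \<in> Q i"
      then have x: "x \<in> \<Omega>" "sel x = i" by (auto simp: Q_def)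
      obtain w where w: "w \<in> B x (real (\<rho> x))" "w \<in> B i (real (\<rho> i))" using sel[OF x(1)] x(2) by auto
      then have "d i x < \<rho> i + \<rho> x" using d_triangle[of i x w] d_sym[of x w] by (simp add: in_B)
      then show "x \<in> B i (2 * real (\<rho> i))" using sel[OF x(1)] x(2) by (simp add: in_B)
    qed
  qed
  then show ?thesis by blast
qed

text \<open>On a heavy ball the values up to \<open>\<theta> / 2\<close> account for at most half of
  \<open>\<theta> V\<close>, so the larger values account for the rest. The balls are disjoint, and
  \<open>truncation_le_min\<close> gives the form required by \<open>layer_cake\<close>.\<close>

lemma covering_sum:
  assumes \<phi>: "\<And>x. 0 \<le> \<phi> x" and S: "finite S" "\<And>x. x \<notin> S \<Longrightarrow> \<phi> x = 0" and \<theta>: "0 < \<theta>"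
    and cov: "covering \<phi> \<theta> I r Q" and q: "1 \<le> q"
  shows "(\<Sum>i\<in>I. V i (real (r i))) \<le> 2 * 2 powr q * (\<Sum>x\<in>S. m x * min (\<phi> x / \<theta>) ((\<phi> x / \<theta>) powr q))"
proof -
  let ?t = "\<lambda>x. m x * (if 1 / 2 < \<phi> x / \<theta> then \<phi> x / \<theta> else 0)"
  have t0: "0 \<le> ?t x" for x using \<phi>[of x] \<theta> by auto
  have fI: "finite I" using cov by (simp add: covering_def)
  have "V i (real (r i)) \<le> 2 * (\<Sum>x\<in>B i (real (r i)). ?t x)" if "i \<in> I" for i
  proof -
    have "\<theta> * V i (real (r i)) < mass \<phi> i (real (r i))" using cov that by (auto simp: covering_def heavy_def)
    also have "\<dots> \<le> (\<Sum>x\<in>B i (real (r i)). \<theta> * ?t x + \<theta> / 2 * m x)"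
      unfolding mass_def
    proof (rule sum_mono)
      fix x
      show "\<phi> x * m x \<le> \<theta> * ?t x + \<theta> / 2 * m x"
      proof (cases "1 / 2 < \<phi> x / \<theta>")
        case False
        then have "\<phi> x \<le> \<theta> / 2" using \<theta> by (simp add: field_simps)
        then show ?thesis using False mult_right_mono[of "\<phi> x" "\<theta> / 2" "m x"] by simp
      qed (use \<theta> in simp)
    qed
    also have "\<dots> = \<theta> * (\<Sum>x\<in>B i (real (r i)). ?t x) + \<theta> / 2 * V i (real (r i))"
      by (simp only: sum.distrib sum_distrib_left gvolume_def)
    finally have "\<theta> * V i (real (r i)) < \<theta> * (2 * (\<Sum>x\<in>B i (real (r i)). ?t x))" by (simp add: algebra_simps)
    then show ?thesis using \<theta> by (simp only: mult_less_cancel_left_pos)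
  qed
  then have "(\<Sum>i\<in>I. V i (real (r i))) \<le> 2 * (\<Sum>i\<in>I. \<Sum>x\<in>B i (real (r i)). ?t x)"
    unfolding sum_distrib_left by (intro sum_mono) auto
  also have "(\<Sum>i\<in>I. \<Sum>x\<in>B i (real (r i)). ?t x) = (\<Sum>x\<in>(\<Union>i\<in>I. B i (real (r i))). ?t x)"
    using cov fI by (intro sum.UNION_disjoint_family[symmetric]) (auto simp: covering_def)
  also have "\<dots> = (\<Sum>x\<in>(\<Union>i\<in>I. B i (real (r i))) \<inter> S. ?t x)"
    using S fI by (intro sum.mono_neutral_right) auto
  also have "\<dots> \<le> (\<Sum>x\<in>S. ?t x)" using S t0 by (intro sum_mono2) auto
  also have "\<dots> \<le> (\<Sum>x\<in>S. m x * (2 powr q * min (\<phi> x / \<theta>) ((\<phi> x / \<theta>) powr q)))"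
    using \<phi> \<theta> q by (intro sum_mono mult_left_mono truncation_le_min) auto
  also have "\<dots> = 2 powr q * (\<Sum>x\<in>S. m x * min (\<phi> x / \<theta>) ((\<phi> x / \<theta>) powr q))"
    by (simp add: sum_distrib_left mult_ac)
  finally show ?thesis by (simp add: mult.assoc)
qed

text \<open>Centred averages over integer radii. The real supremum is meaningful for nonnegative
  functions with finite support, by \<open>maximal_bdd\<close>.\<close>

definition maximal :: "('a \<Rightarrow> real) \<Rightarrow> 'a \<Rightarrow> real" where
  "maximal \<phi> x = (SUP r\<in>{1..}. mass \<phi> x (real r) / V x (real r))"

lemma maximal_bdd:
  assumes \<phi>: "\<And>x. 0 \<le> \<phi> x" and S: "finite S" "\<And>x. x \<notin> S \<Longrightarrow> \<phi> x = 0"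
  shows "bdd_above ((\<lambda>r. mass \<phi> x (real r) / V x (real r)) ` {1..})"
proof (rule bdd_aboveI2)
  fix r :: nat assume r: "r \<in> {1..}"
  have "\<phi> z \<le> (\<Sum>z\<in>S. \<phi> z)" for z
    using S \<phi> member_le_sum[of z S \<phi>] sum_nonneg[of S \<phi>] by (cases "z \<in> S") auto
  then have "mass \<phi> x (real r) \<le> (\<Sum>z\<in>B x (real r). (\<Sum>z\<in>S. \<phi> z) * m z)"
    unfolding mass_def by (intro sum_mono mult_right_mono) auto
  also have "\<dots> = (\<Sum>z\<in>S. \<phi> z) * V x (real r)" by (simp add: gvolume_def sum_distrib_left)
  finally show "mass \<phi> x (real r) / V x (real r) \<le> (\<Sum>z\<in>S. \<phi> z)"
    using V_pos[of "real r" x] r by (simp add: divide_le_eq)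
qed

lemma mass_le_maximal:
  assumes \<phi>: "\<And>x. 0 \<le> \<phi> x" and S: "finite S" "\<And>x. x \<notin> S \<Longrightarrow> \<phi> x = 0" and s: "s > 0"
  shows "mass \<phi> x s \<le> maximal \<phi> x * V x s"
proof -
  define r where "r = nat \<lceil>s\<rceil>"
  have r: "r \<ge> 1" "real r = real_of_int \<lceil>s\<rceil>" using s by (auto simp: r_def; linarith)+
  have "real k < s \<longleftrightarrow> real k < real r" for k
    unfolding r(2) by (metis less_ceiling_iff of_int_less_iff of_int_of_nat_eq)
  then have "B x s = B x (real r)" by (simp add: gball_def)
  then have e: "mass \<phi> x s = mass \<phi> x (real r)" "V x s = V x (real r)" by (simp_all add: mass_def gvolume_def)
  have "mass \<phi> x (real r) / V x (real r) \<le> maximal \<phi> x"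
    unfolding maximal_def using r by (intro cSUP_upper maximal_bdd[where \<phi>=\<phi> and S=S, OF \<phi> S]) auto
  moreover have "0 < V x (real r)" using r(1) by (intro V_pos) simp
  ultimately show ?thesis unfolding e by (simp only: pos_divide_le_eq)
qed

lemma maximal_nonneg:
  assumes \<phi>: "\<And>x. 0 \<le> \<phi> x" and S: "finite S" "\<And>x. x \<notin> S \<Longrightarrow> \<phi> x = 0"
  shows "0 \<le> maximal \<phi> x"
proof -
  have "0 \<le> maximal \<phi> x * V x 1" using mass_le_maximal[where \<phi>=\<phi> and S=S, OF \<phi> S, of 1 x] mass_nonneg[where \<phi>=\<phi>, OF \<phi>, of x 1] by simp
  then show ?thesis using V_pos[of 1 x] by (simp add: zero_le_mult_iff)
qed

text \<open>The set where the maximal function exceeds \<open>t\<close> is covered by the balls of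
  radius \<open>2 r\<close>; \<open>layer_cake\<close> with the exponents 2 and 3 gives
  \<open>16 D\<close> times \<open>2 + 2\<close>.\<close>

lemma maximal_L2:
  assumes \<phi>: "\<And>x. 0 \<le> \<phi> x" and S: "finite S" "\<And>x. x \<notin> S \<Longrightarrow> \<phi> x = 0" and X: "finite X"
  shows "(\<Sum>x\<in>X. (maximal \<phi> x)\<^sup>2 * m x) \<le> 64 * D * (\<Sum>x\<in>S. (\<phi> x)\<^sup>2 * m x)"
proof -
  note M0 = maximal_nonneg[where \<phi>=\<phi> and S=S, OF \<phi> S]
  have "(\<Sum>x\<in>X. m x * maximal \<phi> x powr 2) \<le> (D * (2 * 2 powr 3)) * (2 / (2 - 1) + 2 / (3 - 2)) * (\<Sum>x\<in>S. m x * \<phi> x powr 2)"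
  proof (rule layer_cake[OF X S(1)])
    fix t :: real assume t: "t > 0"
    obtain I r Q where cov: "covering \<phi> t I r Q" using covering_exists[where \<phi>=\<phi> and S=S, OF \<phi> S t] by blast
    have fI: "finite I" using cov by (simp add: covering_def)
    have sub: "{x\<in>X. t < maximal \<phi> x} \<subseteq> (\<Union>i\<in>I. B i (2 * real (r i)))"
    proof
      fix x assume "x \<in> {x\<in>X. t < maximal \<phi> x}"
      then have "t < maximal \<phi> x" by simp
      moreover have "({1..} :: nat set) \<noteq> {}" by auto
      ultimately obtain k where k: "k \<in> {1..}" "t < mass \<phi> x (real k) / V x (real k)"
        unfolding maximal_def using less_cSUP_iff[OF _ maximal_bdd[where \<phi>=\<phi> and S=S, OF \<phi> S], of t x] by blast
      then have "heavy \<phi> t x k" using V_pos[of "real k" x] by (simp add: heavy_def less_divide_eq)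
      then have "x \<in> (\<Union>i\<in>I. Q i)" using cov by (auto simp: covering_def)
      then show "x \<in> (\<Union>i\<in>I. B i (2 * real (r i)))" using cov by (fastforce simp: covering_def)
    qed
    have "(\<Sum>x\<in>X. m x * (if t < maximal \<phi> x then 1 else 0)) = (\<Sum>x\<in>{x\<in>X. t < maximal \<phi> x}. m x)"
      using X by (simp add: sum.If_cases if_distrib[of "\<lambda>u. _ * u"] Int_def cong: if_cong)
    also have "\<dots> \<le> (\<Sum>x\<in>(\<Union>i\<in>I. B i (2 * real (r i))). m x)" using sub fI by (intro sum_mono2) auto
    also have "\<dots> \<le> (\<Sum>i\<in>I. V i (2 * real (r i)))"
      unfolding gvolume_def by (rule sum_Union_le) (use fI in auto)
    also have "\<dots> \<le> (\<Sum>i\<in>I. D * V i (real (r i)))"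
      using cov by (intro sum_mono V_double) (auto simp: covering_def heavy_def)
    also have "\<dots> = D * (\<Sum>i\<in>I. V i (real (r i)))" by (simp add: sum_distrib_left)
    also have "\<dots> \<le> D * (2 * 2 powr 3 * (\<Sum>x\<in>S. m x * min (\<phi> x / t) ((\<phi> x / t) powr 3)))"
      using D by (intro mult_left_mono covering_sum[where \<phi>=\<phi> and S=S, OF \<phi> S t cov]) auto
    finally show "(\<Sum>x\<in>X. m x * (if t < maximal \<phi> x then 1 else 0)) \<le> (D * (2 * 2 powr 3)) * (\<Sum>x\<in>S. m x * min (\<phi> x / t) ((\<phi> x / t) powr 3))"
      by (simp only: mult.assoc)
  qed (use M0 \<phi> in auto)
  then show ?thesis using M0 \<phi> by (simp add: mult.commute)
qed

end

section \<open>The smoothed bad part and its maximal function bound\<close>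

context sub_gaussian_graph
begin

text \<open>At time \<open>steps r\<close> the kernel is spread over distances of order
  \<open>r\<close>, so its dyadic averages about \<open>z\<close> are averages about any
  \<open>x'\<close> of the ball, up to the factor \<open>D^3\<close> from recentring. The freedom of
  \<open>x'\<close> allows the bound to be averaged over the ball.\<close>

lemma heat_le_maximal:
  "\<exists>K>0. \<forall>\<phi> S i x' z r. (\<forall>x. 0 \<le> \<phi> x) \<longrightarrow> finite S \<longrightarrow> (\<forall>x. x \<notin> S \<longrightarrow> \<phi> x = 0) \<longrightarrow> (r::nat) \<ge> 1 \<longrightarrow>
     z \<in> B i (2 * real r) \<longrightarrow> x' \<in> B i (real r) \<longrightarrow> (mk ^^ steps (real r)) \<phi> z \<le> K * maximal \<phi> x'"
proof -
  obtain K where K: "K > 0" "\<forall>g y R F a. (\<forall>z. 0 \<le> g z) \<longrightarrow> R > 0 \<longrightarrow> finite F \<longrightarrow> 0 \<le> a \<longrightarrow>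
    (\<forall>j::nat. (\<Sum>z\<in>F \<inter> B y (2 ^ j * R). g z) \<le> a * D ^ j) \<longrightarrow>
    (\<Sum>z\<in>F. exp (- c * real (d y z) / R) * g z) \<le> K * (a :: real)" using annuli[OF c] by auto
  show ?thesis
  proof (intro exI[of _ "C * exp c * K * D ^ 3"] conjI allI impI)
    show "0 < C * exp c * K * D ^ 3" using C K(1) D by simp
    fix \<phi> :: "'a \<Rightarrow> real" and S i x' z and r :: nat
    assume \<phi>': "\<forall>x. 0 \<le> \<phi> x" and S: "finite S" and S': "\<forall>x. x \<notin> S \<longrightarrow> \<phi> x = 0" and r: "r \<ge> 1"
      and z: "z \<in> B i (2 * real r)" and x': "x' \<in> B i (real r)"
    note \<phi> = \<phi>'[rule_format] and S2 = S'[rule_format]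
    define k where "k = steps (real r)"
    define R where "R = rad k"
    have k: "k \<ge> 1" and R: "real r \<le> R" "R > 0" using steps[of "real r"] r rad_pos[of k] by (auto simp: k_def R_def)
    have dz: "real (d z x') < 3 * real r"
      using d_triangle[of z x' i] d_sym[of z i] z x' by (simp add: in_B)
    define M where "M = maximal \<phi> x'"
    have M: "0 \<le> M" unfolding M_def by (rule maximal_nonneg[where \<phi>=\<phi> and S=S, OF \<phi> S S2])
    let ?a = "M * (D ^ 3 * V z R)"
    have est: "(\<Sum>w\<in>S \<inter> B z (2 ^ j * R). \<phi> w * m w) \<le> ?a * D ^ j" for j
    proof -
      have p1: "R \<le> 2 ^ j * R" using R by (simp add: mult_le_cancel_right1)
      have "(\<Sum>w\<in>S \<inter> B z (2 ^ j * R). \<phi> w * m w) \<le> mass \<phi> z (2 ^ j * R)"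
        unfolding mass_def using \<phi> by (intro sum_mono2) auto
      also have "\<dots> \<le> mass \<phi> x' (2 ^ j * (4 * R))"
        by (rule mass_mono[OF \<phi>], rule B_subset) (use dz p1 R in linarith)
      also have "\<dots> \<le> M * V x' (2 ^ j * (4 * R))"
        unfolding M_def using R by (intro mass_le_maximal[where \<phi>=\<phi> and S=S, OF \<phi> S S2]) auto
      also have "V x' (2 ^ j * (4 * R)) \<le> V z (2 ^ (j + 3) * R)"
      proof (rule V_le)
        have "2 ^ (j + 3) * R = 8 * (2 ^ j * R)" by (simp add: power_add)
        then show "real (d x' z) + 2 ^ j * (4 * R) \<le> 2 ^ (j + 3) * R" using dz p1 R d_sym[of x' z] by linarith
      qed
      also have "V z (2 ^ (j + 3) * R) \<le> D ^ (j + 3) * V z R" by (rule V_double_pow[OF R(2)])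
      finally have "(\<Sum>w\<in>S \<inter> B z (2 ^ j * R). \<phi> w * m w) \<le> M * (D ^ (j + 3) * V z R)" using M by (simp add: mult_left_mono)
      then show ?thesis by (simp add: power_add mult_ac)
    qed
    have Vp: "0 < V z R" using V_pos[OF R(2)] .
    have "(mk ^^ k) \<phi> z = (\<Sum>w\<in>S. p k z w * (\<phi> w * m w))"
      using iter_mk_kernel[OF S, of \<phi> k z] S2 by (simp add: mult_ac)
    also have "\<dots> \<le> (\<Sum>w\<in>S. C * exp c / V z R * exp (- c * real (d z w) / R) * (\<phi> w * m w))"
      unfolding R_def using \<phi> by (intro sum_mono mult_right_mono kernel_le k mult_nonneg_nonneg) auto
    also have "\<dots> = C * exp c / V z R * (\<Sum>w\<in>S. exp (- c * real (d z w) / R) * (\<phi> w * m w))"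
      by (simp add: sum_distrib_left mult.assoc)
    also have "\<dots> \<le> C * exp c / V z R * (K * ?a)"
    proof (rule mult_left_mono)
      show "(\<Sum>w\<in>S. exp (- c * real (d z w) / R) * (\<phi> w * m w)) \<le> K * ?a"
        by (rule K(2)[rule_format]) (use \<phi> R S M D Vp est in auto)
    qed (use C Vp in simp)
    also have "\<dots> = C * exp c * K * D ^ 3 * M" using Vp by simp
    finally show "(mk ^^ steps (real r)) \<phi> z \<le> C * exp c * K * D ^ 3 * maximal \<phi> x'" by (simp add: k_def M_def)
  qed
qed

lemma iter_mk_cmod: "cmod ((mk ^^ k) g x) \<le> (mk ^^ k) (\<lambda>x. cmod (g x)) x"
proof (induction k arbitrary: x)
  case (Suc k)
  have "cmod (mk ((mk ^^ k) g) x) \<le> mk (\<lambda>x. cmod ((mk ^^ k) g x)) x"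
    unfolding mk_def by (rule order_trans[OF norm_sum]) (simp add: abs_mult)
  also have "\<dots> \<le> mk ((mk ^^ k) (\<lambda>x. cmod (g x))) x" by (rule mk_mono) (rule Suc)
  finally show ?case by simp
qed simp

lemma iter_mk_nonneg: "(\<And>x. 0 \<le> f x) \<Longrightarrow> 0 \<le> (mk ^^ k) f x" for f :: "'a \<Rightarrow> real"
proof (induction k arbitrary: x)
  case (Suc k)
  show ?case unfolding funpow.simps o_apply by (rule mk_nonneg) (rule Suc.IH[OF Suc.prems])
qed auto

lemma iter_mk_adjoint:
  fixes b u :: "'a \<Rightarrow> real"
  assumes S: "finite S" "\<And>x. x \<notin> S \<Longrightarrow> b x = 0" and X: "finite X" "\<And>x. x \<notin> X \<Longrightarrow> u x = 0"
  shows "(\<Sum>x\<in>X. u x * m x * (mk ^^ k) b x) = (\<Sum>z\<in>S. b z * m z * (mk ^^ k) u z)"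
proof -
  have "(\<Sum>x\<in>X. u x * m x * (mk ^^ k) b x) = (\<Sum>x\<in>X. \<Sum>z\<in>S. u x * m x * (p k x z * m z * b z))"
    using iter_mk_kernel[of S b k] S by (simp add: sum_distrib_left)
  also have "\<dots> = (\<Sum>z\<in>S. \<Sum>x\<in>X. u x * m x * (p k x z * m z * b z))" by (rule sum.swap)
  also have "\<dots> = (\<Sum>z\<in>S. b z * m z * (\<Sum>x\<in>X. p k z x * m x * u x))"
    unfolding sum_distrib_left by (intro sum.cong refl) (simp add: p_sym[of k _ "_ :: 'a"] mult_ac)
  also have "\<dots> = (\<Sum>z\<in>S. b z * m z * (mk ^^ k) u z)"
    using iter_mk_kernel[of X u k] X by simp
  finally show ?thesis .
qed

lemma iter_mk_support:
  fixes b :: "'a \<Rightarrow> 'b::real_algebra_1"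
  assumes "\<And>x. x \<notin> S \<Longrightarrow> b x = 0" "x \<notin> (\<Union>z\<in>S. {x. d z x \<le> n})" "k \<le> n"
  shows "(mk ^^ k) b x = 0"
proof -
  have "(mk ^^ k) b x = (mk ^^ k) (\<lambda>x. 0) x"
  proof (rule iter_mk_local)
    fix y assume "d x y \<le> k"
    then have "y \<notin> S" using assms(2,3) d_sym[of x y] by auto
    then show "b y = 0" by (rule assms(1))
  qed
  also have "\<dots> = 0" using iter_mk_mult[of k "\<lambda>_. 0 :: 'b" 0] by (simp add: fun_eq_iff)
  finally show ?thesis .
qed

text \<open>Let \<open>u\<close> be the sum of the smoothed moduli and \<open>s\<close> its squared
  norm. Moving the iterates to the other side pairs \<open>b i\<close> with iterates of
  \<open>u\<close>, which on each piece are bounded by the maximal function of \<open>u\<close> on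
  the disjoint balls. Cauchy-Schwarz and the maximal theorem bound \<open>s\<close> by a constant
  times \<open>\<theta> * sqrt \<Lambda> * sqrt s\<close>, and one factor \<open>sqrt s\<close> is
  divided out.\<close>

lemma smoothed_bad_part:
  "\<exists>K>0. \<forall>(f :: 'a \<Rightarrow> complex) S \<theta> I r Q X. finite S \<longrightarrow> (\<forall>x. x \<notin> S \<longrightarrow> f x = 0) \<longrightarrow> \<theta> > 0 \<longrightarrow>
     covering (\<lambda>x. cmod (f x)) \<theta> I r Q \<longrightarrow> finite X \<longrightarrow>
     (\<Sum>x\<in>X. (cmod (\<Sum>i\<in>I. (mk ^^ steps (real (r i))) (\<lambda>x. if x \<in> Q i then f x else 0) x))\<^sup>2 * m x)
       \<le> K * \<theta>\<^sup>2 * (\<Sum>i\<in>I. V i (real (r i)))"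
proof -
  obtain K where K: "K > 0" and HM: "\<forall>\<phi> S i x' z r. (\<forall>x. 0 \<le> \<phi> x) \<longrightarrow> finite S \<longrightarrow> (\<forall>x. x \<notin> S \<longrightarrow> \<phi> x = 0) \<longrightarrow> (r::nat) \<ge> 1 \<longrightarrow>
     z \<in> B i (2 * real r) \<longrightarrow> x' \<in> B i (real r) \<longrightarrow> (mk ^^ steps (real r)) \<phi> z \<le> K * maximal \<phi> x'"
    using heat_le_maximal by auto
  show ?thesis
  proof (intro exI[of _ "64 * D * (K * D)\<^sup>2"] conjI allI impI)
    show "0 < 64 * D * (K * D)\<^sup>2" using K D by simp
    fix f :: "'a \<Rightarrow> complex" and S \<theta> I r Q X
    assume S: "finite S" and f': "\<forall>x. x \<notin> S \<longrightarrow> f x = 0" and \<theta>: "(\<theta>::real) > 0"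
      and cov: "covering (\<lambda>x. cmod (f x)) \<theta> I r Q" and X: "finite (X :: 'a set)"
    note f = f'[rule_format]
    have fI: "finite I" using cov by (simp add: covering_def)
    define k where "k i = steps (real (r i))" for i
    define b where "b i x = (if x \<in> Q i then cmod (f x) else 0)" for i x
    define u where "u x = (\<Sum>i\<in>I. (mk ^^ k i) (b i) x)" for x
    define kmax where "kmax = (\<Sum>i\<in>I. k i)"
    define U where "U = X \<union> (\<Union>z\<in>S. {x. d z x \<le> kmax})"
    have U: "finite U" using X S finite_dball by (simp add: U_def)
    have b0: "0 \<le> b i x" and bS: "x \<notin> S \<Longrightarrow> b i x = 0" for i x using f by (auto simp: b_def)
    have u0: "0 \<le> u x" for x unfolding u_def by (intro sum_nonneg iter_mk_nonneg b0)
    have uU: "u x = 0" if "x \<notin> U" for x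
      unfolding u_def
    proof (intro sum.neutral ballI)
      fix i assume "i \<in> I"
      then have "k i \<le> kmax" unfolding kmax_def using fI by (intro member_le_sum) auto
      then show "(mk ^^ k i) (b i) x = 0" using that by (intro iter_mk_support[OF bS]) (auto simp: U_def)
    qed
    define s where "s = (\<Sum>x\<in>U. (u x)\<^sup>2 * m x)"
    define \<Lambda> where "\<Lambda> = (\<Sum>i\<in>I. V i (real (r i)))"
    have s0: "0 \<le> s" unfolding s_def by (intro sum_nonneg) auto
    define core where "core i = B i (real (r i))" for i
    have bound: "(\<Sum>z\<in>S. b i z * m z * (mk ^^ k i) u z) \<le> K * D * \<theta> * (\<Sum>x\<in>core i. maximal u x * m x)"
      if i: "i \<in> I" for i
    proof -
      let ?T = "\<Sum>z\<in>S. b i z * m z * (mk ^^ k i) u z" and ?V = "V i (real (r i))"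
      have r: "r i \<ge> 1" using cov i by (auto simp: covering_def heavy_def)
      have Vp: "?V > 0" using r by (intro V_pos) simp
      have Q: "Q i \<subseteq> B i (2 * real (r i))" using cov i by (auto simp: covering_def)
      \<comment> \<open>The radius \<open>r i\<close> is the largest heavy one, so the average over
        the ball of radius \<open>2 r i\<close>, which contains the piece, is at most
        \<open>\<theta>\<close>.\<close>
      have sumb: "(\<Sum>z\<in>S. b i z * m z) \<le> D * \<theta> * ?V"
      proof -
        have "(\<Sum>z\<in>S. b i z * m z) = (\<Sum>z\<in>S \<inter> Q i. cmod (f z) * m z)"
          using S by (simp add: b_def sum.inter_restrict if_distrib[of "\<lambda>u. u * _"] cong: if_cong)
        also have "\<dots> \<le> mass (\<lambda>x. cmod (f x)) i (real (2 * r i))"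
          unfolding mass_def using Q by (intro sum_mono2) auto
        also have "\<dots> \<le> \<theta> * V i (real (2 * r i))"
        proof -
          have "\<forall>R>r i. mass (\<lambda>x. cmod (f x)) i (real R) \<le> \<theta> * V i (real R)" using cov i by (simp add: covering_def)
          from this[rule_format, of "2 * r i"] show ?thesis using r by simp
        qed
        also have "\<dots> \<le> \<theta> * (D * ?V)" using \<theta> r V_double[of "real (r i)" i] by (intro mult_left_mono) auto
        finally show ?thesis by (simp add: mult_ac)
      qed
      have T: "?T \<le> K * D * \<theta> * ?V * maximal u x" if x: "x \<in> core i" for x
      proof -
        have M0: "0 \<le> maximal u x" by (rule maximal_nonneg[where \<phi>=u and S=U, OF u0 U uU])
        have "?T \<le> (\<Sum>z\<in>S. b i z * m z * (K * maximal u x))"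
        proof (rule sum_mono)
          fix z
          show "b i z * m z * (mk ^^ k i) u z \<le> b i z * m z * (K * maximal u x)"
          proof (cases "z \<in> Q i")
            case True
            then have "(mk ^^ k i) u z \<le> K * maximal u x"
              unfolding k_def using Q x r u0 U uU by (intro HM[rule_format, where S=U and i=i]) (auto simp: core_def)
            then show ?thesis using b0 by (intro mult_left_mono) auto
          qed (simp add: b_def)
        qed
        also have "\<dots> = (\<Sum>z\<in>S. b i z * m z) * (K * maximal u x)" by (simp add: sum_distrib_right)
        also have "\<dots> \<le> D * \<theta> * ?V * (K * maximal u x)" using M0 K by (intro mult_right_mono sumb) auto
        finally show ?thesis by (simp add: mult_ac)
      qed
      \<comment> \<open>The bound \<open>T\<close> holds at every \<open>x\<close> of the ball, so
        it may be averaged; this replaces a single value of the maximal function by its sum over the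
        ball.\<close>
      have "?T * ?V = (\<Sum>x\<in>core i. ?T * m x)" unfolding gvolume_def core_def sum_distrib_left ..
      also have "\<dots> \<le> (\<Sum>x\<in>core i. K * D * \<theta> * ?V * maximal u x * m x)"
        by (intro sum_mono mult_right_mono T) auto
      also have "\<dots> = K * D * \<theta> * (\<Sum>x\<in>core i. maximal u x * m x) * ?V"
        unfolding sum_distrib_left sum_distrib_right by (intro sum.cong refl) (simp only: mult_ac)
      finally show ?thesis using Vp by (simp only: mult_le_cancel_right_pos)
    qed
    have fcore: "finite (\<Union>i\<in>I. core i)" using fI by (simp add: core_def)
    have dcore: "(\<Sum>x\<in>(\<Union>i\<in>I. core i). h x) = (\<Sum>i\<in>I. \<Sum>x\<in>core i. h x)" for h :: "'a \<Rightarrow> real"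
      using cov fI by (intro sum.UNION_disjoint_family) (auto simp: covering_def core_def)
    have "s = (\<Sum>x\<in>U. \<Sum>i\<in>I. u x * m x * (mk ^^ k i) (b i) x)"
      unfolding s_def by (intro sum.cong refl) (simp add: power2_eq_square sum_distrib_left[symmetric] u_def[symmetric] mult_ac)
    also have "\<dots> = (\<Sum>i\<in>I. \<Sum>x\<in>U. u x * m x * (mk ^^ k i) (b i) x)" by (rule sum.swap)
    also have "\<dots> = (\<Sum>i\<in>I. \<Sum>z\<in>S. b i z * m z * (mk ^^ k i) u z)"
      by (intro sum.cong refl iter_mk_adjoint S U bS uU)
    also have "\<dots> \<le> (\<Sum>i\<in>I. K * D * \<theta> * (\<Sum>x\<in>core i. maximal u x * m x))" by (intro sum_mono bound)
    also have "\<dots> = K * D * \<theta> * (\<Sum>x\<in>(\<Union>i\<in>I. core i). maximal u x * m x)" by (simp add: dcore sum_distrib_left)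
    also have "(\<Sum>x\<in>(\<Union>i\<in>I. core i). maximal u x * m x) \<le> sqrt \<Lambda> * sqrt (64 * D * s)"
    proof -
      have "(\<Sum>x\<in>(\<Union>i\<in>I. core i). maximal u x * m x) \<le> (\<Sum>x\<in>(\<Union>i\<in>I. core i). \<bar>sqrt (m x)\<bar> * \<bar>maximal u x * sqrt (m x)\<bar>)"
      proof (rule sum_mono)
        fix x
        have "maximal u x * m x = sqrt (m x) * (maximal u x * sqrt (m x))" by (simp add: mult.left_commute)
        also have "\<dots> \<le> \<bar>sqrt (m x)\<bar> * \<bar>maximal u x * sqrt (m x)\<bar>" unfolding abs_mult[symmetric] by (rule abs_ge_self)
        finally show "maximal u x * m x \<le> \<bar>sqrt (m x)\<bar> * \<bar>maximal u x * sqrt (m x)\<bar>" .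
      qed
      also have "\<dots> \<le> L2_set (\<lambda>x. sqrt (m x)) (\<Union>i\<in>I. core i) * L2_set (\<lambda>x. maximal u x * sqrt (m x)) (\<Union>i\<in>I. core i)"
        by (rule L2_set_mult_ineq)
      also have "L2_set (\<lambda>x. sqrt (m x)) (\<Union>i\<in>I. core i) = sqrt \<Lambda>"
      proof -
        have "(\<Sum>x\<in>(\<Union>i\<in>I. core i). m x) = \<Lambda>" unfolding dcore unfolding \<Lambda>_def gvolume_def core_def ..
        then show ?thesis by (simp add: L2_set_def)
      qed
      also have "L2_set (\<lambda>x. maximal u x * sqrt (m x)) (\<Union>i\<in>I. core i) = sqrt (\<Sum>x\<in>(\<Union>i\<in>I. core i). (maximal u x)\<^sup>2 * m x)"
        unfolding L2_set_def by (simp add: power_mult_distrib)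
      also have "\<dots> \<le> sqrt (64 * D * s)"
        unfolding s_def by (intro real_sqrt_le_mono maximal_L2[where \<phi>=u and S=U, OF u0 U uU] fcore)
      finally show ?thesis by (simp add: \<Lambda>_def mult_left_mono sum_nonneg)
    qed
    finally have "s \<le> K * D * \<theta> * (sqrt \<Lambda> * sqrt (64 * D * s))" using K D \<theta> by (simp add: mult_left_mono)
    then have s_le: "s \<le> (K * D * \<theta> * sqrt \<Lambda> * sqrt (64 * D)) * sqrt s" by (simp add: real_sqrt_mult mult_ac)
    have \<Lambda>0: "0 \<le> \<Lambda>" unfolding \<Lambda>_def by (intro sum_nonneg) auto
    have "s \<le> (K * D * \<theta> * sqrt \<Lambda> * sqrt (64 * D))\<^sup>2"
    proof (cases "s = 0")
      case False
      then have sp: "sqrt s > 0" using s0 by simp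
      have "sqrt s * sqrt s \<le> (K * D * \<theta> * sqrt \<Lambda> * sqrt (64 * D)) * sqrt s" using s_le s0 by simp
      then have "sqrt s \<le> K * D * \<theta> * sqrt \<Lambda> * sqrt (64 * D)" using sp by (simp only: mult_le_cancel_right_pos)
      then have "(sqrt s)\<^sup>2 \<le> (K * D * \<theta> * sqrt \<Lambda> * sqrt (64 * D))\<^sup>2" using sp by (intro power_mono) auto
      then show ?thesis using s0 by simp
    qed simp
    also have "\<dots> = 64 * D * (K * D)\<^sup>2 * \<theta>\<^sup>2 * \<Lambda>"
      using \<Lambda>0 D by (simp add: power_mult_distrib)
    finally have s_final: "s \<le> 64 * D * (K * D)\<^sup>2 * \<theta>\<^sup>2 * \<Lambda>" .
    have "(\<Sum>x\<in>X. (cmod (\<Sum>i\<in>I. (mk ^^ steps (real (r i))) (\<lambda>x. if x \<in> Q i then f x else 0) x))\<^sup>2 * m x)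
        \<le> (\<Sum>x\<in>X. (u x)\<^sup>2 * m x)"
    proof (intro sum_mono mult_right_mono power_mono)
      fix x
      have "cmod (\<Sum>i\<in>I. (mk ^^ k i) (\<lambda>x. if x \<in> Q i then f x else 0) x) \<le> (\<Sum>i\<in>I. (mk ^^ k i) (\<lambda>x. cmod (if x \<in> Q i then f x else 0)) x)"
        by (rule order_trans[OF norm_sum], rule sum_mono, rule iter_mk_cmod)
      moreover have "(\<lambda>x. cmod (if x \<in> Q i then f x else 0)) = b i" for i by (auto simp: b_def)
      ultimately show "cmod (\<Sum>i\<in>I. (mk ^^ steps (real (r i))) (\<lambda>x. if x \<in> Q i then f x else 0) x) \<le> u x"
        by (simp add: u_def k_def)
    qed auto
    also have "\<dots> \<le> s" unfolding s_def using U by (intro sum_mono2) (auto simp: U_def)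
    finally show "(\<Sum>x\<in>X. (cmod (\<Sum>i\<in>I. (mk ^^ steps (real (r i))) (\<lambda>x. if x \<in> Q i then f x else 0) x))\<^sup>2 * m x)
       \<le> 64 * D * (K * D)\<^sup>2 * \<theta>\<^sup>2 * (\<Sum>i\<in>I. V i (real (r i)))"
      using s_final by (simp add: \<Lambda>_def)
  qed
qed

section \<open>Weak type and strong type bounds\<close>

definition approx :: "nat \<Rightarrow> ('a \<Rightarrow> complex) \<Rightarrow> 'a \<Rightarrow> complex" where
  "approx n f = (\<lambda>x. \<Sum>l\<le>n. of_real (isqrt_coeff l) * (mk ^^ l) f x)"

lemma approx_sum: "approx n (\<lambda>x. \<Sum>i\<in>I. f i x) = (\<lambda>x. \<Sum>i\<in>I. approx n (f i) x)"
  unfolding approx_def iter_mk_sum by (simp add: sum_distrib_left sum.swap[of _ I])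

lemma approx_add: "approx n (\<lambda>x. f x + g x) = (\<lambda>x. approx n f x + approx n g x)"
  using approx_sum[of n "\<lambda>b. if b then f else g" "{True, False}"] by simp

text \<open>Writes \<open>b = P^k b + (I - P^k) b\<close>; shifting the index in the product with
  \<open>P^k\<close> collects the coefficients in \<open>diff_coeff\<close>, up to degree
  \<open>n + k\<close>.\<close>

lemma approx_split:
  "approx n b x = approx n ((mk ^^ k) b) x + (\<Sum>l\<le>n + k. of_real (diff_coeff n k l) * (mk ^^ l) b x)"
proof -
  let ?a = "\<lambda>l. complex_of_real (isqrt_coeff l)"
  have "(\<Sum>l\<le>n + k. of_real (diff_coeff n k l) * (mk ^^ l) b x)
      = (\<Sum>l\<le>n + k. (if l \<le> n then ?a l * (mk ^^ l) b x else 0) - (if k \<le> l then ?a (l - k) * (mk ^^ l) b x else 0))"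
    by (intro sum.cong refl) (simp add: diff_coeff_def left_diff_distrib)
  also have "\<dots> = (\<Sum>l\<le>n + k. (if l \<le> n then ?a l * (mk ^^ l) b x else 0)) - (\<Sum>l\<le>n + k. (if k \<le> l then ?a (l - k) * (mk ^^ l) b x else 0))"
    by (rule sum_subtractf)
  also have "(\<Sum>l\<le>n + k. (if l \<le> n then ?a l * (mk ^^ l) b x else 0)) = approx n b x"
    unfolding approx_def by (rule sum.mono_neutral_cong_right) auto
  also have "(\<Sum>l\<le>n + k. (if k \<le> l then ?a (l - k) * (mk ^^ l) b x else 0)) = (\<Sum>l=k..n + k. ?a (l - k) * (mk ^^ l) b x)"
    by (rule sum.mono_neutral_cong_right) auto
  also have "\<dots> = (\<Sum>l\<le>n. ?a l * (mk ^^ (l + k)) b x)"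
    by (rule sum.reindex_bij_witness[of _ "\<lambda>l. l + k" "\<lambda>l. l - k"]) auto
  also have "\<dots> = approx n ((mk ^^ k) b) x" unfolding approx_def by (simp add: funpow_add)
  finally show ?thesis by simp
qed

text \<open>A function with finite support is a combination of point masses, so sublinearity reduces
  the gradient to those of the heat kernels.\<close>

lemma gradient_diff_part:
  assumes Y: "finite Y" "\<And>x. x \<notin> Y \<Longrightarrow> b x = 0"
  shows "gradient \<mu> (\<lambda>x. \<Sum>l\<in>L. of_real (e l) * (mk ^^ l) b x) x
    \<le> (\<Sum>y\<in>Y. cmod (b y) * m y * (\<Sum>l\<in>L. \<bar>e l\<bar> * gradient \<mu> (heat l y) x))"
proof (cases "finite L")
  case L: True
  have "(\<lambda>x. \<Sum>l\<in>L. of_real (e l) * (mk ^^ l) b x) = (\<lambda>x. \<Sum>y\<in>Y. (b y * of_real (m y)) * (\<Sum>l\<in>L. of_real (e l) * heat l y x))"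
  proof
    fix x
    have "(\<Sum>l\<in>L. of_real (e l) * (mk ^^ l) b x) = (\<Sum>l\<in>L. \<Sum>y\<in>Y. of_real (e l) * (of_real (p l x y * m y) * b y))"
      using iter_mk_kernel[of Y b] Y by (simp add: sum_distrib_left)
    also have "\<dots> = (\<Sum>y\<in>Y. \<Sum>l\<in>L. of_real (e l) * (of_real (p l x y * m y) * b y))" by (rule sum.swap)
    also have "\<dots> = (\<Sum>y\<in>Y. (b y * of_real (m y)) * (\<Sum>l\<in>L. of_real (e l) * heat l y x))"
      unfolding sum_distrib_left heat_def by (intro sum.cong refl) (simp add: mult_ac)
    finally show "(\<Sum>l\<in>L. of_real (e l) * (mk ^^ l) b x) = (\<Sum>y\<in>Y. (b y * of_real (m y)) * (\<Sum>l\<in>L. of_real (e l) * heat l y x))" .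
  qed
  then have "gradient \<mu> (\<lambda>x. \<Sum>l\<in>L. of_real (e l) * (mk ^^ l) b x) x
    \<le> (\<Sum>y\<in>Y. cmod (b y * of_real (m y)) * gradient \<mu> (\<lambda>x. \<Sum>l\<in>L. of_real (e l) * heat l y x) x)"
    using gradient_sum_le[OF Y(1), of "\<lambda>y. b y * of_real (m y)" "\<lambda>y x. \<Sum>l\<in>L. of_real (e l) * heat l y x" x] by simp
  also have "\<dots> \<le> (\<Sum>y\<in>Y. cmod (b y) * m y * (\<Sum>l\<in>L. \<bar>e l\<bar> * gradient \<mu> (heat l y) x))"
  proof (rule sum_mono)
    fix y
    have "gradient \<mu> (\<lambda>x. \<Sum>l\<in>L. of_real (e l) * heat l y x) x \<le> (\<Sum>l\<in>L. \<bar>e l\<bar> * gradient \<mu> (heat l y) x)"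
      using gradient_sum_le[OF L, of "\<lambda>l. of_real (e l)" "\<lambda>l. heat l y" x] by simp
    then show "cmod (b y * of_real (m y)) * gradient \<mu> (\<lambda>x. \<Sum>l\<in>L. of_real (e l) * heat l y x) x
      \<le> cmod (b y) * m y * (\<Sum>l\<in>L. \<bar>e l\<bar> * gradient \<mu> (heat l y) x)"
      by (simp add: norm_mult mult_left_mono)
  qed
  finally show ?thesis .
next
  case False
  then show ?thesis by (simp add: gradient_L2 L2_set_def)
qed

text \<open>The \<open>L^2\<close> bound is a hypothesis here and is supplied by
  \<open>energy\<close> once the spectral calculus of the Laplacian is available. The good part and
  the smoothed part are treated by Chebyshev's inequality with squares, the balls of radius
  \<open>4 r i\<close> by their volume, and the remainder off these balls by Chebyshev's inequality
  with the first power.\<close>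

lemma level_set_bound:
  assumes K0: "K0 \<ge> 0" and energy: "\<And>n f S X. finite S \<Longrightarrow> (\<And>x. x \<notin> S \<Longrightarrow> f x = 0) \<Longrightarrow> finite X \<Longrightarrow>
      (\<Sum>x\<in>X. (gradient \<mu> (approx n f) x)\<^sup>2 * m x) \<le> K0 * (\<Sum>x\<in>S. (cmod (f x))\<^sup>2 * m x)"
  shows "\<exists>K>0. \<forall>n f S X \<theta>. finite S \<longrightarrow> (\<forall>x. x \<notin> S \<longrightarrow> f x = 0) \<longrightarrow> finite X \<longrightarrow> \<theta> > 0 \<longrightarrow>
     (\<Sum>x\<in>X. m x * (if \<theta> < gradient \<mu> (approx n f) x / 3 then 1 else 0))
       \<le> K * (\<Sum>x\<in>S. m x * min (cmod (f x) / \<theta>) ((cmod (f x) / \<theta>) powr 2))"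
proof -
  obtain K1 where K1: "K1 > 0" and SB: "\<forall>(f :: 'a \<Rightarrow> complex) S \<theta> I r Q X. finite S \<longrightarrow> (\<forall>x. x \<notin> S \<longrightarrow> f x = 0) \<longrightarrow> \<theta> > 0 \<longrightarrow>
     covering (\<lambda>x. cmod (f x)) \<theta> I r Q \<longrightarrow> finite X \<longrightarrow>
     (\<Sum>x\<in>X. (cmod (\<Sum>i\<in>I. (mk ^^ steps (real (r i))) (\<lambda>x. if x \<in> Q i then f x else 0) x))\<^sup>2 * m x)
       \<le> K1 * \<theta>\<^sup>2 * (\<Sum>i\<in>I. V i (real (r i)))" using smoothed_bad_part by auto
  obtain K2 where K2: "K2 > 0" and OD: "\<forall>n y r A. r \<ge> 1 \<longrightarrow> finite A \<longrightarrow> (\<forall>x\<in>A. 2 * r \<le> real (d x y)) \<longrightarrow>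
      (\<Sum>l\<le>n + steps r. \<bar>diff_coeff n (steps r) l\<bar> * (\<Sum>x\<in>A. gradient \<mu> (heat l y) x * m x)) \<le> K2"
    using off_diagonal_sum by auto
  let ?K = "K0 + (K0 * K1 + D ^ 2 + K2 * D) * 8"
  show ?thesis
  proof (intro exI[of _ ?K] conjI allI impI)
    show "0 < ?K" using K0 K1 K2 D by (intro add_nonneg_pos mult_pos_pos add_pos_pos add_nonneg_pos) auto
    fix n and f :: "'a \<Rightarrow> complex" and S X \<theta>
    assume S: "finite S" and f': "\<forall>x. x \<notin> S \<longrightarrow> f x = 0" and X: "finite (X :: 'a set)" and \<theta>: "(\<theta>::real) > 0"
    note f = f'[rule_format]
    let ?\<phi> = "\<lambda>x. cmod (f x)"
    obtain I r Q where cov: "covering ?\<phi> \<theta> I r Q"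
      using covering_exists[where \<phi>="?\<phi>" and S=S, OF _ S _ \<theta>] f by auto
    have fI: "finite I" and ri: "\<And>i. i \<in> I \<Longrightarrow> r i \<ge> 1" and Qi: "\<And>i. i \<in> I \<Longrightarrow> Q i \<subseteq> B i (2 * real (r i))"
      and dQ: "disjoint_family_on Q I" and UQ: "(\<Union>i\<in>I. Q i) = {x. \<exists>r. heavy ?\<phi> \<theta> x r}"
      using cov by (auto simp: covering_def heavy_def)
    have mass2: "mass ?\<phi> i (real (2 * r i)) \<le> \<theta> * (D * V i (real (r i)))" if i: "i \<in> I" for i
    proof -
      have "r i < 2 * r i" using ri[OF i] by simp
      then have "mass ?\<phi> i (real (2 * r i)) \<le> \<theta> * V i (real (2 * r i))" using cov i unfolding covering_def by blast
      also have "\<dots> \<le> \<theta> * (D * V i (real (r i)))" using \<theta> ri[OF i] V_double[of "real (r i)" i] by (intro mult_left_mono) auto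
      finally show ?thesis .
    qed
    define k where "k i = steps (real (r i))" for i
    define b where "b i x = (if x \<in> Q i then f x else 0)" for i x
    define g where "g x = (if x \<in> (\<Union>i\<in>I. Q i) then 0 else f x)" for x
    define u where "u x = (\<Sum>i\<in>I. (mk ^^ k i) (b i) x)" for x
    define h where "h i x = (\<Sum>l\<le>n + k i. of_real (diff_coeff n (k i) l) * (mk ^^ l) (b i) x)" for i x
    define \<Lambda> where "\<Lambda> = (\<Sum>i\<in>I. V i (real (r i)))"
    define G where "G = (\<Sum>x\<in>S. m x * min (?\<phi> x / \<theta>) ((?\<phi> x / \<theta>) powr 2))"
    \<comment> \<open>With \<open>q = 2\<close> the constant of \<open>covering_sum\<close> is
      \<open>2 * 4\<close>.\<close>
    have \<Lambda>G: "\<Lambda> \<le> 8 * G"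
      using covering_sum[where \<phi>="?\<phi>" and S=S and q=2, OF _ S _ \<theta> cov] f by (simp add: \<Lambda>_def G_def)
    have \<Lambda>0: "0 \<le> \<Lambda>" unfolding \<Lambda>_def by (intro sum_nonneg) auto
    have f_split: "f = (\<lambda>x. g x + (\<Sum>i\<in>I. b i x))"
    proof
      fix x
      show "f x = g x + (\<Sum>i\<in>I. b i x)"
      proof (cases "x \<in> (\<Union>i\<in>I. Q i)")
        case True
        then obtain i where i: "i \<in> I" "x \<in> Q i" by auto
        have "(\<Sum>j\<in>I. b j x) = (\<Sum>j\<in>{i}. b j x)"
          using i dQ fI by (intro sum.mono_neutral_right) (auto simp: b_def disjoint_family_on_def)
        then show ?thesis using i True by (simp add: b_def g_def)
      next
        case False
        then show ?thesis by (auto simp: b_def g_def intro!: sum.neutral)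
      qed
    qed
    have af: "approx n f x = approx n g x + (approx n u x + (\<Sum>i\<in>I. h i x))" for x
    proof -
      have "approx n f x = approx n g x + (\<Sum>i\<in>I. approx n (b i) x)"
        by (subst f_split) (simp add: approx_add approx_sum)
      also have "(\<Sum>i\<in>I. approx n (b i) x) = (\<Sum>i\<in>I. approx n ((mk ^^ k i) (b i)) x) + (\<Sum>i\<in>I. h i x)"
        unfolding h_def sum.distrib[symmetric] by (intro sum.cong refl approx_split)
      also have "(\<Sum>i\<in>I. approx n ((mk ^^ k i) (b i)) x) = approx n u x"
        unfolding u_def[abs_def] approx_sum ..
      finally show ?thesis .
    qed
    let ?G1 = "gradient \<mu> (approx n g)" and ?G2 = "gradient \<mu> (approx n u)" and ?G3 = "\<lambda>x. \<Sum>i\<in>I. gradient \<mu> (h i) x"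
    have G_le: "gradient \<mu> (approx n f) x \<le> ?G1 x + ?G2 x + ?G3 x" for x
    proof -
      have "gradient \<mu> (approx n f) x \<le> ?G1 x + gradient \<mu> (\<lambda>x. approx n u x + (\<Sum>i\<in>I. h i x)) x"
        using gradient_add_le[of "approx n g" "\<lambda>x. approx n u x + (\<Sum>i\<in>I. h i x)" x] by (simp add: af[abs_def])
      also have "gradient \<mu> (\<lambda>x. approx n u x + (\<Sum>i\<in>I. h i x)) x \<le> ?G2 x + gradient \<mu> (\<lambda>x. \<Sum>i\<in>I. h i x) x"
        by (rule gradient_add_le)
      also have "gradient \<mu> (\<lambda>x. \<Sum>i\<in>I. h i x) x \<le> ?G3 x"
        using gradient_sum_le[OF fI, of "\<lambda>_. 1" h x] by simp
      finally show ?thesis by simp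
    qed
    define N where "N = (\<Union>i\<in>I. B i (4 * real (r i)))"
    have fN: "finite N" using fI by (simp add: N_def)
    \<comment> \<open>If the gradient exceeds \<open>3 \<theta>\<close>, one of its three majorants
      exceeds \<open>\<theta>\<close>.\<close>
    have split: "(if \<theta> < gradient \<mu> (approx n f) x / 3 then 1 else 0)
       \<le> (?G1 x / \<theta>)\<^sup>2 + (?G2 x / \<theta>)\<^sup>2 + indicator N x + (1 - indicator N x) * (?G3 x / \<theta>)" for x
    proof -
      have nn: "0 \<le> ?G3 x / \<theta>" using \<theta> by (intro divide_nonneg_pos sum_nonneg) auto
      have big: "1 \<le> (a / \<theta>)\<^sup>2" if "\<theta> < a" for a using that \<theta> by (simp add: power2_eq_square divide_simps mult_mono less_imp_le)
      show ?thesis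
      proof (cases "\<theta> < gradient \<mu> (approx n f) x / 3")
        case True
        then have "\<theta> < ?G1 x \<or> \<theta> < ?G2 x \<or> \<theta> < ?G3 x" using G_le[of x] by linarith
        then show ?thesis
        proof (elim disjE)
          assume "\<theta> < ?G1 x" then show ?thesis using big[of "?G1 x"] nn by (auto simp: indicator_def add_increasing2)
        next
          assume "\<theta> < ?G2 x" then show ?thesis using big[of "?G2 x"] nn by (auto simp: indicator_def add_increasing add_increasing2)
        next
          assume "\<theta> < ?G3 x" then have "1 \<le> ?G3 x / \<theta>" using \<theta> by simp
          then show ?thesis by (auto simp: indicator_def add_increasing)
        qed
      qed (use nn in \<open>auto simp: indicator_def\<close>)
    qed
    have e1: "(\<Sum>x\<in>X. m x * (?G1 x / \<theta>)\<^sup>2) \<le> K0 * G"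
    proof -
      have g0: "g x = 0" if "x \<notin> S" for x using f[OF that] by (simp add: g_def)
      have "(\<Sum>x\<in>X. m x * (?G1 x / \<theta>)\<^sup>2) = (\<Sum>x\<in>X. (?G1 x)\<^sup>2 * m x) / \<theta>\<^sup>2"
        by (simp add: sum_divide_distrib power_divide mult.commute)
      also have "\<dots> \<le> K0 * (\<Sum>x\<in>S. (cmod (g x))\<^sup>2 * m x) / \<theta>\<^sup>2"
        by (intro divide_right_mono energy S X g0) auto
      also have "\<dots> = K0 * (\<Sum>x\<in>S. m x * (cmod (g x) / \<theta>)\<^sup>2)"
        unfolding times_divide_eq_right[symmetric] sum_divide_distrib by (simp add: power_divide mult.commute)
      also have "(\<Sum>x\<in>S. m x * (cmod (g x) / \<theta>)\<^sup>2) \<le> G"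
        unfolding G_def
      proof (intro sum_mono mult_left_mono)
        fix x
        show "(cmod (g x) / \<theta>)\<^sup>2 \<le> min (?\<phi> x / \<theta>) ((?\<phi> x / \<theta>) powr 2)"
        proof (cases "x \<in> (\<Union>i\<in>I. Q i)")
          case True
          then show ?thesis using \<theta> by (simp add: g_def)
        next
          case False
          \<comment> \<open>Off the pieces the unit ball, which is the single point
            \<open>x\<close>, is not heavy; this gives \<open>|f x| <= \<theta>\<close>.\<close>
          then have "\<not> heavy ?\<phi> \<theta> x 1" unfolding UQ by auto
          moreover have "B x 1 = {x}" using d_zero by (auto simp: in_B)
          ultimately have "?\<phi> x * m x \<le> \<theta> * m x" by (simp add: heavy_def mass_def gvolume_def)
          then have s: "?\<phi> x / \<theta> \<le> 1" "0 \<le> ?\<phi> x / \<theta>" using m_pos[of x] \<theta> by auto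
          then have "(?\<phi> x / \<theta>)\<^sup>2 \<le> ?\<phi> x / \<theta>" using mult_left_mono[OF s] by (simp only: power2_eq_square mult_1_right)
          moreover have "(?\<phi> x / \<theta>)\<^sup>2 = (?\<phi> x / \<theta>) powr 2" using s by simp
          ultimately show ?thesis using False by (simp add: g_def)
        qed
      qed auto
      finally show ?thesis using K0 by (simp add: mult_left_mono)
    qed
    have e2: "(\<Sum>x\<in>X. m x * (?G2 x / \<theta>)\<^sup>2) \<le> K0 * K1 * \<Lambda>"
    proof -
      \<comment> \<open>A finite set carrying \<open>u\<close>: the iterate \<open>mk ^^ k i\<close>
        spreads the support by at most \<open>k i\<close>.\<close>
      define U where "U = (\<Union>z\<in>S. {x. d z x \<le> (\<Sum>i\<in>I. k i)})"
      have U: "finite U" using S finite_dball by (simp add: U_def)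
      have uU: "u x = 0" if "x \<notin> U" for x
        unfolding u_def
      proof (intro sum.neutral ballI)
        fix i assume "i \<in> I"
        then have "k i \<le> (\<Sum>i\<in>I. k i)" using fI by (intro member_le_sum) auto
        moreover have "b i x = 0" if "x \<notin> S" for x using f[OF that] by (simp add: b_def)
        ultimately show "(mk ^^ k i) (b i) x = 0" using that by (intro iter_mk_support[of S "b i"]) (auto simp: U_def)
      qed
      have "(\<Sum>x\<in>X. m x * (?G2 x / \<theta>)\<^sup>2) = (\<Sum>x\<in>X. (?G2 x)\<^sup>2 * m x) / \<theta>\<^sup>2"
        by (simp add: sum_divide_distrib power_divide mult.commute)
      also have "\<dots> \<le> K0 * (\<Sum>x\<in>U. (cmod (u x))\<^sup>2 * m x) / \<theta>\<^sup>2"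
        by (intro divide_right_mono energy U X uU) auto
      also have "\<dots> \<le> K0 * (K1 * \<theta>\<^sup>2 * \<Lambda>) / \<theta>\<^sup>2"
        unfolding u_def b_def[abs_def] k_def \<Lambda>_def
        using K0 by (intro divide_right_mono mult_left_mono SB[rule_format, OF S f \<theta> cov U]) auto
      also have "\<dots> = K0 * K1 * \<Lambda>" using \<theta> by simp
      finally show ?thesis .
    qed
    have e3: "(\<Sum>x\<in>X. m x * indicator N x) \<le> D ^ 2 * \<Lambda>"
    proof -
      have "(\<Sum>x\<in>X. m x * indicator N x) = (\<Sum>x\<in>X \<inter> N. m x)"
        using X by (simp add: indicator_def sum.inter_restrict if_distrib[of "\<lambda>u. _ * u"] cong: if_cong)
      also have "\<dots> \<le> (\<Sum>x\<in>N. m x)" using fN by (intro sum_mono2) auto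
      also have "\<dots> \<le> (\<Sum>i\<in>I. V i (4 * real (r i)))"
        unfolding gvolume_def N_def by (rule sum_Union_le) (use fI in auto)
      also have "\<dots> \<le> (\<Sum>i\<in>I. D ^ 2 * V i (real (r i)))"
      proof (rule sum_mono)
        fix i assume "i \<in> I"
        then show "V i (4 * real (r i)) \<le> D ^ 2 * V i (real (r i))" using V_double_pow[of "real (r i)" i 2] ri[of i] by simp
      qed
      also have "\<dots> = D ^ 2 * \<Lambda>" by (simp add: \<Lambda>_def sum_distrib_left)
      finally show ?thesis .
    qed
    have e4: "(\<Sum>x\<in>X. m x * ((1 - indicator N x) * (?G3 x / \<theta>))) \<le> K2 * D * \<Lambda>"
    proof -
      have one: "(\<Sum>x\<in>X - N. gradient \<mu> (h i) x * m x) \<le> K2 * (\<theta> * (D * V i (real (r i))))" if i: "i \<in> I" for i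
      proof -
        define Y where "Y = Q i \<inter> S"
        have Y: "finite Y" "\<And>x. x \<notin> Y \<Longrightarrow> b i x = 0" using S f by (auto simp: Y_def b_def)
        let ?t = "\<lambda>y l x. \<bar>diff_coeff n (k i) l\<bar> * gradient \<mu> (heat l y) x"
        have "(\<Sum>x\<in>X - N. gradient \<mu> (h i) x * m x)
            \<le> (\<Sum>x\<in>X - N. (\<Sum>y\<in>Y. cmod (b i y) * m y * (\<Sum>l\<le>n + k i. ?t y l x)) * m x)"
          unfolding h_def by (intro sum_mono mult_right_mono gradient_diff_part Y) auto
        also have "\<dots> = (\<Sum>x\<in>X - N. \<Sum>y\<in>Y. \<Sum>l\<le>n + k i. cmod (b i y) * m y * (?t y l x * m x))"
          by (simp add: sum_distrib_left sum_distrib_right mult.assoc)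
        also have "\<dots> = (\<Sum>y\<in>Y. \<Sum>x\<in>X - N. \<Sum>l\<le>n + k i. cmod (b i y) * m y * (?t y l x * m x))" by (rule sum.swap)
        also have "\<dots> = (\<Sum>y\<in>Y. \<Sum>l\<le>n + k i. \<Sum>x\<in>X - N. cmod (b i y) * m y * (?t y l x * m x))"
          by (intro sum.cong refl sum.swap)
        also have "\<dots> = (\<Sum>y\<in>Y. cmod (b i y) * m y * (\<Sum>l\<le>n + k i. \<bar>diff_coeff n (k i) l\<bar> * (\<Sum>x\<in>X - N. gradient \<mu> (heat l y) x * m x)))"
          by (simp add: sum_distrib_left mult.assoc)
        also have "\<dots> \<le> (\<Sum>y\<in>Y. cmod (b i y) * m y * K2)"
        proof (intro sum_mono mult_left_mono)
          fix y assume y: "y \<in> Y"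
          \<comment> \<open>Off \<open>N\<close> the distance to \<open>i\<close> is at least
            \<open>4 r i\<close>, and the piece lies within \<open>2 r i\<close>; the difference is
            the separation required by \<open>off_diagonal_sum\<close>.\<close>
          have "\<forall>x\<in>X - N. 2 * real (r i) \<le> real (d x y)"
          proof
            fix x assume "x \<in> X - N"
            then have "\<not> real (d i x) < 4 * real (r i)" using i by (auto simp: N_def in_B)
            moreover have "real (d i y) < 2 * real (r i)" using y Qi[OF i] by (auto simp: Y_def in_B)
            ultimately show "2 * real (r i) \<le> real (d x y)" using d_triangle[of i x y] d_sym[of x y] by linarith
          qed
          then show "(\<Sum>l\<le>n + k i. \<bar>diff_coeff n (k i) l\<bar> * (\<Sum>x\<in>X - N. gradient \<mu> (heat l y) x * m x)) \<le> K2"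
            unfolding k_def using OD X ri[OF i] by simp
        qed auto
        also have "\<dots> = K2 * (\<Sum>y\<in>Y. cmod (f y) * m y)"
          unfolding sum_distrib_left by (intro sum.cong refl) (simp add: b_def Y_def)
        also have "(\<Sum>y\<in>Y. cmod (f y) * m y) \<le> mass ?\<phi> i (real (2 * r i))"
          unfolding mass_def using Qi[OF i] by (intro sum_mono2) (auto simp: Y_def)
        also have "mass ?\<phi> i (real (2 * r i)) \<le> \<theta> * (D * V i (real (r i)))" by (rule mass2[OF i])
        finally show ?thesis using K2 by (simp add: mult_left_mono)
      qed
      have "(\<Sum>x\<in>X. m x * ((1 - indicator N x) * (?G3 x / \<theta>))) = (\<Sum>x\<in>X - N. m x * (?G3 x / \<theta>))"
        using X by (intro sum.mono_neutral_cong_right) (auto simp: indicator_def)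
      also have "\<dots> = (\<Sum>x\<in>X - N. \<Sum>i\<in>I. gradient \<mu> (h i) x * m x) / \<theta>"
        unfolding sum_divide_distrib by (intro sum.cong refl) (simp add: sum_distrib_left sum_divide_distrib[symmetric] mult.commute)
      also have "(\<Sum>x\<in>X - N. \<Sum>i\<in>I. gradient \<mu> (h i) x * m x) = (\<Sum>i\<in>I. \<Sum>x\<in>X - N. gradient \<mu> (h i) x * m x)" by (rule sum.swap)
      also have "\<dots> / \<theta> \<le> (\<Sum>i\<in>I. K2 * (\<theta> * (D * V i (real (r i))))) / \<theta>"
        using \<theta> by (intro divide_right_mono sum_mono one) auto
      also have "\<dots> = K2 * D * \<Lambda>" using \<theta> by (simp add: \<Lambda>_def sum_distrib_left sum_divide_distrib mult_ac)
      finally show ?thesis .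
    qed
    have "(\<Sum>x\<in>X. m x * (if \<theta> < gradient \<mu> (approx n f) x / 3 then 1 else 0))
       \<le> (\<Sum>x\<in>X. m x * ((?G1 x / \<theta>)\<^sup>2 + (?G2 x / \<theta>)\<^sup>2 + indicator N x + (1 - indicator N x) * (?G3 x / \<theta>)))"
      by (intro sum_mono mult_left_mono split) auto
    also have "\<dots> = (\<Sum>x\<in>X. m x * (?G1 x / \<theta>)\<^sup>2) + (\<Sum>x\<in>X. m x * (?G2 x / \<theta>)\<^sup>2) + (\<Sum>x\<in>X. m x * indicator N x)
        + (\<Sum>x\<in>X. m x * ((1 - indicator N x) * (?G3 x / \<theta>)))"
      by (simp only: distrib_left sum.distrib)
    also have "\<dots> \<le> K0 * G + (K0 * K1 + D ^ 2 + K2 * D) * \<Lambda>"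
      using e1 e2 e3 e4 by (simp add: distrib_right)
    also have "\<dots> \<le> K0 * G + (K0 * K1 + D ^ 2 + K2 * D) * (8 * G)"
      using \<Lambda>G K0 K1 K2 D by (intro add_left_mono mult_left_mono) auto
    also have "\<dots> = ?K * G" by (simp add: algebra_simps)
    finally show "(\<Sum>x\<in>X. m x * (if \<theta> < gradient \<mu> (approx n f) x / 3 then 1 else 0))
       \<le> ?K * (\<Sum>x\<in>S. m x * min (cmod (f x) / \<theta>) ((cmod (f x) / \<theta>) powr 2))" by (simp add: G_def)
  qed
qed

text \<open>The constant of the interpolation contains \<open>q / (2 - q)\<close>, hence
  \<open>q < 2\<close>; at \<open>q = 2\<close> the energy hypothesis is itself the bound.\<close>

lemma strong_type:
  assumes K0: "K0 \<ge> 0" and energy: "\<And>n f S X. finite S \<Longrightarrow> (\<And>x. x \<notin> S \<Longrightarrow> f x = 0) \<Longrightarrow> finite X \<Longrightarrow>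
      (\<Sum>x\<in>X. (gradient \<mu> (approx n f) x)\<^sup>2 * m x) \<le> K0 * (\<Sum>x\<in>S. (cmod (f x))\<^sup>2 * m x)"
    and q: "1 < q" "q < 2"
  shows "\<exists>K>0. \<forall>n f S X. finite S \<longrightarrow> (\<forall>x. x \<notin> S \<longrightarrow> f x = 0) \<longrightarrow> finite X \<longrightarrow>
     (\<Sum>x\<in>X. gradient \<mu> (approx n f) x powr q * m x) \<le> K * (\<Sum>x\<in>S. cmod (f x) powr q * m x)"
proof -
  have "\<exists>K>0. \<forall>n f S X \<theta>. finite S \<longrightarrow> (\<forall>x. x \<notin> S \<longrightarrow> f x = 0) \<longrightarrow> finite X \<longrightarrow> \<theta> > 0 \<longrightarrow>
     (\<Sum>x\<in>X. m x * (if \<theta> < gradient \<mu> (approx n f) x / 3 then 1 else 0))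
       \<le> K * (\<Sum>x\<in>S. m x * min (cmod (f x) / \<theta>) ((cmod (f x) / \<theta>) powr 2))"
    by (rule level_set_bound[OF K0], rule energy)
  then obtain K where K: "K > 0" and L: "\<And>n f S X \<theta>. finite S \<Longrightarrow> (\<forall>x. x \<notin> S \<longrightarrow> f x = 0) \<Longrightarrow> finite X \<Longrightarrow> \<theta> > 0 \<Longrightarrow>
     (\<Sum>x\<in>X. m x * (if \<theta> < gradient \<mu> (approx n f) x / 3 then 1 else 0))
       \<le> K * (\<Sum>x\<in>S. m x * min (cmod (f x) / \<theta>) ((cmod (f x) / \<theta>) powr 2))" by meson
  let ?K = "3 powr q * (K * (q / (q - 1) + q / (2 - q)))"
  show ?thesis
  proof (intro exI[of _ ?K] conjI allI impI)
    show "0 < ?K" using K q by (intro mult_pos_pos add_pos_pos) auto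
    fix n and f :: "'a \<Rightarrow> complex" and S X assume S: "finite S" and f: "\<forall>x. x \<notin> S \<longrightarrow> f x = 0" and X: "finite (X :: 'a set)"
    have "(\<Sum>x\<in>X. m x * (gradient \<mu> (approx n f) x / 3) powr q)
        \<le> K * (q / (q - 1) + q / (2 - q)) * (\<Sum>x\<in>S. m x * cmod (f x) powr q)"
      proof (rule layer_cake[OF X S q])
      fix t :: real assume "t > 0"
      then show "(\<Sum>x\<in>X. m x * (if t < gradient \<mu> (approx n f) x / 3 then 1 else 0))
         \<le> K * (\<Sum>x\<in>S. m x * min (cmod (f x) / t) ((cmod (f x) / t) powr 2))" by (rule L[OF S f X])
    qed auto
    moreover have "(\<Sum>x\<in>X. m x * (gradient \<mu> (approx n f) x / 3) powr q) = (\<Sum>x\<in>X. gradient \<mu> (approx n f) x powr q * m x) / 3 powr q"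
      by (simp add: powr_divide sum_divide_distrib mult.commute)
    ultimately show "(\<Sum>x\<in>X. gradient \<mu> (approx n f) x powr q * m x) \<le> ?K * (\<Sum>x\<in>S. cmod (f x) powr q * m x)"
      by (simp add: divide_le_eq mult_ac)
  qed
qed

end

section \<open>Spectral calculus for the Laplacian\<close>

context wgraph
begin

text \<open>Such a function has zero energy, so it is constant along edges, and the graph is
  connected.\<close>

lemma laplacian_zero_const:
  assumes f: "f \<in> Lp m 2" and z: "laplacian \<mu> f = (\<lambda>x. 0)" shows "f x = f y"
proof -
  have "(Lp_norm m 2 (gradient \<mu> f))\<^sup>2 \<le> 0" using gradient_energy(2)[OF f] by (simp add: z L2_inner_def)
  then have "(norm (gradient \<mu> f x))\<^sup>2 * m x \<le> 0" for x
    using Lp2_sum_le[OF gradient_energy(1)[OF f], of "{x}"] by simp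
  then have "(gradient \<mu> f x)\<^sup>2 = 0" for x
    using m_pos[of x] by (metis mult_le_0_iff not_le real_norm_def power2_abs zero_le_power2 order_antisym)
  then have zero: "\<forall>y\<in>nb x. \<mu> x y / m x * (cmod (f x - f y))\<^sup>2 = 0" for x
    unfolding gradient_sq by (subst (asm) sum_nonneg_eq_0_iff) auto
  have edge: "f x = f y" if "adj \<mu> x y" for x y
  proof -
    have "y \<in> nb x" using that by (simp add: nb_def)
    then show ?thesis using zero[of x, THEN bspec, of y] \<mu>_pos[of y x] by simp
  qed
  have "(x, y) \<in> rel ^^ n \<Longrightarrow> f x = f y" for n x y
    by (induction n arbitrary: y) (auto dest: edge)
  then show ?thesis using d_relpow by blast
qed

end

context sub_gaussian_graph
begin

text \<open>A harmonic function in \<open>L^2\<close> is constant, and the total volume is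
  infinite.\<close>

lemma laplacian_ker:
  assumes f: "f \<in> Lp m 2" and z: "laplacian \<mu> f = (\<lambda>x. 0)" shows "f = (\<lambda>x. 0)"
proof (rule ccontr)
  assume "f \<noteq> (\<lambda>x. 0)"
  then obtain x where x: "f x \<noteq> 0" by auto
  obtain n :: nat where "(Lp_norm m 2 f)\<^sup>2 / (cmod (f x))\<^sup>2 < V x (real n)" using V_unbounded by blast
  moreover have "(cmod (f x))\<^sup>2 * V x (real n) = (\<Sum>y\<in>B x (real n). (norm (f y))\<^sup>2 * m y)"
    unfolding gvolume_def sum_distrib_left
  proof (intro sum.cong refl)
    fix y
    have "f y = f x" by (rule laplacian_zero_const[OF f z])
    then show "(cmod (f x))\<^sup>2 * m y = (norm (f y))\<^sup>2 * m y" by simp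
  qed
  moreover have "\<dots> \<le> (Lp_norm m 2 f)\<^sup>2" by (rule Lp2_sum_le[OF f]) simp
  ultimately show False using x by (simp add: divide_less_eq mult.commute)
qed

text \<open>An eigenfunction for the eigenvalue \<open>2\<close> satisfies \<open>mk f = - f\<close>, which contradicts analyticity.\<close>

lemma laplacian_ker_2:
  assumes f: "f \<in> Lp m 2" and z: "laplacian \<mu> f = (\<lambda>x. of_real 2 * f x)" shows "f = (\<lambda>x. 0)"
proof (rule Lp_norm_eq_0[OF f])
  have mkf: "mk f x = f x * (-1)" for x using fun_cong[OF z, of x] by (simp add: laplacian_eq algebra_simps add_eq_0_iff)
  have it: "(mk ^^ k) f = (\<lambda>x. (-1) ^ k * f x)" for k
  proof (induction k)
    case (Suc k)
    have "(mk ^^ Suc k) f = mk (\<lambda>x. f x * (-1) ^ k)" using Suc by (simp add: mult.commute)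
    also have "\<dots> = (\<lambda>x. mk f x * (-1) ^ k)" using iter_mk_mult[of 1 f "(-1) ^ k"] by simp
    finally show ?case by (simp add: mkf fun_eq_iff mult.commute)
  qed simp
  define k where "k = nat \<lceil>C'\<rceil>"
  have k: "k \<ge> 1" "C' \<le> real k" using C' unfolding k_def by linarith+
  have "mk ((mk ^^ k) f) x = - ((-1) ^ k * f x)" for x using fun_cong[OF it[of "Suc k"], of x] by simp
  then have "laplacian \<mu> ((mk ^^ k) f) = (\<lambda>x. (-1) ^ k * 2 * f x)"
    by (simp add: laplacian_eq fun_cong[OF it[of k]] mult_ac)
  then have "2 * Lp_norm m 2 f \<le> C' / real k * Lp_norm m 2 f"
    using analytic[OF k(1) f] by (simp add: Lp_norm_cmult[OF f] norm_mult norm_power)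
  also have "\<dots> \<le> 1 * Lp_norm m 2 f" using k by (intro mult_right_mono) auto
  finally show "Lp_norm m 2 f = 0" using Lp_norm_nonneg[of 2 f] by linarith
qed

text \<open>The upper bound 2 for the form comes from the Markov operator being a
  contraction.\<close>

sublocale lap: psd_operator m "laplacian \<mu>" 2
proof
  fix f g :: "'a \<Rightarrow> complex" and a b :: complex
  assume f: "f \<in> Lp m 2"
  show "laplacian \<mu> f \<in> Lp m 2" by (rule laplacian_Lp[OF f])
  show "0 \<le> Re (L2_inner m (laplacian \<mu> f) f)"
    using gradient_energy(2)[OF f] zero_le_power2[of "Lp_norm m 2 (gradient \<mu> f)"] by linarith
  have "\<bar>inner (emb (mk f)) (emb f)\<bar> \<le> Lp_norm m 2 (mk f) * Lp_norm m 2 f"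
    using Cauchy_Schwarz_ineq2[of "emb (mk f)" "emb f"] by (simp add: norm_emb mk_Lp f)
  also have "\<dots> \<le> Lp_norm m 2 f * Lp_norm m 2 f" using mk_Lp[OF f] by (intro mult_right_mono) auto
  finally show "Re (L2_inner m (laplacian \<mu> f) f) \<le> 2 * (Lp_norm m 2 f)\<^sup>2"
    unfolding laplacian_inner[OF f] power2_eq_square by linarith
  show "f = (\<lambda>x. 0)" if "laplacian \<mu> f = (\<lambda>x. 0)" by (rule laplacian_ker[OF f that])
  show "f = (\<lambda>x. 0)" if "laplacian \<mu> f = (\<lambda>x. of_real 2 * f x)" by (rule laplacian_ker_2[OF f that])
  assume g: "g \<in> Lp m 2"
  show "laplacian \<mu> (\<lambda>x. a * f x + b * g x) = (\<lambda>x. a * laplacian \<mu> f x + b * laplacian \<mu> g x)"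
    by (simp add: laplacian_eq mk_def fun_eq_iff sum.distrib scaleR_right_distrib sum_distrib_left algebra_simps)
  show "L2_inner m (laplacian \<mu> f) g = L2_inner m f (laplacian \<mu> g)"
    unfolding laplacian_eq by (simp add: L2_inner_diff mk_Lp f g mk_inner)
next
  show "\<exists>K. \<forall>f\<in>Lp m 2. Lp_norm m 2 (laplacian \<mu> f) \<le> K * Lp_norm m 2 f"
    using laplacian_norm_le by blast
qed simp

lemma emb_iter_mk:
  assumes f: "f \<in> Lp m 2" shows "emb ((mk ^^ l) f) = poly_op lap.T ([:1, -1:] ^ l) (emb f)"
proof (induction l)
  case (Suc l)
  have g: "(mk ^^ l) f \<in> Lp m 2" using iter_mk_Lp[OF f] by blast
  have "[:1, -1:] = 1 - [:0, 1 :: real:]" by (simp add: one_pCons)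
  then have p: "poly_op lap.T [:1, -1:] x = x - lap.T x" for x by (simp only: poly_op_diff[OF lap.T_lin] poly_op_1[OF lap.T_lin] poly_op_X[OF lap.T_lin])
  have "mk ((mk ^^ l) f) = (\<lambda>x. (mk ^^ l) f x - laplacian \<mu> ((mk ^^ l) f) x)" by (simp add: laplacian_eq)
  then have "emb ((mk ^^ Suc l) f) = emb ((mk ^^ l) f) - lap.T (emb ((mk ^^ l) f))"
    using emb_diff(2)[OF g laplacian_Lp[OF g]] by (simp add: lap.T_emb g)
  then show ?case unfolding power_Suc poly_op_mult[OF lap.T_lin] p Suc .
qed (simp add: poly_op_1[OF lap.T_lin])

lemma approx_Lp: "f \<in> Lp m 2 \<Longrightarrow> approx n f \<in> Lp m 2"
  and emb_approx: "f \<in> Lp m 2 \<Longrightarrow> emb (approx n f) = poly_op lap.T (isqrt_poly n) (emb f)"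
proof -
  assume f: "f \<in> Lp m 2"
  have *: "approx n f \<in> Lp m 2 \<and> emb (approx n f) = (\<Sum>l\<le>n. ell2_cmult (of_real (isqrt_coeff l)) (emb ((mk ^^ l) f)))"
    unfolding approx_def by (rule emb_sum) (use iter_mk_Lp[OF f] in auto)
  then show "approx n f \<in> Lp m 2" ..
  show "emb (approx n f) = poly_op lap.T (isqrt_poly n) (emb f)"
    using * by (simp add: isqrt_poly_def poly_op_sum[OF lap.T_lin] poly_op_smult[OF lap.T_lin] emb_iter_mk[OF f])
qed

lemma S_approx_bounded:
  assumes f: "f \<in> Lp m 2" shows "Lp_norm m 2 (lap.S (approx n f)) \<le> 2 * Lp_norm m 2 f"
  by (rule lap.S_poly_bounded[OF f approx_Lp[OF f] emb_approx[OF f]]) (use isqrt_poly_bounded in auto)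

lemma S_approx_tendsto:
  assumes f: "f \<in> Lp m 2" shows "Lp_tendsto m 2 (\<lambda>n. lap.S (approx n f)) f"
  by (rule lap.S_poly_tendsto[where p=isqrt_poly and B=2])
    (use f approx_Lp emb_approx isqrt_poly_bounded isqrt_poly_tendsto in auto)

text \<open>The energy inequality has the factor 2 for squares; the constant \<open>sqrt 2\<close>
  is rounded up to 2.\<close>

lemma gradient_le_S:
  assumes f: "f \<in> Lp m 2" shows "Lp_norm m 2 (gradient \<mu> f) \<le> 2 * Lp_norm m 2 (lap.S f)"
proof (rule power2_le_imp_le)
  have "(Lp_norm m 2 (gradient \<mu> f))\<^sup>2 \<le> 2 * (Lp_norm m 2 (lap.S f))\<^sup>2"
    using gradient_energy(2)[OF f] by (simp add: lap.S_norm[OF f])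
  then show "(Lp_norm m 2 (gradient \<mu> f))\<^sup>2 \<le> (2 * Lp_norm m 2 (lap.S f))\<^sup>2"
    using zero_le_power2[of "Lp_norm m 2 (lap.S f)"] four_x_squared[of "Lp_norm m 2 (lap.S f)"] by linarith
qed simp

text \<open>The constant is \<open>(2 * 2)^2\<close>: one factor 2 from
  \<open>gradient_le_S\<close>, the other from \<open>S_approx_bounded\<close>.\<close>

lemma energy:
  assumes S: "finite S" "\<And>x. x \<notin> S \<Longrightarrow> f x = 0" and X: "finite X"
  shows "(\<Sum>x\<in>X. (gradient \<mu> (approx n f) x)\<^sup>2 * m x) \<le> 16 * (\<Sum>x\<in>S. (cmod (f x))\<^sup>2 * m x)"
proof -
  have le: "(\<Sum>x\<in>F. (cmod (f x))\<^sup>2 * m x) \<le> (\<Sum>x\<in>S. (cmod (f x))\<^sup>2 * m x)" if F: "finite F" for F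
  proof -
    have "(\<Sum>x\<in>F. (cmod (f x))\<^sup>2 * m x) = (\<Sum>x\<in>F \<inter> S. (cmod (f x))\<^sup>2 * m x)"
      using F S by (intro sum.mono_neutral_right) auto
    also have "\<dots> \<le> (\<Sum>x\<in>S. (cmod (f x))\<^sup>2 * m x)" using S by (intro sum_mono2) auto
    finally show ?thesis .
  qed
  let ?b = "sqrt (\<Sum>x\<in>S. (cmod (f x))\<^sup>2 * m x)"
  have b: "?b\<^sup>2 = (\<Sum>x\<in>S. (cmod (f x))\<^sup>2 * m x)" by (simp add: sum_nonneg)
  have f: "f \<in> Lp m 2" and nf: "Lp_norm m 2 f \<le> ?b"
    using Lp2_leI[of f ?b] le by (simp_all add: sum_nonneg)
  note a = approx_Lp[OF f, of n]
  have "(\<Sum>x\<in>X. (norm (gradient \<mu> (approx n f) x))\<^sup>2 * m x) \<le> (Lp_norm m 2 (gradient \<mu> (approx n f)))\<^sup>2"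
    by (rule Lp2_sum_le[OF gradient_energy(1)[OF a] X])
  also have "\<dots> \<le> (4 * ?b)\<^sup>2"
    using gradient_le_S[OF a] S_approx_bounded[OF f, of n] nf by (intro power_mono) auto
  also have "\<dots> = 16 * (\<Sum>x\<in>S. (cmod (f x))\<^sup>2 * m x)" unfolding power_mult_distrib b by simp
  finally show ?thesis by simp
qed

section \<open>The Riesz transform\<close>

text \<open>The real gradient viewed as a complex function, so that its convergence can be discussed
  in \<open>ell2\<close>.\<close>

abbreviation "gvec g \<equiv> emb (\<lambda>x. of_real (gradient \<mu> g x))"

lemma gradient_Lp: "f \<in> Lp m 2 \<Longrightarrow> (\<lambda>x. complex_of_real (gradient \<mu> f x)) \<in> Lp m 2"
  by (simp add: Lp_of_real gradient_energy(1))

text \<open>Sublinearity makes the gradient of \<open>f\<close> Lipschitz in terms of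
  \<open>lap.S f\<close>; this is the continuity on which the extension rests.\<close>

lemma gvec_diff:
  assumes f: "f \<in> Lp m 2" and g: "g \<in> Lp m 2"
  shows "norm (gvec f - gvec g) \<le> 2 * norm (emb (lap.S f) - emb (lap.S g))"
proof -
  note h = emb_diff(1)[OF f g]
  have "(\<Sum>x\<in>F. (norm (gradient \<mu> f x - gradient \<mu> g x))\<^sup>2 * m x) \<le> (Lp_norm m 2 (gradient \<mu> (\<lambda>x. f x - g x)))\<^sup>2"
    if "finite F" for F
  proof -
    have "(\<Sum>x\<in>F. (norm (gradient \<mu> f x - gradient \<mu> g x))\<^sup>2 * m x) \<le> (\<Sum>x\<in>F. (norm (gradient \<mu> (\<lambda>x. f x - g x) x))\<^sup>2 * m x)"
      using gradient_diff_le[of f _ g] by (intro sum_mono mult_right_mono power_mono) auto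
    also have "\<dots> \<le> (Lp_norm m 2 (gradient \<mu> (\<lambda>x. f x - g x)))\<^sup>2"
      by (rule Lp2_sum_le[OF gradient_energy(1)[OF h] that])
    finally show ?thesis .
  qed
  then have "Lp_norm m 2 (\<lambda>x. gradient \<mu> f x - gradient \<mu> g x) \<le> Lp_norm m 2 (gradient \<mu> (\<lambda>x. f x - g x))"
    by (rule Lp2_leI(2)) simp_all
  also have "\<dots> \<le> 2 * Lp_norm m 2 (lap.S (\<lambda>x. f x - g x))" by (rule gradient_le_S[OF h])
  also have "Lp_norm m 2 (lap.S (\<lambda>x. f x - g x)) = norm (emb (lap.S f) - emb (lap.S g))"
    using norm_emb[OF lap.S_spec(1)[OF h]] lap.emb_S_diff[OF f g] by simp
  finally have "Lp_norm m 2 (\<lambda>x. gradient \<mu> f x - gradient \<mu> g x) \<le> 2 * norm (emb (lap.S f) - emb (lap.S g))" .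
  moreover have "Lp_norm m 2 (\<lambda>x. gradient \<mu> f x - gradient \<mu> g x) = norm (gvec f - gvec g)"
    unfolding emb_diff(2)[OF gradient_Lp[OF f] gradient_Lp[OF g], symmetric]
      norm_emb[OF emb_diff(1)[OF gradient_Lp[OF f] gradient_Lp[OF g]]]
    unfolding of_real_diff[symmetric] Lp_norm_of_real ..
  ultimately show ?thesis by simp
qed

text \<open>Replacing the limit by its real part does not increase its distance to real functions,
  so the real part is a limit as well.\<close>

lemma limit_real:
  assumes u: "\<And>n. u n \<in> Lp m 2" and l: "(\<lambda>n. emb (\<lambda>x. complex_of_real (u n x))) \<longlonglongrightarrow> y"
  shows "\<exists>h\<in>Lp m 2. y = emb (\<lambda>x. complex_of_real (h x))"
proof
  let ?h = "\<lambda>x. Re (unemb y x)"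
  have le: "(\<Sum>x\<in>F. (norm (a x - Re (unemb z x)))\<^sup>2 * m x) \<le> (Lp_norm m 2 (\<lambda>x. complex_of_real (a x) - unemb z x))\<^sup>2"
    if F: "finite F" and a: "a \<in> Lp m 2" for F a z
  proof -
    have "norm (a x - Re (unemb z x)) \<le> norm (complex_of_real (a x) - unemb z x)" for x
      using abs_Re_le_cmod[of "complex_of_real (a x) - unemb z x"] by simp
    then have "(\<Sum>x\<in>F. (norm (a x - Re (unemb z x)))\<^sup>2 * m x) \<le> (\<Sum>x\<in>F. (norm (complex_of_real (a x) - unemb z x))\<^sup>2 * m x)"
      by (intro sum_mono mult_right_mono power_mono) auto
    also have "\<dots> \<le> (Lp_norm m 2 (\<lambda>x. complex_of_real (a x) - unemb z x))\<^sup>2"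
      using a by (intro Lp2_sum_le F emb_diff(1)) (auto simp: Lp_of_real)
    finally show ?thesis .
  qed
  have "(\<lambda>_. 0 :: real) \<in> Lp m 2" by (simp add: Lp_def)
  from Lp2_leI(1)[OF le[OF _ this, of _ y]] have "(\<lambda>x. 0 - Re (unemb y x)) \<in> Lp m 2" by simp
  then show h: "?h \<in> Lp m 2" by (simp add: Lp_def)
  have le': "norm (emb (\<lambda>x. complex_of_real (u n x)) - emb (\<lambda>x. complex_of_real (?h x))) \<le> norm (emb (\<lambda>x. complex_of_real (u n x)) - y)" for n
  proof -
    have r: "(\<lambda>x. complex_of_real (u n x)) \<in> Lp m 2" "(\<lambda>x. complex_of_real (?h x)) \<in> Lp m 2"
      using u h by (simp_all add: Lp_of_real)
    have "norm (emb (\<lambda>x. complex_of_real (u n x)) - emb (\<lambda>x. complex_of_real (?h x))) = Lp_norm m 2 (\<lambda>x. u n x - ?h x)"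
      unfolding emb_diff(2)[OF r, symmetric] norm_emb[OF emb_diff(1)[OF r]]
      unfolding of_real_diff[symmetric] Lp_norm_of_real ..
    also have "\<dots> \<le> Lp_norm m 2 (\<lambda>x. complex_of_real (u n x) - unemb y x)"
      by (rule Lp2_leI(2)[OF le]) (use u in auto)
    also have "\<dots> = norm (emb (\<lambda>x. complex_of_real (u n x)) - y)"
      using emb_diff[OF r(1) unemb_Lp[of y]] by (simp flip: norm_emb)
    finally show ?thesis .
  qed
  have z: "(\<lambda>n. norm (emb (\<lambda>x. complex_of_real (u n x)) - y)) \<longlonglongrightarrow> 0"
    by (rule tendsto_norm_zero[OF LIM_zero[OF l]])
  have "(\<lambda>n. norm (emb (\<lambda>x. complex_of_real (u n x)) - emb (\<lambda>x. complex_of_real (?h x)))) \<longlonglongrightarrow> 0"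
    by (rule tendsto_sandwich[OF always_eventually[OF allI[OF norm_ge_zero]] always_eventually[OF allI[OF le']] tendsto_const z])
  then have "(\<lambda>n. emb (\<lambda>x. complex_of_real (u n x))) \<longlonglongrightarrow> emb (\<lambda>x. complex_of_real (?h x))"
    by (rule LIM_zero_cancel[OF tendsto_norm_zero_cancel])
  then show "y = emb (\<lambda>x. complex_of_real (?h x))" using l LIMSEQ_unique by blast
qed

text \<open>The functions \<open>lap.S (approx n f)\<close> lie in the range of the square root and
  tend to \<open>f\<close>; the inverse root takes them back to \<open>approx n f\<close>. By
  \<open>gvec_diff\<close> any other admissible sequence has gradients with the same limit, and
  testing on this particular sequence gives uniqueness.\<close>

lemma riesz_transform:
  assumes f: "f \<in> Lp m 2"
  shows "riesz_transform \<mu> f \<in> Lp m 2"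
    and "Lp_tendsto m 2 (\<lambda>n. gradient \<mu> (approx n f)) (riesz_transform \<mu> f)"
proof -
  have S_eq: "laplacian_powr \<mu> (1/2) = lap.S" by (simp add: laplacian_powr_def lap.S_def fun_eq_iff)
  have S_inv: "laplacian_powr \<mu> (-1/2) (lap.S g) = g" if "g \<in> Lp m 2" for g
    using lap.S_inverse[OF that] by (simp add: laplacian_powr_def)
  note a = approx_Lp[OF f]
  have lim: "(\<lambda>n. emb (lap.S (approx n f))) \<longlonglongrightarrow> emb f"
    using S_approx_tendsto[OF f] Lp_tendsto_emb[of "\<lambda>n. lap.S (approx n f)" f] lap.S_spec(1)[OF a] f by simp
  have "Cauchy (\<lambda>n. gvec (approx n f))"
  proof (rule metric_CauchyI)
    fix e :: real assume "e > 0"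
    then obtain N where "\<forall>i\<ge>N. \<forall>j\<ge>N. dist (emb (lap.S (approx i f))) (emb (lap.S (approx j f))) < e / 2"
      using LIMSEQ_imp_Cauchy[OF lim] unfolding Cauchy_def by (meson half_gt_zero)
    then show "\<exists>N. \<forall>i\<ge>N. \<forall>j\<ge>N. dist (gvec (approx i f)) (gvec (approx j f)) < e"
      using gvec_diff[OF a a] unfolding dist_norm by (smt (verit) field_sum_of_halves)
  qed
  then obtain y where "(\<lambda>n. gvec (approx n f)) \<longlonglongrightarrow> y"
    using Cauchy_convergent_iff convergent_def by blast
  moreover obtain h where h: "h \<in> Lp m 2" "y = emb (\<lambda>x. complex_of_real (h x))"
    using limit_real[OF gradient_energy(1)[OF a] calculation] by blast
  ultimately have gl: "(\<lambda>n. gvec (approx n f)) \<longlonglongrightarrow> emb (\<lambda>x. complex_of_real (h x))" by simp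
  have iff: "Lp_tendsto m 2 (\<lambda>n. gradient \<mu> (k n)) h' \<longleftrightarrow> (\<lambda>n. gvec (k n)) \<longlonglongrightarrow> emb (\<lambda>x. complex_of_real (h' x))"
    if "\<And>n. k n \<in> Lp m 2" "h' \<in> Lp m 2" for k :: "nat \<Rightarrow> 'a \<Rightarrow> complex" and h'
    unfolding Lp_tendsto_of_real[symmetric] using that by (intro Lp_tendsto_emb) (simp_all add: gradient_energy(1) Lp_of_real)
  have "riesz_transform \<mu> f = h"
    unfolding riesz_transform_def
  proof (rule the_equality, intro conjI allI impI)
    fix u assume u: "\<forall>n. u n \<in> range_sqrt_laplacian \<mu>" and uf: "Lp_tendsto m 2 u f"
    then have "\<forall>n. \<exists>k. k \<in> Lp m 2 \<and> u n = lap.S k" by (auto simp: range_sqrt_laplacian_def S_eq)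
    then obtain k where k: "\<And>n. k n \<in> Lp m 2" and u_eq: "\<And>n. u n = lap.S (k n)" by metis
    have "(\<lambda>n. emb (lap.S (k n))) \<longlonglongrightarrow> emb f"
      using uf Lp_tendsto_emb[of "\<lambda>n. lap.S (k n)" f] lap.S_spec(1)[OF k] f unfolding u_eq[abs_def] by simp
    note l = tendsto_norm[OF tendsto_diff[OF this lim]]
    have z: "(\<lambda>n. 2 * norm (emb (lap.S (k n)) - emb (lap.S (approx n f)))) \<longlonglongrightarrow> 0"
      by (rule tendsto_mult_right_zero) (use l in simp)
    have "(\<lambda>n. norm (gvec (k n) - gvec (approx n f))) \<longlonglongrightarrow> 0"
      by (rule tendsto_sandwich[OF _ _ tendsto_const z]) (simp_all add: gvec_diff k a)
    then have "(\<lambda>n. gvec (k n) - gvec (approx n f)) \<longlonglongrightarrow> 0" by (rule tendsto_norm_zero_cancel)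
    from tendsto_add[OF this gl] have "(\<lambda>n. gvec (k n)) \<longlonglongrightarrow> emb (\<lambda>x. complex_of_real (h x))" by simp
    then show "Lp_tendsto m 2 (\<lambda>n. gradient \<mu> (laplacian_powr \<mu> (-1/2) (u n))) h"
      unfolding u_eq S_inv[OF k] using iff[of k h] k h(1) by blast
  next
    fix h' assume h': "h' \<in> Lp m 2 \<and> (\<forall>u. (\<forall>n. u n \<in> range_sqrt_laplacian \<mu>) \<longrightarrow> Lp_tendsto m 2 u f \<longrightarrow>
           Lp_tendsto m 2 (\<lambda>n. gradient \<mu> (laplacian_powr \<mu> (-1/2) (u n))) h')"
    have "Lp_tendsto m 2 (\<lambda>n. gradient \<mu> (laplacian_powr \<mu> (-1/2) (lap.S (approx n f)))) h'"
      by (rule h'[THEN conjunct2, THEN spec, of "\<lambda>n. lap.S (approx n f)", THEN mp, THEN mp])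
        (use a S_approx_tendsto[OF f] in \<open>simp_all add: range_sqrt_laplacian_def S_eq\<close>)
    then have "(\<lambda>n. gvec (approx n f)) \<longlonglongrightarrow> emb (\<lambda>x. complex_of_real (h' x))"
      unfolding S_inv[OF a] using iff[of "\<lambda>n. approx n f" h'] a h' by blast
    from LIMSEQ_unique[OF this gl] have "(\<lambda>x. complex_of_real (h' x)) = (\<lambda>x. complex_of_real (h x))"
      using h' h(1) by (intro emb_inject) (simp_all add: Lp_of_real)
    then show "h' = h" by (simp add: fun_eq_iff)
  qed (rule h(1))
  then show "riesz_transform \<mu> f \<in> Lp m 2" "Lp_tendsto m 2 (\<lambda>n. gradient \<mu> (approx n f)) (riesz_transform \<mu> f)"
    using h(1) gl iff[of "\<lambda>n. approx n f" h] a by simp_all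
qed

text \<open>Every point has positive mass, so \<open>L^2\<close> convergence controls each
  value.\<close>

lemma Lp_tendsto_pointwise:
  fixes u :: "nat \<Rightarrow> 'a \<Rightarrow> real"
  assumes "Lp_tendsto m 2 u h" shows "(\<lambda>n. u n x) \<longlonglongrightarrow> h x"
proof -
  have s: "sqrt (m x) > 0" using m_pos by simp
  have le: "norm (u n x - h x) \<le> Lp_norm m 2 (\<lambda>x. u n x - h x) / sqrt (m x)" for n
  proof -
    have "(norm (u n x - h x))\<^sup>2 * m x \<le> (Lp_norm m 2 (\<lambda>x. u n x - h x))\<^sup>2"
      using Lp2_sum_le[of "\<lambda>x. u n x - h x" "{x}"] assms by (simp add: Lp_tendsto_def)
    then have "(norm (u n x - h x) * sqrt (m x))\<^sup>2 \<le> (Lp_norm m 2 (\<lambda>x. u n x - h x))\<^sup>2" by (simp add: power_mult_distrib)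
    then have "norm (u n x - h x) * sqrt (m x) \<le> Lp_norm m 2 (\<lambda>x. u n x - h x)" by (rule power2_le_imp_le) simp
    then show ?thesis using s by (simp only: pos_le_divide_eq)
  qed
  have z: "(\<lambda>n. Lp_norm m 2 (\<lambda>x. u n x - h x) / sqrt (m x)) \<longlonglongrightarrow> 0"
    by (rule tendsto_divide_zero) (use assms in \<open>simp add: Lp_tendsto_def\<close>)
  have "(\<lambda>n. norm (u n x - h x)) \<longlonglongrightarrow> 0"
    by (rule tendsto_sandwich[OF _ _ tendsto_const z]) (simp_all add: le del: real_norm_def)
  then show ?thesis by (rule LIM_zero_cancel[OF tendsto_norm_zero_cancel])
qed

lemma strong_type_le_2:
  assumes q: "1 < q" "q \<le> 2"
  shows "\<exists>K>0. \<forall>n f S X. finite S \<longrightarrow> (\<forall>x. x \<notin> S \<longrightarrow> f x = 0) \<longrightarrow> finite X \<longrightarrow>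
     (\<Sum>x\<in>X. gradient \<mu> (approx n f) x powr q * m x) \<le> K * (\<Sum>x\<in>S. cmod (f x) powr q * m x)"
proof (cases "q = 2")
  case True
  then show ?thesis using energy by (auto intro!: exI[of _ 16])
next
  case False
  show ?thesis by (rule strong_type[of 16]) (use q False energy in auto)
qed

text \<open>A Fatou argument with finite sums: bounds on finite sets pass to the pointwise limit,
  and finite sets determine the norm.\<close>

lemma riesz_transform_bounded:
  assumes q: "1 < q" "q \<le> 2"
  shows "\<exists>K>0. \<forall>f\<in>Lp m q \<inter> Lp m 2. riesz_transform \<mu> f \<in> Lp m q \<and>
    Lp_norm m q (riesz_transform \<mu> f) \<le> K * Lp_norm m q f"
proof -
  obtain K where K: "K > 0" and le: "\<And>n f S X. finite S \<Longrightarrow> (\<forall>x. x \<notin> S \<longrightarrow> f x = 0) \<Longrightarrow> finite X \<Longrightarrow>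
     (\<Sum>x\<in>X. gradient \<mu> (approx n f) x powr q * m x) \<le> K * (\<Sum>x\<in>S. cmod (f x) powr q * m x)"
    using strong_type_le_2[OF q] by meson
  have "riesz_transform \<mu> f \<in> Lp m q \<and> Lp_norm m q (riesz_transform \<mu> f) \<le> K powr (1/q) * Lp_norm m q f"
    if fq: "f \<in> Lp m q" and f2: "f \<in> Lp m 2" for f
  proof -
    let ?I = "\<Sum>\<^sub>\<infinity>x. cmod (f x) powr q * m x"
    have sf: "(\<lambda>x. cmod (f x) powr q * m x) summable_on UNIV" using fq by (simp add: Lp_def)
    have fin: "(\<Sum>x\<in>X. gradient \<mu> (approx n f) x powr q * m x) \<le> K * ?I" if X: "finite X" for n X
    proof -
      \<comment> \<open>At a neighbour of \<open>x\<close> the function \<open>approx n f\<close>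
        reads \<open>f\<close> within distance \<open>n + 1\<close> of \<open>x\<close>, so on
        \<open>X\<close> the gradient does not notice the truncation to \<open>F\<close>.\<close>
      define F where "F = (\<Union>x\<in>X. {y. d x y \<le> n + 1})"
      define g where "g y = (if y \<in> F then f y else 0)" for y
      have F: "finite F" using X finite_dball by (simp add: F_def)
      have loc: "approx n g z = approx n f z" if x: "x \<in> X" and z: "d x z \<le> 1" for x z
        unfolding approx_def
      proof (intro sum.cong refl arg_cong[where f="times _"] iter_mk_local)
        fix l y assume "l \<in> {..n}" "d z y \<le> l"
        then have "d x y \<le> n + 1" using z d_triangle[of x y z] by simp
        then show "g y = f y" using x by (auto simp: g_def F_def)
      qed
      have "gradient \<mu> (approx n g) x = gradient \<mu> (approx n f) x" if x: "x \<in> X" for x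
        unfolding gradient_L2 using loc[OF x] d_nb[of _ x] by (intro L2_set_cong) auto
      then have "(\<Sum>x\<in>X. gradient \<mu> (approx n f) x powr q * m x) = (\<Sum>x\<in>X. gradient \<mu> (approx n g) x powr q * m x)" by simp
      also have "\<dots> \<le> K * (\<Sum>x\<in>F. cmod (g x) powr q * m x)" by (rule le[OF F _ X]) (simp add: g_def)
      also have "(\<Sum>x\<in>F. cmod (g x) powr q * m x) = (\<Sum>x\<in>F. cmod (f x) powr q * m x)" by (simp add: g_def)
      also have "\<dots> \<le> ?I" by (rule finite_sum_le_infsum[OF sf F]) simp_all
      finally show ?thesis using K by simp
    qed
    let ?R = "riesz_transform \<mu> f"
    have lim: "(\<lambda>n. gradient \<mu> (approx n f) x) \<longlonglongrightarrow> ?R x" for x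
      by (rule Lp_tendsto_pointwise[OF riesz_transform(2)[OF f2]])
    have R0: "0 \<le> ?R x" for x by (rule LIMSEQ_le_const[OF lim]) simp
    have lim': "(\<lambda>n. gradient \<mu> (approx n f) x powr q) \<longlonglongrightarrow> norm (?R x) powr q" for x
      using tendsto_powr'[OF lim[of x] tendsto_const[of q]] q R0[of x] by simp
    have fR: "(\<Sum>x\<in>X. norm (?R x) powr q * m x) \<le> K * ?I" if X: "finite X" for X
    proof (rule LIMSEQ_le_const2)
      show "(\<lambda>n. \<Sum>x\<in>X. gradient \<mu> (approx n f) x powr q * m x) \<longlonglongrightarrow> (\<Sum>x\<in>X. norm (?R x) powr q * m x)"
        by (intro tendsto_sum tendsto_mult_right lim')
    qed (use fin[OF X] in auto)
    have sR: "(\<lambda>x. norm (?R x) powr q * m x) summable_on UNIV"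
      by (rule nonneg_bdd_above_summable_on) (use fR in \<open>auto intro!: bdd_aboveI\<close>)
    have I0: "0 \<le> ?I" by (intro infsum_nonneg) simp
    have "(\<Sum>\<^sub>\<infinity>x. norm (?R x) powr q * m x) \<le> K * ?I"
      by (rule infsum_le_finite_sums[OF sR]) (use fR in auto)
    then have "Lp_norm m q ?R \<le> (K * ?I) powr (1/q)"
      unfolding Lp_norm_def using q by (intro powr_mono2 infsum_nonneg) auto
    also have "\<dots> = K powr (1/q) * Lp_norm m q f" unfolding Lp_norm_def using K I0 by (simp add: powr_mult)
    finally show ?thesis using sR by (simp add: Lp_def)
  qed
  then show ?thesis using K by (intro exI[of _ "K powr (1/q)"]) auto
qed

end

text \<open>A real supremum is an upper bound only over a bounded set; here the bound is 2. The
  estimate for \<open>f\<close> follows by scaling to norm 1, and functions of norm 0 are treated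
  separately.\<close>

lemma (in wgraph) le_opnorm:
  assumes b: "Lp_opnorm m 2 (\<lambda>f. laplacian \<mu> ((markov \<mu> ^^ k) f)) \<le> a" and f: "f \<in> Lp m 2"
  shows "Lp_norm m 2 (laplacian \<mu> ((mk ^^ k) f)) \<le> a * Lp_norm m 2 f"
proof -
  let ?L = "\<lambda>f. laplacian \<mu> ((mk ^^ k) f)"
  have mk: "markov \<mu> = mk" by (simp add: markov_eq fun_eq_iff)
  have L: "?L g \<in> Lp m 2" "Lp_norm m 2 (?L g) \<le> 2 * Lp_norm m 2 g" if "g \<in> Lp m 2" for g
    using laplacian_Lp[of "(mk ^^ k) g"] laplacian_norm_le[of "(mk ^^ k) g"] iter_mk_Lp[OF that, of k] by auto
  show ?thesis
  proof (cases "Lp_norm m 2 f = 0")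
    case True
    then show ?thesis using L(2)[OF f] by simp
  next
    case False
    then have p: "Lp_norm m 2 f > 0" using Lp_norm_nonneg[of 2 f] by linarith
    define s where "s = complex_of_real (1 / Lp_norm m 2 f)"
    have s: "cmod s = 1 / Lp_norm m 2 f" using p by (simp add: s_def norm_divide)
    define g where "g = (\<lambda>x. s * f x)"
    have g: "g \<in> Lp m 2" "Lp_norm m 2 g = 1" using Lp_norm_cmult[OF f, of s] p by (simp_all add: g_def s)
    have e: "(mk ^^ k) g = (\<lambda>x. s * (mk ^^ k) f x)" unfolding g_def using iter_mk_mult[of k f s] by (simp add: mult.commute)
    have "mk ((mk ^^ k) g) = (\<lambda>x. s * mk ((mk ^^ k) f) x)"
      unfolding e using iter_mk_mult[of 1 "(mk ^^ k) f" s] by (simp add: mult.commute)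
    then have "?L g = (\<lambda>x. s * ?L f x)" by (simp add: laplacian_eq e right_diff_distrib)
    then have "Lp_norm m 2 (?L f) / Lp_norm m 2 f = Lp_norm m 2 (?L g)"
      using Lp_norm_cmult(2)[OF L(1)[OF f], of s] by (simp add: s)
    also have "\<dots> \<le> Lp_opnorm m 2 ?L"
      unfolding Lp_opnorm_def
    proof (rule cSUP_upper)
      show "bdd_above ((\<lambda>f. Lp_norm m 2 (?L f)) ` {f \<in> Lp m 2. Lp_norm m 2 f = 1})"
        by (rule bdd_aboveI2[where M=2]) (use L(2) in fastforce)
    qed (use g in simp)
    also have "\<dots> \<le> a" using b by (simp add: mk)
    finally show ?thesis using p by (simp only: pos_divide_le_eq)
  qed
qed

theorem theorem3p4:
  fixes \<mu> :: "'a \<Rightarrow> 'a \<Rightarrow> real" and \<beta> :: real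
  assumes graph: "weighted_graph \<mu>"
    and beta: "\<beta> \<ge> 2"
    and doubling: "\<exists>Cdv::real. Cdv > 0 \<and>
          (\<forall>x. \<forall>r::nat. r \<ge> 1 \<longrightarrow> gvolume \<mu> x (2 * real r) \<le> Cdv * gvolume \<mu> x (real r))"
    and sub_gaussian: "\<exists>c C::real. c > 0 \<and> C > 0 \<and>
          (\<forall>x y. \<forall>k::nat. k \<ge> 1 \<longrightarrow>
             pker_iter \<mu> k x y
               \<le> C / gvolume \<mu> x (real k powr (1 / \<beta>))
                   * exp (- c * (real (gdist \<mu> x y) powr \<beta> / real k) powr (1 / (\<beta> - 1))))"
    and analytic: "\<exists>C'::real. C' > 0 \<and>
          (\<forall>k::nat. k \<ge> 1 \<longrightarrow>
             Lp_opnorm (vmass \<mu>) 2 (\<lambda>f. laplacian \<mu> ((markov \<mu> ^^ k) f)) \<le> C' / real k)"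
  shows "\<forall>p::real. 1 < p \<and> p \<le> 2 \<longrightarrow>
           (\<exists>Cp::real. Cp > 0 \<and>
             (\<forall>f \<in> Lp (vmass \<mu>) p \<inter> Lp (vmass \<mu>) 2.
                riesz_transform \<mu> f \<in> Lp (vmass \<mu>) p \<and>
                Lp_norm (vmass \<mu>) p (riesz_transform \<mu> f) \<le> Cp * Lp_norm (vmass \<mu>) p f))"
proof -
  interpret wgraph \<mu> by (rule wgraph.intro) (rule graph)
  obtain D where D: "\<And>x r. r \<ge> 1 \<Longrightarrow> V x (2 * real r) \<le> D * V x (real r)" using doubling by blast
  obtain c C where c: "c > 0" "C > 0" and sg: "\<And>x y k. k \<ge> 1 \<Longrightarrow> pker_iter \<mu> k x y
               \<le> C / V x (real k powr (1 / \<beta>)) * exp (- c * (real (d x y) powr \<beta> / real k) powr (1 / (\<beta> - 1)))"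
    using sub_gaussian by blast
  obtain C' where C': "C' > 0" and an: "\<And>k. k \<ge> 1 \<Longrightarrow>
      Lp_opnorm m 2 (\<lambda>f. laplacian \<mu> ((markov \<mu> ^^ k) f)) \<le> C' / real k"
    using analytic by blast
  \<comment> \<open>The doubling constant is enlarged to be at least 1, as the locale
    requires.\<close>
  interpret sub_gaussian_graph \<mu> \<beta> "max 1 D" C c C'
  proof
    fix r :: nat and x assume "r \<ge> 1"
    then show "V x (2 * real r) \<le> max 1 D * V x (real r)"
      using D[of r x] mult_right_mono[of D "max 1 D" "V x (real r)"] by (simp del: mult_le_cancel_right)
  qed (use beta c C' sg le_opnorm[OF an] in auto)
  show ?thesis using riesz_transform_bounded by blast
qed

end
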